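(* Let $\mathbb K$ be an algebraically closed field of characteristic $3$. Let $\mathfrak e_8=\mathfrak g(A)$ with purely even Cartan matrix $$A=\begin{pmatrix}2&0&-1&0&0&0&0&0\\0&2&0&-1&0&0&0&0\\-1&0&2&-1&0&0&0&0\\0&-1&-1&2&-1&0&0&0\\0&0&0&-1&2&-1&0&0\\0&0&0&0&-1&2&-1&0\\0&0&0&0&0&-1&2&-1\\0&0&0&0&0&0&-1&2\end{pmatrix}.$$ Let $\mathfrak g(6,6)=\mathfrak g(\widetilde A)$ be the Elduque and Cunha Lie superalgebra with Cartan matrix $$\widetilde A=\begin{pmatrix}0&-1&0&0&0&0\\-1&0&-1&0&0&0\\0&-1&2&-1&0&0\\0&0&-1&2&-1&0\\0&0&0&-1&2&-1\\0&0&0&0&-1&2\end{pmatrix}$$ in which indices $1,2$ are odd and the others are even. Then the semisimplification of $\mathfrak e_8$, as an object in $\mathrm{Rep}\,\alpha_3$ under the adjoint action of $e_1+e_2$, is (isomorphic as a Lie superalgebra to) $\mathfrak g(6,6)$.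
   Context: **Contragredient Lie superalgebras.** Lie superalgebras in characteristic $3$ are required to satisfy $[x,[x,x]]=0$ for odd $x$. Let $A=(a_{ij})$ be an $n\times n$ integer matrix (a Cartan matrix) with a parity $\mathrm{par}(i)\in\mathbb Z/2$ for each index; let $\overline A=(\overline a_{ij})$ be its reduction mod $3$, of rank $s$. Let $\widetilde{\mathfrak h}$ be a $\mathbb K$-vector space of dimension $2n-s$ with linearly independent $h_1,\dots,h_n\in\widetilde{\mathfrak h}$ and linearly independent $\alpha_1,\dots,\alpha_n\in\widetilde{\mathfrak h}^*$ such that $\alpha_j(h_i)=\overline a_{ij}$. $\widetilde{\mathfrak g}(A)$ is the Lie superalgebra generated by $\widetilde{\mathfrak h}$ (even) and $e_i,f_i$ ($1\le i\le n$) of parity $\mathrm{par}(i)$, with relations $[e_i,f_j]=\delta_{ij}h_i$, $[h,e_j]=\alpha_j(h)e_j$, $[h,f_j]=-\alpha_j(h)f_j$, $[\widetilde{\mathfrak h},\widetilde{\mathfrak h}]=0$. It is graded by the free abelian group $Q=\bigoplus_k\mathbb Z\alpha_k$ with $\deg e_i=\alpha_i$, $\deg f_i=-\alpha_i$, $\deg h=0$. $\mathfrak g(A)=\widetilde{\mathfrak g}(A)/\mathfrak r$, where $\mathfrak r$ is the largest $Q$-graded ideal meeting $\widetilde{\mathfrak h}$ trivially; images of $e_i,f_i,h_i$ keep their names. If all parities are $0$, $\mathfrak g(A)$ is a Lie algebra. **Semisimplification.** $\mathrm{Rep}\,\alpha_3$ (representations of the Frobenius kernel of $\mathbb G_a$)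 is the symmetric tensor category of finite-dimensional $\mathbb K[t]/(t^3)$-modules, with $t$ acting on $V\otimes W$ by $t\otimes1+1\otimes t$ and the flip as braiding. Its indecomposables are $J_1,J_2,J_3$, where $t$ acts on $J_n=\mathbb K^n$ as one nilpotent Jordan block. A Lie algebra $\mathfrak g$ with a derivation $d$, $d^3=0$, is a Lie algebra in $\mathrm{Rep}\,\alpha_3$ with $t$ acting by $d$; "under the adjoint action of $x$" means $d=\mathrm{ad}\,x$. The semisimplification functor $V\mapsto\overline V$ is the quotient of $\mathrm{Rep}\,\alpha_3$ by negligible morphisms ($u:V\to W$ with $\mathrm{tr}(u\circ v)=0$ for all $v:W\to V$), with target the Verlinde category $\mathrm{Ver}_3$, whose simple objects are $L_1=\overline{J_1}$, $L_2=\overline{J_2}$ ($\overline{J_3}=0$); $\mathrm{Ver}_3$ is identified with super vector spaces, $L_1$ being an even line and $L_2$ an odd line, so $\overline{\mathfrak g}$ is a Lie superalgebra. Explicitly, decompose $\mathfrak g$ into Jordan blocks $x_i$ ($i\le n_1$), $x_i\mapsto x_i'$ ($n_1<i\le n_1+n_2$), and blocks $x_i\mapsto x_i'\mapsto x_i''$ (arrows are the action of $d$). Then $\overline{\mathfrak g}$ has basis $y_i$ ($i\le n_1+n_2$), even for $i\le n_1$ and odd for $i>n_1$; the coefficient of $y_k$ in $[y_i,y_j]$ is the coefficient of $x_k$ in $[x_i,x_j]$ if the parities of $y_i,y_j,y_k$ are compatible and $y_i,y_j$ are not both odd; it is the coefficient of $x_k$ in $-[x_i,x_j']+[x_i',x_j]$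 if $i,j>n_1$, $k\le n_1$; and $0$ otherwise. *)

theory Defs
  imports
    "HOL-Algebra.QuotRing"
    "HOL-Library.Poly_Mapping"
    "HOL-Computational_Algebra.Polynomial"
    "Jordan_Normal_Form.DL_Rank"
    "Jordan_Normal_Form.Jordan_Normal_Form"
begin

section \<open>Lie superalgebras\<close>

text \<open>
  A superalgebra is a \<open>module\<close> record over \<open>class_ring\<close>, the field \<open>'k\<close> viewed as a ring record.
  The product \<open>\<otimes>\<close> is the bracket; the ring unit of the record plays no role. In \<open>part L p\<close> the
  value \<open>False\<close> stands for the even and \<open>True\<close> for the odd part.
\<close>

record ('k, 'a) superalgebra = "('k, 'a) module" +
  part :: "bool \<Rightarrow> 'a set"

definition koszul :: "bool \<Rightarrow> bool \<Rightarrow> 'k::field" where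
  "koszul p q = (if p \<and> q then -1 else 1)"

text \<open>
  The elements that have to vanish in a Lie superalgebra: super antisymmetry, the super Jacobi
  identity, and \<open>[x,[x,x]]\<close> for odd \<open>x\<close>, which in characteristic 3 does not follow from Jacobi.
\<close>

definition lie_identities :: "('k::field, 'a) superalgebra \<Rightarrow> 'a set" where
  "lie_identities L =
     {x \<otimes>\<^bsub>L\<^esub> y \<oplus>\<^bsub>L\<^esub> koszul p q \<odot>\<^bsub>L\<^esub> (y \<otimes>\<^bsub>L\<^esub> x) | p q x y. x \<in> part L p \<and> y \<in> part L q} \<union>
     {x \<otimes>\<^bsub>L\<^esub> (y \<otimes>\<^bsub>L\<^esub> z) \<ominus>\<^bsub>L\<^esub> ((x \<otimes>\<^bsub>L\<^esub> y) \<otimes>\<^bsub>L\<^esub> z \<oplus>\<^bsub>L\<^esub> koszul p q \<odot>\<^bsub>L\<^esub> (y \<otimes>\<^bsub>L\<^esub> (x \<otimes>\<^bsub>L\<^esub> z))) | p q x y z.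
        x \<in> part L p \<and> y \<in> part L q \<and> z \<in> carrier L} \<union>
     {x \<otimes>\<^bsub>L\<^esub> (x \<otimes>\<^bsub>L\<^esub> x) | x. x \<in> part L True}"

locale lie_superalgebra = vectorspace "class_ring :: 'k ring" L
  for L :: "('k::field, 'a) superalgebra" (structure) +
  assumes bracket_closed: "\<lbrakk>x \<in> carrier L; y \<in> carrier L\<rbrakk> \<Longrightarrow> x \<otimes> y \<in> carrier L"
    and bracket_add_left: "\<lbrakk>x \<in> carrier L; y \<in> carrier L; z \<in> carrier L\<rbrakk> \<Longrightarrow>
          (x \<oplus> y) \<otimes> z = x \<otimes> z \<oplus> y \<otimes> z"
    and bracket_add_right: "\<lbrakk>x \<in> carrier L; y \<in> carrier L; z \<in> carrier L\<rbrakk> \<Longrightarrow>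
          x \<otimes> (y \<oplus> z) = x \<otimes> y \<oplus> x \<otimes> z"
    and bracket_smult_left: "\<lbrakk>x \<in> carrier L; y \<in> carrier L\<rbrakk> \<Longrightarrow> (c \<odot> x) \<otimes> y = c \<odot> (x \<otimes> y)"
    and bracket_smult_right: "\<lbrakk>x \<in> carrier L; y \<in> carrier L\<rbrakk> \<Longrightarrow> x \<otimes> (c \<odot> y) = c \<odot> (x \<otimes> y)"
    and part_subspace: "VectorSpace.subspace class_ring (part L p) L"
    and part_sum: "x \<in> carrier L \<Longrightarrow> \<exists>a\<in>part L False. \<exists>b\<in>part L True. x = a \<oplus> b"
    and part_direct: "part L False \<inter> part L True = {\<zero>}"
    and bracket_part: "\<lbrakk>x \<in> part L p; y \<in> part L q\<rbrakk> \<Longrightarrow> x \<otimes> y \<in> part L (p \<noteq> q)"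
    and lie: "lie_identities L \<subseteq> {\<zero>}"

definition superalgebra_iso ::
    "('k::field, 'a) superalgebra \<Rightarrow> ('k, 'b) superalgebra \<Rightarrow> ('a \<Rightarrow> 'b) set" where
  "superalgebra_iso L M = {f \<in> LinearCombinations.module_hom class_ring L M.
     bij_betw f (carrier L) (carrier M) \<and>
     (\<forall>x\<in>carrier L. \<forall>y\<in>carrier L. f (x \<otimes>\<^bsub>L\<^esub> y) = f x \<otimes>\<^bsub>M\<^esub> f y) \<and>
     (\<forall>p. f ` part L p = part M p)}"

definition lie_superalgebra_isomorphic ::
    "('k::field, 'a) superalgebra \<Rightarrow> ('k, 'b) superalgebra \<Rightarrow> bool" where
  "lie_superalgebra_isomorphic L M \<longleftrightarrow>
     lie_superalgebra L \<and> lie_superalgebra M \<and> superalgebra_iso L M \<noteq> {}"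

definition alg_ideal :: "('k::field, 'a) superalgebra \<Rightarrow> 'a set \<Rightarrow> bool" where
  "alg_ideal L I \<longleftrightarrow> VectorSpace.subspace class_ring I L \<and>
     (\<forall>x\<in>carrier L. \<forall>y\<in>I. x \<otimes>\<^bsub>L\<^esub> y \<in> I \<and> y \<otimes>\<^bsub>L\<^esub> x \<in> I)"

definition ideal_generated :: "('k::field, 'a) superalgebra \<Rightarrow> 'a set \<Rightarrow> 'a set" where
  "ideal_generated L S = \<Inter>{I. alg_ideal L I \<and> S \<subseteq> I}"

definition quotient_superalgebra ::
    "('k::field, 'a) superalgebra \<Rightarrow> 'a set \<Rightarrow> ('k, 'a set) superalgebra" where
  "quotient_superalgebra L I =
     \<lparr>carrier = carrier (L Quot I), monoid.mult = monoid.mult (L Quot I), one = one (L Quot I),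
      zero = zero (L Quot I), add = add (L Quot I),
      module.smult = (\<lambda>c X. \<Union>x\<in>X. I +>\<^bsub>L\<^esub> (c \<odot>\<^bsub>L\<^esub> x)),
      part = (\<lambda>p. (\<lambda>x. I +>\<^bsub>L\<^esub> x) ` part L p)\<rparr>"


section \<open>The free nonassociative superalgebra\<close>

datatype (leaves: 'x) magma = Gen 'x | Br "'x magma" "'x magma"

primrec monomial_parity :: "('x \<Rightarrow> bool) \<Rightarrow> 'x magma \<Rightarrow> bool" where
  "monomial_parity par (Gen x) = par x"
| "monomial_parity par (Br m m') = (monomial_parity par m \<noteq> monomial_parity par m')"

definition free_superalgebra ::
    "'x set \<Rightarrow> ('x \<Rightarrow> bool) \<Rightarrow> ('k::field, 'x magma \<Rightarrow>\<^sub>0 'k) superalgebra" where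
  "free_superalgebra X par =
     \<lparr>carrier = {p. \<forall>m\<in>Poly_Mapping.keys p. leaves m \<subseteq> X},
      monoid.mult = (\<lambda>p q. \<Sum>m\<in>Poly_Mapping.keys p. \<Sum>m'\<in>Poly_Mapping.keys q.
                Poly_Mapping.single (Br m m') (Poly_Mapping.lookup p m * Poly_Mapping.lookup q m')),
      one = 0, zero = 0, add = (+),
      module.smult = (\<lambda>c. Poly_Mapping.map ((*) c)),
      part = (\<lambda>b. {p. \<forall>m\<in>Poly_Mapping.keys p. leaves m \<subseteq> X \<and> monomial_parity par m = b})\<rparr>"


section \<open>Contragredient Lie superalgebras\<close>

text \<open>Indices run over \<open>{0..<n}\<close>, so the index \<open>i\<close> here is the index \<open>i + 1\<close> of the usual numbering.\<close>

record ('k, 'h) realization =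
  hscale :: "'k \<Rightarrow> 'h \<Rightarrow> 'h"
  coroot :: "nat \<Rightarrow> 'h"
  root :: "nat \<Rightarrow> 'h \<Rightarrow> 'k"

text \<open>
  The Cartan space is the whole type \<open>'h\<close>. The rank of the reduction of \<open>A\<close> modulo the
  characteristic is computed over \<open>'k\<close>.
\<close>

definition is_realization ::
    "int mat \<Rightarrow> ('k::field, 'h::ab_group_add) realization \<Rightarrow> bool" where
  "is_realization A R \<longleftrightarrow>
     (let n = dim_row A; A' = (map_mat of_int A :: 'k mat) in
       A \<in> carrier_mat n n \<and>
       (\<exists>B. finite_dimensional_vector_space (hscale R) B \<and> card B = 2 * n - vec_space.rank n A') \<and>
       (\<forall>j<n. Vector_Spaces.linear (hscale R) (*) (root R j)) \<and>
       (\<forall>c. (\<Sum>i<n. hscale R (c i) (coroot R i)) = 0 \<longrightarrow> (\<forall>i<n. c i = 0)) \<and>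
       (\<forall>c. (\<forall>v. (\<Sum>j<n. c j * root R j v) = 0) \<longrightarrow> (\<forall>j<n. c j = 0)) \<and>
       (\<forall>i<n. \<forall>j<n. root R j (coroot R i) = A' $$ (i, j)))"

datatype 'h generator = Cartan 'h | Chev_e nat | Chev_f nat

definition generators :: "nat \<Rightarrow> 'h generator set" where
  "generators n = range Cartan \<union> Chev_e ` {..<n} \<union> Chev_f ` {..<n}"

primrec generator_parity :: "(nat \<Rightarrow> bool) \<Rightarrow> 'h generator \<Rightarrow> bool" where
  "generator_parity par (Cartan v) = False"
| "generator_parity par (Chev_e i) = par i"
| "generator_parity par (Chev_f i) = par i"

abbreviation gen :: "'x \<Rightarrow> ('x magma \<Rightarrow>\<^sub>0 'k::field)" where
  "gen x \<equiv> Poly_Mapping.single (Gen x) 1"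

abbreviation contragredient_free ::
    "int mat \<Rightarrow> (nat \<Rightarrow> bool) \<Rightarrow> ('k::field, 'h generator magma \<Rightarrow>\<^sub>0 'k) superalgebra" where
  "contragredient_free A par \<equiv> free_superalgebra (generators (dim_row A)) (generator_parity par)"

text \<open>The first two sets of relations make \<open>Cartan\<close> linear.\<close>

definition contragredient_relations ::
    "int mat \<Rightarrow> (nat \<Rightarrow> bool) \<Rightarrow> ('k::field, 'h::ab_group_add) realization \<Rightarrow>
     ('h generator magma \<Rightarrow>\<^sub>0 'k) set" where
  "contragredient_relations A par R =
     (let n = dim_row A; br = monoid.mult (contragredient_free A par); sc = module.smult (contragredient_free A par) in
       {gen (Cartan (u + v)) - (gen (Cartan u) + gen (Cartan v)) | u v. True} \<union>
       {gen (Cartan (hscale R c v)) - sc c (gen (Cartan v)) | c v. True} \<union>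
       {br (gen (Chev_e i)) (gen (Chev_f j)) - (if i = j then gen (Cartan (coroot R i)) else 0)
          | i j. i < n \<and> j < n} \<union>
       {br (gen (Cartan v)) (gen (Chev_e j)) - sc (root R j v) (gen (Chev_e j)) | v j. j < n} \<union>
       {br (gen (Cartan v)) (gen (Chev_f j)) + sc (root R j v) (gen (Chev_f j)) | v j. j < n} \<union>
       {br (gen (Cartan u)) (gen (Cartan v)) | u v. True})"

definition tilde_ideal ::
    "int mat \<Rightarrow> (nat \<Rightarrow> bool) \<Rightarrow> ('k::field, 'h::ab_group_add) realization \<Rightarrow>
     ('h generator magma \<Rightarrow>\<^sub>0 'k) set" where
  "tilde_ideal A par R = ideal_generated (contragredient_free A par)
     (lie_identities (contragredient_free A par) \<union> contragredient_relations A par R)"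

definition tilde_contragredient ::
    "int mat \<Rightarrow> (nat \<Rightarrow> bool) \<Rightarrow> ('k::field, 'h::ab_group_add) realization \<Rightarrow>
     ('k, ('h generator magma \<Rightarrow>\<^sub>0 'k) set) superalgebra" where
  "tilde_contragredient A par R =
     quotient_superalgebra (contragredient_free A par) (tilde_ideal A par R)"

definition tilde_class ::
    "int mat \<Rightarrow> (nat \<Rightarrow> bool) \<Rightarrow> ('k::field, 'h::ab_group_add) realization \<Rightarrow>
     ('h generator magma \<Rightarrow>\<^sub>0 'k) \<Rightarrow> ('h generator magma \<Rightarrow>\<^sub>0 'k) set" where
  "tilde_class A par R p = tilde_ideal A par R +>\<^bsub>contragredient_free A par\<^esub> p"

text \<open>
  The grading group \<open>Q\<close>: an element \<open>q :: nat \<Rightarrow> int\<close> stands for the formal combination of the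
  simple roots with coefficients \<open>q k\<close>.
\<close>

primrec generator_degree :: "'h generator \<Rightarrow> nat \<Rightarrow> int" where
  "generator_degree (Cartan v) = (\<lambda>k. 0)"
| "generator_degree (Chev_e i) = (\<lambda>k. if k = i then 1 else 0)"
| "generator_degree (Chev_f i) = (\<lambda>k. if k = i then -1 else 0)"

primrec monomial_degree :: "'h generator magma \<Rightarrow> nat \<Rightarrow> int" where
  "monomial_degree (Gen x) = generator_degree x"
| "monomial_degree (Br m m') = (\<lambda>k. monomial_degree m k + monomial_degree m' k)"

definition tilde_component ::
    "int mat \<Rightarrow> (nat \<Rightarrow> bool) \<Rightarrow> ('k::field, 'h::ab_group_add) realization \<Rightarrow> (nat \<Rightarrow> int) \<Rightarrow>
     ('h generator magma \<Rightarrow>\<^sub>0 'k) set set" where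
  "tilde_component A par R q = tilde_class A par R `
     {p \<in> carrier (contragredient_free A par). \<forall>m\<in>Poly_Mapping.keys p. monomial_degree m = q}"

definition tilde_cartan ::
    "int mat \<Rightarrow> (nat \<Rightarrow> bool) \<Rightarrow> ('k::field, 'h::ab_group_add) realization \<Rightarrow>
     ('h generator magma \<Rightarrow>\<^sub>0 'k) set set" where
  "tilde_cartan A par R = range (\<lambda>v. tilde_class A par R (gen (Cartan v)))"

definition graded_ideal ::
    "('k::field, 'a) superalgebra \<Rightarrow> ('q \<Rightarrow> 'a set) \<Rightarrow> 'a set \<Rightarrow> bool" where
  "graded_ideal L component I \<longleftrightarrow> alg_ideal L I \<and>
     (\<forall>x\<in>I. \<exists>S c. finite S \<and> (\<forall>q\<in>S. c q \<in> I \<inter> component q) \<and> x = finsum L c S)"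

text \<open>
  The radical is the largest element with respect to inclusion among the \<open>Q\<close>-graded ideals that
  meet the Cartan space trivially.
\<close>

definition contragredient_radical ::
    "int mat \<Rightarrow> (nat \<Rightarrow> bool) \<Rightarrow> ('k::field, 'h::ab_group_add) realization \<Rightarrow>
     ('h generator magma \<Rightarrow>\<^sub>0 'k) set set" where
  "contragredient_radical A par R = (GREATEST I.
     graded_ideal (tilde_contragredient A par R) (tilde_component A par R) I \<and>
     I \<inter> tilde_cartan A par R = {\<zero>\<^bsub>tilde_contragredient A par R\<^esub>})"

definition contragredient ::
    "int mat \<Rightarrow> (nat \<Rightarrow> bool) \<Rightarrow> ('k::field, 'h::ab_group_add) realization \<Rightarrow>
     ('k, ('h generator magma \<Rightarrow>\<^sub>0 'k) set set) superalgebra" where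
  "contragredient A par R =
     quotient_superalgebra (tilde_contragredient A par R) (contragredient_radical A par R)"

definition chevalley_e ::
    "int mat \<Rightarrow> (nat \<Rightarrow> bool) \<Rightarrow> ('k::field, 'h::ab_group_add) realization \<Rightarrow> nat \<Rightarrow>
     ('h generator magma \<Rightarrow>\<^sub>0 'k) set set" where
  "chevalley_e A par R i =
     contragredient_radical A par R +>\<^bsub>tilde_contragredient A par R\<^esub>
       tilde_class A par R (gen (Chev_e i))"


section \<open>Representations of the Frobenius kernel and their semisimplification\<close>

text \<open>An object of the category is a finite-dimensional vector space \<open>V\<close> with the action \<open>t\<close>.\<close>

definition rep_alpha3 :: "('k::field, 'a, 'x) module_scheme \<Rightarrow> ('a \<Rightarrow> 'a) \<Rightarrow> bool" where
  "rep_alpha3 V t \<longleftrightarrow> vectorspace class_ring V \<and> vectorspace.fin_dim class_ring V \<and>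
     t \<in> LinearCombinations.module_hom class_ring V V \<and> (\<forall>x\<in>carrier V. t (t (t x)) = \<zero>\<^bsub>V\<^esub>)"

text \<open>Morphisms are normalised to be \<open>undefined\<close> off the carrier, so that equality is extensional.\<close>

definition rep_hom ::
    "('k::field, 'a, 'x) module_scheme \<Rightarrow> ('a \<Rightarrow> 'a) \<Rightarrow>
     ('k, 'b, 'y) module_scheme \<Rightarrow> ('b \<Rightarrow> 'b) \<Rightarrow> ('a \<Rightarrow> 'b) set" where
  "rep_hom V s W t = {u \<in> LinearCombinations.module_hom class_ring V W.
     u \<in> extensional (carrier V) \<and> (\<forall>x\<in>carrier V. u (s x) = t (u x))}"

definition lin_trace :: "('k::field, 'a, 'x) module_scheme \<Rightarrow> ('a \<Rightarrow> 'a) \<Rightarrow> 'k" where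
  "lin_trace V f =
     (let B = (SOME B. finite B \<and> vectorspace.basis class_ring V B);
          m = (SOME m. \<forall>b\<in>B. f b = LinearCombinations.module.lincomb V (m b) B)
      in \<Sum>b\<in>B. m b b)"

definition negligible ::
    "('k::field, 'a, 'x) module_scheme \<Rightarrow> ('a \<Rightarrow> 'a) \<Rightarrow>
     ('k, 'b, 'y) module_scheme \<Rightarrow> ('b \<Rightarrow> 'b) \<Rightarrow> ('a \<Rightarrow> 'b) set" where
  "negligible V s W t = {u \<in> rep_hom V s W t. \<forall>v\<in>rep_hom W t V s. lin_trace W (u \<circ> v) = 0}"

definition lie_algebra_in_rep_alpha3 ::
    "('k::field, 'a) superalgebra \<Rightarrow> ('a \<Rightarrow> 'a) \<Rightarrow> bool" where
  "lie_algebra_in_rep_alpha3 L d \<longleftrightarrow>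
     lie_superalgebra L \<and> part L True = {\<zero>\<^bsub>L\<^esub>} \<and> rep_alpha3 L d \<and>
     (\<forall>x\<in>carrier L. \<forall>y\<in>carrier L. d (x \<otimes>\<^bsub>L\<^esub> y) = d x \<otimes>\<^bsub>L\<^esub> y \<oplus>\<^bsub>L\<^esub> x \<otimes>\<^bsub>L\<^esub> d y)"

text \<open>
  The indecomposable \<open>J n\<close> is \<open>'k^n\<close> with \<open>t\<close> acting by the nilpotent Jordan block, which is upper
  triangular here: \<open>unit_vec n i\<close> is sent to \<open>unit_vec n (i - 1)\<close> for \<open>0 < i\<close>.
\<close>

abbreviation J :: "nat \<Rightarrow> ('k::field, 'k vec) module" where
  "J n \<equiv> module_vec TYPE('k) n"

abbreviation Jt :: "nat \<Rightarrow> 'k::field vec \<Rightarrow> 'k vec" where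
  "Jt n v \<equiv> jordan_block n 0 *\<^sub>v v"

text \<open>
  In the quotient category by negligible morphisms, the functor to super vector spaces sends \<open>V\<close>
  to \<open>Hom(L1, V)\<close> (even) plus \<open>Hom(L2, V)\<close> (odd), that is, to \<open>Hom(J 1, V)\<close> plus \<open>Hom(J 2, V)\<close>
  modulo the negligible morphisms. The bracket of \<open>u : J m \<rightarrow> L\<close> and \<open>v : J n \<rightarrow> L\<close> is
  \<open>J k \<rightarrow> J m \<otimes> J n \<rightarrow> L \<otimes> L \<rightarrow> L\<close>, where the first map is the unit isomorphism if \<open>m = 1\<close> or \<open>n = 1\<close>.
  For \<open>m = n = 2\<close> it is the inclusion \<open>J 1 \<rightarrow> J 2 \<otimes> J 2\<close>, \<open>1 \<mapsto> -x \<otimes> x' + x' \<otimes> x\<close>, of the summand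
  \<open>J 1\<close> in \<open>J 1 \<oplus> J 3\<close>, where \<open>x\<close> generates \<open>J 2\<close> and \<open>x' = t x\<close>. If \<open>V\<close> is decomposed into Jordan
  blocks, the classes of the maps taking the generator of \<open>J 1\<close> or \<open>J 2\<close> to the generator of a block
  of the same size form a basis. The following is this algebra before passing to the quotient.
\<close>

definition ver3_hom_algebra ::
    "('k::field, 'a) superalgebra \<Rightarrow> ('a \<Rightarrow> 'a) \<Rightarrow>
     ('k, ('k vec \<Rightarrow> 'a) \<times> ('k vec \<Rightarrow> 'a)) superalgebra" where
  "ver3_hom_algebra L d =
     (let one1 = unit_vec 1 0; x = unit_vec 2 1; x' = Jt 2 x;
          H1 = rep_hom (J 1) (Jt 1) L d; H2 = rep_hom (J 2) (Jt 2) L d;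
          z1 = (\<lambda>v\<in>carrier (J 1). \<zero>\<^bsub>L\<^esub>); z2 = (\<lambda>v\<in>carrier (J 2). \<zero>\<^bsub>L\<^esub>)
      in \<lparr>carrier = H1 \<times> H2,
          monoid.mult = (\<lambda>(u0, u1) (v0, v1).
            (\<lambda>v\<in>carrier (J 1). (v $ 0) \<odot>\<^bsub>L\<^esub>
               (u0 one1 \<otimes>\<^bsub>L\<^esub> v0 one1 \<oplus>\<^bsub>L\<^esub> ((u1 x' \<otimes>\<^bsub>L\<^esub> v1 x) \<ominus>\<^bsub>L\<^esub> (u1 x \<otimes>\<^bsub>L\<^esub> v1 x'))),
             \<lambda>v\<in>carrier (J 2). u0 one1 \<otimes>\<^bsub>L\<^esub> v1 v \<oplus>\<^bsub>L\<^esub> u1 v \<otimes>\<^bsub>L\<^esub> v0 one1)),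
          one = (z1, z2), zero = (z1, z2),
          add = (\<lambda>(u0, u1) (v0, v1).
            (\<lambda>v\<in>carrier (J 1). u0 v \<oplus>\<^bsub>L\<^esub> v0 v, \<lambda>v\<in>carrier (J 2). u1 v \<oplus>\<^bsub>L\<^esub> v1 v)),
          module.smult = (\<lambda>c (u0, u1).
            (\<lambda>v\<in>carrier (J 1). c \<odot>\<^bsub>L\<^esub> u0 v, \<lambda>v\<in>carrier (J 2). c \<odot>\<^bsub>L\<^esub> u1 v)),
          part = (\<lambda>p. if p then {z1} \<times> H2 else H1 \<times> {z2})\<rparr>)"

definition semisimplification ::
    "('k::field, 'a) superalgebra \<Rightarrow> ('a \<Rightarrow> 'a) \<Rightarrow>
     ('k, (('k vec \<Rightarrow> 'a) \<times> ('k vec \<Rightarrow> 'a)) set) superalgebra" where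
  "semisimplification L d = quotient_superalgebra (ver3_hom_algebra L d)
     (negligible (J 1) (Jt 1) L d \<times> negligible (J 2) (Jt 2) L d)"


section \<open>The two Cartan matrices\<close>

definition cartan_e8 :: "int mat" where
  "cartan_e8 = mat_of_rows_list 8
    [[ 2,  0, -1,  0,  0,  0,  0,  0],
     [ 0,  2,  0, -1,  0,  0,  0,  0],
     [-1,  0,  2, -1,  0,  0,  0,  0],
     [ 0, -1, -1,  2, -1,  0,  0,  0],
     [ 0,  0,  0, -1,  2, -1,  0,  0],
     [ 0,  0,  0,  0, -1,  2, -1,  0],
     [ 0,  0,  0,  0,  0, -1,  2, -1],
     [ 0,  0,  0,  0,  0,  0, -1,  2]]"

definition parity_e8 :: "nat \<Rightarrow> bool" where
  "parity_e8 i = False"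

definition cartan_g66 :: "int mat" where
  "cartan_g66 = mat_of_rows_list 6
    [[ 0, -1,  0,  0,  0,  0],
     [-1,  0, -1,  0,  0,  0],
     [ 0, -1,  2, -1,  0,  0],
     [ 0,  0, -1,  2, -1,  0],
     [ 0,  0,  0, -1,  2, -1],
     [ 0,  0,  0,  0, -1,  2]]"

definition parity_g66 :: "nat \<Rightarrow> bool" where
  "parity_g66 i \<longleftrightarrow> i \<in> {0, 1}"

end

(*
  By contragredient_iso, a graded Lie superalgebra that satisfies the relations, is generated by its
  Chevalley generators and is nondegenerate off degree 0 is isomorphic to the contragredient one. This
  identifies e8 with the simply laced Lie algebra given by the root lattice and a bimultiplicative sign.
  There ad(e_1 + e_2) is the raising operator of an sl2 whose weights lie in {-2, ..., 2}; in
  characteristic 3 the weights 2 and -2 are parts of blocks of size 3, so the semisimplification is the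
  kernel of the raising operator in weight 0 (even part) plus the weight space -1 (odd part). The roots
  project to the lattice modulo alpha_1, alpha_2, the fibres give one-dimensional weight spaces, and
  descent through the projected cone shows that the result is again generated by six Chevalley triples,
  now with Cartan matrix of g(6,6). The rank conditions leave no room beyond the coroots: e8 and g(6,6)
  both have nonsingular Cartan matrices modulo 3.
*)
theory Submission
  imports Defs "HOL-Library.Product_Plus" "HOL-Library.Function_Algebras"
begin

section \<open>Nonassociative algebras with parts\<close>

text \<open>An odd element is represented by its component of weight -1. The partner of an odd root
  vector for \<open>\<alpha>\<close> is therefore not the one for \<open>- \<alpha>\<close>, which
  has weight 1, but the one for \<open>- \<alpha> - a\<close>, where \<open>a\<close> is the one of
  the two given roots with \<open>ip a \<alpha> = -1\<close>. The bracket of the two is, up to sign,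
  the coroot of \<open>a + 2 \<alpha>\<close>, whose pairing with \<open>\<alpha>\<close> is 3: this
  is the origin of the zero diagonal entries in characteristic 3. Over a string of four roots the
  kernel of the raising operator in weight 0 is spanned by a combination of two root vectors, so no
  single root vector stands for that weight. As nonzero weight spaces are lines, no table of
  structure constants is needed; one nonzero coefficient of a bracket suffices. In weight 0 this
  asks for coroots that survive reduction modulo 3: the half norms that occur are 1, 2 and 3, while
  the triple of a lattice vector has half norm divisible by 9. Super Jacobi does not give [x,[x,x]]
  = 0 in characteristic 3; the cube is additive on odd elements and vanishes on root
  vectors.\<close>

locale nonassoc_algebra = vectorspace "class_ring :: 'k ring" L
  for L :: "('k::field, 'a) superalgebra" (structure) +
  assumes mult_closed: "\<lbrakk>x \<in> carrier L; y \<in> carrier L\<rbrakk> \<Longrightarrow> x \<otimes> y \<in> carrier L"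
    and mult_add_left: "\<lbrakk>x \<in> carrier L; y \<in> carrier L; z \<in> carrier L\<rbrakk> \<Longrightarrow>
          (x \<oplus> y) \<otimes> z = x \<otimes> z \<oplus> y \<otimes> z"
    and mult_add_right: "\<lbrakk>x \<in> carrier L; y \<in> carrier L; z \<in> carrier L\<rbrakk> \<Longrightarrow>
          x \<otimes> (y \<oplus> z) = x \<otimes> y \<oplus> x \<otimes> z"
    and mult_smult_left: "\<lbrakk>x \<in> carrier L; y \<in> carrier L\<rbrakk> \<Longrightarrow> (c \<odot> x) \<otimes> y = c \<odot> (x \<otimes> y)"
    and mult_smult_right: "\<lbrakk>x \<in> carrier L; y \<in> carrier L\<rbrakk> \<Longrightarrow> x \<otimes> (c \<odot> y) = c \<odot> (x \<otimes> y)"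
    and part_carrier: "part L p \<subseteq> carrier L"

definition alg_hom :: "('k::field, 'a) superalgebra \<Rightarrow> ('k, 'b) superalgebra \<Rightarrow> ('a \<Rightarrow> 'b) \<Rightarrow> bool"
  where "alg_hom L M f \<longleftrightarrow> f \<in> LinearCombinations.module_hom class_ring L M \<and>
     (\<forall>x\<in>carrier L. \<forall>y\<in>carrier L. f (x \<otimes>\<^bsub>L\<^esub> y) = f x \<otimes>\<^bsub>M\<^esub> f y)"

lemma alg_homI:
  assumes "\<And>x. x \<in> carrier L \<Longrightarrow> f x \<in> carrier M"
    and "\<And>x y. \<lbrakk>x \<in> carrier L; y \<in> carrier L\<rbrakk> \<Longrightarrow> f (x \<oplus>\<^bsub>L\<^esub> y) = f x \<oplus>\<^bsub>M\<^esub> f y"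
    and "\<And>c x. x \<in> carrier L \<Longrightarrow> f (c \<odot>\<^bsub>L\<^esub> x) = c \<odot>\<^bsub>M\<^esub> f x"
    and "\<And>x y. \<lbrakk>x \<in> carrier L; y \<in> carrier L\<rbrakk> \<Longrightarrow> f (x \<otimes>\<^bsub>L\<^esub> y) = f x \<otimes>\<^bsub>M\<^esub> f y"
  shows "alg_hom L M f"
  using assms unfolding alg_hom_def LinearCombinations.module_hom_def by auto

lemma alg_homD:
  assumes "alg_hom L M f"
  shows "x \<in> carrier L \<Longrightarrow> f x \<in> carrier M"
    and "\<lbrakk>x \<in> carrier L; y \<in> carrier L\<rbrakk> \<Longrightarrow> f (x \<oplus>\<^bsub>L\<^esub> y) = f x \<oplus>\<^bsub>M\<^esub> f y"
    and "x \<in> carrier L \<Longrightarrow> f (c \<odot>\<^bsub>L\<^esub> x) = c \<odot>\<^bsub>M\<^esub> f x"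
    and "\<lbrakk>x \<in> carrier L; y \<in> carrier L\<rbrakk> \<Longrightarrow> f (x \<otimes>\<^bsub>L\<^esub> y) = f x \<otimes>\<^bsub>M\<^esub> f y"
  using assms unfolding alg_hom_def LinearCombinations.module_hom_def by auto

lemma lie_identities_cases:
  assumes "t \<in> lie_identities L"
  obtains (skew) p q x y where "x \<in> part L p" "y \<in> part L q"
      "t = x \<otimes>\<^bsub>L\<^esub> y \<oplus>\<^bsub>L\<^esub> koszul p q \<odot>\<^bsub>L\<^esub> (y \<otimes>\<^bsub>L\<^esub> x)"
  | (jacobi) p q x y z where "x \<in> part L p" "y \<in> part L q" "z \<in> carrier L"
      "t = x \<otimes>\<^bsub>L\<^esub> (y \<otimes>\<^bsub>L\<^esub> z) \<ominus>\<^bsub>L\<^esub>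
         ((x \<otimes>\<^bsub>L\<^esub> y) \<otimes>\<^bsub>L\<^esub> z \<oplus>\<^bsub>L\<^esub> koszul p q \<odot>\<^bsub>L\<^esub> (y \<otimes>\<^bsub>L\<^esub> (x \<otimes>\<^bsub>L\<^esub> z)))"
  | (cube) x where "x \<in> part L True" "t = x \<otimes>\<^bsub>L\<^esub> (x \<otimes>\<^bsub>L\<^esub> x)"
  using assms unfolding lie_identities_def by blast

lemma lie_identities_intros:
  shows "\<lbrakk>x \<in> part L p; y \<in> part L q\<rbrakk> \<Longrightarrow>
      x \<otimes>\<^bsub>L\<^esub> y \<oplus>\<^bsub>L\<^esub> koszul p q \<odot>\<^bsub>L\<^esub> (y \<otimes>\<^bsub>L\<^esub> x) \<in> lie_identities L"
    and "\<lbrakk>x \<in> part L p; y \<in> part L q; z \<in> carrier L\<rbrakk> \<Longrightarrow>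
      x \<otimes>\<^bsub>L\<^esub> (y \<otimes>\<^bsub>L\<^esub> z) \<ominus>\<^bsub>L\<^esub>
        ((x \<otimes>\<^bsub>L\<^esub> y) \<otimes>\<^bsub>L\<^esub> z \<oplus>\<^bsub>L\<^esub> koszul p q \<odot>\<^bsub>L\<^esub> (y \<otimes>\<^bsub>L\<^esub> (x \<otimes>\<^bsub>L\<^esub> z))) \<in> lie_identities L"
    and "x \<in> part L True \<Longrightarrow> x \<otimes>\<^bsub>L\<^esub> (x \<otimes>\<^bsub>L\<^esub> x) \<in> lie_identities L"
  unfolding lie_identities_def by blast+

lemma superalgebra_iso_alt:
  "f \<in> superalgebra_iso L M \<longleftrightarrow> alg_hom L M f \<and> bij_betw f (carrier L) (carrier M) \<and>
     (\<forall>p. f ` part L p = part M p)"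
  unfolding superalgebra_iso_def alg_hom_def by auto

lemma lie_superalgebra_nonassoc_algebra:
  assumes "lie_superalgebra L" shows "nonassoc_algebra L"
proof -
  interpret lie_superalgebra L by fact
  show ?thesis
    by unfold_locales (use bracket_closed bracket_add_left bracket_add_right bracket_smult_left
        bracket_smult_right part_subspace[unfolded VectorSpace.subspace_def submodule_def] in auto)
qed

lemma class_ring_field: "Ring.field (class_ring :: 'k::field ring)"
  by (rule class_field.field_axioms)

text \<open>The axioms are equations and pass to surjective images. This spares checking vector
  space axioms by hand on cosets and on pairs of normalised morphisms.\<close>

lemma nonassoc_algebra_surj_image:
  assumes "nonassoc_algebra M" and im: "f ` carrier M = carrier N"
    and add: "\<And>x y. \<lbrakk>x \<in> carrier M; y \<in> carrier M\<rbrakk> \<Longrightarrow> f (x \<oplus>\<^bsub>M\<^esub> y) = f x \<oplus>\<^bsub>N\<^esub> f y"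
    and smult: "\<And>c x. x \<in> carrier M \<Longrightarrow> f (c \<odot>\<^bsub>M\<^esub> x) = c \<odot>\<^bsub>N\<^esub> f x"
    and mult: "\<And>x y. \<lbrakk>x \<in> carrier M; y \<in> carrier M\<rbrakk> \<Longrightarrow> f (x \<otimes>\<^bsub>M\<^esub> y) = f x \<otimes>\<^bsub>N\<^esub> f y"
    and zero: "f \<zero>\<^bsub>M\<^esub> = \<zero>\<^bsub>N\<^esub>"
    and part: "\<And>p. part N p \<subseteq> carrier N"
  shows "nonassoc_algebra N"
proof -
  interpret M: nonassoc_algebra M by fact
  note rev = add[symmetric] smult[symmetric] mult[symmetric] zero[symmetric]
  have neg: "\<forall>v\<in>carrier N. \<exists>w\<in>carrier N. v \<oplus>\<^bsub>N\<^esub> w = \<zero>\<^bsub>N\<^esub>"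
  proof
    fix v assume "v \<in> carrier N"
    then obtain x where x: "x \<in> carrier M" "v = f x" using im by auto
    then have "v \<oplus>\<^bsub>N\<^esub> f (\<ominus>\<^bsub>M\<^esub> x) = \<zero>\<^bsub>N\<^esub>"
      by (metis M.M.add.inv_closed M.M.r_neg add zero)
    with x show "\<exists>w\<in>carrier N. v \<oplus>\<^bsub>N\<^esub> w = \<zero>\<^bsub>N\<^esub>" using im by blast
  qed
  have vs: "vectorspace class_ring N"
    apply (rule vs_criteria[OF class_ring_field _ _ neg])
    unfolding im[symmetric]
    by (auto simp: rev M.M.a_assoc M.M.a_comm M.smult_l_distr M.smult_r_distr
          M.smult_assoc1 M.M.a_ac class_ring_simps
          M.smult_l_distr[simplified] M.smult_assoc1[simplified]
          M.smult_r_distr[simplified] M.smult_one[simplified] M.smult_closed[simplified])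
  interpret N: vectorspace class_ring N by fact
  have sm: "c \<odot>\<^bsub>M\<^esub> x \<in> carrier M" if "x \<in> carrier M" for c x
    using that by simp
  show ?thesis
    by unfold_locales
      (use part in \<open>auto simp: im[symmetric] rev sm M.mult_closed M.mult_add_left M.mult_add_right
        M.mult_smult_left M.mult_smult_right\<close>)
qed

text \<open>All axioms are pulled back along the bijection. Membership in a part can be tested on
  the image (\<open>mem\<close>), because an isomorphism matches the parts exactly.\<close>

lemma lie_superalgebra_transport:
  assumes "nonassoc_algebra N" "lie_superalgebra L" "f \<in> superalgebra_iso N L"
  shows "lie_superalgebra N"
proof -
  interpret N: nonassoc_algebra N by fact
  interpret L: lie_superalgebra L by fact
  have hom: "alg_hom N L f" and bij: "bij_betw f (carrier N) (carrier L)"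
    and part: "\<And>p. f ` part N p = part L p"
    using assms(3) by (auto simp: superalgebra_iso_alt)
  note h = alg_homD[OF hom]
  interpret lm: mod_hom class_ring N L f
    by unfold_locales (use hom in \<open>auto simp: alg_hom_def\<close>)
  have inj: "x = y" if "f x = f y" "x \<in> carrier N" "y \<in> carrier N" for x y
    using bij that by (auto simp: bij_betw_def inj_on_def)
  have mem: "x \<in> part N p \<longleftrightarrow> x \<in> carrier N \<and> f x \<in> part L p" for x p
  proof
    assume "x \<in> part N p" then show "x \<in> carrier N \<and> f x \<in> part L p"
      using N.part_carrier part by blast
  next
    assume a: "x \<in> carrier N \<and> f x \<in> part L p"
    then obtain y where "y \<in> part N p" "f x = f y" using part[of p] by (metis imageE)
    then show "x \<in> part N p" using inj N.part_carrier a by blast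
  qed
  have L0: "\<zero>\<^bsub>L\<^esub> \<in> part L p" for p
    using L.part_subspace[of p] by (auto simp: VectorSpace.subspace_def submodule_def)
  have Ladd: "x \<oplus>\<^bsub>L\<^esub> y \<in> part L p" if "x \<in> part L p" "y \<in> part L p" for x y p
    using that L.part_subspace[of p] by (auto simp: VectorSpace.subspace_def submodule_def)
  have Lsm: "c \<odot>\<^bsub>L\<^esub> x \<in> part L p" if "x \<in> part L p" for c x p
    using that L.part_subspace[of p] by (auto simp: VectorSpace.subspace_def submodule_def)
  have sm: "c \<odot>\<^bsub>N\<^esub> x \<in> carrier N" if "x \<in> carrier N" for c x
    using that by simp
  show ?thesis
  proof (rule lie_superalgebra.intro[OF N.vectorspace_axioms], rule lie_superalgebra_axioms.intro)
    show "VectorSpace.subspace class_ring (part N p) N" for p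
      unfolding VectorSpace.subspace_def submodule_def
      by (intro conjI N.vectorspace_axioms N.module_axioms)
        (auto simp: mem h L0 Ladd Lsm sm lm.f0_is_0)
    show "\<exists>a\<in>part N False. \<exists>b\<in>part N True. x = a \<oplus>\<^bsub>N\<^esub> b" if x: "x \<in> carrier N" for x
    proof -
      obtain a b where ab: "a \<in> part L False" "b \<in> part L True" "f x = a \<oplus>\<^bsub>L\<^esub> b"
        using L.part_sum[OF h(1)[OF x]] by blast
      then obtain a' b' where ab': "a' \<in> part N False" "b' \<in> part N True" "a = f a'" "b = f b'"
        using part by (metis imageE)
      then have "x = a' \<oplus>\<^bsub>N\<^esub> b'" using ab x by (intro inj) (auto simp: mem h)
      then show ?thesis using ab' by blast
    qed
    show "part N False \<inter> part N True = {\<zero>\<^bsub>N\<^esub>}"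
    proof (intro equalityI subsetI)
      fix x assume "x \<in> part N False \<inter> part N True"
      then have "f x \<in> part L False \<inter> part L True" "x \<in> carrier N" by (auto simp: mem)
      then have "f x = f \<zero>\<^bsub>N\<^esub>" "x \<in> carrier N" using L.part_direct lm.f0_is_0 by auto
      then show "x \<in> {\<zero>\<^bsub>N\<^esub>}" using inj by simp
    qed (auto simp: mem L0 lm.f0_is_0)
    show "x \<otimes>\<^bsub>N\<^esub> y \<in> part N (p \<noteq> q)" if "x \<in> part N p" "y \<in> part N q" for x y p q
      using that L.bracket_part[of "f x" p "f y" q] by (auto simp: mem h N.mult_closed)
    show "lie_identities N \<subseteq> {\<zero>\<^bsub>N\<^esub>}"
    proof
      fix t assume t: "t \<in> lie_identities N"
      \<comment> \<open>Each identity of \<open>N\<close> goes to the identity of the same shape in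
        \<open>L\<close>, hence to zero, and \<open>f\<close> is injective.\<close>
      have tm: "f t \<in> lie_identities L \<and> t \<in> carrier N"
        using t
      proof (cases rule: lie_identities_cases)
        case (skew p q x y)
        then show ?thesis
          using lie_identities_intros(1)[of "f x" L p "f y" q] by (simp add: mem h N.mult_closed sm)
      next
        case (jacobi p q x y z)
        then show ?thesis
          using lie_identities_intros(2)[of "f x" L p "f y" q "f z"]
          by (simp add: mem h N.mult_closed sm)
      next
        case (cube x)
        then show ?thesis
          using lie_identities_intros(3)[of "f x" L] by (simp add: mem h N.mult_closed)
      qed
      then have "f t = f \<zero>\<^bsub>N\<^esub>" using L.lie by (auto simp: lm.f0_is_0)
      then show "t \<in> {\<zero>\<^bsub>N\<^esub>}" using inj tm by simp
    qed
  qed (rule N.mult_closed N.mult_add_left N.mult_add_right N.mult_smult_left N.mult_smult_right; assumption)+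
qed

lemma superalgebra_iso_inv:
  assumes "nonassoc_algebra L" "\<And>p. part L p \<subseteq> carrier L" "f \<in> superalgebra_iso L M"
  shows "inv_into (carrier L) f \<in> superalgebra_iso M L"
proof -
  interpret nonassoc_algebra L by fact
  let ?g = "inv_into (carrier L) f"
  have hom: "alg_hom L M f" and bij: "bij_betw f (carrier L) (carrier M)"
    and part: "\<And>p. f ` part L p = part M p"
    using assms(3) by (auto simp: superalgebra_iso_alt)
  note h = alg_homD[OF hom]
  have gf: "?g (f x) = x" if "x \<in> carrier L" for x
    using bij that by (simp add: bij_betw_inv_into_left)
  have ex: "\<exists>x\<in>carrier L. y = f x" if "y \<in> carrier M" for y
    using bij that by (auto simp: bij_betw_def)
  have sm: "c \<odot>\<^bsub>L\<^esub> x \<in> carrier L" if "x \<in> carrier L" for c x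
    using that by simp
  have "alg_hom M L ?g"
    by (rule alg_homI)
      (auto dest!: ex simp: gf h(2-4)[symmetric] mult_closed sm)
  moreover have "?g ` part M p = part L p" for p
    unfolding part[symmetric] using assms(2)[of p] by (auto simp: image_image gf subset_iff)
  ultimately show ?thesis
    using bij_betw_inv_into[OF bij] by (simp add: superalgebra_iso_alt)
qed

lemma superalgebra_iso_comp:
  assumes f: "f \<in> superalgebra_iso L M" and g: "g \<in> superalgebra_iso M N"
  shows "g \<circ> f \<in> superalgebra_iso L N"
proof -
  have h: "alg_hom L M f" "alg_hom M N g" using f g by (auto simp: superalgebra_iso_alt)
  have "alg_hom L N (g \<circ> f)" by (rule alg_homI) (auto simp: alg_homD[OF h(1)] alg_homD[OF h(2)])
  moreover have "bij_betw (g \<circ> f) (carrier L) (carrier N)"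
    using f g by (auto simp: superalgebra_iso_alt intro: bij_betw_trans)
  moreover have "\<forall>p. (g \<circ> f) ` part L p = part N p"
    using f g unfolding superalgebra_iso_alt by (simp only: image_comp[symmetric] simp_thms)
  ultimately show ?thesis by (simp add: superalgebra_iso_alt)
qed

text \<open>The ideals of this development are controlled as kernels of explicit homomorphisms: the
  ideal of relations lies inside one, while the radical and the set of negligible morphisms are
  equal to one.\<close>

lemma kernel_ideal:
  fixes L :: "('k::field, 'a) superalgebra" and M :: "('k, 'b) superalgebra"
  assumes "nonassoc_algebra L" "nonassoc_algebra M" "alg_hom L M f"
  shows "alg_ideal L {x \<in> carrier L. f x = \<zero>\<^bsub>M\<^esub>}"
proof -
  interpret L: nonassoc_algebra L by fact
  interpret M: nonassoc_algebra M by fact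
  have mh: "mod_hom class_ring L M f"
    using assms(3) by (intro mod_hom.intro mod_hom_axioms.intro L.module_axioms M.module_axioms) (simp add: alg_hom_def)
  have zero: "f x \<otimes>\<^bsub>M\<^esub> \<zero>\<^bsub>M\<^esub> = \<zero>\<^bsub>M\<^esub>" "\<zero>\<^bsub>M\<^esub> \<otimes>\<^bsub>M\<^esub> f x = \<zero>\<^bsub>M\<^esub>" if "x \<in> carrier L" for x
  proof -
    have "f x \<in> carrier M" using alg_homD(1)[OF assms(3)] that by blast
    moreover have z: "(0 :: 'k) \<odot>\<^bsub>M\<^esub> y = \<zero>\<^bsub>M\<^esub>" if "y \<in> carrier M" for y using M.smult_l_null[of y] that by simp
    ultimately show "f x \<otimes>\<^bsub>M\<^esub> \<zero>\<^bsub>M\<^esub> = \<zero>\<^bsub>M\<^esub>" "\<zero>\<^bsub>M\<^esub> \<otimes>\<^bsub>M\<^esub> f x = \<zero>\<^bsub>M\<^esub>"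
      using M.mult_smult_right[of "f x" "\<zero>\<^bsub>M\<^esub>" 0] M.mult_smult_left[of "\<zero>\<^bsub>M\<^esub>" "f x" 0]
        z[OF M.mult_closed[of "f x" "\<zero>\<^bsub>M\<^esub>"]] z[OF M.mult_closed[of "\<zero>\<^bsub>M\<^esub>" "f x"]] z[of "\<zero>\<^bsub>M\<^esub>"] by simp_all
  qed
  have "submodule class_ring {x \<in> carrier L. f x = \<zero>\<^bsub>M\<^esub>} L"
    using mod_hom.ker_is_submodule[OF mh] mod_hom.ker_def[OF mh] by simp
  then show ?thesis
    unfolding alg_ideal_def VectorSpace.subspace_def
    using L.mult_closed alg_homD(4)[OF assms(3)] L.vectorspace_axioms zero by simp
qed

subsection \<open>Quotients\<close>

locale algebra_ideal = nonassoc_algebra L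
  for L :: "('k::field, 'a) superalgebra" (structure) +
  fixes I assumes ideal: "alg_ideal L I"
begin

lemma ideal_subset: "I \<subseteq> carrier L" and ideal_zero: "\<zero> \<in> I"
  and ideal_add: "\<lbrakk>x \<in> I; y \<in> I\<rbrakk> \<Longrightarrow> x \<oplus> y \<in> I"
  and ideal_smult: "x \<in> I \<Longrightarrow> c \<odot> x \<in> I"
  and ideal_mult: "\<lbrakk>x \<in> carrier L; y \<in> I\<rbrakk> \<Longrightarrow> x \<otimes> y \<in> I"
  and ideal_mult': "\<lbrakk>x \<in> carrier L; y \<in> I\<rbrakk> \<Longrightarrow> y \<otimes> x \<in> I"
  using ideal unfolding alg_ideal_def VectorSpace.subspace_def submodule_def by auto

lemma smult_carrier: "x \<in> carrier L \<Longrightarrow> c \<odot> x \<in> carrier L" by simp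

lemma neg_eq: "x \<in> carrier L \<Longrightarrow> \<ominus> x = (- 1) \<odot> x"
  using smult_l_minus[of "1" x] smult_one[of x] by (simp add: class_ring_simps)

lemma ideal_minus: "\<lbrakk>x \<in> I; y \<in> I\<rbrakk> \<Longrightarrow> x \<ominus> y \<in> I"
  unfolding a_minus_def using neg_eq ideal_subset ideal_add ideal_smult by auto

lemma minus_minus_add: "\<lbrakk>x \<in> carrier L; y \<in> carrier L; z \<in> carrier L\<rbrakk> \<Longrightarrow> (x \<ominus> y) \<oplus> (y \<ominus> z) = x \<ominus> z"
  by (simp add: a_minus_def M.a_assoc[of x] M.a_assoc[of "\<ominus> y" y "\<ominus> z", symmetric] M.l_neg)

lemma minus_swap: "\<lbrakk>x \<in> carrier L; y \<in> carrier L\<rbrakk> \<Longrightarrow> \<ominus> (x \<ominus> y) = y \<ominus> x"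
  by (simp add: a_minus_def M.minus_add M.a_comm)

lemma ideal_neg: "x \<in> I \<Longrightarrow> \<ominus> x \<in> I"
  using neg_eq ideal_subset ideal_smult by auto

lemma coset_def: "x \<in> carrier L \<Longrightarrow> I +> x = {y \<in> carrier L. y \<ominus> x \<in> I}"
proof (intro equalityI subsetI)
  fix y assume x: "x \<in> carrier L" and "y \<in> I +> x"
  then obtain h where h: "h \<in> I" "y = h \<oplus> x" by (auto simp: a_r_coset_def r_coset_def)
  then have "y \<ominus> x = h" using x ideal_subset
    by (simp add: a_minus_def M.a_assoc M.r_neg subset_iff)
  then show "y \<in> {y \<in> carrier L. y \<ominus> x \<in> I}" using h x ideal_subset by auto
next
  fix y assume x: "x \<in> carrier L" and y: "y \<in> {y \<in> carrier L. y \<ominus> x \<in> I}"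
  then have "y = (y \<ominus> x) \<oplus> x" by (simp add: a_minus_def M.a_assoc M.l_neg)
  then show "y \<in> I +> x" using y by (auto simp: a_r_coset_def r_coset_def)
qed

lemma coset_eq_iff:
  assumes "x \<in> carrier L" "y \<in> carrier L"
  shows "I +> x = I +> y \<longleftrightarrow> x \<ominus> y \<in> I"
proof
  assume "I +> x = I +> y"
  moreover have "x \<ominus> x \<in> I" using assms ideal_zero by (simp add: a_minus_def M.r_neg)
  ultimately show "x \<ominus> y \<in> I" using assms by (auto simp: coset_def)
next
  assume xy: "x \<ominus> y \<in> I"
  then have yx: "y \<ominus> x \<in> I" using ideal_neg[OF xy] minus_swap assms by simp
  have "z \<ominus> x \<in> I \<longleftrightarrow> z \<ominus> y \<in> I" if "z \<in> carrier L" for z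
    using ideal_add[OF _ xy, of "z \<ominus> x"] ideal_add[OF _ yx, of "z \<ominus> y"] minus_minus_add[of z x y]
      minus_minus_add[of z y x] that assms by auto
  then show "I +> x = I +> y"
    using assms by (auto simp: coset_def)
qed

lemma coset_self: "x \<in> carrier L \<Longrightarrow> x \<in> I +> x"
  using ideal_zero by (simp add: coset_def a_minus_def M.r_neg)

text \<open>The quotient record defines its operations as unions over all representatives. When the
  resulting coset does not depend on the representative, the union has just one member.\<close>

lemma coset_collapse:
  assumes "x \<in> carrier L" "\<And>y. \<lbrakk>y \<in> carrier L; y \<ominus> x \<in> I\<rbrakk> \<Longrightarrow> F y = F x"
  shows "(\<Union>y\<in>I +> x. F y) = F x"
proof -
  have "F y = F x" if "y \<in> I +> x" for y
    using that assms by (simp add: coset_def)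
  then show ?thesis using coset_self[OF assms(1)] by blast
qed

lemma minus_closed: "\<lbrakk>x \<in> carrier L; y \<in> carrier L\<rbrakk> \<Longrightarrow> x \<ominus> y \<in> carrier L"
  by simp

lemma mult_minus_left: "\<lbrakk>x \<in> carrier L; y \<in> carrier L; z \<in> carrier L\<rbrakk> \<Longrightarrow> (x \<ominus> y) \<otimes> z = x \<otimes> z \<ominus> y \<otimes> z"
  using mult_add_left[of x "\<ominus> y" z] mult_smult_left[of y z "- 1"] neg_eq[of y] neg_eq[of "y \<otimes> z"]
  by (simp add: a_minus_def mult_closed)

lemma mult_minus_right: "\<lbrakk>x \<in> carrier L; y \<in> carrier L; z \<in> carrier L\<rbrakk> \<Longrightarrow> z \<otimes> (x \<ominus> y) = z \<otimes> x \<ominus> z \<otimes> y"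
  using mult_add_right[of z x "\<ominus> y"] mult_smult_right[of z y "- 1"] neg_eq[of y] neg_eq[of "z \<otimes> y"]
  by (simp add: a_minus_def mult_closed)

lemma smult_minus: "\<lbrakk>x \<in> carrier L; y \<in> carrier L\<rbrakk> \<Longrightarrow> c \<odot> (x \<ominus> y) = c \<odot> x \<ominus> c \<odot> y"
  using smult_r_distr[of c x "\<ominus> y"] smult_r_minus[of c y] by (simp add: a_minus_def)

abbreviation Q where "Q \<equiv> quotient_superalgebra L I"

lemma quotient_carrier: "carrier Q = (\<lambda>x. I +> x) ` carrier L"
  by (auto simp: quotient_superalgebra_def FactRing_def A_RCOSETS_def RCOSETS_def a_r_coset_def)

lemma quotient_part: "part Q p = (\<lambda>x. I +> x) ` part L p"
  by (simp add: quotient_superalgebra_def)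

lemma quotient_zero: "\<zero>\<^bsub>Q\<^esub> = I +> \<zero>"
  using ideal_subset by (auto simp: quotient_superalgebra_def FactRing_def coset_def a_minus_def)

lemma quotient_add:
  assumes "x \<in> carrier L" "y \<in> carrier L"
  shows "(I +> x) \<oplus>\<^bsub>Q\<^esub> (I +> y) = I +> (x \<oplus> y)"
proof -
  have eq: "(x' \<oplus> y') \<ominus> (x \<oplus> y) = (x' \<ominus> x) \<oplus> (y' \<ominus> y)" if "x' \<in> carrier L" "y' \<in> carrier L" for x' y'
    using that assms by (simp add: a_minus_def M.minus_add M.a_ac)
  have "z \<in> set_add L (I +> x) (I +> y)" if z: "z \<in> I +> (x \<oplus> y)" for z
  proof -
    have zc: "z \<in> carrier L" "z \<ominus> (x \<oplus> y) \<in> I" using z assms by (auto simp: coset_def)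
    have "z = (z \<ominus> y) \<oplus> y" using zc assms by (simp add: a_minus_def M.a_assoc M.l_neg)
    moreover have "(z \<ominus> y) \<ominus> x = z \<ominus> (x \<oplus> y)"
      using zc assms by (simp add: a_minus_def M.minus_add M.a_ac)
    ultimately have "z \<ominus> y \<in> I +> x" using zc assms by (simp add: coset_def)
    then show ?thesis using \<open>z = (z \<ominus> y) \<oplus> y\<close> coset_self[OF assms(2)]
      unfolding set_add_def set_mult_def by (simp, blast)
  qed
  moreover have "z \<in> I +> (x \<oplus> y)" if z: "z \<in> set_add L (I +> x) (I +> y)" for z
    using z assms by (auto simp: set_add_def set_mult_def coset_def eq intro: ideal_add)
  ultimately have "set_add L (I +> x) (I +> y) = I +> (x \<oplus> y)" by blast
  then show ?thesis by (simp add: quotient_superalgebra_def FactRing_def)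
qed

lemma quotient_smult:
  assumes "x \<in> carrier L"
  shows "c \<odot>\<^bsub>Q\<^esub> (I +> x) = I +> (c \<odot> x)"
proof -
  have "(\<Union>y\<in>I +> x. I +> (c \<odot> y)) = I +> (c \<odot> x)"
    using assms by (intro coset_collapse) (auto simp: coset_eq_iff smult_minus[symmetric] smult_carrier ideal_smult)
  then show ?thesis by (simp add: quotient_superalgebra_def)
qed

lemma quotient_mult:
  assumes "x \<in> carrier L" "y \<in> carrier L"
  shows "(I +> x) \<otimes>\<^bsub>Q\<^esub> (I +> y) = I +> (x \<otimes> y)"
proof -
  have "(\<Union>x'\<in>I +> x. \<Union>y'\<in>I +> y. I +> (x' \<otimes> y')) = (\<Union>x'\<in>I +> x. I +> (x' \<otimes> y))"
  proof (intro SUP_cong refl coset_collapse assms)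
    fix x' y' assume "x' \<in> I +> x" and y': "y' \<in> carrier L" "y' \<ominus> y \<in> I"
    then have "x' \<in> carrier L" using assms by (simp add: coset_def)
    then show "I +> (x' \<otimes> y') = I +> (x' \<otimes> y)" using y' assms
      by (simp add: coset_eq_iff mult_closed mult_minus_right[symmetric] ideal_mult)
  qed
  also have "\<dots> = I +> (x \<otimes> y)"
    using assms by (intro coset_collapse)
      (auto simp: coset_eq_iff mult_closed mult_minus_left[symmetric] ideal_mult')
  finally show ?thesis by (simp add: quotient_superalgebra_def FactRing_def rcoset_mult_def)
qed

lemma quotient_nonassoc_algebra: "nonassoc_algebra Q"
  by (rule nonassoc_algebra_surj_image[OF nonassoc_algebra_axioms, where f = "\<lambda>x. I +> x"])
    (use part_carrier in \<open>auto simp: quotient_carrier quotient_add quotient_smult quotient_mult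
      quotient_zero quotient_part\<close>)

lemma quotient_lift:
  assumes f: "alg_hom L M f" and M: "nonassoc_algebra M" and ker: "\<And>x. x \<in> I \<Longrightarrow> f x = \<zero>\<^bsub>M\<^esub>"
  obtains g where "alg_hom Q M g" "\<And>x. x \<in> carrier L \<Longrightarrow> g (I +> x) = f x"
proof -
  interpret M: nonassoc_algebra M by fact
  interpret lm: mod_hom class_ring L M f
    by unfold_locales (use f in \<open>auto simp: alg_hom_def\<close>)
  note h = alg_homD[OF f]
  \<comment> \<open>The factor map evaluates \<open>f\<close> at a chosen representative; the choice
    is harmless because \<open>f\<close> vanishes on the ideal.\<close>
  let ?g = "\<lambda>X. f (SOME x. x \<in> X)"
  have g: "?g (I +> x) = f x" if x: "x \<in> carrier L" for x
  proof -
    let ?y = "SOME y. y \<in> I +> x"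
    have "?y \<in> I +> x" by (rule someI, rule coset_self[OF x])
    then have y: "?y \<in> carrier L" "?y \<ominus> x \<in> I" using x by (auto simp: coset_def)
    have "f ?y = f (?y \<ominus> x) \<oplus>\<^bsub>M\<^esub> f x"
      using h(2)[of "?y \<ominus> x" x] x y(1) by (simp add: a_minus_def a_assoc M.l_neg)
    then show ?thesis using ker[OF y(2)] x h(1) by simp
  qed
  have "alg_hom Q M ?g"
    by (rule alg_homI) (auto simp: quotient_carrier quotient_add quotient_smult quotient_mult g h
        smult_carrier mult_closed)
  then show ?thesis using that g by blast
qed

lemma first_isomorphism:
  assumes f: "alg_hom L M f" and M: "nonassoc_algebra M"
    and ker: "\<And>x. x \<in> carrier L \<Longrightarrow> x \<in> I \<longleftrightarrow> f x = \<zero>\<^bsub>M\<^esub>"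
    and surj: "f ` carrier L = carrier M" and part: "\<And>p. f ` part L p = part M p"
  obtains g where "g \<in> superalgebra_iso Q M" "\<And>x. x \<in> carrier L \<Longrightarrow> g (I +> x) = f x"
proof -
  interpret M: nonassoc_algebra M by fact
  interpret lm: mod_hom class_ring L M f
    by unfold_locales (use f in \<open>auto simp: alg_hom_def\<close>)
  note h = alg_homD[OF f]
  have "f x = \<zero>\<^bsub>M\<^esub>" if "x \<in> I" for x using ker[of x] ideal_subset that by auto
  from quotient_lift[OF f M this]
  obtain g where g: "alg_hom Q M g" "\<And>x. x \<in> carrier L \<Longrightarrow> g (I +> x) = f x" by blast
  have "inj_on g (carrier Q)"
  proof (rule inj_onI, clarsimp simp: quotient_carrier g)
    fix x y assume xy: "x \<in> carrier L" "y \<in> carrier L" "f x = f y"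
    have "f (x \<ominus> y) = \<zero>\<^bsub>M\<^esub>" using lm.f_minus[OF xy(1,2)] xy h(1)[OF xy(2)]
      by (simp only: M.M.minus_eq M.M.r_neg)
    then show "I +> x = I +> y" using xy ker[OF minus_closed[OF xy(1,2)]] by (simp add: coset_eq_iff)
  qed
  moreover have "g ` carrier Q = carrier M" using surj g(2) by (simp add: quotient_carrier image_image)
  moreover have "g ` part Q p = part M p" for p
    unfolding quotient_part image_image part[symmetric] using g(2) part_carrier[of p]
    by (intro image_cong) auto
  ultimately have "g \<in> superalgebra_iso Q M" using g(1) by (simp add: superalgebra_iso_alt bij_betw_def)
  then show ?thesis using that g(2) by blast
qed

end

subsection \<open>Algebras on a subspace of a type\<close>

text \<open>A bridge between two styles: concrete algebras live on a subset of a type and use its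
  own addition and \<open>sum\<close>, while the goal speaks about records with carriers.\<close>

definition alg_record :: "('k \<Rightarrow> 'v \<Rightarrow> 'v) \<Rightarrow> ('v \<Rightarrow> 'v \<Rightarrow> 'v) \<Rightarrow> 'v set \<Rightarrow> (bool \<Rightarrow> 'v set) \<Rightarrow>
    ('k::field, 'v::ab_group_add) superalgebra" where
  "alg_record sc m V P = \<lparr>carrier = V, monoid.mult = m, one = 0, zero = 0, add = (+),
     module.smult = sc, part = P\<rparr>"

lemma alg_record_simps [simp]:
  "carrier (alg_record sc m V P) = V" "monoid.mult (alg_record sc m V P) = m"
  "zero (alg_record sc m V P) = 0" "add (alg_record sc m V P) = (+)"
  "module.smult (alg_record sc m V P) = sc" "part (alg_record sc m V P) = P"
  by (simp_all add: alg_record_def)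

locale bilinear_product = vector_space sc
  for sc :: "'k::field \<Rightarrow> 'v::ab_group_add \<Rightarrow> 'v" +
  fixes m :: "'v \<Rightarrow> 'v \<Rightarrow> 'v"
  assumes m_add_left: "m (x + y) z = m x z + m y z"
    and m_add_right: "m x (y + z) = m x y + m x z"
    and m_scale_left: "m (sc c x) y = sc c (m x y)"
    and m_scale_right: "m x (sc c y) = sc c (m x y)"
begin

lemma m_zero_left [simp]: "m 0 y = 0"
  using m_add_left[of 0 0 y] by simp

lemma m_zero_right [simp]: "m x 0 = 0"
  using m_add_right[of x 0 0] by simp

lemma m_minus_left: "m (- x) y = - m x y"
  using m_add_left[of x "- x" y] by (simp add: eq_neg_iff_add_eq_0 add.commute)

lemma m_minus_right: "m x (- y) = - m x y"
  using m_add_right[of x y "- y"] by (simp add: eq_neg_iff_add_eq_0 add.commute)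

lemma m_diff_left: "m (x - y) z = m x z - m y z"
  using m_add_left[of x "- y" z] by (simp add: m_minus_left)

lemma m_diff_right: "m x (y - z) = m x y - m x z"
  using m_add_right[of x y "- z"] by (simp add: m_minus_right)

lemma m_sum_left: "m (\<Sum>i\<in>S. f i) y = (\<Sum>i\<in>S. m (f i) y)"
  by (induction S rule: infinite_finite_induct) (auto simp: m_add_left)

lemma m_sum_right: "m x (\<Sum>i\<in>S. f i) = (\<Sum>i\<in>S. m x (f i))"
  by (induction S rule: infinite_finite_induct) (auto simp: m_add_right)

lemma alg_record_nonassoc_algebra:
  assumes V: "subspace V" and cl: "\<And>x y. \<lbrakk>x \<in> V; y \<in> V\<rbrakk> \<Longrightarrow> m x y \<in> V" and P: "\<And>p. P p \<subseteq> V"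
  shows "nonassoc_algebra (alg_record sc m V P)"
proof -
  have neg: "\<forall>v\<in>V. \<exists>w\<in>V. v + w = 0"
    by (intro ballI, rule_tac x="- v" in bexI) (auto intro: subspace_neg[OF V])
  have "vectorspace class_ring (alg_record sc m V P)"
    apply (rule vs_criteria[OF class_ring_field])
    subgoal using subspace_0[OF V] by simp
    subgoal using subspace_add[OF V] by simp
    subgoal using neg by simp
    subgoal using subspace_scale[OF V] by simp
    subgoal by (simp add: add.commute)
    subgoal by (simp add: add.assoc)
    subgoal by simp
    subgoal by simp
    subgoal by simp
    subgoal by (simp add: scale_left_distrib)
    subgoal by (simp add: scale_right_distrib)
    done
  then show ?thesis
    by (rule nonassoc_algebra.intro, unfold nonassoc_algebra_axioms_def)
      (use P in \<open>auto simp only: alg_record_simps cl m_add_left m_add_right m_scale_left m_scale_right\<close>)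
qed

end

lemma alg_record_neg:
  assumes "nonassoc_algebra (alg_record sc m V P)" "x \<in> V"
  shows "\<ominus>\<^bsub>alg_record sc m V P\<^esub> x = - x"
proof -
  interpret nonassoc_algebra "alg_record sc m V P" by fact
  have "\<ominus>\<^bsub>alg_record sc m V P\<^esub> x + x = 0" using M.l_neg[of x] assms(2) by simp
  then show ?thesis by (simp add: eq_neg_iff_add_eq_0)
qed

lemma alg_record_minus:
  assumes "nonassoc_algebra (alg_record sc m V P)" "y \<in> V"
  shows "x \<ominus>\<^bsub>alg_record sc m V P\<^esub> y = x - y"
  using alg_record_neg[OF assms] by (simp add: a_minus_def)

lemma alg_record_finsum:
  assumes "nonassoc_algebra (alg_record sc m V P)" "\<And>i. i \<in> S \<Longrightarrow> f i \<in> V"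
  shows "finsum (alg_record sc m V P) f S = sum f S"
proof -
  interpret nonassoc_algebra "alg_record sc m V P" by fact
  show ?thesis using assms(2)
    by (induction S rule: infinite_finite_induct) (auto simp: M.finsum_insert Pi_def)
qed

context bilinear_product
begin

lemma alg_record_subspace:
  assumes "nonassoc_algebra (alg_record sc m V P)" "W \<subseteq> V"
  shows "VectorSpace.subspace class_ring W (alg_record sc m V P) \<longleftrightarrow> subspace W"
proof -
  interpret N: nonassoc_algebra "alg_record sc m V P" by fact
  show ?thesis
    using assms(2) N.vectorspace_axioms N.module_axioms
    unfolding VectorSpace.subspace_def submodule_def subspace_def by auto
qed

lemma alg_record_lie_superalgebra:
  assumes V: "subspace V" and cl: "\<And>x y. \<lbrakk>x \<in> V; y \<in> V\<rbrakk> \<Longrightarrow> m x y \<in> V"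
    and P: "\<And>p. P p \<subseteq> V" "\<And>p. subspace (P p)"
    and sum: "\<And>x. x \<in> V \<Longrightarrow> \<exists>a\<in>P False. \<exists>b\<in>P True. x = a + b"
    and direct: "P False \<inter> P True \<subseteq> {0}"
    and mP: "\<And>x y p q. \<lbrakk>x \<in> P p; y \<in> P q\<rbrakk> \<Longrightarrow> m x y \<in> P (p \<noteq> q)"
    and skew: "\<And>x y p q. \<lbrakk>x \<in> P p; y \<in> P q\<rbrakk> \<Longrightarrow> m x y + sc (koszul p q) (m y x) = 0"
    and jacobi: "\<And>x y z p q. \<lbrakk>x \<in> P p; y \<in> P q; z \<in> V\<rbrakk> \<Longrightarrow>
      m x (m y z) = m (m x y) z + sc (koszul p q) (m y (m x z))"
    and cube: "\<And>x. x \<in> P True \<Longrightarrow> m x (m x x) = 0"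
  shows "lie_superalgebra (alg_record sc m V P)"
proof -
  have n: "nonassoc_algebra (alg_record sc m V P)"
    by (rule alg_record_nonassoc_algebra) (use assms in auto)
  interpret N: nonassoc_algebra "alg_record sc m V P" by fact
  have Pc: "x \<in> V" if "x \<in> P p" for x p using P that by auto
  show ?thesis
  proof (rule lie_superalgebra.intro[OF N.vectorspace_axioms], rule lie_superalgebra_axioms.intro)
    show "lie_identities (alg_record sc m V P) \<subseteq> {\<zero>\<^bsub>alg_record sc m V P\<^esub>}"
    proof
      fix t assume "t \<in> lie_identities (alg_record sc m V P)"
      then have "t = 0"
      proof (cases rule: lie_identities_cases)
        case (skew p q x y) then show ?thesis using assms(8) by simp
      next
        case (jacobi p q x y z)
        then have "m (m x y) z + sc (koszul p q) (m y (m x z)) \<in> V"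
          using V cl by (auto intro!: subspace_add subspace_scale dest!: Pc)
        then show ?thesis using jacobi assms(9)[of x p y q z] by (simp add: alg_record_minus[OF n])
      next
        case (cube x) then show ?thesis using assms(10) by simp
      qed
      then show "t \<in> {\<zero>\<^bsub>alg_record sc m V P\<^esub>}" by simp
    qed
  qed (use sum direct mP P cl in \<open>auto simp: alg_record_subspace[OF n] subspace_0
      m_add_left m_add_right m_scale_left m_scale_right\<close>)
qed

lemma lie_superalgebraD:
  assumes "lie_superalgebra (alg_record sc m V P)"
  shows "\<lbrakk>x \<in> P p; y \<in> P q\<rbrakk> \<Longrightarrow> m x y = - sc (koszul p q) (m y x)"
    and "\<lbrakk>x \<in> P p; y \<in> P q; z \<in> V\<rbrakk> \<Longrightarrow>
      m x (m y z) = m (m x y) z + sc (koszul p q) (m y (m x z))"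
    and "x \<in> P True \<Longrightarrow> m x (m x x) = 0"
    and "subspace V" and "subspace (P p)" and "P p \<subseteq> V"
    and "\<lbrakk>x \<in> V; y \<in> V\<rbrakk> \<Longrightarrow> m x y \<in> V"
    and "\<lbrakk>x \<in> P p; y \<in> P q\<rbrakk> \<Longrightarrow> m x y \<in> P (p \<noteq> q)"
proof -
  interpret L: lie_superalgebra "alg_record sc m V P" by fact
  have n: "nonassoc_algebra (alg_record sc m V P)" by (rule lie_superalgebra_nonassoc_algebra) fact
  interpret N: nonassoc_algebra "alg_record sc m V P" by fact
  have am: "abelian_monoid (alg_record sc m V P)"
    using L.module_axioms by (simp add: Module.module_def abelian_group_def)
  show sV: "subspace V" using abelian_monoid.a_closed[OF am] abelian_monoid.zero_closed[OF am]
      Module.module.smult_closed[OF L.module_axioms]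
    by (simp add: subspace_def)
  show Pc: "P p \<subseteq> V" for p using N.part_carrier by simp
  show "subspace (P p)" for p using L.part_subspace[of p] alg_record_subspace[OF n Pc] by simp
  show cl: "m x y \<in> V" if "x \<in> V" "y \<in> V" for x y using that L.bracket_closed[of x y] by simp
  show "m x y \<in> P (p \<noteq> q)" if "x \<in> P p" "y \<in> P q" for x y using that L.bracket_part[of x p y q] by simp
  show "m x y = - sc (koszul p q) (m y x)" if "x \<in> P p" "y \<in> P q"
    using lie_identities_intros(1)[of x "alg_record sc m V P" p y q] L.lie that
    by (auto simp: eq_neg_iff_add_eq_0)
  show "m x (m y z) = m (m x y) z + sc (koszul p q) (m y (m x z))" if "x \<in> P p" "y \<in> P q" "z \<in> V"
  proof -
    have "x \<in> V" "y \<in> V" using that Pc by auto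
    then have "m (m x y) z + sc (koszul p q) (m y (m x z)) \<in> V"
      using that sV cl by (auto intro!: subspace_add subspace_scale)
    then show ?thesis
      using lie_identities_intros(2)[of x "alg_record sc m V P" p y q z] L.lie that
      by (auto simp: alg_record_minus[OF n])
  qed
  show "m x (m x x) = 0" if "x \<in> P True"
    using lie_identities_intros(3)[of x "alg_record sc m V P"] L.lie that by auto
qed

end

lemma ideal_generated_ideal:
  assumes "nonassoc_algebra L" "S \<subseteq> carrier L"
  shows "alg_ideal L (ideal_generated L S)" and "S \<subseteq> ideal_generated L S"
    and "\<lbrakk>alg_ideal L K; S \<subseteq> K\<rbrakk> \<Longrightarrow> ideal_generated L S \<subseteq> K"
proof -
  interpret nonassoc_algebra L by fact
  have sm: "c \<odot>\<^bsub>L\<^esub> x \<in> carrier L" if "x \<in> carrier L" for c x using that by simp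
  have c: "alg_ideal L (carrier L)"
    unfolding alg_ideal_def VectorSpace.subspace_def submodule_def
    using vectorspace_axioms module_axioms sm by (auto simp: mult_closed)
  have sub: "ideal_generated L S \<subseteq> carrier L" using c assms(2) by (auto simp: ideal_generated_def)
  have cl: "\<zero>\<^bsub>L\<^esub> \<in> K" "\<And>x y. \<lbrakk>x \<in> K; y \<in> K\<rbrakk> \<Longrightarrow> x \<oplus>\<^bsub>L\<^esub> y \<in> K" "\<And>a x. x \<in> K \<Longrightarrow> a \<odot>\<^bsub>L\<^esub> x \<in> K"
    "\<And>x y. \<lbrakk>x \<in> carrier L; y \<in> K\<rbrakk> \<Longrightarrow> x \<otimes>\<^bsub>L\<^esub> y \<in> K \<and> y \<otimes>\<^bsub>L\<^esub> x \<in> K" if "alg_ideal L K" for K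
    using that unfolding alg_ideal_def VectorSpace.subspace_def submodule_def by simp_all
  show "alg_ideal L (ideal_generated L S)"
    unfolding alg_ideal_def VectorSpace.subspace_def submodule_def
    using sub vectorspace_axioms module_axioms
    by (simp add: ideal_generated_def cl)
  show "S \<subseteq> ideal_generated L S" by (auto simp: ideal_generated_def)
  show "\<lbrakk>alg_ideal L K; S \<subseteq> K\<rbrakk> \<Longrightarrow> ideal_generated L S \<subseteq> K" by (auto simp: ideal_generated_def)
qed

subsection \<open>The free algebra\<close>

abbreviation poly_scale :: "'k::field \<Rightarrow> ('m \<Rightarrow>\<^sub>0 'k) \<Rightarrow> ('m \<Rightarrow>\<^sub>0 'k)" where
  "poly_scale c \<equiv> Poly_Mapping.map ((*) c)"

text \<open>The product of \<open>free_superalgebra\<close>, detached from the record so that it can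
  be an instance of \<open>bilinear_product\<close>.\<close>

definition free_mult :: "('x magma \<Rightarrow>\<^sub>0 'k::field) \<Rightarrow> ('x magma \<Rightarrow>\<^sub>0 'k) \<Rightarrow> ('x magma \<Rightarrow>\<^sub>0 'k)" where
  "free_mult p q = (\<Sum>m\<in>Poly_Mapping.keys p. \<Sum>m'\<in>Poly_Mapping.keys q.
     Poly_Mapping.single (Br m m') (Poly_Mapping.lookup p m * Poly_Mapping.lookup q m'))"

lemma lookup_poly_scale [simp]: "Poly_Mapping.lookup (poly_scale c p) k = c * Poly_Mapping.lookup p k"
  by (simp add: Poly_Mapping.map.rep_eq when_def)

lemma poly_scale_single [simp]: "poly_scale c (Poly_Mapping.single k x) = Poly_Mapping.single k (c * x)"
  by (rule poly_mapping_eqI) (simp add: lookup_single when_def)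

lemma vector_space_poly_scale: "vector_space (poly_scale :: 'k::field \<Rightarrow> ('m \<Rightarrow>\<^sub>0 'k) \<Rightarrow> _)"
  by unfold_locales (auto intro!: poly_mapping_eqI simp: lookup_add algebra_simps)

lemma poly_mapping_monomials:
  fixes p :: "'m \<Rightarrow>\<^sub>0 'k::field"
  assumes "finite A" "Poly_Mapping.keys p \<subseteq> A"
  shows "p = (\<Sum>k\<in>A. Poly_Mapping.single k (Poly_Mapping.lookup p k))"
proof (rule poly_mapping_eqI)
  fix k
  have "(\<Sum>j\<in>A. Poly_Mapping.lookup p j when j = k) = (Poly_Mapping.lookup p k when k \<in> A)"
    using assms(1) by (simp add: when_def)
  also have "\<dots> = Poly_Mapping.lookup p k" using assms(2) by (auto simp: when_def in_keys_iff)
  finally show "Poly_Mapping.lookup p k =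
      Poly_Mapping.lookup (\<Sum>k\<in>A. Poly_Mapping.single k (Poly_Mapping.lookup p k)) k"
    by (simp add: lookup_sum lookup_single)
qed

text \<open>The index sets \<open>keys\<close> change with the arguments. Over a common finite
  superset bilinearity holds term by term.\<close>

lemma free_mult_superset:
  assumes "finite A" "Poly_Mapping.keys p \<subseteq> A" "finite B" "Poly_Mapping.keys q \<subseteq> B"
  shows "free_mult p q = (\<Sum>m\<in>A. \<Sum>m'\<in>B.
     Poly_Mapping.single (Br m m') (Poly_Mapping.lookup p m * Poly_Mapping.lookup q m'))"
proof -
  have "free_mult p q = (\<Sum>m\<in>Poly_Mapping.keys p. \<Sum>m'\<in>B.
     Poly_Mapping.single (Br m m') (Poly_Mapping.lookup p m * Poly_Mapping.lookup q m'))"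
    unfolding free_mult_def using assms
    by (intro sum.cong refl sum.mono_neutral_left) (auto simp: in_keys_iff)
  also have "\<dots> = (\<Sum>m\<in>A. \<Sum>m'\<in>B.
     Poly_Mapping.single (Br m m') (Poly_Mapping.lookup p m * Poly_Mapping.lookup q m'))"
    using assms by (intro sum.mono_neutral_left) (auto simp: in_keys_iff)
  finally show ?thesis .
qed

lemma free_mult_single [simp]:
  "free_mult (Poly_Mapping.single a x) (Poly_Mapping.single b y) = Poly_Mapping.single (Br a b) (x * y)"
  by (subst free_mult_superset[of "{a}" _ "{b}"]) (auto split: if_splits)

interpretation free: bilinear_product "poly_scale :: 'k::field \<Rightarrow> _" "free_mult :: ('x magma \<Rightarrow>\<^sub>0 'k) \<Rightarrow> _"
proof (rule bilinear_product.intro[OF vector_space_poly_scale], unfold_locales)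
  fix x y z :: "'x magma \<Rightarrow>\<^sub>0 'k" and c
  let ?K = "Poly_Mapping.keys x \<union> Poly_Mapping.keys y" and ?Z = "Poly_Mapping.keys z"
  let ?Y = "Poly_Mapping.keys y \<union> Poly_Mapping.keys z" and ?X = "Poly_Mapping.keys x"
  have K: "Poly_Mapping.keys (x + y) \<subseteq> ?K" "Poly_Mapping.keys (y + z) \<subseteq> ?Y"
    "Poly_Mapping.keys (poly_scale c x) \<subseteq> ?K" "Poly_Mapping.keys (poly_scale c y) \<subseteq> ?K"
    "Poly_Mapping.keys x \<subseteq> ?K" "Poly_Mapping.keys y \<subseteq> ?K"
    "Poly_Mapping.keys y \<subseteq> ?Y" "Poly_Mapping.keys z \<subseteq> ?Y"
    by (auto simp: in_keys_iff lookup_add)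
  have f: "finite ?K" "finite ?Y" "finite ?Z" "finite ?X" by auto
  show "free_mult (x + y) z = free_mult x z + free_mult y z"
    unfolding free_mult_superset[OF f(1) K(1) f(3) order_refl]
      free_mult_superset[OF f(1) K(5) f(3) order_refl]
      free_mult_superset[OF f(1) K(6) f(3) order_refl]
    by (simp add: lookup_add distrib_right single_add sum.distrib)
  show "free_mult x (y + z) = free_mult x y + free_mult x z"
    unfolding free_mult_superset[OF f(4) order_refl f(2) K(2)]
      free_mult_superset[OF f(4) order_refl f(2) K(7)]
      free_mult_superset[OF f(4) order_refl f(2) K(8)]
    by (simp add: lookup_add distrib_left single_add sum.distrib)
  have ps: "poly_scale c (sum g S) = (\<Sum>i\<in>S. poly_scale c (g i))" for g :: "'b \<Rightarrow> 'x magma \<Rightarrow>\<^sub>0 'k" and S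
    by (rule poly_mapping_eqI) (simp add: lookup_sum sum_distrib_left)
  show "free_mult (poly_scale c x) y = poly_scale c (free_mult x y)"
    unfolding free_mult_superset[OF f(1) K(3) f(1) K(6)] free_mult_superset[OF f(1) K(5) f(1) K(6)]
    by (simp add: ps mult.assoc)
  show "free_mult x (poly_scale c y) = poly_scale c (free_mult x y)"
    unfolding free_mult_superset[OF f(1) K(5) f(1) K(4)] free_mult_superset[OF f(1) K(5) f(1) K(6)]
    by (simp add: ps mult.left_commute)
qed

definition free_carrier :: "'x set \<Rightarrow> ('x magma \<Rightarrow>\<^sub>0 'k::field) set" where
  "free_carrier X = {p. \<forall>m\<in>Poly_Mapping.keys p. leaves m \<subseteq> X}"

definition free_part :: "'x set \<Rightarrow> ('x \<Rightarrow> bool) \<Rightarrow> bool \<Rightarrow> ('x magma \<Rightarrow>\<^sub>0 'k::field) set" where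
  "free_part X par b = {p. \<forall>m\<in>Poly_Mapping.keys p. leaves m \<subseteq> X \<and> monomial_parity par m = b}"

lemma free_superalgebra_eq:
  "free_superalgebra X par = alg_record poly_scale free_mult (free_carrier X) (free_part X par)"
  unfolding free_superalgebra_def alg_record_def free_mult_def[abs_def] free_carrier_def free_part_def by simp

lemma subspace_keys: "free.subspace {p. \<forall>m\<in>Poly_Mapping.keys p. T m}"
  by (auto simp: free.subspace_def in_keys_iff lookup_add)

lemma free_carrier_subspace: "free.subspace (free_carrier X)"
  unfolding free_carrier_def by (rule subspace_keys)

lemma free_part_subset: "free_part X par b \<subseteq> free_carrier X"
  by (auto simp: free_part_def free_carrier_def)

lemma free_carrier_mult:
  assumes "p \<in> free_carrier X" "q \<in> free_carrier X"
  shows "free_mult p q \<in> free_carrier X"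
  unfolding free_mult_def
  by (intro free.subspace_sum[OF free_carrier_subspace])
    (use assms in \<open>auto simp: free_carrier_def\<close>)

lemma free_nonassoc_algebra: "nonassoc_algebra (free_superalgebra X par)"
  unfolding free_superalgebra_eq
  by (rule free.alg_record_nonassoc_algebra[OF free_carrier_subspace free_carrier_mult free_part_subset])

section \<open>Recognising contragredient Lie superalgebras\<close>

text \<open>A candidate for the contragredient algebra. Injectivity of \<open>H\<close> will make
  the kernel of evaluation meet the Cartan space trivially, and \<open>G_indep\<close> will make
  that kernel graded. \<open>nondegenerate\<close> demands that a single bracket leads back to
  degree 0 without vanishing; this replaces the usual argument with iterated Chevalley
  generators.\<close>

locale contragredient_model = bilinear_product sc m
  for sc :: "'k::field \<Rightarrow> 'v::ab_group_add \<Rightarrow> 'v" and m +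
  fixes V :: "'v set" and P :: "bool \<Rightarrow> 'v set" and A :: "int mat" and par :: "nat \<Rightarrow> bool"
    and R :: "('k, 'h::ab_group_add) realization"
    and E F :: "nat \<Rightarrow> 'v" and H :: "'h \<Rightarrow> 'v" and G :: "(nat \<Rightarrow> int) \<Rightarrow> 'v set"
  assumes lie: "lie_superalgebra (alg_record sc m V P)"
    and E_part: "i < dim_row A \<Longrightarrow> E i \<in> P (par i)"
    and F_part: "i < dim_row A \<Longrightarrow> F i \<in> P (par i)"
    and H_part: "H h \<in> P False"
    and E_degree: "i < dim_row A \<Longrightarrow> E i \<in> G (\<lambda>k. if k = i then 1 else 0)"
    and F_degree: "i < dim_row A \<Longrightarrow> F i \<in> G (\<lambda>k. if k = i then -1 else 0)"
    and H_degree: "H h \<in> G (\<lambda>k. 0)"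
    and H_add: "H (h + h') = H h + H h'"
    and H_scale: "H (hscale R c h) = sc c (H h)"
    and H_inj: "H h = 0 \<Longrightarrow> h = 0"
    and EF: "\<lbrakk>i < dim_row A; j < dim_row A\<rbrakk> \<Longrightarrow> m (E i) (F j) = (if i = j then H (coroot R i) else 0)"
    and HE: "j < dim_row A \<Longrightarrow> m (H h) (E j) = sc (root R j h) (E j)"
    and HF: "j < dim_row A \<Longrightarrow> m (H h) (F j) = - sc (root R j h) (F j)"
    and HH: "m (H h) (H h') = 0"
    and G_subspace: "subspace (G q)"
    and G_subset: "G q \<subseteq> V"
    and G_mult: "\<lbrakk>x \<in> G q; y \<in> G q'\<rbrakk> \<Longrightarrow> m x y \<in> G (\<lambda>k. q k + q' k)"
    and G_indep: "\<lbrakk>finite S; \<And>q. q \<in> S \<Longrightarrow> cf q \<in> G q; sum cf S = 0; q \<in> S\<rbrakk> \<Longrightarrow> cf q = 0"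
    and generation: "\<lbrakk>subspace W; \<And>x y. \<lbrakk>x \<in> W; y \<in> W\<rbrakk> \<Longrightarrow> m x y \<in> W; \<And>h. H h \<in> W;
        \<And>i. i < dim_row A \<Longrightarrow> E i \<in> W; \<And>i. i < dim_row A \<Longrightarrow> F i \<in> W\<rbrakk> \<Longrightarrow> V \<subseteq> W"
    and nondegenerate: "\<lbrakk>y \<in> G q; y \<noteq> 0; q \<noteq> (\<lambda>k. 0)\<rbrakk> \<Longrightarrow> \<exists>z\<in>G (\<lambda>k. - q k). m z y \<noteq> 0"
begin

abbreviation "n \<equiv> dim_row A"
abbreviation "X \<equiv> (generators n :: 'h generator set)"
abbreviation "FA \<equiv> (contragredient_free A par :: ('k, 'h generator magma \<Rightarrow>\<^sub>0 'k) superalgebra)"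
abbreviation "FC \<equiv> (free_carrier X :: ('h generator magma \<Rightarrow>\<^sub>0 'k) set)"
abbreviation "I \<equiv> tilde_ideal A par R"
abbreviation "L \<equiv> alg_record sc m V P"

lemmas L_skew = lie_superalgebraD(1)[OF lie] and L_jacobi = lie_superalgebraD(2)[OF lie]
  and L_cube = lie_superalgebraD(3)[OF lie] and V_subspace = lie_superalgebraD(4)[OF lie]
  and P_subspace = lie_superalgebraD(5)[OF lie] and P_subset = lie_superalgebraD(6)[OF lie]
  and V_mult = lie_superalgebraD(7)[OF lie] and P_mult = lie_superalgebraD(8)[OF lie]

lemma L_nonassoc: "nonassoc_algebra L"
  by (rule lie_superalgebra_nonassoc_algebra[OF lie])

lemma FA_eq: "FA = alg_record poly_scale free_mult FC (free_part X (generator_parity par))"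
  by (rule free_superalgebra_eq)

lemma FA_nonassoc: "nonassoc_algebra FA"
  by (rule free_nonassoc_algebra)

lemma FA_minus: "\<lbrakk>x \<in> FC; y \<in> FC\<rbrakk> \<Longrightarrow> x \<ominus>\<^bsub>FA\<^esub> y = x - y"
  using alg_record_minus[OF FA_nonassoc[unfolded FA_eq]] unfolding FA_eq by simp

primrec eval_gen :: "'h generator \<Rightarrow> 'v" where
  "eval_gen (Cartan v) = H v"
| "eval_gen (Chev_e i) = E i"
| "eval_gen (Chev_f i) = F i"

primrec eval_monomial :: "'h generator magma \<Rightarrow> 'v" where
  "eval_monomial (Gen x) = eval_gen x"
| "eval_monomial (Br a b) = m (eval_monomial a) (eval_monomial b)"

definition eval :: "('h generator magma \<Rightarrow>\<^sub>0 'k) \<Rightarrow> 'v" where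
  "eval p = (\<Sum>k\<in>Poly_Mapping.keys p. sc (Poly_Mapping.lookup p k) (eval_monomial k))"

lemma eval_superset:
  "\<lbrakk>finite S; Poly_Mapping.keys p \<subseteq> S\<rbrakk> \<Longrightarrow>
    eval p = (\<Sum>k\<in>S. sc (Poly_Mapping.lookup p k) (eval_monomial k))"
  unfolding eval_def by (intro sum.mono_neutral_left) (auto simp: in_keys_iff)

lemma eval_add: "eval (p + q) = eval p + eval q"
proof -
  let ?S = "Poly_Mapping.keys p \<union> Poly_Mapping.keys q"
  have "Poly_Mapping.keys (p + q) \<subseteq> ?S" by (auto simp: in_keys_iff lookup_add)
  then show ?thesis
    using eval_superset[of ?S p] eval_superset[of ?S q] eval_superset[of ?S "p + q"]
    by (simp add: lookup_add scale_left_distrib sum.distrib)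
qed

lemma eval_scale: "eval (poly_scale c p) = sc c (eval p)"
proof -
  have "Poly_Mapping.keys (poly_scale c p) \<subseteq> Poly_Mapping.keys p" by (auto simp: in_keys_iff)
  then show ?thesis
    using eval_superset[of "Poly_Mapping.keys p" "poly_scale c p"]
    by (simp add: eval_def scale_sum_right)
qed

lemma eval_single: "eval (Poly_Mapping.single k c) = sc c (eval_monomial k)"
  by (subst eval_superset[of "{k}"]) (auto split: if_splits)

lemma eval_0 [simp]: "eval 0 = 0"
  by (simp add: eval_def)

lemma eval_minus: "eval (p - q) = eval p - eval q"
  using eval_add[of "p - q" q] by simp

lemma eval_sum: "eval (\<Sum>i\<in>S. f i) = (\<Sum>i\<in>S. eval (f i))"
  by (induction S rule: infinite_finite_induct) (auto simp: eval_add)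

lemma eval_mult: "eval (free_mult p q) = m (eval p) (eval q)"
  by (simp add: free_mult_def eval_sum eval_single eval_def[of p] eval_def[of q] m_sum_left m_sum_right
      m_scale_left m_scale_right scale_sum_right)
    (subst sum.swap, simp add: mult.commute)

lemma eval_monomial_part: "leaves a \<subseteq> X \<Longrightarrow> eval_monomial a \<in> P (monomial_parity (generator_parity par) a)"
proof (induction a)
  case (Gen x)
  then show ?case by (cases x) (auto simp: generators_def H_part E_part F_part)
next
  case (Br a b)
  then show ?case using P_mult by simp
qed

lemma eval_part: "p \<in> free_part X (generator_parity par) b \<Longrightarrow> eval p \<in> P b"
  unfolding eval_def
  by (intro subspace_sum[OF P_subspace] subspace_scale[OF P_subspace])
    (use eval_monomial_part in \<open>force simp: free_part_def\<close>)

lemma eval_carrier: "p \<in> FC \<Longrightarrow> eval p \<in> V"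
  unfolding eval_def
  by (intro subspace_sum[OF V_subspace] subspace_scale[OF V_subspace])
    (use eval_monomial_part P_subset in \<open>unfold free_carrier_def, blast\<close>)

lemma eval_monomial_degree: "leaves a \<subseteq> X \<Longrightarrow> eval_monomial a \<in> G (monomial_degree a)"
proof (induction a)
  case (Gen x)
  then show ?case by (cases x) (auto simp: generators_def H_degree E_degree F_degree)
next
  case (Br a b)
  then show ?case using G_mult by simp
qed

definition free_component :: "(nat \<Rightarrow> int) \<Rightarrow> ('h generator magma \<Rightarrow>\<^sub>0 'k) set" where
  "free_component q = {p \<in> FC. \<forall>k\<in>Poly_Mapping.keys p. monomial_degree k = q}"

lemma eval_degree: "p \<in> free_component q \<Longrightarrow> eval p \<in> G q"
  unfolding eval_def
  by (intro subspace_sum[OF G_subspace] subspace_scale[OF G_subspace])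
    (use eval_monomial_degree in \<open>auto simp: free_carrier_def free_component_def\<close>)

definition homogeneous_part :: "('h generator magma \<Rightarrow>\<^sub>0 'k) \<Rightarrow> (nat \<Rightarrow> int) \<Rightarrow> ('h generator magma \<Rightarrow>\<^sub>0 'k)" where
  "homogeneous_part p q = (\<Sum>k\<in>{k\<in>Poly_Mapping.keys p. monomial_degree k = q}.
     Poly_Mapping.single k (Poly_Mapping.lookup p k))"

abbreviation degrees :: "('h generator magma \<Rightarrow>\<^sub>0 'k) \<Rightarrow> (nat \<Rightarrow> int) set" where
  "degrees p \<equiv> monomial_degree ` Poly_Mapping.keys p"

lemma homogeneous_part_sum: "p = (\<Sum>q\<in>degrees p. homogeneous_part p q)"
proof -
  have "p = (\<Sum>k\<in>Poly_Mapping.keys p. Poly_Mapping.single k (Poly_Mapping.lookup p k))"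
    by (rule poly_mapping_monomials) auto
  also have "\<dots> = (\<Sum>q\<in>degrees p. homogeneous_part p q)"
    unfolding homogeneous_part_def by (rule sum.image_gen) simp
  finally show ?thesis .
qed

lemma homogeneous_part_component: "p \<in> FC \<Longrightarrow> homogeneous_part p q \<in> free_component q"
proof -
  assume p: "p \<in> FC"
  have s: "free.subspace (free_component q)"
    unfolding free_component_def free_carrier_def
    using subspace_keys[of "\<lambda>k. leaves k \<subseteq> X \<and> monomial_degree k = q"]
    by (simp add: ball_conj_distrib Collect_conj_eq)
  show ?thesis
    unfolding homogeneous_part_def
    by (rule free.subspace_sum[OF s]) (use p in \<open>auto simp: free_component_def free_carrier_def split: if_splits\<close>)
qed

lemma single_part: "leaves a \<subseteq> X \<Longrightarrow>
    Poly_Mapping.single a c \<in> free_part X (generator_parity par) (monomial_parity (generator_parity par) a)"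
  by (auto simp: free_part_def)

lemma single_carrier [simp]: "leaves a \<subseteq> X \<Longrightarrow> Poly_Mapping.single a c \<in> FC"
  by (auto simp: free_carrier_def)

lemma gens [simp]: "Cartan v \<in> X" "i < n \<Longrightarrow> Chev_e i \<in> X" "i < n \<Longrightarrow> Chev_f i \<in> X"
  by (auto simp: generators_def)

lemma zero_carrier [simp]: "0 \<in> FC"
  by (auto simp: free_carrier_def)

lemma relations_carrier: "contragredient_relations A par R \<subseteq> FC"
  unfolding contragredient_relations_def Let_def FA_eq alg_record_simps
  by (auto intro!: free.subspace_add[OF free_carrier_subspace] free.subspace_diff[OF free_carrier_subspace])

lemma identities_carrier: "lie_identities FA \<subseteq> FC"
proof
  interpret N: nonassoc_algebra FA by (rule FA_nonassoc)
  have c: "x \<in> FC" if "x \<in> free_part X (generator_parity par) b" for x b using that free_part_subset by blast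
  fix t assume "t \<in> lie_identities FA"
  then show "t \<in> FC"
  proof (cases rule: lie_identities_cases)
    case (skew p q x y)
    then have "x \<in> FC" "y \<in> FC" using c by (auto simp: FA_eq)
    then show ?thesis unfolding skew(3) FA_eq alg_record_simps
      by (intro free.subspace_add[OF free_carrier_subspace] free.subspace_scale[OF free_carrier_subspace] free_carrier_mult)
  next
    case (jacobi p q x y z)
    then have xyz: "x \<in> FC" "y \<in> FC" "z \<in> FC" using c by (auto simp: FA_eq)
    then have "free_mult (free_mult x y) z + poly_scale (koszul p q) (free_mult y (free_mult x z)) \<in> FC"
      by (intro free.subspace_add[OF free_carrier_subspace] free.subspace_scale[OF free_carrier_subspace] free_carrier_mult)
    moreover have "free_mult x (free_mult y z) \<in> FC" using xyz by (intro free_carrier_mult)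
    ultimately show ?thesis unfolding jacobi(4) unfolding FA_eq alg_record_simps
      by (subst FA_minus[unfolded FA_eq]) (auto intro: free.subspace_diff[OF free_carrier_subspace])
  next
    case (cube x)
    then have "x \<in> FC" using c by (auto simp: FA_eq)
    then show ?thesis unfolding cube(2) FA_eq alg_record_simps
      by (intro free_carrier_mult)
  qed
qed

lemmas relations_ideal = ideal_generated_ideal[OF FA_nonassoc,
    of "lie_identities FA \<union> contragredient_relations A par R", folded tilde_ideal_def]

lemma rels_FC: "lie_identities FA \<union> contragredient_relations A par R \<subseteq> carrier FA"
  using relations_carrier identities_carrier by (simp add: FA_eq)

sublocale TI: algebra_ideal FA I
  by (rule algebra_ideal.intro[OF FA_nonassoc], unfold_locales, rule relations_ideal(1)[OF rels_FC])

lemma I_subspace: "free.subspace I" and I_subset: "I \<subseteq> FC"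
proof -
  show "I \<subseteq> FC" using TI.ideal_subset by (simp add: FA_eq)
  then show "free.subspace I"
    using relations_ideal(1)[OF rels_FC] free.alg_record_subspace[OF FA_nonassoc[unfolded FA_eq]]
    unfolding alg_ideal_def by (simp add: FA_eq)
qed

lemma I_mult: "\<lbrakk>x \<in> FC; y \<in> I\<rbrakk> \<Longrightarrow> free_mult x y \<in> I" "\<lbrakk>x \<in> FC; y \<in> I\<rbrakk> \<Longrightarrow> free_mult y x \<in> I"
  using TI.ideal_mult[of x y] TI.ideal_mult'[of x y] by (simp_all add: FA_eq)

lemmas I_add = free.subspace_add[OF I_subspace] and I_diff = free.subspace_diff[OF I_subspace]
  and I_scale = free.subspace_scale[OF I_subspace] and I_neg = free.subspace_neg[OF I_subspace]
  and I_0 = free.subspace_0[OF I_subspace]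

lemma eval_hom: "alg_hom FA L eval"
  by (rule alg_homI) (simp_all add: FA_eq eval_carrier eval_add eval_scale eval_mult)

lemma eval_identity: "t \<in> lie_identities FA \<Longrightarrow> eval t = 0"
proof -
  have c: "x \<in> FC" if "x \<in> free_part X (generator_parity par) b" for x b using that free_part_subset by blast
  assume "t \<in> lie_identities FA"
  then show "eval t = 0"
  proof (cases rule: lie_identities_cases)
    case (skew p q x y)
    then have "eval x \<in> P p" "eval y \<in> P q" by (auto simp: FA_eq eval_part)
    then show ?thesis using skew(3) by (simp add: FA_eq eval_add eval_scale eval_mult L_skew[of "eval x" p "eval y" q])
  next
    case (jacobi p q x y z)
    then have xyz: "x \<in> FC" "y \<in> FC" "z \<in> FC" using c by (auto simp: FA_eq)
    have e: "eval x \<in> P p" "eval y \<in> P q" using jacobi by (auto simp: FA_eq eval_part)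
    have "free_mult (free_mult x y) z + poly_scale (koszul p q) (free_mult y (free_mult x z)) \<in> FC"
      "free_mult x (free_mult y z) \<in> FC"
      using xyz by (auto intro!: free.subspace_add[OF free_carrier_subspace] free.subspace_scale[OF free_carrier_subspace] free_carrier_mult)
    then have "t = free_mult x (free_mult y z) - (free_mult (free_mult x y) z + poly_scale (koszul p q) (free_mult y (free_mult x z)))"
      using jacobi(4) FA_minus by (simp add: FA_eq)
    then show ?thesis using L_jacobi[OF e eval_carrier[OF xyz(3)]]
      by (simp add: eval_minus eval_add eval_scale eval_mult)
  next
    case (cube x)
    then show ?thesis using L_cube by (simp add: FA_eq eval_mult eval_part)
  qed
qed

lemma eval_relation: "t \<in> contragredient_relations A par R \<Longrightarrow> eval t = 0"
  unfolding contragredient_relations_def Let_def FA_eq alg_record_simps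
  by (auto simp: eval_minus eval_add eval_single eval_scale H_add H_scale EF HE HF HH)

lemma I_eval: "p \<in> I \<Longrightarrow> eval p = 0"
proof -
  have "alg_ideal FA {p \<in> FC. eval p = 0}"
    using kernel_ideal[OF FA_nonassoc L_nonassoc eval_hom] by (simp add: FA_eq)
  moreover have "lie_identities FA \<union> contragredient_relations A par R \<subseteq> {p \<in> FC. eval p = 0}"
    using eval_identity eval_relation relations_carrier identities_carrier by auto
  ultimately have "I \<subseteq> {p \<in> FC. eval p = 0}" by (rule relations_ideal(3)[OF rels_FC])
  then show "p \<in> I \<Longrightarrow> eval p = 0" by auto
qed

subsection \<open>Words in the generators\<close>

abbreviation mon :: "'h generator magma \<Rightarrow> 'h generator magma \<Rightarrow>\<^sub>0 'k" where
  "mon a \<equiv> Poly_Mapping.single a 1"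

lemma rel_mem: "t \<in> contragredient_relations A par R \<Longrightarrow> t \<in> I"
  using relations_ideal(2)[OF rels_FC] by auto

lemma rel_add: "gen (Cartan (u + v)) - (gen (Cartan u) + gen (Cartan v)) \<in> I"
  by (rule rel_mem) (auto simp: contragredient_relations_def Let_def)

lemma rel_scale: "gen (Cartan (hscale R c v)) - poly_scale c (gen (Cartan v)) \<in> I"
  by (rule rel_mem) (unfold contragredient_relations_def Let_def FA_eq alg_record_simps, blast)

lemma rel_EF: "\<lbrakk>i < n; j < n\<rbrakk> \<Longrightarrow> mon (Br (Gen (Chev_e i)) (Gen (Chev_f j))) -
    (if i = j then gen (Cartan (coroot R i)) else 0) \<in> I"
  by (rule rel_mem) (unfold contragredient_relations_def Let_def FA_eq alg_record_simps free_mult_single, simp, blast)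

lemma rel_HE: "j < n \<Longrightarrow> mon (Br (Gen (Cartan v)) (Gen (Chev_e j))) - Poly_Mapping.single (Gen (Chev_e j)) (root R j v) \<in> I"
  by (rule rel_mem) (unfold contragredient_relations_def Let_def FA_eq alg_record_simps free_mult_single poly_scale_single, simp, blast)

lemma rel_HF: "j < n \<Longrightarrow> mon (Br (Gen (Cartan v)) (Gen (Chev_f j))) + Poly_Mapping.single (Gen (Chev_f j)) (root R j v) \<in> I"
  by (rule rel_mem) (unfold contragredient_relations_def Let_def FA_eq alg_record_simps free_mult_single poly_scale_single, simp, blast)

lemma rel_HH: "mon (Br (Gen (Cartan u)) (Gen (Cartan v))) \<in> I"
  by (rule rel_mem) (unfold contragredient_relations_def Let_def FA_eq alg_record_simps free_mult_single poly_scale_single, simp, blast)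

abbreviation "mpar \<equiv> monomial_parity (generator_parity par :: 'h generator \<Rightarrow> bool)"

lemma rel_skew:
  assumes "leaves a \<subseteq> X" "leaves b \<subseteq> X"
  shows "mon (Br a b) + Poly_Mapping.single (Br b a) (koszul (mpar a) (mpar b)) \<in> I"
proof -
  have "mon a \<otimes>\<^bsub>FA\<^esub> mon b \<oplus>\<^bsub>FA\<^esub> koszul (mpar a) (mpar b) \<odot>\<^bsub>FA\<^esub> (mon b \<otimes>\<^bsub>FA\<^esub> mon a) \<in> lie_identities FA"
    by (rule lie_identities_intros(1)) (simp_all add: FA_eq single_part assms)
  then show ?thesis using relations_ideal(2)[OF rels_FC] by (auto simp: FA_eq)
qed

lemma rel_jacobi:
  assumes "leaves a \<subseteq> X" "leaves b \<subseteq> X" "z \<in> FC"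
  shows "free_mult (mon a) (free_mult (mon b) z) - (free_mult (mon (Br a b)) z +
    poly_scale (koszul (mpar a) (mpar b)) (free_mult (mon b) (free_mult (mon a) z))) \<in> I"
proof -
  have "mon a \<otimes>\<^bsub>FA\<^esub> (mon b \<otimes>\<^bsub>FA\<^esub> z) \<ominus>\<^bsub>FA\<^esub>
     ((mon a \<otimes>\<^bsub>FA\<^esub> mon b) \<otimes>\<^bsub>FA\<^esub> z \<oplus>\<^bsub>FA\<^esub> koszul (mpar a) (mpar b) \<odot>\<^bsub>FA\<^esub> (mon b \<otimes>\<^bsub>FA\<^esub> (mon a \<otimes>\<^bsub>FA\<^esub> z))) \<in> lie_identities FA"
    by (rule lie_identities_intros(2)) (simp_all add: FA_eq single_part assms)
  moreover have "free_mult (mon a) (free_mult (mon b) z) \<in> FC" "free_mult (mon (Br a b)) z +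
    poly_scale (koszul (mpar a) (mpar b)) (free_mult (mon b) (free_mult (mon a) z)) \<in> FC"
    using assms by (auto intro!: free.subspace_add[OF free_carrier_subspace] free.subspace_scale[OF free_carrier_subspace] free_carrier_mult single_carrier)
  ultimately show ?thesis using relations_ideal(2)[OF rels_FC] FA_minus by (auto simp: FA_eq)
qed

lemma rel_jacobi_mon:
  assumes "leaves a \<subseteq> X" "leaves b \<subseteq> X" "leaves c \<subseteq> X"
  shows "mon (Br a (Br b c)) - (mon (Br (Br a b) c) + Poly_Mapping.single (Br b (Br a c)) (koszul (mpar a) (mpar b))) \<in> I"
  using rel_jacobi[OF assms(1,2) single_carrier[OF assms(3), of 1]] by simp

text \<open>A sign in place of two copies: statements about words cover the raising and the lowering
  generators at once.\<close>

definition chev :: "bool \<Rightarrow> nat \<Rightarrow> 'h generator" where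
  "chev s i = (if s then Chev_e i else Chev_f i)"

primrec word :: "bool \<Rightarrow> nat \<Rightarrow> nat list \<Rightarrow> 'h generator magma" where
  "word s i [] = Gen (chev s i)"
| "word s i (j # w) = Br (Gen (chev s i)) (word s j w)"

lemma leaves_chev [simp]: "i < n \<Longrightarrow> chev s i \<in> X"
  by (simp add: chev_def)

lemma leaves_word: "set (i # w) \<subseteq> {..<n} \<Longrightarrow> leaves (word s i w) \<subseteq> X"
  by (induction w arbitrary: i) auto

abbreviation "mdeg \<equiv> (monomial_degree :: 'h generator magma \<Rightarrow> nat \<Rightarrow> int)"
abbreviation dadd :: "(nat \<Rightarrow> int) \<Rightarrow> (nat \<Rightarrow> int) \<Rightarrow> nat \<Rightarrow> int" where
  "dadd q q' \<equiv> (\<lambda>k. q k + q' k)"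

definition word_span :: "bool set \<Rightarrow> (nat \<Rightarrow> int) \<Rightarrow> ('h generator magma \<Rightarrow>\<^sub>0 'k) set" where
  "word_span S q = free.span (I \<union> {gen (Cartan v) | v. q = (\<lambda>k. 0)} \<union>
     {mon (word s i w) | s i w. s \<in> S \<and> set (i # w) \<subseteq> {..<n} \<and> mdeg (word s i w) = q})"

lemma word_span_subspace: "free.subspace (word_span S q)"
  unfolding word_span_def by (rule free.subspace_span)

lemma word_span_I: "p \<in> I \<Longrightarrow> p \<in> word_span S q"
  unfolding word_span_def by (rule free.span_base) auto

lemma word_span_Cartan: "Poly_Mapping.single (Gen (Cartan v)) c \<in> word_span S (\<lambda>k. 0)"
proof -
  have "gen (Cartan v) \<in> word_span S (\<lambda>k. 0)" unfolding word_span_def by (rule free.span_base) blast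
  from free.subspace_scale[OF word_span_subspace this, of c] show ?thesis by simp
qed

lemma word_span_word:
  assumes "s \<in> S" "set (i # w) \<subseteq> {..<n}" "mdeg (word s i w) = q"
  shows "Poly_Mapping.single (word s i w) c \<in> word_span S q"
proof -
  have "mon (word s i w) \<in> word_span S q" unfolding word_span_def
    by (rule free.span_base) (use assms in blast)
  from free.subspace_scale[OF word_span_subspace this, of c] show ?thesis by simp
qed

lemma word_span_cong: "\<lbrakk>p - p' \<in> I; p' \<in> word_span S q\<rbrakk> \<Longrightarrow> p \<in> word_span S q"
  using free.subspace_add[OF word_span_subspace word_span_I[of "p - p'"]] by fastforce

lemma word_span_mono: "S \<subseteq> S' \<Longrightarrow> word_span S q \<subseteq> word_span S' q"
  unfolding word_span_def by (rule free.span_mono) blast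

lemma word_span_FC: "word_span S q \<subseteq> FC"
proof -
  have "mon (word s i w) \<in> FC" if "set (i # w) \<subseteq> {..<n}" for s i w
    using leaves_word[OF that] by (rule single_carrier)
  moreover have "gen (Cartan v) \<in> FC" for v by simp
  ultimately show ?thesis
    unfolding word_span_def using I_subset
    by (intro free.span_minimal[OF _ free_carrier_subspace]) blast
qed

lemma word_span_induct:
  assumes "p \<in> word_span S q"
    and "\<And>x. x \<in> I \<Longrightarrow> f x \<in> W" and "\<And>v. q = (\<lambda>k. 0) \<Longrightarrow> f (gen (Cartan v)) \<in> W"
    and "\<And>s i w. \<lbrakk>s \<in> S; set (i # w) \<subseteq> {..<n}; mdeg (word s i w) = q\<rbrakk> \<Longrightarrow> f (mon (word s i w)) \<in> W"
    and "free.subspace W" "\<And>x y. f (x + y) = f x + f y" "\<And>c x. f (poly_scale c x) = poly_scale c (f x)"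
  shows "f p \<in> W"
  using assms(1) unfolding word_span_def
proof (rule free.span_induct)
  have "f 0 = 0" using assms(7)[of 0 0] by simp
  then show "free.subspace {a. f a \<in> W}"
    using assms(5-7) by (auto simp: free.subspace_def)
qed (use assms(2-4) in auto)

lemma Cartan_chev: "i < n \<Longrightarrow> \<exists>c. mon (Br (Gen (Cartan v)) (Gen (chev s i))) - Poly_Mapping.single (Gen (chev s i)) c \<in> I"
  using rel_HE[of i v] exI[of "\<lambda>c. mon (Br (Gen (Cartan v)) (Gen (Chev_f i))) - Poly_Mapping.single (Gen (Chev_f i)) c \<in> I"
    "- root R i v"] rel_HF[of i v]
  by (cases s) (auto simp: chev_def single_uminus)

lemma I_single_mult:
  assumes "Poly_Mapping.single a c - Poly_Mapping.single b d \<in> I" "leaves z \<subseteq> X"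
  shows "Poly_Mapping.single (Br a z) c - Poly_Mapping.single (Br b z) d \<in> I"
    and "Poly_Mapping.single (Br z a) c - Poly_Mapping.single (Br z b) d \<in> I"
  using I_mult(1)[OF single_carrier[OF assms(2), of 1] assms(1)] I_mult(2)[OF single_carrier[OF assms(2), of 1] assms(1)]
  by (simp_all add: free.m_diff_left free.m_diff_right)

lemma I_single_scale:
  assumes "Poly_Mapping.single a c - Poly_Mapping.single b d \<in> I"
  shows "Poly_Mapping.single a (e * c) - Poly_Mapping.single b (e * d) \<in> I"
  using I_scale[OF assms, of e] by (simp add: free.scale_right_diff_distrib)

text \<open>Words are weight vectors: a Cartan generator is even and acts on a bracket as a
  derivation, so the scalars of the letters add up.\<close>

lemma Cartan_word:
  "set (i # w) \<subseteq> {..<n} \<Longrightarrow> \<exists>c. mon (Br (Gen (Cartan v)) (word s i w)) - Poly_Mapping.single (word s i w) c \<in> I"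
proof (induction w arbitrary: i)
  case Nil
  then show ?case using Cartan_chev by simp
next
  case (Cons j w)
  let ?h = "Gen (Cartan v)" and ?g = "Gen (chev s i)" and ?Y = "word s j w"
  obtain c where c: "mon (Br ?h ?g) - Poly_Mapping.single ?g c \<in> I" using Cartan_chev[of i v s] Cons.prems by auto
  obtain c' where c': "mon (Br ?h ?Y) - Poly_Mapping.single ?Y c' \<in> I" using Cons by auto
  have Y: "leaves ?Y \<subseteq> X" "leaves ?g \<subseteq> X" "leaves ?h \<subseteq> X" using leaves_word[of j w] Cons.prems by auto
  have "mon (Br ?h (Br ?g ?Y)) - (mon (Br (Br ?h ?g) ?Y) + Poly_Mapping.single (Br ?g (Br ?h ?Y)) (koszul (mpar ?h) (mpar ?g))) \<in> I"
    by (rule rel_jacobi_mon) (use Y in auto)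
  from I_add[OF I_add[OF this I_single_mult(1)[OF c Y(1)]] I_single_mult(2)[OF c' Y(2)]]
  have "mon (Br ?h (Br ?g ?Y)) - Poly_Mapping.single (Br ?g ?Y) (c + c') \<in> I"
    by (simp add: single_add koszul_def algebra_simps)
  then show ?case by auto
qed

lemma chev_word_span:
  assumes i: "i < n" and p: "p \<in> word_span {s} q"
  shows "free_mult (mon (Gen (chev s i))) p \<in> word_span {s} (dadd (generator_degree (chev s i)) q)"
proof (rule word_span_induct[OF p])
  show "free_mult (mon (Gen (chev s i))) x \<in> word_span {s} (dadd (generator_degree (chev s i)) q)" if "x \<in> I" for x
    using that i by (intro word_span_I I_mult) auto
  show "free_mult (mon (Gen (chev s i))) (gen (Cartan v)) \<in> word_span {s} (dadd (generator_degree (chev s i)) q)"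
    if q: "q = (\<lambda>k. 0)" for v
  proof -
    let ?h = "Gen (Cartan v)" and ?g = "Gen (chev s i)"
    obtain c where c: "mon (Br ?h ?g) - Poly_Mapping.single ?g c \<in> I" using Cartan_chev[of i v s] i by blast
    have "mon (Br ?g ?h) + Poly_Mapping.single (Br ?h ?g) (koszul (mpar ?g) (mpar ?h)) \<in> I"
      by (rule rel_skew) (use i in auto)
    from I_diff[OF this c] have "mon (Br ?g ?h) - Poly_Mapping.single ?g (- c) \<in> I"
      by (simp add: koszul_def single_uminus)
    then show ?thesis
      using word_span_word[of s "{s}" i "[]" q "- c"] i q
      by (auto intro: word_span_cong[OF _ word_span_word[where w = "[]", simplified]])
  qed
  show "free_mult (mon (Gen (chev s i))) (mon (word s' j w)) \<in> word_span {s} (dadd (generator_degree (chev s i)) q)"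
    if "s' \<in> {s}" "set (j # w) \<subseteq> {..<n}" "mdeg (word s' j w) = q" for s' j w
    using word_span_word[of s "{s}" i "j # w" "dadd (generator_degree (chev s i)) q" 1] that i by simp
qed (simp_all add: word_span_subspace free.m_add_right free.m_scale_right)

lemma chev_opposite:
  assumes "i < n" "j < n"
  shows "\<exists>c h. mon (Br (Gen (chev (\<not> s) j)) (Gen (chev s i))) - Poly_Mapping.single (Gen (Cartan h)) c \<in> I \<and> (i \<noteq> j \<longrightarrow> c = 0)"
proof -
  let ?k = "koszul (par j) (par i)"
  have a: "mon (Br (Gen (Chev_e i)) (Gen (Chev_f j))) - Poly_Mapping.single (Gen (Cartan (coroot R i))) (if i = j then 1 else 0) \<in> I" if "i < n" "j < n" for i j
    using rel_EF[OF that] by (simp split: if_splits)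
  have "mon (Br (Gen (Chev_f j)) (Gen (Chev_e i))) + Poly_Mapping.single (Br (Gen (Chev_e i)) (Gen (Chev_f j))) ?k \<in> I"
    using rel_skew[of "Gen (Chev_f j)" "Gen (Chev_e i)"] assms by simp
  from I_diff[OF this I_single_scale[OF a[OF assms], of ?k]]
  have "mon (Br (Gen (Chev_f j)) (Gen (Chev_e i))) - Poly_Mapping.single (Gen (Cartan (coroot R i))) (if i = j then - ?k else 0) \<in> I"
    by (simp add: single_uminus split: if_splits)
  then show ?thesis
    using a[OF assms(2,1)] by (cases s) (fastforce simp: chev_def)+
qed

text \<open>Jacobi moves the opposite letter past the first letter of the word. The bracket of these
  two letters is a multiple of a Cartan generator, which acts on the rest by a scalar; the other
  term is the induction hypothesis followed by one more letter of sign \<open>s\<close>.\<close>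

lemma chev_opposite_word:
  "\<lbrakk>set (i # w) \<subseteq> {..<n}; j < n\<rbrakk> \<Longrightarrow> free_mult (mon (Gen (chev (\<not> s) j))) (mon (word s i w))
     \<in> word_span {s} (dadd (generator_degree (chev (\<not> s) j)) (mdeg (word s i w)))"
proof (induction w arbitrary: i)
  case Nil
  then obtain c h where c: "mon (Br (Gen (chev (\<not> s) j)) (Gen (chev s i))) - Poly_Mapping.single (Gen (Cartan h)) c \<in> I"
    "i \<noteq> j \<longrightarrow> c = 0" using chev_opposite[of i j s] by auto
  have "Poly_Mapping.single (Gen (Cartan h)) c \<in> word_span {s} (dadd (generator_degree (chev (\<not> s) j)) (mdeg (Gen (chev s i))))"
  proof (cases "i = j")
    case True
    then have eq: "dadd (generator_degree (chev (\<not> s) j)) (mdeg (Gen (chev s i))) = (\<lambda>k. 0)" by (auto simp: chev_def)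
    show ?thesis unfolding eq by (rule word_span_Cartan)
  next
    case False
    then show ?thesis using c(2) free.subspace_0[OF word_span_subspace] by simp
  qed
  then show ?case using word_span_cong[OF c(1)] by simp
next
  case (Cons l w)
  let ?a = "Gen (chev (\<not> s) j)" and ?b = "Gen (chev s i)" and ?Y = "word s l w"
  let ?q = "dadd (mdeg ?a) (mdeg (Br ?b ?Y))"
  have Y: "leaves ?Y \<subseteq> X" "leaves ?a \<subseteq> X" "leaves ?b \<subseteq> X" using leaves_word[of l w] Cons.prems by auto
  obtain c h where c: "mon (Br ?a ?b) - Poly_Mapping.single (Gen (Cartan h)) c \<in> I" "i \<noteq> j \<longrightarrow> c = 0"
    using chev_opposite[of i j s] Cons.prems by auto
  obtain c' where c': "mon (Br (Gen (Cartan h)) ?Y) - Poly_Mapping.single ?Y c' \<in> I"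
    using Cartan_word[of l w h s] Cons.prems by auto
  let ?k = "koszul (mpar ?a) (mpar ?b)"
  let ?Z = "poly_scale ?k (free_mult (mon ?b) (free_mult (mon ?a) (mon ?Y)))"
  have "mon (Br ?a (Br ?b ?Y)) - (mon (Br (Br ?a ?b) ?Y) + ?Z) \<in> I"
    using rel_jacobi_mon[OF Y(2,3,1)] by simp
  from I_add[OF I_add[OF this I_single_mult(1)[OF c(1) Y(1)]] I_single_scale[OF c', of c]]
  have 1: "mon (Br ?a (Br ?b ?Y)) - (?Z + Poly_Mapping.single ?Y (c * c')) \<in> I"
    by (simp add: algebra_simps)
  have "free_mult (mon ?b) (free_mult (mon ?a) (mon ?Y)) \<in> word_span {s} (dadd (generator_degree (chev s i)) (dadd (mdeg ?a) (mdeg ?Y)))"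
    by (rule chev_word_span) (use Cons in \<open>auto simp del: free_mult_single\<close>)
  moreover have eq: "dadd (generator_degree (chev s i)) (dadd (mdeg ?a) (mdeg ?Y)) = ?q" by (auto simp: algebra_simps)
  ultimately have 2: "?Z \<in> word_span {s} ?q" by (simp only: free.subspace_scale[OF word_span_subspace])
  \<comment> \<open>For \<open>i = j\<close> the degrees of the two letters cancel, so the rest of
    the word already has the required degree; for \<open>i \<noteq> j\<close> the coefficient
    \<open>c\<close> is zero.\<close>
  have 3: "Poly_Mapping.single ?Y (c * c') \<in> word_span {s} ?q"
  proof (cases "i = j")
    case True
    have "mdeg ?Y = ?q" using True by (auto simp: chev_def)
    then show ?thesis by (intro word_span_word) (use Cons.prems in auto)
  next
    case False
    then show ?thesis using c(2) free.subspace_0[OF word_span_subspace] by simp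
  qed
  show ?case
    using word_span_cong[OF 1 free.subspace_add[OF word_span_subspace 2 3]] by simp
qed

lemma generator_word_span:
  assumes x: "x \<in> X" and p: "p \<in> word_span UNIV q"
  shows "free_mult (mon (Gen x)) p \<in> word_span UNIV (dadd (generator_degree x) q)"
proof (rule word_span_induct[OF p])
  note mono = word_span_mono[of "{_}" UNIV, THEN subsetD]
  have s1: "word_span {s} q' \<subseteq> word_span UNIV q'" for s q' by (rule word_span_mono) simp
  show "free_mult (mon (Gen x)) y \<in> word_span UNIV (dadd (generator_degree x) q)" if "y \<in> I" for y
    using that x by (intro word_span_I I_mult) auto
  have xc: "(\<exists>v. x = Cartan v) \<or> (\<exists>s i. x = chev s i \<and> i < n)"
    using x unfolding generators_def chev_def by (auto intro: exI[of _ True] exI[of _ False])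
  show "free_mult (mon (Gen x)) (gen (Cartan v)) \<in> word_span UNIV (dadd (generator_degree x) q)"
    if q: "q = (\<lambda>k. 0)" for v
    using xc
  proof
    assume "\<exists>u. x = Cartan u"
    then show ?thesis using rel_HH[of _ v] by (auto intro!: word_span_I)
  next
    assume "\<exists>s i. x = chev s i \<and> i < n"
    then obtain s i where si: "x = chev s i" "i < n" by auto
    have "gen (Cartan v) \<in> word_span {s} q" using word_span_Cartan[of v 1 "{s}"] q by simp
    then show ?thesis using chev_word_span[OF si(2)] s1[of s] si(1) by blast
  qed
  show "free_mult (mon (Gen x)) (mon (word s j w)) \<in> word_span UNIV (dadd (generator_degree x) q)"
    if w: "s \<in> UNIV" "set (j # w) \<subseteq> {..<n}" "mdeg (word s j w) = q" for s j w
    using xc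
  proof
    assume "\<exists>u. x = Cartan u"
    then obtain u where u: "x = Cartan u" by auto
    obtain c where c: "mon (Br (Gen (Cartan u)) (word s j w)) - Poly_Mapping.single (word s j w) c \<in> I"
      using Cartan_word[OF w(2), of u s] by blast
    have "mon (Br (Gen (Cartan u)) (word s j w)) \<in> word_span UNIV q"
      by (rule word_span_cong[OF c word_span_word[OF w]])
    then show ?thesis using u by simp
  next
    assume "\<exists>s i. x = chev s i \<and> i < n"
    then obtain s' i where si: "x = chev s' i" "i < n" by auto
    show ?thesis
    proof (cases "s' = s")
      case True
      have "mon (word s j w) \<in> word_span {s} q" by (rule word_span_word) (use w in auto)
      then show ?thesis using chev_word_span[OF si(2)] s1[of s] si(1) True by blast
    next
      case False
      then have "s' = (\<not> s)" by auto
      then show ?thesis using chev_opposite_word[OF w(2) si(2), of s] s1[of s] si(1) w(3) by blast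
    qed
  qed
qed (simp_all add: word_span_subspace free.m_add_right free.m_scale_right)

text \<open>By Jacobi, left multiplication by a bracket is the super commutator of the two left
  multiplications. Stability under the generators thus gives stability under all monomials.\<close>

lemma monomial_mult_word_span:
  "\<lbrakk>leaves a \<subseteq> X; p \<in> word_span UNIV q\<rbrakk> \<Longrightarrow> free_mult (mon a) p \<in> word_span UNIV (dadd (mdeg a) q)"
proof (induction a arbitrary: p q)
  case (Gen x)
  then show ?case using generator_word_span by simp
next
  case (Br a b)
  let ?k = "koszul (mpar a) (mpar b)" and ?q = "dadd (mdeg (Br a b)) q"
  have l: "leaves a \<subseteq> X" "leaves b \<subseteq> X" using Br.prems by auto
  have pc: "p \<in> FC" using Br.prems word_span_FC by blast
  have q1: "dadd (mdeg a) (dadd (mdeg b) q) = ?q" "dadd (mdeg b) (dadd (mdeg a) q) = ?q"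
    by (auto simp: algebra_simps)
  have 1: "free_mult (mon a) (free_mult (mon b) p) \<in> word_span UNIV ?q"
    using Br.IH(1)[OF l(1) Br.IH(2)[OF l(2) Br.prems(2)]] unfolding q1 .
  have 2: "free_mult (mon b) (free_mult (mon a) p) \<in> word_span UNIV ?q"
    using Br.IH(2)[OF l(2) Br.IH(1)[OF l(1) Br.prems(2)]] unfolding q1 .
  have "free_mult (mon (Br a b)) p - (free_mult (mon a) (free_mult (mon b) p) -
      poly_scale ?k (free_mult (mon b) (free_mult (mon a) p))) \<in> I"
    using I_neg[OF rel_jacobi[OF l pc]] by (simp add: algebra_simps)
  then show ?case
    by (rule word_span_cong)
      (intro free.subspace_diff free.subspace_scale word_span_subspace 1 2)
qed

lemma monomial_word_span: "leaves a \<subseteq> X \<Longrightarrow> mon a \<in> word_span UNIV (mdeg a)"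
proof (induction a)
  case (Gen x)
  then have "(\<exists>v. x = Cartan v) \<or> (\<exists>i<n. x = chev True i) \<or> (\<exists>i<n. x = chev False i)"
    unfolding generators_def by (auto simp: chev_def)
  then consider v where "x = Cartan v" | s i where "x = chev s i" "i < n" by blast
  then show ?case
  proof cases
    case 1
    then show ?thesis using word_span_Cartan[of v 1] by simp
  next
    case (2 s i)
    then show ?thesis using word_span_word[of s UNIV i "[]"] by simp
  qed
next
  case (Br a b)
  then show ?case using monomial_mult_word_span[of a "mon b"] by simp
qed

text \<open>A word in letters of one sign never has degree 0. Only Cartan generators remain, and by
  the linearity relations their classes already form a subspace.\<close>

lemma degree_zero_Cartan:
  assumes "p \<in> free_component (\<lambda>k. 0)" obtains v where "p - gen (Cartan v) \<in> I"
proof -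
  have "p = (\<Sum>k\<in>Poly_Mapping.keys p. poly_scale (Poly_Mapping.lookup p k) (mon k))"
    using poly_mapping_monomials[of "Poly_Mapping.keys p" p] by simp
  moreover have "\<dots> \<in> word_span UNIV (\<lambda>k. 0)"
    using assms monomial_word_span
    by (intro free.subspace_sum free.subspace_scale word_span_subspace)
      (fastforce simp: free_component_def free_carrier_def)
  ultimately have p: "p \<in> word_span UNIV (\<lambda>k. 0)" by simp
  let ?W = "{p. \<exists>v. p - gen (Cartan v) \<in> I}"
  have rel0: "gen (Cartan 0) \<in> I" using I_neg[OF rel_add[of 0 0]] by simp
  have W: "free.subspace ?W"
  proof (rule free.subspaceI)
    show "0 \<in> ?W" using I_neg[OF rel0] by (intro CollectI exI[of _ 0]) simp
    show "x + y \<in> ?W" if xy: "x \<in> ?W" "y \<in> ?W" for x y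
    proof -
      obtain u v where uv: "x - gen (Cartan u) \<in> I" "y - gen (Cartan v) \<in> I" using xy by auto
      from I_diff[OF I_add[OF this] rel_add[of u v]] have "x + y - gen (Cartan (u + v)) \<in> I"
        by (simp add: algebra_simps)
      then show ?thesis by blast
    qed
    show "poly_scale c x \<in> ?W" if x: "x \<in> ?W" for c x
    proof -
      obtain u where u: "x - gen (Cartan u) \<in> I" using x by auto
      from I_diff[OF I_scale[OF this, of c] rel_scale[of c u]]
      have "poly_scale c x - gen (Cartan (hscale R c u)) \<in> I"
        by (simp add: free.scale_right_diff_distrib del: poly_scale_single)
      then show ?thesis by blast
    qed
  qed
  have word_degree: "mdeg (word s i w) \<noteq> (\<lambda>k. 0)" for s i w
  proof -
    \<comment> \<open>Strengthened for the induction: all coefficients have the sign given by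
      \<open>s\<close>, and that of the first letter is nonzero.\<close>
    have "(if s then mdeg (word s i w) k \<ge> 0 else mdeg (word s i w) k \<le> 0) \<and> mdeg (word s i w) i \<noteq> 0" for k
    proof (induction w arbitrary: i k)
      case Nil
      then show ?case by (simp add: chev_def)
    next
      case (Cons j w)
      from Cons[of j k] Cons[of j i] show ?case by (auto simp: chev_def split: if_splits)
    qed
    then show ?thesis by metis
  qed
  have "id p \<in> ?W"
  proof (rule word_span_induct[OF p])
    show "id x \<in> ?W" if "x \<in> I" for x
      using I_diff[OF that rel0] by auto
    show "id (gen (Cartan v)) \<in> ?W" for v
      using I_0 by (intro CollectI exI[of _ v]) simp
  qed (use W word_degree in auto)
  then show ?thesis using that by auto
qed

subsection \<open>The radical\<close>

abbreviation "T \<equiv> tilde_contragredient A par R"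
abbreviation "cl \<equiv> tilde_class A par R"

lemma T_eq: "T = quotient_superalgebra FA I"
  by (simp add: tilde_contragredient_def)

lemma T_nonassoc: "nonassoc_algebra T"
  unfolding T_eq by (rule TI.quotient_nonassoc_algebra)

lemma cl_def: "cl p = a_r_coset FA I p"
  by (simp add: tilde_class_def)

lemma T_carrier: "carrier T = cl ` FC"
  unfolding T_eq TI.quotient_carrier by (simp add: cl_def FA_eq)

lemma cl_add: "\<lbrakk>p \<in> FC; q \<in> FC\<rbrakk> \<Longrightarrow> cl p \<oplus>\<^bsub>T\<^esub> cl q = cl (p + q)"
  using TI.quotient_add[of p q] unfolding T_eq cl_def by (simp add: FA_eq)

lemma cl_mult: "\<lbrakk>p \<in> FC; q \<in> FC\<rbrakk> \<Longrightarrow> cl p \<otimes>\<^bsub>T\<^esub> cl q = cl (free_mult p q)"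
  using TI.quotient_mult[of p q] unfolding T_eq cl_def by (simp add: FA_eq)

lemma cl_zero: "\<zero>\<^bsub>T\<^esub> = cl 0"
  using TI.quotient_zero unfolding T_eq cl_def by (simp add: FA_eq)

lemma cl_eq_iff: "\<lbrakk>p \<in> FC; q \<in> FC\<rbrakk> \<Longrightarrow> cl p = cl q \<longleftrightarrow> p - q \<in> I"
  using TI.coset_eq_iff[of p q] FA_minus[of p q] unfolding cl_def by (simp add: FA_eq)

lemma cl_finsum: "\<lbrakk>finite S; \<And>i. i \<in> S \<Longrightarrow> f i \<in> FC\<rbrakk> \<Longrightarrow> finsum T (\<lambda>i. cl (f i)) S = cl (sum f S)"
proof (induction S rule: finite_induct)
  case empty
  interpret N: nonassoc_algebra T by (rule T_nonassoc)
  show ?case by (simp add: cl_zero)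
next
  case (insert i S)
  interpret N: nonassoc_algebra T by (rule T_nonassoc)
  have "sum f S \<in> FC" using insert.prems by (intro free.subspace_sum[OF free_carrier_subspace]) auto
  moreover have "cl (f j) \<in> carrier T" if "j \<in> insert i S" for j using insert.prems that T_carrier by auto
  ultimately show ?case using insert by (simp add: N.M.finsum_insert cl_add)
qed

lemma eval_surj: "eval ` FC = V"
proof
  show "V \<subseteq> eval ` FC"
  proof (rule generation)
    show "subspace (eval ` FC)"
    proof (rule subspaceI)
      show "0 \<in> eval ` FC" by (rule image_eqI[of _ _ 0]) simp_all
      show "x + y \<in> eval ` FC" if xy: "x \<in> eval ` FC" "y \<in> eval ` FC" for x y
        using xy free.subspace_add[OF free_carrier_subspace] by (force simp: eval_add[symmetric])
      show "sc c x \<in> eval ` FC" if x: "x \<in> eval ` FC" for c x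
        using x free.subspace_scale[OF free_carrier_subspace] by (force simp: eval_scale[symmetric])
    qed
    show "m x y \<in> eval ` FC" if xy: "x \<in> eval ` FC" "y \<in> eval ` FC" for x y
      using xy free_carrier_mult by (force simp: eval_mult[symmetric])
    show "H h \<in> eval ` FC" for h by (rule image_eqI[of _ _ "gen (Cartan h)"]) (simp_all add: eval_single)
    show "E i \<in> eval ` FC" if "i < n" for i
      by (rule image_eqI[of _ _ "gen (Chev_e i)"]) (use that in \<open>simp_all add: eval_single\<close>)
    show "F i \<in> eval ` FC" if "i < n" for i
      by (rule image_eqI[of _ _ "gen (Chev_f i)"]) (use that in \<open>simp_all add: eval_single\<close>)
  qed
qed (auto simp: eval_carrier)

text \<open>Generation yields some preimage. Its component of parity \<open>b\<close> has the same
  image, because the difference lies in both parts of \<open>L\<close>.\<close>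

lemma eval_part_surj: "eval ` free_part X (generator_parity par) b = P b"
proof
  interpret LL: lie_superalgebra L by (rule lie)
  show "P b \<subseteq> eval ` free_part X (generator_parity par) b"
  proof
    fix x assume x: "x \<in> P b"
    then obtain r where r: "r \<in> FC" "x = eval r" using P_subset eval_surj by blast
    define h where "h c = (\<Sum>k\<in>{k\<in>Poly_Mapping.keys r. mpar k = c}. Poly_Mapping.single k (Poly_Mapping.lookup r k))" for c
    have fs: "free.subspace (free_part X (generator_parity par) c)" for c
      unfolding free_part_def by (rule subspace_keys)
    have h: "h c \<in> free_part X (generator_parity par) c" for c
      unfolding h_def by (rule free.subspace_sum[OF fs])
        (use r(1) in \<open>auto simp: free_part_def free_carrier_def split: if_splits\<close>)
    have "r = (\<Sum>k\<in>Poly_Mapping.keys r. Poly_Mapping.single k (Poly_Mapping.lookup r k))"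
      by (rule poly_mapping_monomials) auto
    also have "\<dots> = h b + h (\<not> b)"
      unfolding h_def by (subst sum.union_disjoint[symmetric]) (auto intro!: sum.cong)
    finally have "x - eval (h b) = eval (h (\<not> b))" using r(2) eval_add[of "h b" "h (\<not> b)"] by simp
    moreover have "x - eval (h b) \<in> P b" using x eval_part[OF h] by (intro subspace_diff[OF P_subspace])
    moreover have "eval (h (\<not> b)) \<in> P (\<not> b)" by (rule eval_part[OF h])
    moreover have "P b \<inter> P (\<not> b) = {0}" using LL.part_direct by (cases b) auto
    ultimately have "eval (h b) = x" by (metis IntI eq_iff_diff_eq_0 singletonD)
    then show "x \<in> eval ` free_part X (generator_parity par) b" using h by blast
  qed
qed (auto simp: eval_part)

lemma component_subset: "free_component q \<subseteq> FC"
  by (auto simp: free_component_def)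

lemma tilde_component_eq: "tilde_component A par R q = cl ` free_component q"
  by (simp add: tilde_component_def free_component_def FA_eq)

lemma component_indep: "\<lbrakk>finite S; sum cf S = 0; q \<in> S; \<And>q. q \<in> S \<Longrightarrow> cf q \<in> G q\<rbrakk> \<Longrightarrow> cf q = 0"
  by (rule G_indep)

text \<open>A preimage under evaluation need not be homogeneous. Its component of degree
  \<open>q\<close> already maps to \<open>z\<close>, since the components of \<open>L\<close> are
  independent.\<close>

lemma component_lift:
  assumes z: "z \<in> G q" obtains r where "r \<in> free_component q" "eval r = z"
proof -
  obtain r where r: "r \<in> FC" "z = eval r" using z G_subset eval_surj by blast
  \<comment> \<open>The degree \<open>q\<close> may be missing from \<open>degrees r\<close>; its
    homogeneous part is then 0.\<close>
  let ?S = "insert q (degrees r)"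
  have hr: "homogeneous_part r q' = 0" if "q' \<notin> degrees r" for q'
    using that by (auto simp: homogeneous_part_def intro!: sum.neutral)
  have "(\<Sum>q'\<in>degrees r. homogeneous_part r q') = (\<Sum>q'\<in>?S. homogeneous_part r q')"
    using hr by (intro sum.mono_neutral_left) auto
  then have "eval r = (\<Sum>q'\<in>?S. eval (homogeneous_part r q'))"
    using homogeneous_part_sum[of r] by (simp only: eval_sum[symmetric])
  then have "(\<Sum>q'\<in>?S. eval (homogeneous_part r q') - (if q' = q then z else 0)) = 0"
    unfolding sum_subtractf using r(2) by simp
  then have "eval (homogeneous_part r q) - (if q = q then z else 0) = 0"
  proof (rule component_indep[rotated])
    show "eval (homogeneous_part r q') - (if q' = q then z else 0) \<in> G q'" for q'
      using z eval_degree[OF homogeneous_part_component[OF r(1)]]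
      by (intro subspace_diff[OF G_subspace]) (auto simp: subspace_0[OF G_subspace])
  qed auto
  then have "eval (homogeneous_part r q) = z" by simp
  then show ?thesis using that homogeneous_part_component[OF r(1)] by blast
qed

text \<open>In degree 0 everything is Cartan, and the ideal contains no nonzero Cartan element. In
  another degree a nonzero image could be bracketed, by nondegeneracy, to an element of the ideal of
  degree 0 with nonzero image.\<close>

lemma graded_ideal_eval_zero:
  assumes M: "alg_ideal T M" "M \<inter> tilde_cartan A par R = {\<zero>\<^bsub>T\<^esub>}"
    and p: "p \<in> free_component q" "cl p \<in> M"
  shows "eval p = 0"
proof (rule ccontr)
  interpret M: algebra_ideal T M
    by (rule algebra_ideal.intro[OF T_nonassoc], unfold_locales) (rule M(1))
  have zero_deg: "eval p = 0" if p: "p \<in> free_component (\<lambda>k. 0)" "cl p \<in> M" for p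
  proof -
    obtain v where v: "p - gen (Cartan v) \<in> I" using degree_zero_Cartan[OF p(1)] .
    then have "cl p = cl (gen (Cartan v))" using p(1) component_subset by (subst cl_eq_iff) auto
    then have "cl p \<in> M \<inter> tilde_cartan A par R" using p(2) by (auto simp: tilde_cartan_def)
    then have "cl p = cl 0" using M(2) cl_zero by simp
    then have "p \<in> I" using p(1) component_subset by (subst (asm) cl_eq_iff) auto
    then show ?thesis by (rule I_eval)
  qed
  assume ne: "eval p \<noteq> 0"
  then have q: "q \<noteq> (\<lambda>k. 0)" using zero_deg p by auto
  obtain z where z: "z \<in> G (\<lambda>k. - q k)" "m z (eval p) \<noteq> 0"
    using nondegenerate[OF eval_degree[OF p(1)] ne q] by blast
  obtain r where r: "r \<in> free_component (\<lambda>k. - q k)" "eval r = z" using component_lift[OF z(1)] .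
  have rp: "r \<in> FC" "p \<in> FC" using r p component_subset by auto
  let ?t = "free_mult r p"
  have s: "free.subspace (free_component (\<lambda>k. 0))"
    unfolding free_component_def free_carrier_def
    using subspace_keys[of "\<lambda>k. leaves k \<subseteq> X \<and> monomial_degree k = (\<lambda>k. 0)"]
    by (simp add: ball_conj_distrib Collect_conj_eq)
  have "?t \<in> free_component (\<lambda>k. 0)"
    unfolding free_mult_def
    by (intro free.subspace_sum[OF s])
      (use r(1) p(1) in \<open>auto simp: free_component_def free_carrier_def\<close>)
  moreover have "cl ?t \<in> M"
    using M.ideal_mult[OF _ p(2), of "cl r"] cl_mult[OF rp] rp(1) T_carrier by simp
  ultimately have "eval ?t = 0" by (rule zero_deg)
  then show False using z(2) r(2) by (simp add: eval_mult)
qed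

text \<open>The kernel \<open>K\<close> of the map induced by evaluation is itself a graded ideal
  that meets the Cartan space trivially, and it contains all others. So the \<open>GREATEST\<close>
  in the definition of the radical is attained and equals \<open>K\<close>, and the first
  isomorphism theorem applies.\<close>

lemma contragredient_iso:
  obtains f where "f \<in> superalgebra_iso (contragredient A par R) L"
    "\<And>i. i < n \<Longrightarrow> f (chevalley_e A par R i) = E i" "nonassoc_algebra (contragredient A par R)"
proof -
  interpret N: nonassoc_algebra T by (rule T_nonassoc)
  interpret NL: nonassoc_algebra L by (rule L_nonassoc)
  have "eval x = \<zero>\<^bsub>L\<^esub>" if "x \<in> I" for x using I_eval that by simp
  from TI.quotient_lift[OF eval_hom L_nonassoc this]
  obtain g where g: "alg_hom T L g" and gcl: "\<And>p. p \<in> FC \<Longrightarrow> g (cl p) = eval p"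
    unfolding T_eq cl_def by (auto simp: FA_eq)
  define K where "K = {x \<in> carrier T. g x = 0}"
  have Kid: "alg_ideal T K"
    using kernel_ideal[OF T_nonassoc L_nonassoc g] by (simp add: K_def)
  have clK: "cl p \<in> K \<longleftrightarrow> eval p = 0" if "p \<in> FC" for p
    using that by (auto simp: K_def T_carrier gcl)
  interpret K: algebra_ideal T K
    by (rule algebra_ideal.intro[OF T_nonassoc], unfold_locales) (rule Kid)
  have rad: "contragredient_radical A par R = K"
    unfolding contragredient_radical_def
  proof (rule Greatest_equality)
    have "\<exists>S c. finite S \<and> (\<forall>q\<in>S. c q \<in> K \<inter> tilde_component A par R q) \<and> x = finsum T c S" if "x \<in> K" for x
    proof -
      obtain p where p: "p \<in> FC" "x = cl p" using \<open>x \<in> K\<close> by (auto simp: K_def T_carrier)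
      then have p0: "eval p = 0" using clK \<open>x \<in> K\<close> by auto
      have hc: "homogeneous_part p q \<in> free_component q" for q by (rule homogeneous_part_component[OF p(1)])
      then have hF: "homogeneous_part p q \<in> FC" for q using component_subset by blast
      have "(\<Sum>q\<in>degrees p. eval (homogeneous_part p q)) = 0"
        using p0 by (simp add: eval_sum[symmetric] homogeneous_part_sum[of p, symmetric])
      then have "eval (homogeneous_part p q) = 0" if "q \<in> degrees p" for q
        by (rule component_indep[rotated]) (use that in \<open>simp_all add: eval_degree[OF hc]\<close>)
      then have "\<forall>q\<in>degrees p. cl (homogeneous_part p q) \<in> K \<inter> tilde_component A par R q"
        using clK[OF hF] hc by (simp add: tilde_component_eq)
      moreover have "x = finsum T (\<lambda>q. cl (homogeneous_part p q)) (degrees p)"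
        using cl_finsum[of "degrees p" "homogeneous_part p"] hF p(2) by (simp add: homogeneous_part_sum[of p, symmetric])
      ultimately show ?thesis
        by (intro exI[of _ "degrees p"] exI[of _ "\<lambda>q. cl (homogeneous_part p q)"]) simp
    qed
    moreover have "K \<inter> tilde_cartan A par R = {\<zero>\<^bsub>T\<^esub>}"
    proof -
      have "H 0 = 0" using H_add[of 0 0] by simp
      then have "cl (gen (Cartan v)) \<in> K \<longleftrightarrow> v = 0" for v
        using H_inj[of v] by (auto simp: clK eval_single)
      moreover have "cl (gen (Cartan 0)) = \<zero>\<^bsub>T\<^esub>"
        using I_neg[OF rel_add[of 0 0]] by (simp add: cl_zero cl_eq_iff)
      ultimately show ?thesis unfolding tilde_cartan_def using K.ideal_zero by auto
    qed
    ultimately show "graded_ideal T (tilde_component A par R) K \<and> K \<inter> tilde_cartan A par R = {\<zero>\<^bsub>T\<^esub>}"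
      using Kid unfolding graded_ideal_def by blast
  next
    fix M assume M: "graded_ideal T (tilde_component A par R) M \<and> M \<inter> tilde_cartan A par R = {\<zero>\<^bsub>T\<^esub>}"
    then have Mi: "alg_ideal T M" "M \<inter> tilde_cartan A par R = {\<zero>\<^bsub>T\<^esub>}" by (auto simp: graded_ideal_def)
    show "M \<le> K"
    proof
      fix x assume x: "x \<in> M"
      have "\<forall>x\<in>M. \<exists>S c. finite S \<and> (\<forall>q\<in>S. c q \<in> M \<inter> tilde_component A par R q) \<and> x = finsum T c S"
        using M by (simp add: graded_ideal_def)
      from bspec[OF this x]
      obtain S c where S: "finite S" "\<forall>q\<in>S. c q \<in> M \<inter> tilde_component A par R q" "x = finsum T c S"
        by (elim exE conjE)
      have c: "c q \<in> K" if q: "q \<in> S" for q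
      proof -
        have "c q \<in> M" "c q \<in> cl ` free_component q" using S(2) q tilde_component_eq by simp_all
        then obtain p where p: "p \<in> free_component q" "c q = cl p" "cl p \<in> M" by (elim imageE) simp
        then have "p \<in> FC" using component_subset by blast
        then show ?thesis using graded_ideal_eval_zero[OF Mi p(1,3)] p(2) clK by simp
      qed
      have "finite S \<Longrightarrow> (\<And>q. q \<in> S \<Longrightarrow> c q \<in> K) \<Longrightarrow> finsum T c S \<in> K"
      proof (induction S rule: finite_induct)
        case (insert i S)
        then have "c \<in> S \<rightarrow> carrier T" "c i \<in> carrier T" using K.ideal_subset by auto
        with insert show ?case by (simp add: N.M.finsum_insert K.ideal_add)
      qed (simp add: K.ideal_zero)
      then show "x \<in> K" using S c by simp
    qed
  qed
  have "part T p = cl ` free_part X (generator_parity par) p" for p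
    unfolding T_eq TI.quotient_part by (simp add: cl_def FA_eq)
  moreover have "g ` (cl ` free_part X (generator_parity par) p) = part L p" for p
  proof -
    have "(\<lambda>x. g (cl x)) ` free_part X (generator_parity par) p = eval ` free_part X (generator_parity par) p"
      by (intro image_cong refl gcl subsetD[OF free_part_subset])
    then show ?thesis using eval_part_surj[of p] by (simp add: image_image)
  qed
  ultimately have part: "g ` part T p = part L p" for p by simp
  have surj: "g ` carrier T = carrier L"
    using eval_surj gcl by (simp add: T_carrier image_image cong: image_cong)
  have ker: "x \<in> K \<longleftrightarrow> g x = \<zero>\<^bsub>L\<^esub>" if "x \<in> carrier T" for x using that by (simp add: K_def)
  obtain f where f: "f \<in> superalgebra_iso (quotient_superalgebra T K) L"
      "\<And>x. x \<in> carrier T \<Longrightarrow> f (a_r_coset T K x) = g x"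
    by (rule K.first_isomorphism[OF g L_nonassoc ker surj part]) blast+
  show ?thesis
  proof (rule that)
    show "f \<in> superalgebra_iso (contragredient A par R) L" using f(1) by (simp add: contragredient_def rad)
    show "nonassoc_algebra (contragredient A par R)"
      unfolding contragredient_def rad by (rule K.quotient_nonassoc_algebra)
    show "f (chevalley_e A par R i) = E i" if "i < n" for i
      using f(2)[of "cl (gen (Chev_e i))"] that gcl[of "gen (Chev_e i)"]
      by (simp add: chevalley_e_def rad T_carrier eval_single)
  qed
qed

end

text \<open>For a nonsingular reduced matrix the Cartan space has dimension
  \<open>2n - n = n\<close>. The \<open>n\<close> independent coroots are then a basis, and a linear
  map may take any prescribed values on them.\<close>

lemma realization_extension:
  fixes R :: "('k::field, 'h::ab_group_add) realization" and y :: "nat \<Rightarrow> 'v::ab_group_add"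
  assumes R: "is_realization A R" and rank: "vec_space.rank (dim_row A) (map_mat of_int A :: 'k mat) = dim_row A"
    and vs: "vector_space (sc :: 'k \<Rightarrow> 'v \<Rightarrow> 'v)"
  obtains H where "\<And>h h'. H (h + h') = H h + H h'" "\<And>c h. H (hscale R c h) = sc c (H h)"
    "\<And>i. i < dim_row A \<Longrightarrow> H (coroot R i) = y i"
    "\<And>h. \<exists>c. h = (\<Sum>i<dim_row A. hscale R (c i) (coroot R i))"
proof -
  let ?n = "dim_row A"
  obtain B where B: "finite_dimensional_vector_space (hscale R) B" "card B = 2 * ?n - ?n"
    and indep: "\<And>c. (\<Sum>i<?n. hscale R (c i) (coroot R i)) = 0 \<Longrightarrow> \<forall>i<?n. c i = 0"
    using R unfolding is_realization_def Let_def rank by blast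
  interpret h: finite_dimensional_vector_space "hscale R" B by (rule B(1))
  interpret v: vector_space sc by (rule vs)
  interpret hv: vector_space_pair "hscale R" sc ..
  let ?C = "coroot R ` {..<?n}"
  \<comment> \<open>The realization states independence for an indexed family; injectivity turns it
    into independence of a set.\<close>
  have inj: "inj_on (coroot R) {..<?n}"
  proof (rule inj_onI, rule ccontr)
    fix i j assume ij: "i \<in> {..<?n}" "j \<in> {..<?n}" "coroot R i = coroot R j" "i \<noteq> j"
    let ?c = "\<lambda>k. if k = i then 1 else if k = j then -1 else 0 :: 'k"
    have "(\<Sum>k<?n. hscale R (?c k) (coroot R k)) = (\<Sum>k\<in>{i, j}. hscale R (?c k) (coroot R k))"
      using ij by (intro sum.mono_neutral_right) auto
    also have "\<dots> = 0" using ij by simp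
    finally have "?c i = 0" using indep[of ?c] ij(1) by blast
    then show False by simp
  qed
  have ind: "h.independent ?C"
  proof (subst h.independent_explicit_finite_subsets, intro allI impI ballI)
    fix S u v assume S: "S \<subseteq> ?C" "finite S" "(\<Sum>v\<in>S. hscale R (u v) v) = 0" and v: "v \<in> S"
    let ?c = "\<lambda>i. if coroot R i \<in> S then u (coroot R i) else 0"
    have "(\<Sum>i<?n. hscale R (?c i) (coroot R i)) = (\<Sum>v\<in>?C. hscale R (if v \<in> S then u v else 0) v)"
      by (subst sum.reindex[OF inj]) simp
    also have "\<dots> = (\<Sum>v\<in>S. hscale R (u v) v)"
      using S(1) by (intro sum.mono_neutral_cong_right) auto
    finally have z: "\<forall>i<?n. ?c i = 0" using indep[of ?c] S(3) by simp
    obtain i where "i < ?n" "v = coroot R i" using v S(1) by auto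
    then show "u v = 0" using z v by auto
  qed
  have "h.dim UNIV \<le> card ?C"
    using B(2) h.dimension_def h.dim_UNIV card_image[OF inj] by simp
  then have span: "h.span ?C = UNIV" using h.card_ge_dim_independent[OF _ ind, of UNIV] by auto
  obtain H where H: "Vector_Spaces.linear (hscale R) sc H" "\<forall>x\<in>?C. H x = y (inv_into {..<?n} (coroot R) x)"
    using hv.linear_independent_extend[OF ind, of "\<lambda>x. y (inv_into {..<?n} (coroot R) x)"] by blast
  interpret H: Vector_Spaces.linear "hscale R" sc H by (rule H(1))
  have "\<exists>c. h = (\<Sum>i<?n. hscale R (c i) (coroot R i))" for h
  proof -
    have "h \<in> h.span ?C" using span by simp
    then obtain u where "h = (\<Sum>v\<in>?C. hscale R (u v) v)" by (auto simp: h.span_finite)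
    then have "h = (\<Sum>i<?n. hscale R (u (coroot R i)) (coroot R i))" by (simp add: sum.reindex[OF inj])
    then show ?thesis by (intro exI[of _ "\<lambda>i. u (coroot R i)"])
  qed
  moreover have "H (coroot R i) = y i" if "i < ?n" for i
    using H(2) that inv_into_f_f[OF inj, of i] by auto
  ultimately show ?thesis using that[of H] H.add H.scale by blast
qed

text \<open>Since coroots are a basis, every condition on the Cartan space is checked on the
  finitely many \<open>y i\<close>. Their independence makes the linear extension injective.\<close>

lemma (in bilinear_product) contragredient_iso_full_rank:
  fixes R :: "('k, 'h::ab_group_add) realization" and y E F :: "nat \<Rightarrow> 'v" and G :: "(nat \<Rightarrow> int) \<Rightarrow> 'v set"
  assumes R: "is_realization A R" and rank: "vec_space.rank (dim_row A) (map_mat of_int A :: 'k mat) = dim_row A"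
    and lie: "lie_superalgebra (alg_record sc m V P)"
    and parts: "\<And>i. i < dim_row A \<Longrightarrow> E i \<in> P (par i)" "\<And>i. i < dim_row A \<Longrightarrow> F i \<in> P (par i)"
      "\<And>i. i < dim_row A \<Longrightarrow> y i \<in> P False"
    and degrees: "\<And>i. i < dim_row A \<Longrightarrow> E i \<in> G (\<lambda>k. if k = i then 1 else 0)"
      "\<And>i. i < dim_row A \<Longrightarrow> F i \<in> G (\<lambda>k. if k = i then -1 else 0)"
      "\<And>i. i < dim_row A \<Longrightarrow> y i \<in> G (\<lambda>k. 0)"
    and y_indep: "\<And>c i. \<lbrakk>(\<Sum>i<dim_row A. sc (c i) (y i)) = 0; i < dim_row A\<rbrakk> \<Longrightarrow> c i = 0"
    and EF: "\<And>i j. \<lbrakk>i < dim_row A; j < dim_row A\<rbrakk> \<Longrightarrow> m (E i) (F j) = (if i = j then y i else 0)"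
    and yE: "\<And>i j. \<lbrakk>i < dim_row A; j < dim_row A\<rbrakk> \<Longrightarrow> m (y i) (E j) = sc (of_int (A $$ (i, j))) (E j)"
    and yF: "\<And>i j. \<lbrakk>i < dim_row A; j < dim_row A\<rbrakk> \<Longrightarrow> m (y i) (F j) = - sc (of_int (A $$ (i, j))) (F j)"
    and yy: "\<And>i j. \<lbrakk>i < dim_row A; j < dim_row A\<rbrakk> \<Longrightarrow> m (y i) (y j) = 0"
    and G_subspace: "\<And>q. subspace (G q)" and G_subset: "\<And>q. G q \<subseteq> V"
    and G_mult: "\<And>u v q q'. \<lbrakk>u \<in> G q; v \<in> G q'\<rbrakk> \<Longrightarrow> m u v \<in> G (\<lambda>k. q k + q' k)"
    and G_indep: "\<And>S cf q. \<lbrakk>finite S; \<And>q. q \<in> S \<Longrightarrow> cf q \<in> G q; sum cf S = 0; q \<in> S\<rbrakk> \<Longrightarrow> cf q = 0"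
    and generation: "\<And>W. \<lbrakk>subspace W; \<And>u v. \<lbrakk>u \<in> W; v \<in> W\<rbrakk> \<Longrightarrow> m u v \<in> W; \<And>i. i < dim_row A \<Longrightarrow> y i \<in> W;
        \<And>i. i < dim_row A \<Longrightarrow> E i \<in> W; \<And>i. i < dim_row A \<Longrightarrow> F i \<in> W\<rbrakk> \<Longrightarrow> V \<subseteq> W"
    and nondegenerate: "\<And>u q. \<lbrakk>u \<in> G q; u \<noteq> 0; q \<noteq> (\<lambda>k. 0)\<rbrakk> \<Longrightarrow> \<exists>z\<in>G (\<lambda>k. - q k). m z u \<noteq> 0"
  obtains f where "f \<in> superalgebra_iso (contragredient A par R) (alg_record sc m V P)"
    "\<And>i. i < dim_row A \<Longrightarrow> f (chevalley_e A par R i) = E i" "nonassoc_algebra (contragredient A par R)"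
proof -
  let ?n = "dim_row A"
  obtain H where H: "\<And>h h'. H (h + h') = H h + H h'" "\<And>c h. H (hscale R c h) = sc c (H h)"
    "\<And>i. i < ?n \<Longrightarrow> H (coroot R i) = y i"
    "\<And>h. \<exists>c. h = (\<Sum>i<?n. hscale R (c i) (coroot R i))"
    by (rule realization_extension[OF R rank vector_space_axioms, of y]) blast
  note R' = R[unfolded is_realization_def Let_def]
  have lin: "Vector_Spaces.linear (hscale R) (*) (root R j)" if "j < ?n" for j
    using conjunct1[OF conjunct2[OF conjunct2[OF R']]] that by (elim allE impE)
  have Amat: "A \<in> carrier_mat ?n ?n" using conjunct1[OF R'] .
  have rc: "root R j (coroot R i) = of_int (A $$ (i, j))" if ij: "i < ?n" "j < ?n" for i j
  proof -
    have "\<forall>i<?n. \<forall>j<?n. root R j (coroot R i) = map_mat of_int A $$ (i, j)"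
      by (rule conjunct2[OF conjunct2[OF conjunct2[OF conjunct2[OF conjunct2[OF R']]]]])
    moreover have "j < dim_col A" using ij(2) carrier_matD(2)[OF Amat] by (simp only:)
    ultimately show ?thesis using index_map_mat(1)[of i A j of_int] ij by metis
  qed
  have H0: "H 0 = 0" using H(1)[of 0 0] by simp
  have Hsum: "H (\<Sum>i\<in>S. g i) = (\<Sum>i\<in>S. H (g i))" for g and S :: "nat set"
    by (induction S rule: infinite_finite_induct) (auto simp: H0 H(1))
  have Hh: "\<exists>c. H h = (\<Sum>i<?n. sc (c i) (y i)) \<and> (\<forall>j<?n. root R j h = (\<Sum>i<?n. c i * of_int (A $$ (i, j)))) \<and>
     h = (\<Sum>i<?n. hscale R (c i) (coroot R i))" for h
  proof -
    obtain c where c: "h = (\<Sum>i<?n. hscale R (c i) (coroot R i))" using H(4) by blast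
    have "H h = (\<Sum>i<?n. sc (c i) (y i))" unfolding c by (simp add: Hsum H(2,3))
    moreover have "root R j h = (\<Sum>i<?n. c i * of_int (A $$ (i, j)))" if j: "j < ?n" for j
    proof -
      interpret r: Vector_Spaces.linear "hscale R" "(*)" "root R j" by (rule lin[OF j])
      show ?thesis unfolding c by (simp add: r.sum r.scale rc j)
    qed
    ultimately show ?thesis using c by blast
  qed
  have sP: "subspace (P False)" using lie_superalgebraD(5)[OF lie] .
  have "contragredient_model sc m V P A par R E F H G"
  proof (intro contragredient_model.intro bilinear_product_axioms contragredient_model_axioms.intro)
    show "H h \<in> P False" for h
    proof -
      obtain c where c: "H h = (\<Sum>i<?n. sc (c i) (y i))" using Hh[of h] by (elim exE conjE)
      show ?thesis unfolding c by (intro subspace_sum[OF sP] subspace_scale[OF sP] parts(3)) simp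
    qed
    show "H h \<in> G (\<lambda>k. 0)" for h
    proof -
      obtain c where c: "H h = (\<Sum>i<?n. sc (c i) (y i))" using Hh[of h] by (elim exE conjE)
      show ?thesis unfolding c by (intro subspace_sum[OF G_subspace] subspace_scale[OF G_subspace] degrees(3)) simp
    qed
    show "h = 0" if z: "H h = 0" for h
    proof -
      obtain c where c: "H h = (\<Sum>i<?n. sc (c i) (y i))" "h = (\<Sum>i<?n. hscale R (c i) (coroot R i))" using Hh[of h] by (elim exE conjE)
      have c0: "c i = 0" if "i < ?n" for i using y_indep[of c i] c(1) z that by simp
      obtain B where "finite_dimensional_vector_space (hscale R) B"
        using conjunct1[OF conjunct2[OF R']] by (elim exE conjE)
      then interpret h: finite_dimensional_vector_space "hscale R" B .
      show ?thesis unfolding c(2) by (rule sum.neutral) (simp add: c0)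
    qed
    show "m (E i) (F j) = (if i = j then H (coroot R i) else 0)" if "i < ?n" "j < ?n" for i j
      using EF[OF that] H(3) that by simp
    show "m (H h) (E j) = sc (root R j h) (E j)" if j: "j < ?n" for h j
    proof -
      obtain c where c: "H h = (\<Sum>i<?n. sc (c i) (y i))" "root R j h = (\<Sum>i<?n. c i * of_int (A $$ (i, j)))"
        using Hh[of h] j by (elim exE conjE) simp
      show ?thesis unfolding c by (simp add: m_sum_left m_scale_left yE j scale_sum_left)
    qed
    show "m (H h) (F j) = - sc (root R j h) (F j)" if j: "j < ?n" for h j
    proof -
      obtain c where c: "H h = (\<Sum>i<?n. sc (c i) (y i))" "root R j h = (\<Sum>i<?n. c i * of_int (A $$ (i, j)))"
        using Hh[of h] j by (elim exE conjE) simp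
      show ?thesis unfolding c by (simp add: m_sum_left m_scale_left yF j scale_sum_left sum_negf)
    qed
    show "m (H h) (H h') = 0" for h h'
    proof -
      obtain c c' where c: "H h = (\<Sum>i<?n. sc (c i) (y i))" "H h' = (\<Sum>i<?n. sc (c' i) (y i))"
        using Hh[of h] Hh[of h'] by (elim exE conjE)
      show ?thesis unfolding c by (simp add: m_sum_left m_sum_right m_scale_left m_scale_right yy)
    qed
    show "V \<subseteq> W" if W: "subspace W" "\<And>x y. \<lbrakk>x \<in> W; y \<in> W\<rbrakk> \<Longrightarrow> m x y \<in> W" "\<And>h. H h \<in> W"
        "\<And>i. i < ?n \<Longrightarrow> E i \<in> W" "\<And>i. i < ?n \<Longrightarrow> F i \<in> W" for W
      by (rule generation[OF W(1,2) _ W(4,5)]) (use W(3) H(3) in metis)+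
    show "cf q = 0" if "finite S" "\<And>q. q \<in> S \<Longrightarrow> cf q \<in> G q" "sum cf S = 0" "q \<in> S" for S and cf :: "(nat \<Rightarrow> int) \<Rightarrow> 'v" and q
      by (rule G_indep[OF that])
  qed (rule lie parts degrees H(1,2) G_subspace G_subset G_mult nondegenerate; assumption)+
  from contragredient_model.contragredient_iso[OF this] show ?thesis using that .
qed

section \<open>The semisimplification of a Lie algebra graded by an sl2-triple\<close>

text \<open>The weight is an integer carried by the projections \<open>pr j\<close>, not an
  eigenvalue: in characteristic 3 the eigenvalue of the bracket of \<open>e\<close> and
  \<open>f\<close> cannot tell weight 2 from weight -1. The vanishing outside -2..2 is what replaces
  complete reducibility in the arguments below.\<close>

locale sl2_graded_lie = bilinear_product sc br
  for sc :: "'k::field \<Rightarrow> 'v::ab_group_add \<Rightarrow> 'v" and br +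
  fixes V :: "'v set" and pr :: "int \<Rightarrow> 'v \<Rightarrow> 'v" and e f :: 'v
  assumes three: "(3 :: 'k) = 0"
    and skew: "br x y = - br y x"
    and jacobi: "br x (br y z) = br (br x y) z + br y (br x z)"
    and V_subspace: "subspace V" and V_mult: "\<lbrakk>x \<in> V; y \<in> V\<rbrakk> \<Longrightarrow> br x y \<in> V"
    and e_V: "e \<in> V" and f_V: "f \<in> V"
    and pr_add: "pr j (x + y) = pr j x + pr j y" and pr_scale: "pr j (sc c x) = sc c (pr j x)"
    and pr_V: "x \<in> V \<Longrightarrow> pr j x \<in> V"
    and pr_pr: "pr i (pr j x) = (if i = j then pr j x else 0)"
    and pr_outside: "\<lbrakk>x \<in> V; j < -2 \<or> 2 < j\<rbrakk> \<Longrightarrow> pr j x = 0"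
    and pr_sum: "x \<in> V \<Longrightarrow> x = (\<Sum>j\<in>{-2..2}. pr j x)"
    and pr_br: "\<lbrakk>x \<in> V; y \<in> V\<rbrakk> \<Longrightarrow> pr (i + j) (br (pr i x) (pr j y)) = br (pr i x) (pr j y)"
    and pr_e: "pr 2 e = e" and pr_f: "pr (-2) f = f"
    and sl2: "x \<in> V \<Longrightarrow> br e (br f (pr j x)) - br f (br e (pr j x)) = sc (of_int j) (pr j x)"
begin

abbreviation d where "d x \<equiv> br e x"

lemma two_neq_zero: "(2 :: 'k) \<noteq> 0"
proof
  assume "(2 :: 'k) = 0"
  then have "(3 :: 'k) - 2 = 0" using three by simp
  then show False by simp
qed

lemma two_eq: "(2 :: 'k) = -1"
  using three by (simp add: eq_neg_iff_add_eq_0)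

lemma four_eq: "(4 :: 'k) = 1"
proof -
  have "(4 :: 'k) = 3 + 1" by simp
  then show ?thesis using three by simp
qed

lemma pr_0 [simp]: "pr j 0 = 0"
  using pr_add[of j 0 0] by simp

lemma pr_neg: "pr j (- x) = - pr j x"
  using pr_add[of j x "- x"] by (simp add: eq_neg_iff_add_eq_0 add.commute)

lemma pr_diff: "pr j (x - y) = pr j x - pr j y"
  using pr_add[of j x "- y"] by (simp add: pr_neg)

lemma pr_sum': "pr j (sum g S) = (\<Sum>i\<in>S. pr j (g i))"
  by (induction S rule: infinite_finite_induct) (auto simp: pr_add)

definition homog :: "int \<Rightarrow> 'v set" where "homog j = {x \<in> V. pr j x = x}"

lemma homog_V: "x \<in> homog j \<Longrightarrow> x \<in> V"
  and homog_pr: "x \<in> homog j \<Longrightarrow> pr i x = (if i = j then x else 0)"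
  and pr_homog: "x \<in> V \<Longrightarrow> pr j x \<in> homog j"
  using pr_pr[of i j x] by (auto simp: homog_def pr_V pr_pr)

lemma homog_subspace: "subspace (homog j)"
  using V_subspace by (auto simp: homog_def subspace_def pr_add pr_scale)

lemma homog_br: "\<lbrakk>x \<in> homog i; y \<in> homog j\<rbrakk> \<Longrightarrow> br x y \<in> homog (i + j)"
  using pr_br[of x y i j] V_mult[of x y] by (auto simp: homog_def)

lemma homog_outside: "\<lbrakk>x \<in> homog j; j < -2 \<or> 2 < j\<rbrakk> \<Longrightarrow> x = 0"
  using pr_outside[of x j] by (auto simp: homog_def)

lemma homog_d: "x \<in> homog j \<Longrightarrow> d x \<in> homog (j + 2)"
  and homog_f: "x \<in> homog j \<Longrightarrow> br f x \<in> homog (j - 2)"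
  using homog_br[of e 2 x j] homog_br[of f "-2" x j] e_V f_V pr_e pr_f
  by (auto simp: homog_def add.commute)

lemma homog_sl2: "x \<in> homog j \<Longrightarrow> d (br f x) = br f (d x) + sc (of_int j) x"
  using sl2[of x j] by (auto simp: homog_def algebra_simps)

lemma d_V: "x \<in> V \<Longrightarrow> d x \<in> V"
  using e_V V_mult by auto

lemma pr_d: "x \<in> V \<Longrightarrow> pr j (d x) = d (pr (j - 2) x)"
proof -
  assume x: "x \<in> V"
  have "pr j (d x) = (\<Sum>i\<in>{-2..2}. pr j (d (pr i x)))"
    by (subst pr_sum[OF x], simp only: m_sum_right pr_sum')
  also have "\<dots> = (\<Sum>i\<in>{-2..2}. if i = j - 2 then d (pr i x) else 0)"
    using homog_pr[OF homog_d[OF pr_homog[OF x]]] by (intro sum.cong) auto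
  also have "\<dots> = (if j - 2 \<in> {-2..2} then d (pr (j - 2) x) else 0)" by (subst sum.delta) auto
  also have "\<dots> = d (pr (j - 2) x)" using pr_outside[OF x, of "j - 2"] by auto
  finally show ?thesis .
qed

lemma d_derivation: "d (br x y) = br (d x) y + br x (d y)"
  by (rule jacobi)

text \<open>Three applications raise the weight by 6, beyond the range from -2 to 2.\<close>

lemma d_cube: "x \<in> V \<Longrightarrow> d (d (d x)) = 0"
proof -
  assume x: "x \<in> V"
  then have V: "d (d (d x)) \<in> V" by (intro d_V)
  have "pr j (d (d (d x))) = 0" if "j \<in> {-2..2}" for j
    using x that pr_outside[OF x, of "j - 6"] by (simp add: pr_d d_V)
  then show ?thesis using pr_sum[OF V] by simp
qed

text \<open>Weight -3 is zero, so \<open>f\<close> kills \<open>x\<close> and the \<open>sl2\<close>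
  relation reads \<open>br f (d x) = x\<close>.\<close>

lemma low_d_inj: "\<lbrakk>x \<in> homog (-1); d x = 0\<rbrakk> \<Longrightarrow> x = 0"
  using homog_sl2[of x "-1"] homog_outside[OF homog_f[of x "-1"]] by simp

text \<open>Weight 3 is zero, so the \<open>sl2\<close> relation gives
  \<open>d (br f y) = y\<close>: the preimage is \<open>br f y\<close>.\<close>

lemma high_d_surj: "y \<in> homog 1 \<Longrightarrow> \<exists>x\<in>homog (-1). d x = y"
  using homog_sl2[of y 1] homog_outside[OF homog_d[of y 1]] homog_f[of y 1] by auto

lemma low_dd_inj: "\<lbrakk>x \<in> homog (-2); d (d x) = 0\<rbrakk> \<Longrightarrow> x = 0"
proof -
  assume x: "x \<in> homog (-2)" "d (d x) = 0"
  have "br f x = 0" using homog_outside[OF homog_f[OF x(1)]] by simp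
  then have 1: "br f (d x) = sc 2 x" using homog_sl2[OF x(1)] by (simp add: eq_neg_iff_add_eq_0[symmetric])
  \<comment> \<open>The vector \<open>d x\<close> has weight 0, so \<open>e\<close> and
    \<open>f\<close> commute on it.\<close>
  have "d (br f (d x)) = 0" using homog_sl2[OF homog_d[OF x(1)]] x(2) by simp
  then have "d x = 0" using two_neq_zero unfolding 1 by (simp add: m_scale_right)
  then show ?thesis using 1 two_neq_zero by simp
qed

text \<open>The preimage is \<open>f\<close> applied twice; bringing it back up multiplies by 2
  twice, and 4 is 1 in characteristic 3.\<close>

lemma high_dd_surj: "y \<in> homog 2 \<Longrightarrow> \<exists>x\<in>homog (-2). d (d x) = y"
proof -
  assume y: "y \<in> homog 2"
  have "d y = 0" using homog_outside[OF homog_d[OF y]] by simp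
  then have 1: "d (br f y) = sc 2 y" using homog_sl2[OF y] by simp
  have fy: "br f y \<in> homog 0" "br f (br f y) \<in> homog (-2)" using homog_f[OF y] homog_f[of "br f y" 0] by auto
  have "d (br f (br f y)) = sc 2 (br f y)" using homog_sl2[OF fy(1)] 1 by (simp add: m_scale_right)
  then have "d (d (br f (br f y))) = y" by (simp add: m_scale_right 1 four_eq)
  then show ?thesis using fy by blast
qed

text \<open>The multiplicity space of the trivial module is the centraliser in degree 0; that of the
  two-dimensional module is represented by its lowest weight vectors.\<close>

definition "even_space = {x \<in> homog 0. d x = 0}"
abbreviation "odd_space \<equiv> homog (-1)"

definition scale2 :: "'k \<Rightarrow> 'v \<times> 'v \<Rightarrow> 'v \<times> 'v" where
  "scale2 c x = (sc c (fst x), sc c (snd x))"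

text \<open>The odd-odd term is the bracket composed with the inclusion of \<open>J 1\<close> into
  the tensor square of \<open>J 2\<close>, written with the lowest vector of a block and its image
  under \<open>d\<close>.\<close>

definition br2 :: "'v \<times> 'v \<Rightarrow> 'v \<times> 'v \<Rightarrow> 'v \<times> 'v" where
  "br2 x y = (br (fst x) (fst y) + (br (d (snd x)) (snd y) - br (snd x) (d (snd y))),
    br (fst x) (snd y) + br (snd x) (fst y))"

definition part2 :: "'v set \<Rightarrow> 'v set \<Rightarrow> bool \<Rightarrow> ('v \<times> 'v) set" where
  "part2 Y Z p = (if p then {0} \<times> Z else Y \<times> {0})"

sublocale pair: bilinear_product scale2 br2
  by unfold_locales (auto simp: scale2_def br2_def algebra_simps m_add_left m_add_right m_scale_left m_scale_right
      scale_right_diff_distrib)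

lemma pair_subspace: "\<lbrakk>subspace Y; subspace Z\<rbrakk> \<Longrightarrow> pair.subspace (Y \<times> Z)"
  by (auto simp: subspace_def pair.subspace_def scale2_def zero_prod_def)

lemma even_subspace: "subspace even_space"
  using homog_subspace[of 0] by (auto simp: even_space_def subspace_def m_add_right m_scale_right)

lemma d_d_odd: "x \<in> odd_space \<Longrightarrow> d (d x) = 0"
  using homog_outside[OF homog_d[OF homog_d[of x "-1"]]] by simp

text \<open>Applying \<open>d\<close> to \<open>br (d u) v - br u (d v)\<close> leaves
  \<open>br (d u) (d v)\<close> twice with opposite signs, because second derivatives of odd
  elements lie in weight 3 and vanish.\<close>

lemma br2_closed:
  assumes "x \<in> even_space \<times> odd_space" "y \<in> even_space \<times> odd_space"
  shows "br2 x y \<in> even_space \<times> odd_space"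
proof -
  obtain a u b v where xy: "x = (a, u)" "y = (b, v)" by (cases x, cases y)
  have h: "a \<in> homog 0" "b \<in> homog 0" "u \<in> odd_space" "v \<in> odd_space" "d a = 0" "d b = 0"
    using assms xy by (auto simp: even_space_def)
  have "br a b + (br (d u) v - br u (d v)) \<in> homog 0"
    using homog_br[OF h(1,2)] homog_br[OF homog_d[OF h(3)] h(4)] homog_br[OF h(3) homog_d[OF h(4)]]
    by (intro subspace_add subspace_diff homog_subspace) auto
  moreover have "d (br a b + (br (d u) v - br u (d v))) = 0"
    using h d_d_odd by (simp add: m_add_right m_diff_right d_derivation[of a b] d_derivation[of "d u" v]
        d_derivation[of u "d v"])
  moreover have "br a v + br u b \<in> odd_space"
    using homog_br[OF h(1,4)] homog_br[OF h(3,2)] by (intro subspace_add homog_subspace) auto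
  ultimately show ?thesis by (simp add: br2_def xy even_space_def)
qed

abbreviation "S_alg \<equiv> alg_record scale2 br2 (even_space \<times> odd_space) (part2 even_space odd_space)"

lemma skew_part2:
  assumes "x \<in> part2 Y Z p" "y \<in> part2 Y' Z' q"
  shows "br2 x y + scale2 (koszul p q) (br2 y x) = 0"
proof -
  have "br (fst x) (fst y) = - br (fst y) (fst x)" "br (d (snd x)) (snd y) = - br (snd y) (d (snd x))"
    "br (snd x) (d (snd y)) = - br (d (snd y)) (snd x)" "br (fst x) (snd y) = - br (snd y) (fst x)"
    "br (snd x) (fst y) = - br (fst y) (snd x)" by (rule skew)+
  then show ?thesis
    using assms by (cases p; cases q) (auto simp: part2_def br2_def scale2_def koszul_def zero_prod_def)
qed

lemma br_left_jacobi: "br (br x y) z = br x (br y z) - br y (br x z)"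
  using jacobi[of x y z] by simp

text \<open>For three odd elements the super Jacobi identity fails in the characteristic 3 Lie algebra only
  by an element of the image of \<open>d\<close>, of degree \<open>-3 + 2\<close>.\<close>

lemma odd_jacobi:
  assumes "u \<in> odd_space" "v \<in> odd_space" "w \<in> odd_space"
  shows "br u (br (d v) w - br v (d w)) = br (br (d u) v - br u (d v)) w - br v (br (d u) w - br u (d w))"
proof -
  let ?t = "br u (br v w) + br v (br u w)"
  have "br u (br v w) \<in> homog (-3)" "br v (br u w) \<in> homog (-3)"
    using homog_br[OF assms(1) homog_br[OF assms(2,3)]] homog_br[OF assms(2) homog_br[OF assms(1,3)]] by auto
  then have "br u (br v w) = 0" "br v (br u w) = 0" using homog_outside by auto
  then have 0: "d ?t = 0" by simp
  have two: "x + x = - x" for x :: 'v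
    using scale_left_distrib[of 1 1 x] two_eq by simp
  have dt: "d ?t = br (d u) (br v w) + (br u (br (d v) w) + br u (br v (d w))) +
      (br (d v) (br u w) + (br v (br (d u) w) + br v (br u (d w))))"
    by (simp only: m_add_right d_derivation[of u "br v w"] d_derivation[of v w]
        d_derivation[of v "br u w"] d_derivation[of u w])
  have "br u (br (d v) w - br v (d w)) - (br (br (d u) v - br u (d v)) w - br v (br (d u) w - br u (d w)))
    = (br u (br (d v) w) + br u (br (d v) w)) + (br v (br (d u) w) + br v (br (d u) w))
      - br u (br v (d w)) - br (d u) (br v w) - br (d v) (br u w) - br v (br u (d w))"
    by (simp add: m_diff_left m_diff_right br_left_jacobi)
  also have "\<dots> = - d ?t"
    unfolding two dt by simp
  finally show ?thesis using 0 by simp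
qed

text \<open>Even elements are killed by \<open>d\<close> and so commute with it; all cases of the
  Jacobi identity with an even argument reduce to the ordinary one. Three odd arguments are the
  content of \<open>odd_jacobi\<close>. The cube condition is a hypothesis, since in characteristic
  3 it does not follow from super Jacobi.\<close>

lemma S_lie:
  assumes cube: "\<And>u. u \<in> odd_space \<Longrightarrow> br u (br u (d u)) = 0"
  shows "lie_superalgebra S_alg"
proof (rule pair.alg_record_lie_superalgebra)
  show "pair.subspace (even_space \<times> odd_space)" by (intro pair_subspace even_subspace homog_subspace)
  show "part2 even_space odd_space p \<subseteq> even_space \<times> odd_space" for p
    using subspace_0[OF even_subspace] subspace_0[OF homog_subspace] by (auto simp: part2_def)
  show "pair.subspace (part2 even_space odd_space p)" for p
    unfolding part2_def using subspace_0 even_subspace homog_subspace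
    by (auto intro!: pair_subspace simp: subspace_def)
  show "\<exists>a\<in>part2 even_space odd_space False. \<exists>b\<in>part2 even_space odd_space True. x = a + b"
    if "x \<in> even_space \<times> odd_space" for x
    using that by (intro bexI[of _ "(fst x, 0)"] bexI[of _ "(0, snd x)"]) (auto simp: part2_def)
  show "part2 even_space odd_space False \<inter> part2 even_space odd_space True \<subseteq> {0}"
    by (auto simp: part2_def zero_prod_def)
  have zero: "0 \<in> even_space" "0 \<in> odd_space" using subspace_0[OF even_subspace] subspace_0[OF homog_subspace] by auto
  show "br2 x y \<in> part2 even_space odd_space (p \<noteq> q)"
    if xy: "x \<in> part2 even_space odd_space p" "y \<in> part2 even_space odd_space q" for x y p q
  proof -
    have "x \<in> even_space \<times> odd_space" "y \<in> even_space \<times> odd_space"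
      using xy zero by (auto simp: part2_def split: if_splits)
    from br2_closed[OF this] show ?thesis
      using xy by (cases p; cases q) (auto simp: part2_def br2_def)
  qed
  show "br2 x (br2 y z) = br2 (br2 x y) z + scale2 (koszul p q) (br2 y (br2 x z))"
    if x: "x \<in> part2 even_space odd_space p" and y: "y \<in> part2 even_space odd_space q"
      and z: "z \<in> even_space \<times> odd_space" for x y z p q
  proof -
    obtain c w where zc: "z = (c, w)" "d c = 0" "w \<in> odd_space" using z by (auto simp: even_space_def)
    have flip: "br (br a b) g = br a (br b g) - br b (br a g)" for a b g by (rule br_left_jacobi)
    have comm: "d (br a g) = br a (d g)" if "d a = 0" for a g using d_derivation[of a g] that by simp
    note simps = br2_def scale2_def koszul_def m_diff_left m_diff_right m_add_left m_add_right flip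
    show ?thesis
    proof (cases p; cases q)
      assume pq: "\<not> p" "\<not> q"
      then obtain a b where "x = (a, 0)" "y = (b, 0)" "d a = 0" "d b = 0" using x y by (auto simp: part2_def even_space_def)
      then show ?thesis using pq by (simp add: simps zc(1))
    next
      assume pq: "\<not> p" "q"
      then obtain a v where av: "x = (a, 0)" "y = (0, v)" "d a = 0" using x y by (auto simp: part2_def even_space_def)
      then show ?thesis using pq zc(2) by (simp add: simps zc(1) comm[OF av(3)])
    next
      assume pq: "p" "\<not> q"
      then obtain u b where ub: "x = (0, u)" "y = (b, 0)" "d b = 0" using x y by (auto simp: part2_def even_space_def)
      then show ?thesis using pq zc(2) by (simp add: simps zc(1) comm[OF ub(3)])
    next
      assume pq: "p" "q"
      then obtain u v where uv: "x = (0, u)" "y = (0, v)" "u \<in> odd_space" "v \<in> odd_space" using x y by (auto simp: part2_def)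
      show ?thesis
      proof (rule prod_eqI)
        show "fst (br2 x (br2 y z)) = fst (br2 (br2 x y) z + scale2 (koszul p q) (br2 y (br2 x z)))"
          using pq zc(2) by (simp add: simps zc(1) uv)
        show "snd (br2 x (br2 y z)) = snd (br2 (br2 x y) z + scale2 (koszul p q) (br2 y (br2 x z)))"
          using pq odd_jacobi[OF uv(3,4) zc(3)] by (simp add: br2_def scale2_def koszul_def zc(1) uv)
      qed
    qed
  qed
  show "br2 x (br2 x x) = 0" if x: "x \<in> part2 even_space odd_space True" for x
  proof -
    obtain u where u: "x = (0, u)" "u \<in> odd_space" using x by (auto simp: part2_def)
    show ?thesis
      using cube[OF u(2)] skew[of "d u" u]
      by (simp add: u(1) br2_def m_diff_right m_minus_right zero_prod_def)
  qed
qed (use br2_closed skew_part2 in auto)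

abbreviation "cube u \<equiv> br u (br u (d u))"

text \<open>The cube of an odd element is \<open>[u, {u, u}]\<close> for the odd product \<open>{u, v}\<close>, and the polarisations
  vanish by the super Jacobi identity.\<close>

lemma cube_add:
  assumes "u \<in> odd_space" "v \<in> odd_space"
  shows "cube (u + v) = cube u + cube v"
proof -
  let ?q = "\<lambda>u v. br (d u) v - br u (d v)"
  have two: "x + x = - x" for x :: 'v
    using scale_left_distrib[of 1 1 x] two_eq by simp
  have cq: "cube w = br w (?q w w)" for w
  proof -
    have "?q w w = - (br w (d w) + br w (d w))" using skew[of "d w" w] by simp
    then show ?thesis by (simp only: two minus_minus)
  qed
  have sym: "?q v u = ?q u v"
    using skew[of "d v" u] skew[of v "d u"] by simp
  have pol: "br w (?q w z) + br w (?q w z) + br z (?q w w) = 0" if "w \<in> odd_space" "z \<in> odd_space" for w z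
    using odd_jacobi[OF that(1) that(1) that(2), unfolded eq_diff_eq] skew[of z "?q w w"] by simp
  define A B C where "A = ?q u u" and "B = ?q v v" and "C = ?q u v"
  have "?q (u + v) (u + v) = ?q u u + ?q v v + (?q u v + ?q v u)"
    by (simp add: m_add_left m_add_right)
  then have "?q (u + v) (u + v) = A + B + (C + C)" unfolding sym A_def B_def C_def .
  then have "cube (u + v) = br (u + v) (A + B + (C + C))" using cq[of "u + v"] by simp
  also have "\<dots> = br u A + br v B + (br u C + br u C + br v A) + (br v C + br v C + br u B)"
    by (simp add: m_add_left m_add_right)
  also have "\<dots> = br u A + br v B" using pol[OF assms] pol[OF assms(2,1)] unfolding sym A_def[symmetric] B_def[symmetric] C_def[symmetric] by simp
  finally show ?thesis using cq[of u] cq[of v] by (simp add: A_def B_def)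
qed

text \<open>The cube map is additive and semilinear with respect to the third power of scalars, so
  it vanishes on a span once it vanishes on the spanning vectors.\<close>

lemma cube_sum_zero:
  assumes "finite S" "\<And>i. i \<in> S \<Longrightarrow> z i \<in> odd_space" "\<And>i. i \<in> S \<Longrightarrow> cube (z i) = 0"
  shows "cube (\<Sum>i\<in>S. sc (c i) (z i)) = 0"
  using assms
proof (induction S rule: finite_induct)
  case (insert i S)
  have "sc (c i) (z i) \<in> odd_space" "(\<Sum>i\<in>S. sc (c i) (z i)) \<in> odd_space"
    using insert by (auto intro!: subspace_scale[OF homog_subspace] subspace_sum[OF homog_subspace])
  from cube_add[OF this] show ?case using insert by (simp add: m_scale_left m_scale_right)
qed simp

end

subsection \<open>Traces and functionals\<close>

text \<open>A basis of \<open>W\<close> stays independent after adding \<open>x\<close>, and a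
  linear map can be prescribed on it. Such functionals detect morphisms that are not
  negligible.\<close>

lemma (in vector_space) separating_functional:
  assumes W: "subspace W" and x: "x \<notin> W"
  obtains p where "\<And>y z. p (y + z) = p y + p z" "\<And>c y. p (scale c y) = c * p y"
    "\<And>w. w \<in> W \<Longrightarrow> p w = 0" "p x = (1 :: 'a)"
proof -
  interpret vs: vector_space_pair scale "(*) :: 'a \<Rightarrow> 'a \<Rightarrow> 'a"
    by unfold_locales (auto simp: algebra_simps)
  obtain B where B: "B \<subseteq> W" "independent B" "W \<subseteq> span B" using maximal_independent_subset by blast
  have sp: "span B = W" using B W span_minimal by blast
  then have ind: "independent (insert x B)" using B(2) x by (simp add: independent_insert)
  obtain g where g: "Vector_Spaces.linear scale (*) g" "\<forall>y\<in>insert x B. g y = (if y = x then 1 else 0)"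
    using vs.linear_independent_extend[OF ind, of "\<lambda>y. if y = x then 1 else 0"] by blast
  interpret g: Vector_Spaces.linear scale "(*)" g by fact
  have "g w = 0" if "w \<in> W" for w
    using that unfolding sp[symmetric]
  proof (rule span_induct)
    show "subspace {a. g a = 0}" by (auto simp: subspace_def g.add g.scale g.zero)
    show "g b = 0" if "b \<in> B" for b using g(2) that x B(1) by auto
  qed
  then show ?thesis using that[of g] g(2) g.add g.scale by auto
qed

text \<open>\<open>lin_trace\<close> refers to a chosen basis and a chosen matrix. For an
  endomorphism that factors through a space of dimension at most two, the trace can be computed on
  that space instead, which removes both choices. Every composite through \<open>J 1\<close> or
  \<open>J 2\<close> is of this kind.\<close>

lemma lin_trace_rank_two:
  fixes W :: "('k::field, 'a, 'x) module_scheme"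
  assumes "vectorspace class_ring W" and fd: "vectorspace.fin_dim class_ring W"
    and p: "\<And>y z. \<lbrakk>y \<in> carrier W; z \<in> carrier W\<rbrakk> \<Longrightarrow> p (y \<oplus>\<^bsub>W\<^esub> z) = p y + p z"
      "\<And>c y. y \<in> carrier W \<Longrightarrow> p (c \<odot>\<^bsub>W\<^esub> y) = c * p y"
    and q: "\<And>y z. \<lbrakk>y \<in> carrier W; z \<in> carrier W\<rbrakk> \<Longrightarrow> q (y \<oplus>\<^bsub>W\<^esub> z) = q y + q z"
      "\<And>c y. y \<in> carrier W \<Longrightarrow> q (c \<odot>\<^bsub>W\<^esub> y) = c * q y"
    and w: "w1 \<in> carrier W" "w2 \<in> carrier W"
    and h: "\<And>y. y \<in> carrier W \<Longrightarrow> h y = p y \<odot>\<^bsub>W\<^esub> w1 \<oplus>\<^bsub>W\<^esub> q y \<odot>\<^bsub>W\<^esub> w2"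
  shows "lin_trace W h = p w1 + q w2"
proof -
  interpret W: vectorspace class_ring W by fact
  have sm: "c \<odot>\<^bsub>W\<^esub> y \<in> carrier W" if "y \<in> carrier W" for c y using that by simp
  have sl: "(a + b) \<odot>\<^bsub>W\<^esub> y = a \<odot>\<^bsub>W\<^esub> y \<oplus>\<^bsub>W\<^esub> b \<odot>\<^bsub>W\<^esub> y" if "y \<in> carrier W" for a b y
    using W.smult_l_distr[of a b y] that by simp
  have sr: "a \<odot>\<^bsub>W\<^esub> (y \<oplus>\<^bsub>W\<^esub> z) = a \<odot>\<^bsub>W\<^esub> y \<oplus>\<^bsub>W\<^esub> a \<odot>\<^bsub>W\<^esub> z" if "y \<in> carrier W" "z \<in> carrier W" for a y z
    using W.smult_r_distr[of a y z] that by simp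
  have sa: "(a * b) \<odot>\<^bsub>W\<^esub> y = a \<odot>\<^bsub>W\<^esub> (b \<odot>\<^bsub>W\<^esub> y)" if "y \<in> carrier W" for a b y
    using W.smult_assoc1[of a b y] that by simp
  define B where "B = (SOME B. finite B \<and> W.basis B)"
  have B: "finite B" "W.basis B"
    using someI_ex[OF W.finite_basis_exists[OF fd]] by (auto simp: B_def)
  then have BW: "B \<subseteq> carrier W" by (simp add: W.basis_def)
  have lc: "\<exists>c. y = W.lincomb c B" if "y \<in> carrier W" for y
    using W.basis_criterion[OF B(1) BW] B(2) that by metis
  have uniq: "a b = a' b" if "W.lincomb a B = W.lincomb a' B" "b \<in> B" for a a' b
  proof -
    have c: "W.lincomb a B \<in> carrier W" by (rule W.lincomb_closed) (use BW in auto)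
    \<comment> \<open>\<open>basis_criterion\<close> asserts uniqueness of coordinates for functions
      restricted to \<open>B\<close>, so the two families are restricted first.\<close>
    have r: "W.lincomb (restrict a B) B = W.lincomb a B" "W.lincomb (restrict a' B) B = W.lincomb a' B"
      by (rule W.lincomb_cong, use BW in auto)+
    have "\<exists>!f. f \<in> B \<rightarrow>\<^sub>E carrier class_ring \<and> W.lincomb f B = W.lincomb a B"
      using W.basis_criterion[OF B(1) BW] B(2) c by blast
    moreover have "restrict a B \<in> B \<rightarrow>\<^sub>E carrier class_ring" "restrict a' B \<in> B \<rightarrow>\<^sub>E carrier class_ring"
      by auto
    ultimately have "restrict a B = restrict a' B" using r that(1) by metis
    then show ?thesis using that(2) by (metis restrict_apply')
  qed
  obtain c1 c2 where c: "w1 = W.lincomb c1 B" "w2 = W.lincomb c2 B" using lc w by metis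
  have comb: "a \<odot>\<^bsub>W\<^esub> W.lincomb c1 B \<oplus>\<^bsub>W\<^esub> b \<odot>\<^bsub>W\<^esub> W.lincomb c2 B = W.lincomb (\<lambda>x. a * c1 x + b * c2 x) B" for a b
    using B(1) BW unfolding W.lincomb_def
  proof (induction B rule: finite_induct)
    case empty
    then show ?case using W.smult_r_null by simp
  next
    case (insert x S)
    have x: "x \<in> carrier W" and cl: "\<And>g. finsum W (\<lambda>v. g v \<odot>\<^bsub>W\<^esub> v) S \<in> carrier W"
      using insert.prems by (auto intro!: W.M.finsum_closed simp: sm)
    have "a \<odot>\<^bsub>W\<^esub> (c1 x \<odot>\<^bsub>W\<^esub> x \<oplus>\<^bsub>W\<^esub> finsum W (\<lambda>v. c1 v \<odot>\<^bsub>W\<^esub> v) S) \<oplus>\<^bsub>W\<^esub>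
        b \<odot>\<^bsub>W\<^esub> (c2 x \<odot>\<^bsub>W\<^esub> x \<oplus>\<^bsub>W\<^esub> finsum W (\<lambda>v. c2 v \<odot>\<^bsub>W\<^esub> v) S)
      = (a * c1 x + b * c2 x) \<odot>\<^bsub>W\<^esub> x \<oplus>\<^bsub>W\<^esub> (a \<odot>\<^bsub>W\<^esub> finsum W (\<lambda>v. c1 v \<odot>\<^bsub>W\<^esub> v) S \<oplus>\<^bsub>W\<^esub> b \<odot>\<^bsub>W\<^esub> finsum W (\<lambda>v. c2 v \<odot>\<^bsub>W\<^esub> v) S)"
      using x cl by (simp add: sr sl sa sm W.M.a_ac)
    then show ?case using insert x by (simp add: W.M.finsum_insert Pi_def subset_iff sm)
  qed
  have lin: "P (W.lincomb c B) = (\<Sum>b\<in>B. c b * P b)"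
    if P: "\<And>y z. \<lbrakk>y \<in> carrier W; z \<in> carrier W\<rbrakk> \<Longrightarrow> P (y \<oplus>\<^bsub>W\<^esub> z) = P y + P z"
      "\<And>c y. y \<in> carrier W \<Longrightarrow> P (c \<odot>\<^bsub>W\<^esub> y) = c * P y" for P :: "'a \<Rightarrow> 'k" and c
    using B(1) BW unfolding W.lincomb_def
  proof (induction B rule: finite_induct)
    case empty
    have "P \<zero>\<^bsub>W\<^esub> = P \<zero>\<^bsub>W\<^esub> + P \<zero>\<^bsub>W\<^esub>" using P(1)[of "\<zero>\<^bsub>W\<^esub>" "\<zero>\<^bsub>W\<^esub>"] by simp
    then have "P \<zero>\<^bsub>W\<^esub> = 0" by (simp only: add_cancel_left_right add_cancel_right_right)
    then show ?case by simp
  next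
    case (insert x S)
    have "finsum W (\<lambda>v. c v \<odot>\<^bsub>W\<^esub> v) S \<in> carrier W"
      using insert.prems by (auto intro!: W.M.finsum_closed simp: sm)
    then show ?case using insert by (simp add: W.M.finsum_insert Pi_def subset_iff P sm)
  qed
  define m where "m = (SOME m. \<forall>b\<in>B. h b = W.lincomb (m b) B)"
  have hB: "h b = W.lincomb (\<lambda>x. p b * c1 x + q b * c2 x) B" if "b \<in> B" for b
    using h[of b] that BW comb[of "p b" "q b"] c by auto
  have "\<exists>m. \<forall>b\<in>B. h b = W.lincomb (m b) B"
    by (rule exI[of _ "\<lambda>b x. p b * c1 x + q b * c2 x"]) (use hB in blast)
  from someI_ex[OF this] have m: "h b = W.lincomb (m b) B" if "b \<in> B" for b using that by (simp add: m_def)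
  have mb: "m b b = p b * c1 b + q b * c2 b" if "b \<in> B" for b
    using uniq[of "m b" "\<lambda>x. p b * c1 x + q b * c2 x" b] that m[OF that] hB[OF that] by simp
  have "lin_trace W h = (\<Sum>b\<in>B. m b b)"
    unfolding lin_trace_def B_def[symmetric] Let_def m_def[symmetric] ..
  also have "\<dots> = (\<Sum>b\<in>B. c1 b * p b) + (\<Sum>b\<in>B. c2 b * q b)"
    by (simp add: mb sum.distrib mult.commute)
  finally show ?thesis using lin[of p c1] lin[of q c2] p q c by simp
qed

subsection \<open>Morphisms from the indecomposables\<close>

lemma J_simps [simp]:
  "carrier (module_vec TYPE('k::field) n) = carrier_vec n" "add (module_vec TYPE('k) n) = (+)"
  "module.smult (module_vec TYPE('k) n) = (\<cdot>\<^sub>v)" "zero (module_vec TYPE('k) n) = 0\<^sub>v n"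
  by (simp_all add: module_vec_def)

lemma Jt_1: "v \<in> carrier_vec 1 \<Longrightarrow> Jt 1 v = 0\<^sub>v 1"
  by (rule eq_vecI) (auto simp: jordan_block_def scalar_prod_def)

lemma Jt_2: "v \<in> carrier_vec 2 \<Longrightarrow> Jt 2 v = vec 2 (\<lambda>i. if i = 0 then v $ 1 else 0)"
  by (rule eq_vecI) (auto simp: jordan_block_def scalar_prod_def less_2_cases_iff numeral_2_eq_2)

lemma rep_homD:
  assumes "u \<in> rep_hom V s W t"
  shows "x \<in> carrier V \<Longrightarrow> u x \<in> carrier W"
    and "\<lbrakk>x \<in> carrier V; y \<in> carrier V\<rbrakk> \<Longrightarrow> u (x \<oplus>\<^bsub>V\<^esub> y) = u x \<oplus>\<^bsub>W\<^esub> u y"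
    and "x \<in> carrier V \<Longrightarrow> u (c \<odot>\<^bsub>V\<^esub> x) = c \<odot>\<^bsub>W\<^esub> u x"
    and "x \<in> carrier V \<Longrightarrow> u (s x) = t (u x)"
    and "u \<in> extensional (carrier V)"
  using assms unfolding rep_hom_def LinearCombinations.module_hom_def by auto

lemma rep_homI:
  assumes "\<And>x. x \<in> carrier V \<Longrightarrow> u x \<in> carrier W"
    and "\<And>x y. \<lbrakk>x \<in> carrier V; y \<in> carrier V\<rbrakk> \<Longrightarrow> u (x \<oplus>\<^bsub>V\<^esub> y) = u x \<oplus>\<^bsub>W\<^esub> u y"
    and "\<And>c x. x \<in> carrier V \<Longrightarrow> u (c \<odot>\<^bsub>V\<^esub> x) = c \<odot>\<^bsub>W\<^esub> u x"
    and "\<And>x. x \<in> carrier V \<Longrightarrow> u (s x) = t (u x)"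
    and "u \<in> extensional (carrier V)"
  shows "u \<in> rep_hom V s W t"
  using assms unfolding rep_hom_def LinearCombinations.module_hom_def by auto

text \<open>The contragredient algebra consists of cosets of cosets. Morphisms must take values in
  this \<open>W\<close>, whereas all weight arguments happen in the concrete \<open>V\<close>; the
  isomorphism \<open>g\<close> carries the action \<open>t\<close> to the bracket with
  \<open>e\<close>.\<close>

locale sl2_graded_copy = sl2_graded_lie sc br V pr e f
  for sc :: "'k::field \<Rightarrow> 'v::ab_group_add \<Rightarrow> 'v" and br V pr e f +
  fixes W :: "('k, 'a) superalgebra" and P :: "bool \<Rightarrow> 'v set" and g :: "'a \<Rightarrow> 'v" and t :: "'a \<Rightarrow> 'a"
  assumes W_lie: "lie_superalgebra W" and W_fin_dim: "vectorspace.fin_dim class_ring W"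
    and g_iso: "g \<in> superalgebra_iso W (alg_record sc br V P)"
    and t_closed: "y \<in> carrier W \<Longrightarrow> t y \<in> carrier W"
    and g_t: "y \<in> carrier W \<Longrightarrow> g (t y) = br e (g y)"
begin

sublocale W: nonassoc_algebra W by (rule lie_superalgebra_nonassoc_algebra[OF W_lie])

lemma g_hom: "alg_hom W (alg_record sc br V P) g" and g_bij: "bij_betw g (carrier W) V"
  using g_iso by (auto simp: superalgebra_iso_alt)

lemma g_V: "y \<in> carrier W \<Longrightarrow> g y \<in> V"
  and g_add: "\<lbrakk>y \<in> carrier W; z \<in> carrier W\<rbrakk> \<Longrightarrow> g (y \<oplus>\<^bsub>W\<^esub> z) = g y + g z"
  and g_smult: "y \<in> carrier W \<Longrightarrow> g (c \<odot>\<^bsub>W\<^esub> y) = sc c (g y)"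
  and g_mult: "\<lbrakk>y \<in> carrier W; z \<in> carrier W\<rbrakk> \<Longrightarrow> g (y \<otimes>\<^bsub>W\<^esub> z) = br (g y) (g z)"
  using alg_homD[OF g_hom] by simp_all

lemma W_smult: "y \<in> carrier W \<Longrightarrow> c \<odot>\<^bsub>W\<^esub> y \<in> carrier W"
  using W.smult_closed[of c y] by simp

lemma g_zero: "g \<zero>\<^bsub>W\<^esub> = 0"
proof -
  have "g \<zero>\<^bsub>W\<^esub> = g \<zero>\<^bsub>W\<^esub> + g \<zero>\<^bsub>W\<^esub>" using g_add[of "\<zero>\<^bsub>W\<^esub>" "\<zero>\<^bsub>W\<^esub>"] by simp
  then show ?thesis by (simp only: add_cancel_left_right add_cancel_right_right)
qed

lemma g_minus: "\<lbrakk>y \<in> carrier W; z \<in> carrier W\<rbrakk> \<Longrightarrow> g (y \<ominus>\<^bsub>W\<^esub> z) = g y - g z"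
proof -
  assume yz: "y \<in> carrier W" "z \<in> carrier W"
  have "g (\<ominus>\<^bsub>W\<^esub> z) + g z = 0" using g_add[of "\<ominus>\<^bsub>W\<^esub> z" z] yz by (simp add: W.M.l_neg g_zero)
  then show ?thesis using yz g_add[of y "\<ominus>\<^bsub>W\<^esub> z"] by (simp add: a_minus_def eq_neg_iff_add_eq_0[symmetric])
qed

lemma g_inj: "\<lbrakk>y \<in> carrier W; z \<in> carrier W; g y = g z\<rbrakk> \<Longrightarrow> y = z"
  using g_bij by (auto simp: bij_betw_def inj_on_def)

definition gi where "gi = inv_into (carrier W) g"

lemma gi_carrier [simp]: "a \<in> V \<Longrightarrow> gi a \<in> carrier W" and g_gi [simp]: "a \<in> V \<Longrightarrow> g (gi a) = a"
  and gi_g: "y \<in> carrier W \<Longrightarrow> gi (g y) = y"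
  using g_bij unfolding gi_def
  by (auto simp: bij_betw_def inv_into_into f_inv_into_f bij_betw_inv_into_left)

lemmas g_rules = g_V g_add g_smult g_mult g_zero g_minus g_t t_closed W_smult W.mult_closed

definition hom1 :: "'v \<Rightarrow> 'k vec \<Rightarrow> 'a" where
  "hom1 a = (\<lambda>v\<in>carrier_vec 1. (v $ 0) \<odot>\<^bsub>W\<^esub> gi a)"

text \<open>The nilpotent block is upper triangular, so coordinate 1 belongs to the generator of
  \<open>J 2\<close>, which goes to \<open>a\<close>, and coordinate 0 to its derivative.\<close>

definition hom2 :: "'v \<Rightarrow> 'k vec \<Rightarrow> 'a" where
  "hom2 a = (\<lambda>v\<in>carrier_vec 2. (v $ 0) \<odot>\<^bsub>W\<^esub> gi (d a) \<oplus>\<^bsub>W\<^esub> (v $ 1) \<odot>\<^bsub>W\<^esub> gi a)"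

abbreviation "H1 \<equiv> rep_hom (J 1) (Jt 1) W t"
abbreviation "H2 \<equiv> rep_hom (J 2) (Jt 2) W t"

lemma hom1_rep: "a \<in> {a \<in> V. d a = 0} \<Longrightarrow> hom1 a \<in> H1"
proof (rule rep_homI)
  assume a: "a \<in> {a \<in> V. d a = 0}"
  show "hom1 a (Jt 1 v) = t (hom1 a v)" if v: "v \<in> carrier (J 1)" for v
  proof -
    have v': "v \<in> carrier_vec 1" using v by simp
    show ?thesis unfolding Jt_1[OF v'] using a v'
      by (intro g_inj) (auto simp: hom1_def g_rules m_scale_right)
  qed
qed (auto simp: hom1_def W_smult intro!: g_inj simp: g_rules scale_left_distrib)

lemma hom2_rep: "a \<in> {a \<in> V. d (d a) = 0} \<Longrightarrow> hom2 a \<in> H2"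
proof (rule rep_homI)
  assume a: "a \<in> {a \<in> V. d (d a) = 0}"
  then have V: "a \<in> V" "d a \<in> V" using d_V by auto
  show "hom2 a (Jt 2 v) = t (hom2 a v)" if v: "v \<in> carrier (J 2)" for v
  proof -
    have v': "v \<in> carrier_vec 2" using v by simp
    show ?thesis unfolding Jt_2[OF v'] using a V v'
      by (intro g_inj) (auto simp: hom2_def g_rules m_scale_right m_add_right)
  qed
qed (auto simp: hom2_def W_smult d_V intro!: g_inj simp: g_rules scale_left_distrib scale_right_distrib algebra_simps)

text \<open>A morphism from \<open>J 1\<close> is the choice of a vector killed by the action.
  Together with \<open>hom1_rep\<close> this identifies the morphisms with the kernel of
  \<open>d\<close>.\<close>

lemma H1_eq:
  assumes u: "u \<in> H1"
  shows "g (u (unit_vec 1 0)) \<in> {a \<in> V. d a = 0}" and "u = hom1 (g (u (unit_vec 1 0)))"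
proof -
  note [simp del] = One_nat_def
  note h = rep_homD[OF u, unfolded J_simps]
  let ?e = "unit_vec 1 0 :: 'k vec"
  have z: "u (0\<^sub>v 1) = \<zero>\<^bsub>W\<^esub>"
  proof (rule g_inj)
    have "0\<^sub>v 1 = 0 \<cdot>\<^sub>v (0\<^sub>v 1 :: 'k vec)" by auto
    then show "g (u (0\<^sub>v 1)) = g \<zero>\<^bsub>W\<^esub>" using h(3)[of "0\<^sub>v 1" 0] h(1)[of "0\<^sub>v 1"] g_smult[of "u (0\<^sub>v 1)" 0] g_zero by simp
  qed (use h in auto)
  have ec: "?e \<in> carrier_vec 1" by simp
  have uc: "u ?e \<in> carrier W" by (rule h(1)[OF ec])
  have "t (u ?e) = \<zero>\<^bsub>W\<^esub>" using h(4)[OF ec] Jt_1[OF ec] z by simp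
  then show "g (u ?e) \<in> {a \<in> V. d a = 0}" using g_t[OF uc] g_V[OF uc] g_zero by simp
  show "u = hom1 (g (u ?e))"
  proof (rule extensionalityI[OF h(5)])
    show "hom1 (g (u ?e)) \<in> extensional (carrier_vec 1)" by (simp add: hom1_def)
    fix v :: "'k vec" assume v: "v \<in> carrier_vec 1"
    then have "v = (v $ 0) \<cdot>\<^sub>v ?e" by (intro eq_vecI) auto
    then have "u v = (v $ 0) \<odot>\<^bsub>W\<^esub> u ?e" using h(3)[OF ec, of "v $ 0"] by simp
    then show "u v = hom1 (g (u ?e)) v" using v by (simp add: hom1_def gi_g[OF uc])
  qed
qed

text \<open>\<open>J 2\<close> is generated by \<open>unit_vec 2 1\<close> subject to the vanishing
  of the second derivative, so a morphism is the choice of a vector killed by \<open>d\<close>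
  applied twice.\<close>

lemma H2_eq:
  assumes u: "u \<in> H2"
  shows "g (u (unit_vec 2 1)) \<in> {a \<in> V. d (d a) = 0}" and "u = hom2 (g (u (unit_vec 2 1)))"
proof -
  note [simp del] = One_nat_def
  note h = rep_homD[OF u, unfolded J_simps]
  let ?e = "unit_vec 2 0 :: 'k vec" and ?x = "unit_vec 2 1 :: 'k vec"
  have z: "u (0\<^sub>v 2) = \<zero>\<^bsub>W\<^esub>"
  proof (rule g_inj)
    have "0\<^sub>v 2 = 0 \<cdot>\<^sub>v (0\<^sub>v 2 :: 'k vec)" by auto
    then show "g (u (0\<^sub>v 2)) = g \<zero>\<^bsub>W\<^esub>" using h(3)[of "0\<^sub>v 2" 0] h(1)[of "0\<^sub>v 2"] g_smult[of "u (0\<^sub>v 2)" 0] g_zero by simp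
  qed (use h in auto)
  have ec: "?e \<in> carrier_vec 2" "?x \<in> carrier_vec 2" by auto
  have uc: "u ?e \<in> carrier W" "u ?x \<in> carrier W" using h(1) ec by auto
  have J: "Jt 2 ?x = ?e" "Jt 2 ?e = 0\<^sub>v 2" unfolding Jt_2[OF ec(1)] Jt_2[OF ec(2)] by (auto intro!: eq_vecI)
  have te: "t (u ?x) = u ?e" "t (u ?e) = \<zero>\<^bsub>W\<^esub>" using h(4)[OF ec(1)] h(4)[OF ec(2)] J z by auto
  have du: "d (g (u ?x)) = g (u ?e)" "d (g (u ?e)) = 0" using te g_t uc g_zero by metis+
  then show "g (u ?x) \<in> {a \<in> V. d (d a) = 0}" using g_V[OF uc(2)] by simp
  show "u = hom2 (g (u ?x))"
  proof (rule extensionalityI[OF h(5)])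
    show "hom2 (g (u ?x)) \<in> extensional (carrier_vec 2)" by (simp add: hom2_def)
    fix v :: "'k vec" assume v: "v \<in> carrier_vec 2"
    have "v = (v $ 0) \<cdot>\<^sub>v ?e + (v $ 1) \<cdot>\<^sub>v ?x"
      using v by (intro eq_vecI) (auto simp: less_2_cases_iff)
    then have "u v = (v $ 0) \<odot>\<^bsub>W\<^esub> u ?e \<oplus>\<^bsub>W\<^esub> (v $ 1) \<odot>\<^bsub>W\<^esub> u ?x"
      using h(2)[of "(v $ 0) \<cdot>\<^sub>v ?e" "(v $ 1) \<cdot>\<^sub>v ?x"] h(3)[OF ec(1)] h(3)[OF ec(2)] ec by simp
    then show "u v = hom2 (g (u ?x)) v" using v by (simp add: hom2_def du gi_g uc)
  qed
qed

lemma hom1_unit: "a \<in> V \<Longrightarrow> hom1 a (unit_vec 1 0) = gi a"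
  by (rule g_inj) (auto simp: hom1_def g_rules)

lemma hom2_unit: "a \<in> V \<Longrightarrow> hom2 a (unit_vec 2 1) = gi a" "a \<in> V \<Longrightarrow> hom2 a (Jt 2 (unit_vec 2 1)) = gi (d a)"
proof -
  assume a: "a \<in> V"
  then show "hom2 a (unit_vec 2 1) = gi a" by (intro g_inj) (auto simp: hom2_def g_rules d_V)
  have "Jt 2 (unit_vec 2 1 :: 'k vec) = unit_vec 2 0" by (subst Jt_2) (auto intro!: eq_vecI)
  then show "hom2 a (Jt 2 (unit_vec 2 1)) = gi (d a)" using a by (intro g_inj) (auto simp: hom2_def g_rules d_V)
qed

end

section \<open>Kernels of the raising operator and their lowest weight components\<close>

context sl2_graded_lie
begin

lemma sum_degrees: "sum h {-2..2 :: int} = h (-2) + h (-1) + h 0 + h 1 + (h 2 :: 'v)"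
proof -
  have "{-2..2 :: int} = {-2, -1, 0, 1, 2}" by auto
  then show ?thesis by (simp add: add.assoc)
qed

text \<open>Since \<open>d\<close> shifts weights, every component of a kernel vector is again in
  the kernel, and there \<open>d\<close> is injective in negative weights.\<close>

lemma ker1_low: "\<lbrakk>a \<in> V; d a = 0; j < 0\<rbrakk> \<Longrightarrow> pr j a = 0"
proof -
  assume a: "a \<in> V" "d a = 0" "j < 0"
  then have 0: "d (pr j a) = 0" using pr_d[of a "j + 2"] by simp
  consider "j < -2" | "j = -2" | "j = -1" using a(3) by linarith
  then show "pr j a = 0"
    using 0 pr_outside[of a j] low_d_inj[OF pr_homog[of a "-1"]] low_dd_inj[OF pr_homog[of a "-2"]] a(1)
    by cases auto
qed

lemma ker2_low: "\<lbrakk>u \<in> V; d (d u) = 0; j < -1\<rbrakk> \<Longrightarrow> pr j u = 0"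
proof -
  assume u: "u \<in> V" "d (d u) = 0" "j < -1"
  then have 0: "d (d (pr j u)) = 0" using pr_d[of "d u" "j + 4"] pr_d[of u "j + 2"] d_V[of u] by (simp add: add.commute)
  consider "j < -2" | "j = -2" using u(3) by linarith
  then show "pr j u = 0" using 0 pr_outside[of u j] low_dd_inj[OF pr_homog[of u "-2"]] u(1) by cases auto
qed

text \<open>Kernel components of weight 1 and 2 are always images. The weight 0 component of an
  image comes from weight -2, where \<open>d\<close> applied twice is injective, so it is zero as
  soon as it lies in the kernel.\<close>

lemma ker1_image_iff: "\<lbrakk>a \<in> V; d a = 0\<rbrakk> \<Longrightarrow> pr 0 a = 0 \<longleftrightarrow> (\<exists>b\<in>V. a = d b)"
proof
  assume a: "a \<in> V" "d a = 0" "pr 0 a = 0"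
  then have "a = pr 1 a + pr 2 a" using pr_sum[OF a(1)] ker1_low[OF a(1,2)] by (simp add: sum_degrees)
  moreover obtain x where x: "x \<in> homog (-1)" "d x = pr 1 a" using high_d_surj[OF pr_homog[OF a(1)]] by blast
  moreover obtain y where y: "y \<in> homog (-2)" "d (d y) = pr 2 a" using high_dd_surj[OF pr_homog[OF a(1)]] by blast
  ultimately have "a = d (x + d y)" by (simp add: m_add_right)
  moreover have "x + d y \<in> V"
    by (rule subspace_add[OF V_subspace homog_V[OF x(1)] d_V[OF homog_V[OF y(1)]]])
  ultimately show "\<exists>b\<in>V. a = d b" by blast
next
  assume a: "a \<in> V" "d a = 0" "\<exists>b\<in>V. a = d b"
  then obtain b where b: "b \<in> V" "a = d b" by blast
  have 0: "pr 0 a = d (pr (-2) b)" using pr_d[OF b(1), of 0] b(2) by simp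
  moreover have "d (pr 0 a) = 0" using pr_d[OF a(1), of 2] a(2) by simp
  ultimately have "pr (-2) b = 0" using low_dd_inj[OF pr_homog[OF b(1)]] by simp
  then show "pr 0 a = 0" using 0 by simp
qed

text \<open>The right-hand side says that the block of \<open>u\<close> is not a summand of size 2.
  In weight 1 nothing is a second derivative, as it would come from weight -3; in weight 2
  everything is one. So only the component of weight -1 matters.\<close>

lemma ker2_image_iff: "\<lbrakk>u \<in> V; d (d u) = 0\<rbrakk> \<Longrightarrow> pr (-1) u = 0 \<longleftrightarrow> (\<exists>b\<in>V. d u = d (d b))"
proof
  assume u: "u \<in> V" "d (d u) = 0" "pr (-1) u = 0"
  have "d (pr 1 u) = 0" "d (pr 2 u) = 0"
    using homog_outside[OF homog_d[OF pr_homog[OF u(1)]]] by auto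
  then have "d u = d (pr 0 u)"
    using arg_cong[OF pr_sum[OF u(1)], of d] ker2_low[OF u(1,2)] u(3) by (simp add: sum_degrees m_add_right)
  moreover have "d (pr 0 u) \<in> homog 2" using homog_d[OF pr_homog[OF u(1), of 0]] by simp
  ultimately show "\<exists>b\<in>V. d u = d (d b)" using high_dd_surj homog_V by metis
next
  assume u: "u \<in> V" "d (d u) = 0" "\<exists>b\<in>V. d u = d (d b)"
  then obtain b where b: "b \<in> V" "d u = d (d b)" by blast
  have "d (pr (-1) u) = d (d (pr (-3) b))"
    using pr_d[OF u(1), of 1] pr_d[OF d_V[OF b(1)], of 1] pr_d[OF b(1), of "-1"] b(2) by simp
  then have "d (pr (-1) u) = 0" using pr_outside[OF b(1), of "-3"] by simp
  then show "pr (-1) u = 0" using low_d_inj[OF pr_homog[OF u(1)]] by simp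
qed

text \<open>Any other pair of degrees with sum \<open>a + b\<close> has a member below its bound and
  contributes nothing.\<close>

lemma pr_br_lowest:
  assumes x: "x \<in> V" "\<And>i. i < a \<Longrightarrow> pr i x = 0" and y: "y \<in> V" "\<And>j. j < b \<Longrightarrow> pr j y = 0"
  shows "pr (a + b) (br x y) = br (pr a x) (pr b y)"
proof -
  have t: "pr (a + b) (br (pr i x) (pr j y)) = (if i = a then if j = b then br (pr a x) (pr b y) else 0 else 0)" for i j
  proof (cases "i + j = a + b")
    case True
    then have "i = a \<and> j = b \<or> i < a \<or> j < b" by auto
    then show ?thesis using x y pr_br[OF x(1) y(1), of a b] by auto
  next
    case False
    then show ?thesis
      using homog_pr[OF homog_br[OF pr_homog[OF x(1), of i] pr_homog[OF y(1), of j]], of "a + b"] by auto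
  qed
  have "pr (a + b) (br x y) = (\<Sum>j\<in>{-2..2}. \<Sum>i\<in>{-2..2}. pr (a + b) (br (pr i x) (pr j y)))"
    by (subst pr_sum[OF x(1)], subst pr_sum[OF y(1)], simp only: m_sum_left m_sum_right pr_sum')
  also have "\<dots> = (if a \<in> {-2..2} then if b \<in> {-2..2} then br (pr a x) (pr b y) else 0 else 0)"
    unfolding t by (cases "a \<in> {-2..2}") (simp_all add: sum.delta, auto intro!: sum.neutral)
  also have "\<dots> = br (pr a x) (pr b y)" using pr_outside[OF x(1), of a] pr_outside[OF y(1), of b] by auto
  finally show ?thesis .
qed

definition "lowest x = (pr 0 (fst x), pr (-1) (snd x))"

abbreviation "ker1 \<equiv> {a \<in> V. d a = 0}"
abbreviation "ker2 \<equiv> {a \<in> V. d (d a) = 0}"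

lemma br2_ker: "\<lbrakk>x \<in> ker1 \<times> ker2; y \<in> ker1 \<times> ker2\<rbrakk> \<Longrightarrow> br2 x y \<in> ker1 \<times> ker2"
proof -
  assume xy: "x \<in> ker1 \<times> ker2" "y \<in> ker1 \<times> ker2"
  obtain a u b v where eq: "x = (a, u)" "y = (b, v)" by (cases x, cases y)
  have h: "a \<in> V" "d a = 0" "u \<in> V" "d (d u) = 0" "b \<in> V" "d b = 0" "v \<in> V" "d (d v) = 0"
    using xy eq by auto
  have "br a b + (br (d u) v - br u (d v)) \<in> V" "br a v + br u b \<in> V"
    using h V_subspace by (auto intro!: subspace_add subspace_diff V_mult d_V)
  moreover have "d (br a b + (br (d u) v - br u (d v))) = 0"
    using h by (simp add: m_add_right m_diff_right d_derivation[of a b] d_derivation[of "d u" v] d_derivation[of u "d v"])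
  moreover have "d (br a v + br u b) = br a (d v) + br (d u) b"
    using h by (simp add: m_add_right d_derivation[of a v] d_derivation[of u b])
  then have "d (d (br a v + br u b)) = 0"
    using h by (simp add: m_add_right d_derivation[of a "d v"] d_derivation[of "d u" b])
  ultimately show ?thesis by (simp add: eq br2_def)
qed

text \<open>If \<open>u\<close> starts in weight -1, then \<open>d u\<close> starts in weight 1. All
  products in \<open>br2\<close> therefore start exactly in the degrees that \<open>lowest\<close>
  retains, and only lowest components contribute there.\<close>

lemma lowest_mult: "\<lbrakk>x \<in> ker1 \<times> ker2; y \<in> ker1 \<times> ker2\<rbrakk> \<Longrightarrow> lowest (br2 x y) = br2 (lowest x) (lowest y)"
proof -
  assume xy: "x \<in> ker1 \<times> ker2" "y \<in> ker1 \<times> ker2"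
  obtain a u b v where eq: "x = (a, u)" "y = (b, v)" by (cases x, cases y)
  have h: "a \<in> V" "d a = 0" "u \<in> V" "d (d u) = 0" "b \<in> V" "d b = 0" "v \<in> V" "d (d v) = 0"
    using xy eq by auto
  have du: "pr i (d w) = 0" if "i < 1" "w \<in> V" "d (d w) = 0" for i w
    using pr_d[OF that(2), of i] ker2_low[OF that(2,3), of "i - 2"] that(1) by simp
  have d1: "pr 1 (d w) = d (pr (-1) w)" if "w \<in> V" for w using pr_d[OF that, of 1] by simp
  note low = ker1_low[OF h(1,2)] ker1_low[OF h(5,6)] ker2_low[OF h(3,4)] ker2_low[OF h(7,8)]
  have "pr 0 (br a b) = br (pr 0 a) (pr 0 b)" using pr_br_lowest[of a 0 b 0] h low by simp
  moreover have "pr 0 (br (d u) v) = br (d (pr (-1) u)) (pr (-1) v)"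
    using pr_br_lowest[of "d u" 1 v "-1"] h low du d_V d1 by simp
  moreover have "pr 0 (br u (d v)) = br (pr (-1) u) (d (pr (-1) v))"
    using pr_br_lowest[of u "-1" "d v" 1] h low du d_V d1 by simp
  moreover have "pr (-1) (br a v) = br (pr 0 a) (pr (-1) v)" using pr_br_lowest[of a 0 v "-1"] h low by simp
  moreover have "pr (-1) (br u b) = br (pr (-1) u) (pr 0 b)" using pr_br_lowest[of u "-1" b 0] h low by simp
  ultimately show ?thesis by (simp add: eq lowest_def br2_def pr_add pr_diff)
qed

lemma lowest_image: "lowest ` (ker1 \<times> ker2) = even_space \<times> odd_space"
proof
  show "lowest ` (ker1 \<times> ker2) \<subseteq> even_space \<times> odd_space"
  proof (rule image_subsetI)
    fix x assume "x \<in> ker1 \<times> ker2"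
    then have h: "fst x \<in> V" "d (fst x) = 0" "snd x \<in> V" by (simp_all add: mem_Times_iff)
    have "d (pr 0 (fst x)) = 0" using pr_d[OF h(1), of 2] h(2) by simp
    then show "lowest x \<in> even_space \<times> odd_space"
      unfolding lowest_def even_space_def using pr_homog[OF h(1)] pr_homog[OF h(3)] by simp
  qed
  show "even_space \<times> odd_space \<subseteq> lowest ` (ker1 \<times> ker2)"
  proof
    fix y assume "y \<in> even_space \<times> odd_space"
    then have y: "fst y \<in> homog 0" "d (fst y) = 0" "snd y \<in> odd_space"
      by (simp_all add: even_space_def mem_Times_iff)
    have "lowest y = y"
      using homog_pr[OF y(1), of 0] homog_pr[OF y(3), of "-1"] by (simp add: lowest_def)
    moreover have "y \<in> ker1 \<times> ker2"
      using d_d_odd[OF y(3)] homog_V[OF y(1)] homog_V[OF y(3)] y(2) by (simp add: mem_Times_iff)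
    ultimately show "y \<in> lowest ` (ker1 \<times> ker2)" using imageI[of y "ker1 \<times> ker2" lowest] by (simp only:)
  qed
qed

lemma S_nonassoc: "nonassoc_algebra S_alg"
  by (rule pair.alg_record_nonassoc_algebra[OF pair_subspace[OF even_subspace homog_subspace] br2_closed])
    (use subspace_0[OF even_subspace] subspace_0[OF homog_subspace] in \<open>auto simp: part2_def\<close>)

lemma ker_subspace: "subspace ker1" "subspace ker2"
  using V_subspace by (auto simp: subspace_def m_add_right m_scale_right)

lemma ker_nonassoc: "nonassoc_algebra (alg_record scale2 br2 (ker1 \<times> ker2) (part2 ker1 ker2))"
  by (rule pair.alg_record_nonassoc_algebra[OF pair_subspace[OF ker_subspace] br2_ker])
    (use subspace_0[OF V_subspace] in \<open>auto simp: part2_def\<close>)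

end

section \<open>Negligible morphisms and the quotient superalgebra\<close>

context sl2_graded_copy
begin

definition dual1 :: "('v \<Rightarrow> 'k) \<Rightarrow> 'a \<Rightarrow> 'k vec" where
  "dual1 p = (\<lambda>y\<in>carrier W. vec 1 (\<lambda>_. p (g y)))"

text \<open>\<open>Jt 2\<close> moves coordinate 1 to coordinate 0, hence the derivative in
  coordinate 1. The map commutes with the actions when \<open>p\<close> vanishes on all second
  derivatives.\<close>

definition dual2 :: "('v \<Rightarrow> 'k) \<Rightarrow> 'a \<Rightarrow> 'k vec" where
  "dual2 p = (\<lambda>y\<in>carrier W. vec 2 (\<lambda>i. if i = 0 then p (g y) else p (d (g y))))"

lemma W_vectorspace: "vectorspace class_ring W"
  by (rule W.vectorspace_axioms)

text \<open>A morphism from \<open>W\<close> to \<open>J 1\<close> is a functional that kills the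
  image of \<open>d\<close>, and the composite with \<open>hom1 a\<close> has as trace the value of
  this functional at \<open>a\<close>. Such functionals separate \<open>a\<close> from the image, so
  \<open>hom1 a\<close> is negligible exactly when \<open>a\<close> is in the image.\<close>

lemma negligible_hom1:
  assumes a: "a \<in> ker1"
  shows "hom1 a \<in> negligible (J 1) (Jt 1) W t \<longleftrightarrow> pr 0 a = 0"
proof -
  note [simp del] = One_nat_def
  have tr: "lin_trace W (hom1 a \<circ> v) = v (gi a) $ 0" if v: "v \<in> rep_hom W t (J 1) (Jt 1)" for v
  proof -
    note h = rep_homD[OF v, unfolded J_simps]
    have "lin_trace W (hom1 a \<circ> v) = v (gi a) $ 0 + 0"
    proof (rule lin_trace_rank_two[OF W_vectorspace W_fin_dim, where q = "\<lambda>_. 0" and ?w2.0 = "gi a"])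
      show "v (y \<oplus>\<^bsub>W\<^esub> z) $ 0 = v y $ 0 + v z $ 0" if "y \<in> carrier W" "z \<in> carrier W" for y z
        using h(1)[OF that(1)] h(1)[OF that(2)] h(2)[OF that] by auto
      show "v (c \<odot>\<^bsub>W\<^esub> y) $ 0 = c * v y $ 0" if "y \<in> carrier W" for c y
        using h(1)[OF that] h(3)[OF that] by auto
      show "(hom1 a \<circ> v) y = v y $ 0 \<odot>\<^bsub>W\<^esub> gi a \<oplus>\<^bsub>W\<^esub> 0 \<odot>\<^bsub>W\<^esub> gi a" if "y \<in> carrier W" for y
        using h(1)[OF that] a by (intro g_inj) (auto simp: hom1_def g_rules)
    qed (use a in auto)
    then show ?thesis by simp
  qed
  show ?thesis
  proof
    assume n: "hom1 a \<in> negligible (J 1) (Jt 1) W t"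
    show "pr 0 a = 0"
    proof (rule ccontr)
      assume "pr 0 a \<noteq> 0"
      then have na: "a \<notin> d ` V" using ker1_image_iff[of a] a by auto
      have "subspace (d ` V)"
        by (auto simp: subspace_def m_add_right[symmetric] m_scale_right[symmetric]
            intro!: imageI subspace_add[OF V_subspace] subspace_scale[OF V_subspace] image_eqI[of _ _ 0] subspace_0[OF V_subspace])
      from separating_functional[OF this na]
      obtain p where p: "\<And>y z. p (y + z) = p y + p z" "\<And>c y. p (sc c y) = c * p y"
        "\<And>w. w \<in> d ` V \<Longrightarrow> p w = 0" "p a = 1" by blast
      have "dual1 p \<in> rep_hom W t (J 1) (Jt 1)"
        by (rule rep_homI) (auto simp: dual1_def g_rules p Jt_1 intro!: eq_vecI)
      then have "lin_trace W (hom1 a \<circ> dual1 p) = 0" using n by (simp add: negligible_def)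
      then show False using tr[OF \<open>dual1 p \<in> _\<close>] a p(4) by (simp add: dual1_def)
    qed
  next
    assume "pr 0 a = 0"
    then obtain b where b: "b \<in> V" "a = d b" using ker1_image_iff[of a] a by auto
    have ta: "gi a = t (gi b)" using b a by (intro g_inj) (auto simp: g_rules)
    have "lin_trace W (hom1 a \<circ> v) = 0" if v: "v \<in> rep_hom W t (J 1) (Jt 1)" for v
    proof -
      note h = rep_homD[OF v, unfolded J_simps]
      have "v (gi a) = 0\<^sub>v 1" using h(4)[of "gi b"] h(1)[of "gi b"] b(1) Jt_1 ta by simp
      then show ?thesis using tr[OF v] by simp
    qed
    then show "hom1 a \<in> negligible (J 1) (Jt 1) W t" using hom1_rep[OF a] by (simp add: negligible_def)
  qed
qed

text \<open>The two diagonal contributions agree, whence the factor 2, the dimension of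
  \<open>J 2\<close>; it is nonzero in characteristic 3. The remaining value is that of a functional
  at \<open>d a\<close> that kills second derivatives, so the criterion is whether
  \<open>d a\<close> is a second derivative.\<close>

lemma negligible_hom2:
  assumes a: "a \<in> ker2"
  shows "hom2 a \<in> negligible (J 2) (Jt 2) W t \<longleftrightarrow> pr (-1) a = 0"
proof -
  note [simp del] = One_nat_def
  have aV: "a \<in> V" "d a \<in> V" using a d_V by auto
  have tr: "lin_trace W (hom2 a \<circ> v) = 2 * (v (gi (d a)) $ 0)" if v: "v \<in> rep_hom W t (J 2) (Jt 2)" for v
  proof -
    note h = rep_homD[OF v, unfolded J_simps]
    have "lin_trace W (hom2 a \<circ> v) = v (gi (d a)) $ 0 + v (gi a) $ 1"
    proof (rule lin_trace_rank_two[OF W_vectorspace W_fin_dim])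
      show "v (y \<oplus>\<^bsub>W\<^esub> z) $ 0 = v y $ 0 + v z $ 0" "v (y \<oplus>\<^bsub>W\<^esub> z) $ 1 = v y $ 1 + v z $ 1" if "y \<in> carrier W" "z \<in> carrier W" for y z
        using h(1)[OF that(1)] h(1)[OF that(2)] h(2)[OF that] by auto
      show "v (c \<odot>\<^bsub>W\<^esub> y) $ 0 = c * v y $ 0" "v (c \<odot>\<^bsub>W\<^esub> y) $ 1 = c * v y $ 1" if "y \<in> carrier W" for c y
        using h(1)[OF that] h(3)[OF that] by auto
      show "(hom2 a \<circ> v) y = v y $ 0 \<odot>\<^bsub>W\<^esub> gi (d a) \<oplus>\<^bsub>W\<^esub> v y $ 1 \<odot>\<^bsub>W\<^esub> gi a" if "y \<in> carrier W" for y
        using h(1)[OF that] by (simp add: hom2_def)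
    qed (use aV in auto)
    moreover have "gi (d a) = t (gi a)" using aV by (intro g_inj) (auto simp: g_rules)
    then have "v (gi (d a)) $ 0 = v (gi a) $ 1"
      using h(4)[of "gi a"] h(1)[of "gi a"] aV by (simp add: Jt_2)
    ultimately show ?thesis by simp
  qed
  show ?thesis
  proof
    assume n: "hom2 a \<in> negligible (J 2) (Jt 2) W t"
    show "pr (-1) a = 0"
    proof (rule ccontr)
      assume "pr (-1) a \<noteq> 0"
      then have na: "d a \<notin> (\<lambda>x. d (d x)) ` V" using ker2_image_iff[of a] a by auto
      have "subspace ((\<lambda>x. d (d x)) ` V)"
        by (auto simp: subspace_def m_add_right[symmetric] m_scale_right[symmetric]
            intro!: imageI subspace_add[OF V_subspace] subspace_scale[OF V_subspace] image_eqI[of _ _ 0] subspace_0[OF V_subspace])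
      from separating_functional[OF this na]
      obtain p where p: "\<And>y z. p (y + z) = p y + p z" "\<And>c y. p (sc c y) = c * p y"
        "\<And>w. w \<in> (\<lambda>x. d (d x)) ` V \<Longrightarrow> p w = 0" "p (d a) = 1" by blast
      have "dual2 p \<in> rep_hom W t (J 2) (Jt 2)"
        by (rule rep_homI) (auto simp: dual2_def g_rules p Jt_2 m_add_right m_scale_right intro!: eq_vecI)
      then have "lin_trace W (hom2 a \<circ> dual2 p) = 0" using n by (simp add: negligible_def)
      then show False using tr[OF \<open>dual2 p \<in> _\<close>] aV p(4) two_neq_zero by (simp add: dual2_def)
    qed
  next
    assume "pr (-1) a = 0"
    then obtain b where b: "b \<in> V" "d a = d (d b)" using ker2_image_iff[of a] a by auto
    have ta: "gi (d a) = t (t (gi b))" using b aV by (intro g_inj) (auto simp: g_rules d_V)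
    have "lin_trace W (hom2 a \<circ> v) = 0" if v: "v \<in> rep_hom W t (J 2) (Jt 2)" for v
    proof -
      note h = rep_homD[OF v, unfolded J_simps]
      have "v (gi (d a)) $ 0 = 0"
        using h(4)[of "t (gi b)"] h(4)[of "gi b"] h(1)[of "gi b"] h(1)[of "t (gi b)"] b(1) ta by (simp add: Jt_2 t_closed)
      then show ?thesis using tr[OF v] by simp
    qed
    then show "hom2 a \<in> negligible (J 2) (Jt 2) W t" using hom2_rep[OF a] by (simp add: negligible_def)
  qed
qed

abbreviation "XA \<equiv> ver3_hom_algebra W t"

lemma XA_carrier: "carrier XA = H1 \<times> H2"
  by (simp add: ver3_hom_algebra_def Let_def)

definition "hom12 x = (hom1 (fst x), hom2 (snd x))"

lemma hom12_image: "hom12 ` (ker1 \<times> ker2) = H1 \<times> H2"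
proof
  show "hom12 ` (ker1 \<times> ker2) \<subseteq> H1 \<times> H2" using hom1_rep hom2_rep by (auto simp: hom12_def)
  show "H1 \<times> H2 \<subseteq> hom12 ` (ker1 \<times> ker2)"
  proof
    fix y assume y: "y \<in> H1 \<times> H2"
    then have "y = hom12 (g (fst y (unit_vec 1 0)), g (snd y (unit_vec 2 1)))"
      using H1_eq(2)[of "fst y"] H2_eq(2)[of "snd y"] by (auto simp: hom12_def prod_eq_iff)
    moreover have "(g (fst y (unit_vec 1 0)), g (snd y (unit_vec 2 1))) \<in> ker1 \<times> ker2"
      using y H1_eq(1)[of "fst y"] H2_eq(1)[of "snd y"] by auto
    ultimately show "y \<in> hom12 ` (ker1 \<times> ker2)" by (rule image_eqI)
  qed
qed

lemma hom12_rules: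
  assumes x: "x \<in> ker1 \<times> ker2"
  shows "hom12 (scale2 c x) = c \<odot>\<^bsub>XA\<^esub> hom12 x"
    and "y \<in> ker1 \<times> ker2 \<Longrightarrow> hom12 (x + y) = hom12 x \<oplus>\<^bsub>XA\<^esub> hom12 y"
    and "y \<in> ker1 \<times> ker2 \<Longrightarrow> hom12 (br2 x y) = hom12 x \<otimes>\<^bsub>XA\<^esub> hom12 y"
proof -
  note [simp del] = One_nat_def
  obtain a u where xe: "x = (a, u)" by (cases x)
  have h: "a \<in> V" "d a = 0" "u \<in> V" "d (d u) = 0" "d u \<in> V" using x xe d_V by auto
  have sV: "sc c z \<in> V" if "z \<in> V" for z c using that subspace_scale[OF V_subspace] by blast
  have aV: "z + w \<in> V" "z - w \<in> V" if "z \<in> V" "w \<in> V" for z w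
    using that subspace_add[OF V_subspace] subspace_diff[OF V_subspace] by auto
  have "hom1 (sc c a) = (\<lambda>v\<in>carrier_vec 1. c \<odot>\<^bsub>W\<^esub> hom1 a v)"
    unfolding hom1_def
    by (intro restrict_ext g_inj) (use h sV in \<open>simp_all add: g_rules algebra_simps\<close>)
  moreover have "hom2 (sc c u) = (\<lambda>v\<in>carrier_vec 2. c \<odot>\<^bsub>W\<^esub> hom2 u v)"
    unfolding hom2_def
    by (intro restrict_ext g_inj) (use h sV in \<open>simp_all add: g_rules m_scale_right scale_right_distrib mult.commute\<close>)
  ultimately show "hom12 (scale2 c x) = c \<odot>\<^bsub>XA\<^esub> hom12 x"
    by (simp add: hom12_def scale2_def xe ver3_hom_algebra_def Let_def)
  assume y: "y \<in> ker1 \<times> ker2"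
  obtain b w where ye: "y = (b, w)" by (cases y)
  have k: "b \<in> V" "d b = 0" "w \<in> V" "d (d w) = 0" "d w \<in> V" using y ye d_V by auto
  have "hom1 (a + b) = (\<lambda>v\<in>carrier_vec 1. hom1 a v \<oplus>\<^bsub>W\<^esub> hom1 b v)"
    unfolding hom1_def
    by (intro restrict_ext g_inj) (use h k aV in \<open>simp_all add: g_rules scale_right_distrib\<close>)
  moreover have "hom2 (u + w) = (\<lambda>v\<in>carrier_vec 2. hom2 u v \<oplus>\<^bsub>W\<^esub> hom2 w v)"
    unfolding hom2_def
    by (intro restrict_ext g_inj) (use h k aV in \<open>simp_all add: g_rules m_add_right scale_right_distrib\<close>)
  ultimately show "hom12 (x + y) = hom12 x \<oplus>\<^bsub>XA\<^esub> hom12 y"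
    by (simp add: hom12_def xe ye ver3_hom_algebra_def Let_def)
  have V: "br a b \<in> V" "br (d u) w \<in> V" "br u (d w) \<in> V" "br a w \<in> V" "br u b \<in> V" "br a (d w) \<in> V" "br (d u) b \<in> V"
    using h k V_mult by auto
  have dd: "d (br a w + br u b) = br a (d w) + br (d u) b"
    using h k by (simp add: m_add_right d_derivation[of a w] d_derivation[of u b])
  have "hom1 (br a b + (br (d u) w - br u (d w))) = (\<lambda>v\<in>carrier_vec 1. (v $ 0) \<odot>\<^bsub>W\<^esub>
      (gi a \<otimes>\<^bsub>W\<^esub> gi b \<oplus>\<^bsub>W\<^esub> ((gi (d u) \<otimes>\<^bsub>W\<^esub> gi w) \<ominus>\<^bsub>W\<^esub> (gi u \<otimes>\<^bsub>W\<^esub> gi (d w)))))"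
    unfolding hom1_def
    by (intro restrict_ext g_inj) (use h k V aV in \<open>simp_all add: g_rules\<close>)
  moreover have "hom2 (br a w + br u b) = (\<lambda>v\<in>carrier_vec 2. gi a \<otimes>\<^bsub>W\<^esub> hom2 w v \<oplus>\<^bsub>W\<^esub> hom2 u v \<otimes>\<^bsub>W\<^esub> gi b)"
    unfolding hom2_def dd
    by (intro restrict_ext g_inj) (use h k V aV in \<open>simp_all add: g_rules m_add_left m_add_right m_scale_left m_scale_right scale_right_distrib\<close>)
  ultimately show "hom12 (br2 x y) = hom12 x \<otimes>\<^bsub>XA\<^esub> hom12 y"
    using h k by (simp add: hom12_def xe ye br2_def ver3_hom_algebra_def Let_def hom1_unit hom2_unit)
qed

lemma hom1_zero: "hom1 0 = (\<lambda>v\<in>carrier (J 1). \<zero>\<^bsub>W\<^esub>)" and hom2_zero: "hom2 0 = (\<lambda>v\<in>carrier (J 2). \<zero>\<^bsub>W\<^esub>)"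
  unfolding hom1_def hom2_def J_simps
  by (intro restrict_ext g_inj; use subspace_0[OF V_subspace] in \<open>simp add: g_rules\<close>)+

lemma hom12_zero: "hom12 0 = \<zero>\<^bsub>XA\<^esub>"
  by (simp add: hom12_def hom1_zero hom2_zero ver3_hom_algebra_def Let_def)

lemma hom12_times: "hom12 ` (B \<times> C) = hom1 ` B \<times> hom2 ` C"
  and lowest_times: "lowest ` (B \<times> C) = pr 0 ` B \<times> pr (-1) ` C"
  by (auto simp: hom12_def[abs_def] lowest_def[abs_def] image_iff)

lemma hom12_part: "hom12 ` part2 ker1 ker2 p = part XA p"
proof -
  have "hom1 ` ker1 = H1" "hom2 ` ker2 = H2"
    using hom1_rep hom2_rep H1_eq H2_eq by blast+
  moreover have "part XA p = (if p then {hom1 0} \<times> H2 else H1 \<times> {hom2 0})"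
    unfolding hom1_zero hom2_zero by (simp add: ver3_hom_algebra_def Let_def)
  ultimately show ?thesis by (simp add: part2_def hom12_times)
qed

lemma XA_nonassoc: "nonassoc_algebra XA"
proof (rule nonassoc_algebra_surj_image[OF ker_nonassoc, where f = hom12])
  show "part XA p \<subseteq> carrier XA" for p
    unfolding hom12_part[symmetric] XA_carrier hom12_image[symmetric]
    using subspace_0[OF V_subspace] by (intro image_mono) (auto simp: part2_def)
qed (simp_all add: hom12_rules hom12_zero hom12_image XA_carrier del: mem_Collect_eq)

definition "lowest_part y = lowest (g (fst y (unit_vec 1 0)), g (snd y (unit_vec 2 1)))"

lemma lowest_part_hom12: "x \<in> ker1 \<times> ker2 \<Longrightarrow> lowest_part (hom12 x) = lowest x"
  using hom1_unit[of "fst x"] hom2_unit(1)[of "snd x"]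
  by (auto simp: lowest_part_def hom12_def)

text \<open>Morphisms correspond to pairs of kernel vectors, and taking lowest components is a
  surjective homomorphism to \<open>S_alg\<close>. By the two negligibility criteria its kernel is
  exactly the set that the semisimplification divides out.\<close>

lemma semisimplification_iso:
  obtains F where "F \<in> superalgebra_iso (semisimplification W t) S_alg"
    "nonassoc_algebra (semisimplification W t)"
proof -
  let ?K = "ker1 \<times> ker2"
  let ?N = "negligible (J 1) (Jt 1) W t \<times> negligible (J 2) (Jt 2) W t"
  interpret K: nonassoc_algebra "alg_record scale2 br2 ?K (part2 ker1 ker2)" by (rule ker_nonassoc)
  have Kadd: "x + y \<in> ?K" and Kscale: "scale2 c x \<in> ?K" if "x \<in> ?K" "y \<in> ?K" for x y c
    using that pair.subspace_add[OF pair_subspace[OF ker_subspace]] pair.subspace_scale[OF pair_subspace[OF ker_subspace]]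
    by blast+
  have ex: "\<exists>x\<in>?K. y = hom12 x" if "y \<in> carrier XA" for y
    using that unfolding XA_carrier hom12_image[symmetric] by (rule imageE) blast
  have hom: "alg_hom XA S_alg lowest_part"
  proof (rule alg_homI)
    fix y z c assume "y \<in> carrier XA"
    then obtain x where x: "x \<in> ?K" "y = hom12 x" using ex by blast
    show "lowest_part y \<in> carrier S_alg"
      using lowest_image x lowest_part_hom12[OF x(1)] by auto
    show "lowest_part (c \<odot>\<^bsub>XA\<^esub> y) = c \<odot>\<^bsub>S_alg\<^esub> lowest_part y"
      using x lowest_part_hom12[OF Kscale[OF x(1) x(1)]] lowest_part_hom12[OF x(1)]
      by (simp add: hom12_rules(1)[symmetric] lowest_def scale2_def pr_scale del: mem_Collect_eq)
    assume "z \<in> carrier XA"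
    then obtain w where w: "w \<in> ?K" "z = hom12 w" using ex by blast
    show "lowest_part (y \<oplus>\<^bsub>XA\<^esub> z) = lowest_part y \<oplus>\<^bsub>S_alg\<^esub> lowest_part z"
      using lowest_part_hom12[OF Kadd[OF x(1) w(1)]] lowest_part_hom12[OF x(1)] lowest_part_hom12[OF w(1)]
      unfolding x(2) w(2) hom12_rules(2)[OF x(1) w(1), symmetric]
      by (simp add: lowest_def pr_add)
    show "lowest_part (y \<otimes>\<^bsub>XA\<^esub> z) = lowest_part y \<otimes>\<^bsub>S_alg\<^esub> lowest_part z"
      using lowest_part_hom12[OF br2_ker[OF x(1) w(1)]] lowest_part_hom12[OF x(1)] lowest_part_hom12[OF w(1)]
      unfolding x(2) w(2) hom12_rules(3)[OF x(1) w(1), symmetric]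
      by (simp add: lowest_mult[OF x(1) w(1)])
  qed
  have N: "hom12 x \<in> ?N \<longleftrightarrow> lowest_part (hom12 x) = 0" if "x \<in> ?K" for x
    using that negligible_hom1[of "fst x"] negligible_hom2[of "snd x"] lowest_part_hom12[OF that]
    by (auto simp: hom12_def lowest_def zero_prod_def)
  have ker: "y \<in> ?N \<longleftrightarrow> lowest_part y = \<zero>\<^bsub>S_alg\<^esub>" if y: "y \<in> carrier XA" for y
  proof -
    obtain x where "x \<in> ?K" "y = hom12 x" using ex[OF y] by (elim bexE)
    then show ?thesis using N[of x] by (simp only: alg_record_simps)
  qed
  have Nsub: "?N \<subseteq> carrier XA" by (auto simp: negligible_def XA_carrier)
  have "?N = {y \<in> carrier XA. lowest_part y = \<zero>\<^bsub>S_alg\<^esub>}" using ker Nsub by blast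
  then have "alg_ideal XA ?N" using kernel_ideal[OF XA_nonassoc S_nonassoc hom] by simp
  then interpret N: algebra_ideal XA ?N
    by (intro algebra_ideal.intro[OF XA_nonassoc], unfold_locales)
  have im: "lowest_part ` (hom12 ` B) = lowest ` B" if "B \<subseteq> ?K" for B
    unfolding image_image by (rule image_cong) (use lowest_part_hom12 that in auto)
  have surj: "lowest_part ` carrier XA = carrier S_alg"
    using im[of ?K] lowest_image hom12_image by (simp add: XA_carrier)
  have even: "pr 0 ` ker1 = even_space" "pr (-1) ` ker2 = odd_space"
    using lowest_image[unfolded lowest_times] subspace_0[OF even_subspace] subspace_0[OF homog_subspace, of "-1"]
    by (auto simp only: times_eq_iff)
  have part: "lowest_part ` part XA p = part S_alg p" for p
  proof -
    have "part2 ker1 ker2 p \<subseteq> ?K" using subspace_0[OF V_subspace] by (auto simp: part2_def)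
    from im[OF this] have "lowest_part ` part XA p = lowest ` part2 ker1 ker2 p" by (simp only: hom12_part)
    also have "\<dots> = part2 even_space odd_space p"
      by (cases p) (simp_all only: part2_def if_True if_False lowest_times even image_insert image_empty pr_0)
    finally show ?thesis by simp
  qed
  obtain F where "F \<in> superalgebra_iso (quotient_superalgebra XA ?N) S_alg"
    by (rule N.first_isomorphism[OF hom S_nonassoc ker surj part]) blast+
  then show ?thesis
    using that N.quotient_nonassoc_algebra by (simp add: semisimplification_def)
qed

end

section \<open>Simply laced Lie algebras in characteristic 3\<close>

datatype basis_index = HB nat | XB "nat \<Rightarrow> int"

definition simple :: "nat \<Rightarrow> nat \<Rightarrow> int" where
  "simple i = (\<lambda>k. if k = i then 1 else 0)"

abbreviation smul :: "int \<Rightarrow> (nat \<Rightarrow> int) \<Rightarrow> nat \<Rightarrow> int" where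
  "smul c v \<equiv> (\<lambda>k. c * v k)"

text \<open>The bilinear form \<open>ff\<close> is not symmetric: its parity is the cocycle that gives the signs of
  the structure constants.\<close>

locale even_lattice =
  fixes n :: nat and ff :: "(nat \<Rightarrow> int) \<Rightarrow> (nat \<Rightarrow> int) \<Rightarrow> int" and lattice :: "(nat \<Rightarrow> int) set"
  defines "lattice \<equiv> {v. \<forall>i\<ge>n. v i = 0}"
  assumes ff_add_left: "ff (v + w) u = ff v u + ff w u"
    and ff_add_right: "ff u (v + w) = ff u v + ff u w"
    and positive: "\<lbrakk>v \<in> lattice; v \<noteq> 0\<rbrakk> \<Longrightarrow> 0 < ff v v"
    and finite_roots: "finite {v \<in> lattice. ff v v = 1}"
    and ff_simple: "i < n \<Longrightarrow> ff (simple i) (simple i) = 1"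
    and off_diagonal: "\<lbrakk>i < n; j < n; i \<noteq> j\<rbrakk> \<Longrightarrow> ff (simple i) (simple j) + ff (simple j) (simple i) \<le> 0"
begin

text \<open>The symmetrised form. \<open>ff v v\<close> is half the norm, so the vectors of norm 2
  are those with \<open>ff v v = 1\<close>.\<close>

definition ip :: "(nat \<Rightarrow> int) \<Rightarrow> (nat \<Rightarrow> int) \<Rightarrow> int" where "ip v w = ff v w + ff w v"

definition "roots = {v \<in> lattice. ff v v = 1}"

lemma ff_zero [simp]: "ff 0 v = 0" "ff v 0 = 0"
  using ff_add_left[of 0 0 v] ff_add_right[of v 0 0] by auto

lemma ff_neg [simp]: "ff (- v) w = - ff v w" "ff v (- w) = - ff v w"
  using ff_add_left[of v "- v" w] ff_add_right[of v w "- w"] by auto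

lemma ff_diff: "ff (v - w) u = ff v u - ff w u" "ff u (v - w) = ff u v - ff u w"
  using ff_add_left[of v "- w" u] ff_add_right[of u v "- w"] by auto

lemma smul_alt: "smul 0 v = 0" "smul (c + 1) v = smul c v + v" "smul (c - 1) v = smul c v - v"
  by (auto simp: fun_eq_iff algebra_simps)

lemma ff_smul: "ff (smul c v) w = c * ff v w" "ff w (smul c v) = c * ff w v"
proof -
  show "ff (smul c v) w = c * ff v w"
    by (induction c rule: int_induct[where k = 0])
      (simp_all only: smul_alt ff_zero ff_add_left ff_diff, simp_all add: left_diff_distrib distrib_right)
  show "ff w (smul c v) = c * ff w v"
    by (induction c rule: int_induct[where k = 0])
      (simp_all only: smul_alt ff_zero ff_add_right ff_diff, simp_all add: left_diff_distrib distrib_right)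
qed

lemma ip_rules:
  "ip (v + w) u = ip v u + ip w u" "ip u (v + w) = ip u v + ip u w" "ip (v - w) u = ip v u - ip w u"
  "ip u (v - w) = ip u v - ip u w" "ip (- v) u = - ip v u" "ip u (- v) = - ip u v"
  "ip (smul c v) u = c * ip v u" "ip u (smul c v) = c * ip u v" "ip 0 u = 0" "ip u 0 = 0"
  by (simp_all add: ip_def ff_add_left ff_add_right ff_diff ff_smul algebra_simps)

lemma ip_commute: "ip v w = ip w v"
  by (simp add: ip_def)

lemma ip_self: "ip v v = 2 * ff v v"
  by (simp add: ip_def)

lemma ff_add_self: "ff (v + w) (v + w) = ff v v + ff w w + ip v w"
  and ff_diff_self: "ff (v - w) (v - w) = ff v v + ff w w - ip v w"
  by (simp_all add: ip_def ff_add_left ff_add_right ff_diff)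

lemma lattice_closed [simp]:
  "0 \<in> lattice" "\<lbrakk>v \<in> lattice; w \<in> lattice\<rbrakk> \<Longrightarrow> v + w \<in> lattice"
  "\<lbrakk>v \<in> lattice; w \<in> lattice\<rbrakk> \<Longrightarrow> v - w \<in> lattice" "v \<in> lattice \<Longrightarrow> - v \<in> lattice"
  "v \<in> lattice \<Longrightarrow> smul c v \<in> lattice" "i < n \<Longrightarrow> simple i \<in> lattice"
  by (auto simp: lattice_def simple_def)

lemma ff_nonneg: "v \<in> lattice \<Longrightarrow> 0 \<le> ff v v"
  using positive[of v] by (cases "v = 0") auto

lemma roots_lattice: "\<alpha> \<in> roots \<Longrightarrow> \<alpha> \<in> lattice" and roots_ff: "\<alpha> \<in> roots \<Longrightarrow> ff \<alpha> \<alpha> = 1"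
  and roots_neg [simp]: "- \<alpha> \<in> roots \<longleftrightarrow> \<alpha> \<in> roots" and simple_root [simp]: "i < n \<Longrightarrow> simple i \<in> roots"
  unfolding roots_def using lattice_closed(4)[of "- \<alpha>"] by (auto simp: ff_simple)

lemma zero_not_root [simp]: "0 \<notin> roots"
  by (auto simp: roots_def)

lemma ip_root_self: "\<alpha> \<in> roots \<Longrightarrow> ip \<alpha> \<alpha> = 2"
  by (simp add: ip_self roots_ff)

text \<open>Positivity is applied to the sum and the difference, whose half norms are
  \<open>2 + ip \<alpha> \<beta>\<close> and \<open>2 - ip \<alpha> \<beta>\<close>. All later case
  distinctions on root strings rest on this.\<close>

lemma root_pair:
  assumes "\<alpha> \<in> roots" "\<beta> \<in> roots"
  shows "ip \<alpha> \<beta> \<in> {-2, -1, 0, 1, 2}" and "ip \<alpha> \<beta> = -2 \<longleftrightarrow> \<alpha> + \<beta> = 0" and "ip \<alpha> \<beta> = 2 \<longleftrightarrow> \<alpha> = \<beta>"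
    and "\<alpha> + \<beta> \<in> roots \<longleftrightarrow> ip \<alpha> \<beta> = -1" and "\<alpha> - \<beta> \<in> roots \<longleftrightarrow> ip \<alpha> \<beta> = 1"
proof -
  have L: "\<alpha> + \<beta> \<in> lattice" "\<alpha> - \<beta> \<in> lattice" using assms by (auto simp: roots_lattice)
  have f: "ff (\<alpha> + \<beta>) (\<alpha> + \<beta>) = 2 + ip \<alpha> \<beta>" "ff (\<alpha> - \<beta>) (\<alpha> - \<beta>) = 2 - ip \<alpha> \<beta>"
    by (simp_all add: ff_add_self ff_diff_self roots_ff assms)
  show "ip \<alpha> \<beta> \<in> {-2, -1, 0, 1, 2}" using ff_nonneg[OF L(1)] ff_nonneg[OF L(2)] f by auto
  show "ip \<alpha> \<beta> = -2 \<longleftrightarrow> \<alpha> + \<beta> = 0" using positive[OF L(1)] f by (cases "\<alpha> + \<beta> = 0") auto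
  show "ip \<alpha> \<beta> = 2 \<longleftrightarrow> \<alpha> = \<beta>" using positive[OF L(2)] f by (cases "\<alpha> - \<beta> = 0") auto
  show "\<alpha> + \<beta> \<in> roots \<longleftrightarrow> ip \<alpha> \<beta> = -1" "\<alpha> - \<beta> \<in> roots \<longleftrightarrow> ip \<alpha> \<beta> = 1" using L f by (auto simp: roots_def)
qed

definition eps :: "(nat \<Rightarrow> int) \<Rightarrow> (nat \<Rightarrow> int) \<Rightarrow> 'k::field" where
  "eps v w = (if even (ff v w) then 1 else -1)"

lemma eps_rules:
  "eps (u + v) w = eps u w * eps v w" "eps w (u + v) = eps w u * eps w v"
  "eps (u - v) w = eps u w * eps v w" "eps w (u - v) = eps w u * eps w v"
  "eps (- v) w = eps v w" "eps w (- v) = eps w v"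
  by (auto simp: eps_def ff_add_left ff_add_right ff_diff)

lemma eps_square: "eps v w * eps v w = 1" "eps v w * (eps v w * c) = c"
  by (auto simp: eps_def)

lemma eps_nonzero: "eps v w \<noteq> 0"
  by (auto simp: eps_def)

lemma eps_root: "\<alpha> \<in> roots \<Longrightarrow> eps \<alpha> \<alpha> = -1"
  by (simp add: eps_def roots_ff)

lemma eps_swap: "eps w v = (if even (ip v w) then eps v w else - eps v w)"
  by (auto simp: eps_def ip_def)

lemma eps_minus_one: "ip v w = -1 \<Longrightarrow> eps w v = - eps v w"
  using eps_swap[of w v] by simp

lemma eps_orthogonal: "ip v w = 0 \<Longrightarrow> eps w v = eps v w"
  using eps_swap[of w v] by simp

end

subsection \<open>The Lie algebra\<close>

definition fs :: "'k::field \<Rightarrow> ('b \<Rightarrow> 'k) \<Rightarrow> 'b \<Rightarrow> 'k" where "fs c f = (\<lambda>b. c * f b)"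

lemma fs_apply [simp]: "fs c f b = c * f b"
  by (simp add: fs_def)

lemma vector_space_fs: "vector_space (fs :: 'k::field \<Rightarrow> ('b \<Rightarrow> 'k) \<Rightarrow> _)"
  by unfold_locales (auto simp: fun_eq_iff algebra_simps)

definition unit_fun :: "'b \<Rightarrow> 'b \<Rightarrow> 'k::field" where "unit_fun b = (\<lambda>x. if x = b then 1 else 0)"

locale simply_laced = even_lattice n ff lattice
  for n ff lattice +
  fixes three :: "'k::field itself"
  assumes char_three: "CHAR('k) = 3"
begin

interpretation fsv: vector_space "fs :: 'k \<Rightarrow> (basis_index \<Rightarrow> 'k) \<Rightarrow> _"
  by (rule vector_space_fs)

definition Bs :: "basis_index set" where "Bs = HB ` {..<n} \<union> XB ` roots"

lemma finite_Bs: "finite Bs"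
  using finite_roots by (simp add: Bs_def roots_def)

definition hh :: "(nat \<Rightarrow> int) \<Rightarrow> basis_index \<Rightarrow> 'k" where
  "hh v b = (case b of HB i \<Rightarrow> if i < n then of_int (v i) else 0 | XB _ \<Rightarrow> 0)"

text \<open>Zero off the roots, so that the structure constants need no side condition on whether a
  sum is a root.\<close>

definition xx :: "(nat \<Rightarrow> int) \<Rightarrow> basis_index \<Rightarrow> 'k" where
  "xx \<alpha> = (if \<alpha> \<in> roots then unit_fun (XB \<alpha>) else 0)"

text \<open>The minus sign before \<open>hh \<alpha>\<close> is the sign
  \<open>eps \<alpha> (- \<alpha>)\<close>, which equals \<open>eps \<alpha> \<alpha> = -1\<close>
  on roots; with it the opposite case follows the same rule as the others.\<close>

fun str :: "basis_index \<Rightarrow> basis_index \<Rightarrow> basis_index \<Rightarrow> 'k" where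
  "str (HB i) (HB j) = 0"
| "str (HB i) (XB \<beta>) = fs (of_int (ip (simple i) \<beta>)) (xx \<beta>)"
| "str (XB \<alpha>) (HB i) = - fs (of_int (ip (simple i) \<alpha>)) (xx \<alpha>)"
| "str (XB \<alpha>) (XB \<beta>) = (if \<alpha> + \<beta> = 0 then - hh \<alpha> else fs (eps \<alpha> \<beta>) (xx (\<alpha> + \<beta>)))"

definition br :: "(basis_index \<Rightarrow> 'k) \<Rightarrow> (basis_index \<Rightarrow> 'k) \<Rightarrow> basis_index \<Rightarrow> 'k" where
  "br f g = (\<Sum>a\<in>Bs. \<Sum>b\<in>Bs. fs (f a * g b) (str a b))"

definition VL :: "(basis_index \<Rightarrow> 'k) set" where "VL = {f. \<forall>b. b \<notin> Bs \<longrightarrow> f b = 0}"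

sublocale L: bilinear_product "fs :: 'k \<Rightarrow> (basis_index \<Rightarrow> 'k) \<Rightarrow> _" br
proof (rule bilinear_product.intro[OF vector_space_fs], unfold_locales)
  fix x y z :: "basis_index \<Rightarrow> 'k" and c
  show "br (x + y) z = br x z + br y z" "br x (y + z) = br x y + br x z"
    by (simp_all add: br_def sum.distrib[symmetric] fsv.scale_left_distrib[symmetric] distrib_right distrib_left)
  show "br (fs c x) y = fs c (br x y)" "br x (fs c y) = fs c (br x y)"
    by (simp_all add: br_def fsv.scale_sum_right mult.assoc mult.left_commute)
qed

lemma sum_fun_apply: "(\<Sum>a\<in>S. F a) b = (\<Sum>a\<in>S. F a b)" for F :: "'x \<Rightarrow> 'y \<Rightarrow> 'k"
  by (induction S rule: infinite_finite_induct) auto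

lemma br_unit: "\<lbrakk>a \<in> Bs; b \<in> Bs\<rbrakk> \<Longrightarrow> br (unit_fun a) (unit_fun b) = str a b"
proof -
  assume ab: "a \<in> Bs" "b \<in> Bs"
  have "br (unit_fun a) (unit_fun b) = (\<Sum>a'\<in>Bs. \<Sum>b'\<in>Bs. if b' = b then if a' = a then str a b else 0 else 0)"
    unfolding br_def by (intro sum.cong refl) (auto simp: unit_fun_def fun_eq_iff)
  also have "\<dots> = str a b" using ab finite_Bs by (simp add: sum.delta)
  finally show ?thesis .
qed

lemma br_expand_left: "br f g = (\<Sum>a\<in>Bs. fs (f a) (br (unit_fun a) g))"
  and br_expand_right: "br f g = (\<Sum>b\<in>Bs. fs (g b) (br f (unit_fun b)))"
proof -
  have 1: "br (unit_fun a) g = (\<Sum>b\<in>Bs. fs (g b) (str a b))" if "a \<in> Bs" for a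
  proof -
    have "br (unit_fun a) g = (\<Sum>a'\<in>Bs. if a' = a then \<Sum>b\<in>Bs. fs (g b) (str a b) else 0)"
      unfolding br_def by (intro sum.cong refl) (auto simp: unit_fun_def fun_eq_iff sum_fun_apply)
    then show ?thesis using that finite_Bs by (simp add: sum.delta)
  qed
  show "br f g = (\<Sum>a\<in>Bs. fs (f a) (br (unit_fun a) g))"
    unfolding br_def[of f g] by (intro sum.cong refl) (simp add: 1 fsv.scale_sum_right)
  have 2: "br f (unit_fun b) = (\<Sum>a\<in>Bs. fs (f a) (str a b))" if "b \<in> Bs" for b
  proof -
    have "br f (unit_fun b) = (\<Sum>a\<in>Bs. \<Sum>b'\<in>Bs. if b' = b then fs (f a) (str a b) else 0)"
      unfolding br_def by (intro sum.cong refl) (auto simp: unit_fun_def fun_eq_iff)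
    then show ?thesis using that finite_Bs by (simp add: sum.delta)
  qed
  show "br f g = (\<Sum>b\<in>Bs. fs (g b) (br f (unit_fun b)))"
    unfolding br_def[of f g] by (subst sum.swap, intro sum.cong refl) (simp add: 2 fsv.scale_sum_right mult.commute)
qed

lemma VL_subspace: "fsv.subspace VL"
  by (auto simp: VL_def fsv.subspace_def)

lemma hh_VL [simp]: "hh v \<in> VL" and xx_VL [simp]: "xx \<alpha> \<in> VL"
  by (auto simp: VL_def hh_def xx_def Bs_def unit_fun_def split: basis_index.splits)

lemma str_VL: "str a b \<in> VL"
  using fsv.subspace_scale[OF VL_subspace] fsv.subspace_neg[OF VL_subspace]
  by (cases a; cases b) (auto simp: fsv.subspace_0[OF VL_subspace])

lemma br_VL [simp]: "br f g \<in> VL"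
  unfolding br_def by (intro fsv.subspace_sum fsv.subspace_scale VL_subspace str_VL)

lemma hh_rules: "hh (v + w) = hh v + hh w" "hh (v - w) = hh v - hh w" "hh (- v) = - hh v" "hh 0 = 0"
  "hh (smul c v) = fs (of_int c) (hh v)"
  by (auto simp: hh_def fun_eq_iff split: basis_index.splits)

lemma lattice_sum: "v \<in> lattice \<Longrightarrow> ip v w = (\<Sum>i<n. v i * ip (simple i) w)"
proof -
  assume v: "v \<in> lattice"
  have s: "ip (\<lambda>k. \<Sum>i\<in>S. c i * b i k) w = (\<Sum>i\<in>S. c i * ip (b i) w)" if "finite S" for S :: "nat set" and c b
    using that
  proof (induction S rule: finite_induct)
    case empty
    then show ?case using ip_rules(9)[of w] by (simp add: zero_fun_def)
  next
    case (insert i S)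
    have "(\<lambda>k. \<Sum>j\<in>insert i S. c j * b j k) = smul (c i) (b i) + (\<lambda>k. \<Sum>j\<in>S. c j * b j k)"
      using insert by (auto simp: fun_eq_iff)
    then show ?case using insert by (simp only: ip_rules) simp
  qed
  have "v = (\<lambda>k. \<Sum>i<n. v i * simple i k)"
    using v by (auto simp: fun_eq_iff simple_def lattice_def sum.delta if_distrib cong: if_cong)
  then have "ip v w = ip (\<lambda>k. \<Sum>i<n. v i * simple i k) w" by simp
  then show ?thesis by (simp only: s[OF finite_lessThan])
qed

lemma hh_unit: "i < n \<Longrightarrow> hh (simple i) = unit_fun (HB i)"
  by (auto simp: hh_def unit_fun_def simple_def fun_eq_iff split: basis_index.splits)

lemma hh_sum: "hh v = (\<Sum>i<n. fs (of_int (v i)) (unit_fun (HB i)))"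
  by (auto simp: fun_eq_iff hh_def sum_fun_apply unit_fun_def if_distrib cong: if_cong split: basis_index.splits)

lemma xx_unit: "\<alpha> \<in> roots \<Longrightarrow> xx \<alpha> = unit_fun (XB \<alpha>)"
  by (simp add: xx_def)

lemma br_hh_hh: "br (hh v) (hh w) = 0"
  by (simp add: hh_sum L.m_sum_left L.m_sum_right L.m_scale_left L.m_scale_right br_unit Bs_def)

lemma br_hh_xx: "v \<in> lattice \<Longrightarrow> br (hh v) (xx \<beta>) = fs (of_int (ip v \<beta>)) (xx \<beta>)"
proof (cases "\<beta> \<in> roots")
  case True
  assume v: "v \<in> lattice"
  have "br (hh v) (xx \<beta>) = (\<Sum>i<n. fs (of_int (v i * ip (simple i) \<beta>)) (xx \<beta>))"
    using True by (simp add: hh_sum L.m_sum_left L.m_scale_left xx_unit br_unit Bs_def)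
  also have "\<dots> = fs (of_int (ip v \<beta>)) (xx \<beta>)"
    by (simp add: lattice_sum[OF v] fsv.scale_sum_left[symmetric] of_int_sum)
  finally show ?thesis .
qed (simp add: xx_def)

lemma br_xx_hh: "v \<in> lattice \<Longrightarrow> br (xx \<beta>) (hh v) = - fs (of_int (ip v \<beta>)) (xx \<beta>)"
proof (cases "\<beta> \<in> roots")
  case True
  assume v: "v \<in> lattice"
  have "br (xx \<beta>) (hh v) = (\<Sum>i<n. - fs (of_int (v i * ip (simple i) \<beta>)) (xx \<beta>))"
    using True by (simp add: hh_sum L.m_sum_right L.m_scale_right xx_unit br_unit Bs_def)
  also have "\<dots> = - fs (of_int (ip v \<beta>)) (xx \<beta>)"
    by (simp add: lattice_sum[OF v] fsv.scale_sum_left[symmetric] of_int_sum sum_negf)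
  finally show ?thesis .
qed (simp add: xx_def)

lemma br_xx_xx: "\<lbrakk>\<alpha> \<in> roots; \<beta> \<in> roots\<rbrakk> \<Longrightarrow>
    br (xx \<alpha>) (xx \<beta>) = (if \<alpha> + \<beta> = 0 then - hh \<alpha> else fs (eps \<alpha> \<beta>) (xx (\<alpha> + \<beta>)))"
  by (simp add: xx_unit[of \<alpha>] xx_unit[of \<beta>] br_unit Bs_def)

lemma xx_nonroot: "\<alpha> \<notin> roots \<Longrightarrow> xx \<alpha> = 0"
  by (simp add: xx_def)

lemma br_xx_xx_zero:
  assumes "\<alpha> \<in> roots" "\<beta> \<in> roots" "ip \<alpha> \<beta> \<noteq> -1" "ip \<alpha> \<beta> \<noteq> -2" shows "br (xx \<alpha>) (xx \<beta>) = 0"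
  using assms root_pair[OF assms(1,2)] by (simp add: br_xx_xx xx_nonroot)

lemma br_xx_xx_sum:
  assumes "\<alpha> \<in> roots" "\<beta> \<in> roots" "ip \<alpha> \<beta> = -1" shows "br (xx \<alpha>) (xx \<beta>) = fs (eps \<alpha> \<beta>) (xx (\<alpha> + \<beta>))"
  using assms root_pair[OF assms(1,2)] by (auto simp: br_xx_xx)

lemma br_xx_neg: "\<alpha> \<in> roots \<Longrightarrow> br (xx \<alpha>) (xx (- \<alpha>)) = - hh \<alpha>"
  by (simp add: br_xx_xx)

lemma str_skew: "\<lbrakk>a \<in> Bs; b \<in> Bs\<rbrakk> \<Longrightarrow> str a b = - str b a"
proof (cases a; cases b)
  fix \<alpha> \<beta> assume ab: "a \<in> Bs" "b \<in> Bs" "a = XB \<alpha>" "b = XB \<beta>"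
  then have r: "\<alpha> \<in> roots" "\<beta> \<in> roots" by (auto simp: Bs_def)
  show ?thesis
  proof (cases "\<alpha> + \<beta> = 0")
    case True
    then have "\<beta> = - \<alpha>" by (simp add: eq_neg_iff_add_eq_0 add.commute)
    then show ?thesis using ab by (simp add: hh_rules)
  next
    case False
    show ?thesis
    proof (cases "ip \<alpha> \<beta> = -1")
      case True
      then show ?thesis using False ab(3,4) by (simp add: add.commute eps_minus_one[OF True])
    next
      case n: False
      then have "\<alpha> + \<beta> \<notin> roots" using root_pair(4)[OF r] by simp
      then show ?thesis using False ab(3,4) by (simp add: add.commute xx_nonroot)
    qed
  qed
qed auto

lemma br_skew: "br f g = - br g f"
proof -
  have "br f g = (\<Sum>a\<in>Bs. \<Sum>b\<in>Bs. - fs (g b * f a) (str b a))"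
    unfolding br_def by (intro sum.cong refl) (subst str_skew, auto simp: mult.commute)
  also have "\<dots> = - br g f" unfolding br_def sum_negf by (subst sum.swap) simp
  finally show ?thesis .
qed

definition jac :: "(basis_index \<Rightarrow> 'k) \<Rightarrow> (basis_index \<Rightarrow> 'k) \<Rightarrow> (basis_index \<Rightarrow> 'k) \<Rightarrow> basis_index \<Rightarrow> 'k" where
  "jac f g h = br f (br g h) + br g (br h f) + br h (br f g)"

lemma jac_rotate: "jac f g h = jac g h f"
  by (simp add: jac_def algebra_simps)

lemma br_cartan_root: "v \<in> lattice \<Longrightarrow> br (hh v) (br (xx \<alpha>) (xx \<beta>)) = fs (of_int (ip v \<alpha> + ip v \<beta>)) (br (xx \<alpha>) (xx \<beta>))"
proof (cases "\<alpha> \<in> roots \<and> \<beta> \<in> roots")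
  case True
  assume v: "v \<in> lattice"
  show ?thesis
  proof (cases "\<alpha> + \<beta> = 0")
    case True
    then have "\<beta> = - \<alpha>" by (simp add: eq_neg_iff_add_eq_0 add.commute)
    then show ?thesis using \<open>\<alpha> \<in> roots \<and> _\<close> by (simp add: br_xx_xx L.m_minus_right br_hh_hh ip_rules)
  next
    case False
    then show ?thesis using \<open>\<alpha> \<in> roots \<and> _\<close> v
      by (simp add: br_xx_xx L.m_scale_right br_hh_xx ip_rules mult.commute)
  qed
qed (auto simp: xx_nonroot)

lemma jac_hh_hh_xx: "\<lbrakk>v \<in> lattice; w \<in> lattice\<rbrakk> \<Longrightarrow> jac (hh v) (hh w) (xx \<alpha>) = 0"
  by (simp add: jac_def br_hh_hh br_hh_xx br_xx_hh L.m_minus_right L.m_scale_right mult.commute)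

lemma jac_hh_xx_xx: "v \<in> lattice \<Longrightarrow> jac (hh v) (xx \<alpha>) (xx \<beta>) = 0"
proof -
  assume v: "v \<in> lattice"
  have "br (xx \<beta>) (xx \<alpha>) = - br (xx \<alpha>) (xx \<beta>)" by (rule br_skew)
  then show ?thesis
    by (simp add: jac_def br_cartan_root[OF v] br_hh_xx[OF v] br_xx_hh[OF v] L.m_minus_right L.m_scale_right
        fsv.scale_left_distrib)
qed

text \<open>The coroot term has the coefficient \<open>ip \<beta> \<alpha>\<close>. For pairing -1
  or 1 exactly one of the other two double brackets is nonzero and must cancel it; for pairing 0 all
  terms vanish, and for 2 or -2 the roots coincide up to sign.\<close>

lemma jac_xx_opposite:
  assumes r: "\<alpha> \<in> roots" "\<beta> \<in> roots"
  shows "jac (xx \<alpha>) (xx \<beta>) (xx (- \<beta>)) = 0"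
proof -
  have L: "\<beta> \<in> lattice" using r roots_lattice by auto
  have rb: "- \<beta> \<in> roots" using r by simp
  have 1: "br (xx \<alpha>) (br (xx \<beta>) (xx (- \<beta>))) = fs (of_int (ip \<beta> \<alpha>)) (xx \<alpha>)"
    using r L by (simp add: br_xx_neg L.m_minus_right br_xx_hh)
  have bb: "br (xx (- \<beta>)) (xx \<beta>) = hh \<beta>" using br_xx_neg[OF rb] by (simp add: hh_rules)
  consider "ip \<alpha> \<beta> = 2" | "ip \<alpha> \<beta> = -2" | "ip \<alpha> \<beta> = -1" | "ip \<alpha> \<beta> = 0" | "ip \<alpha> \<beta> = 1"
    using root_pair(1)[OF r] by auto
  then show ?thesis
  proof cases
    case 1
    then have "\<alpha> = \<beta>" using root_pair(3)[OF r] by simp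
    then show ?thesis using r L
      by (simp add: jac_def br_xx_neg bb L.m_minus_right br_xx_hh br_xx_xx_zero ip_root_self)
  next
    case 2
    then have "\<alpha> = - \<beta>" using root_pair(2)[OF r] by (simp add: eq_neg_iff_add_eq_0)
    then show ?thesis using rb L r
      by (simp add: jac_def br_xx_neg bb L.m_minus_right br_xx_hh br_xx_xx_zero ip_root_self ip_rules)
  next
    case 3
    have s: "\<alpha> + \<beta> \<in> roots" using 3 root_pair(4)[OF r] by simp
    have "br (xx (- \<beta>)) (xx \<alpha>) = 0"
      by (rule br_xx_xx_zero[OF rb r(1)]) (use 3 in \<open>simp_all add: ip_rules ip_commute[of \<beta> \<alpha>]\<close>)
    moreover have "br (xx (- \<beta>)) (xx (\<alpha> + \<beta>)) = fs (eps (- \<beta>) (\<alpha> + \<beta>)) (xx (- \<beta> + (\<alpha> + \<beta>)))"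
      by (rule br_xx_xx_sum[OF rb s]) (use 3 r in \<open>simp add: ip_rules ip_commute[of \<beta> \<alpha>] ip_root_self\<close>)
    ultimately show ?thesis
      unfolding jac_def 1 using 3 r
      by (simp add: br_xx_xx_sum L.m_scale_right eps_rules eps_root eps_minus_one[OF 3] eps_square ip_commute[of \<beta> \<alpha>])
  next
    case 4
    have "br (xx (- \<beta>)) (xx \<alpha>) = 0"
      by (rule br_xx_xx_zero[OF rb r(1)]) (use 4 in \<open>simp_all add: ip_rules ip_commute[of \<beta> \<alpha>]\<close>)
    moreover have "br (xx \<alpha>) (xx \<beta>) = 0" by (rule br_xx_xx_zero[OF r]) (use 4 in simp_all)
    ultimately show ?thesis unfolding jac_def 1 using 4 by (simp add: ip_commute[of \<beta> \<alpha>])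
  next
    case 5
    have s: "\<alpha> - \<beta> \<in> roots" using 5 root_pair(5)[OF r] by simp
    have "br (xx (- \<beta>)) (xx \<alpha>) = fs (eps (- \<beta>) \<alpha>) (xx (- \<beta> + \<alpha>))"
      by (rule br_xx_xx_sum[OF rb r(1)]) (use 5 in \<open>simp add: ip_rules ip_commute[of \<beta> \<alpha>]\<close>)
    moreover have "br (xx \<beta>) (xx (\<alpha> - \<beta>)) = fs (eps \<beta> (\<alpha> - \<beta>)) (xx (\<beta> + (\<alpha> - \<beta>)))"
      by (rule br_xx_xx_sum[OF r(2) s]) (use 5 r in \<open>simp add: ip_rules ip_commute[of \<beta> \<alpha>] ip_root_self\<close>)
    moreover have "br (xx \<alpha>) (xx \<beta>) = 0" by (rule br_xx_xx_zero[OF r]) (use 5 in simp_all)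
    ultimately show ?thesis unfolding jac_def 1 using 5 r
      by (simp add: L.m_scale_right eps_rules eps_root eps_square ip_commute[of \<beta> \<alpha>] mult.assoc[symmetric])
  qed
qed

text \<open>Without opposite pairs there are two situations. If the roots add up to 0, the three
  terms are coroots with a common sign and add up to \<open>hh 0\<close>. Otherwise all terms are
  multiples of the root vector of the sum; its half norm being 1 forces the pairings to sum to -2,
  so two of them are -1 and the third is 0, and the two surviving signs are opposite.\<close>

lemma jac_xx_xx_xx:
  assumes r: "\<alpha> \<in> roots" "\<beta> \<in> roots" "\<gamma> \<in> roots"
  shows "jac (xx \<alpha>) (xx \<beta>) (xx \<gamma>) = 0"
proof -
  have neg: "b = - a" if "a + b = 0" for a b :: "nat \<Rightarrow> int" using that by (simp add: eq_neg_iff_add_eq_0 add.commute)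
  show ?thesis
  proof (cases "\<beta> + \<gamma> = 0 \<or> \<gamma> + \<alpha> = 0 \<or> \<alpha> + \<beta> = 0")
    case True
    then show ?thesis
      using jac_xx_opposite[OF r(1,2)] jac_xx_opposite[OF r(2,3)] jac_xx_opposite[OF r(3,1)]
        jac_rotate[of "xx \<alpha>" "xx \<beta>" "xx \<gamma>"] jac_rotate[of "xx \<beta>" "xx \<gamma>" "xx \<alpha>"] neg by metis
  next
    case nz: False
    then have ne: "ip \<alpha> \<beta> \<noteq> -2" "ip \<beta> \<gamma> \<noteq> -2" "ip \<gamma> \<alpha> \<noteq> -2"
      using root_pair(2)[OF r(1,2)] root_pair(2)[OF r(2,3)] root_pair(2)[OF r(3,1)] by auto
    let ?\<delta> = "\<alpha> + \<beta> + \<gamma>"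
    show ?thesis
    proof (cases "?\<delta> = 0")
      case True
      then have g: "\<gamma> = - (\<alpha> + \<beta>)" by (rule neg)
      then have ab: "ip \<alpha> \<beta> = -1" using r(3) root_pair(4)[OF r(1,2)] roots_neg[of "\<alpha> + \<beta>"] by simp
      have bg: "ip \<beta> \<gamma> = -1" and ga: "ip \<gamma> \<alpha> = -1"
        using ab r by (simp_all add: g ip_rules ip_root_self ip_commute[of \<beta> \<alpha>])
      have e: "\<beta> + \<gamma> = - \<alpha>" "\<gamma> + \<alpha> = - \<beta>" "\<alpha> + \<beta> = - \<gamma>" by (simp_all add: g)
      have "eps \<beta> \<gamma> = (eps \<alpha> \<beta> :: 'k)" "eps \<gamma> \<alpha> = (eps \<alpha> \<beta> :: 'k)"
        unfolding g by (simp_all add: eps_rules eps_root r eps_minus_one[OF ab])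
      then have "br (xx \<alpha>) (br (xx \<beta>) (xx \<gamma>)) = - fs (eps \<alpha> \<beta>) (hh \<alpha>)"
        "br (xx \<beta>) (br (xx \<gamma>) (xx \<alpha>)) = - fs (eps \<alpha> \<beta>) (hh \<beta>)"
        "br (xx \<gamma>) (br (xx \<alpha>) (xx \<beta>)) = - fs (eps \<alpha> \<beta>) (hh \<gamma>)"
        unfolding br_xx_xx_sum[OF r(1,2) ab] br_xx_xx_sum[OF r(2,3) bg] br_xx_xx_sum[OF r(3,1) ga] e
          L.m_scale_right br_xx_neg[OF r(1)] br_xx_neg[OF r(2)] br_xx_neg[OF r(3)] fsv.scale_minus_right by simp_all
      then have "jac (xx \<alpha>) (xx \<beta>) (xx \<gamma>) = - fs (eps \<alpha> \<beta>) (hh (\<alpha> + \<beta> + \<gamma>))"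
        unfolding jac_def hh_rules fsv.scale_right_distrib by simp
      then show ?thesis using True by (simp add: hh_rules)
    next
      case d: False
      have B: "br (xx a) (br (xx b) (xx c)) = fs (if ip b c = -1 then eps b c * (eps a b * eps a c) else 0) (xx (a + b + c))"
        if abc: "a \<in> roots" "b \<in> roots" "c \<in> roots" "ip b c \<noteq> -2" "a + b + c \<noteq> 0" for a b c
      proof (cases "ip b c = -1")
        case True
        then have s: "b + c \<in> roots" using root_pair(4)[OF abc(2,3)] by simp
        show ?thesis using True s abc
          by (simp add: br_xx_xx_sum L.m_scale_right br_xx_xx[OF abc(1) s] add.assoc[symmetric] eps_rules)
      next
        case False
        then show ?thesis using br_xx_xx_zero[OF abc(2,3)] abc(4) by simp
      qed
      have p: "\<beta> + \<gamma> + \<alpha> = ?\<delta>" "\<gamma> + \<alpha> + \<beta> = ?\<delta>" by (simp_all add: algebra_simps)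
      have J: "jac (xx \<alpha>) (xx \<beta>) (xx \<gamma>) = fs ((if ip \<beta> \<gamma> = -1 then eps \<beta> \<gamma> * (eps \<alpha> \<beta> * eps \<alpha> \<gamma>) else 0)
          + (if ip \<gamma> \<alpha> = -1 then eps \<gamma> \<alpha> * (eps \<beta> \<gamma> * eps \<beta> \<alpha>) else 0)
          + (if ip \<alpha> \<beta> = -1 then eps \<alpha> \<beta> * (eps \<gamma> \<alpha> * eps \<gamma> \<beta>) else 0)) (xx ?\<delta>)"
        unfolding jac_def using B[OF r(1,2,3)] B[OF r(2,3,1)] B[OF r(3,1,2)] ne d
        by (simp only: p fsv.scale_left_distrib) simp
      show ?thesis
      proof (cases "?\<delta> \<in> roots")
        case True
        have "ff ?\<delta> ?\<delta> = 3 + ip \<alpha> \<beta> + ip \<beta> \<gamma> + ip \<gamma> \<alpha>"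
          using r by (simp add: ff_add_self[of "\<alpha> + \<beta>" \<gamma>] ff_add_self[of \<alpha> \<beta>] roots_ff ip_rules ip_commute[of \<gamma> \<alpha>])
        then have s: "ip \<alpha> \<beta> + ip \<beta> \<gamma> + ip \<gamma> \<alpha> = -2" using roots_ff[OF True] by simp
        have "ip \<alpha> \<beta> \<ge> -1" "ip \<beta> \<gamma> \<ge> -1" "ip \<gamma> \<alpha> \<ge> -1"
          using ne root_pair(1)[OF r(1,2)] root_pair(1)[OF r(2,3)] root_pair(1)[OF r(3,1)] by auto
        with s consider "ip \<alpha> \<beta> = 0" "ip \<beta> \<gamma> = -1" "ip \<gamma> \<alpha> = -1" | "ip \<alpha> \<beta> = -1" "ip \<beta> \<gamma> = 0" "ip \<gamma> \<alpha> = -1"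
          | "ip \<alpha> \<beta> = -1" "ip \<beta> \<gamma> = -1" "ip \<gamma> \<alpha> = 0" | "ip \<alpha> \<beta> \<ge> 1 \<or> ip \<beta> \<gamma> \<ge> 1 \<or> ip \<gamma> \<alpha> \<ge> 1" by linarith
        then show ?thesis
        proof cases
          case 1
          then show ?thesis by (simp add: J eps_orthogonal[OF 1(1)] eps_minus_one[OF 1(2)] eps_minus_one[OF 1(3)] mult.left_commute mult.commute)
        next
          case 2
          then show ?thesis by (simp add: J eps_minus_one[OF 2(1)] eps_orthogonal[OF 2(2)] eps_minus_one[OF 2(3)] mult.left_commute mult.commute)
        next
          case 3
          then show ?thesis by (simp add: J eps_minus_one[OF 3(1)] eps_minus_one[OF 3(2)] eps_orthogonal[OF 3(3)] mult.left_commute mult.commute)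
        next
          case 4
          then show ?thesis using s \<open>ip \<alpha> \<beta> \<ge> -1\<close> \<open>ip \<beta> \<gamma> \<ge> -1\<close> \<open>ip \<gamma> \<alpha> \<ge> -1\<close> by linarith
        qed
      next
        case False
        then show ?thesis by (simp add: J xx_nonroot)
      qed
    qed
  qed
qed

lemma jac_unit: "\<lbrakk>a \<in> Bs; b \<in> Bs; c \<in> Bs\<rbrakk> \<Longrightarrow> jac (unit_fun a) (unit_fun b) (unit_fun c) = 0"
proof -
  have cs: "(\<exists>v\<in>lattice. unit_fun a = hh v) \<or> (\<exists>\<alpha>\<in>roots. unit_fun a = xx \<alpha>)" if "a \<in> Bs" for a
    using that unfolding Bs_def
    by (elim UnE imageE) (metis hh_unit lattice_closed(6) lessThan_iff, metis xx_unit)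
  have hhh: "jac (hh u) (hh v) (hh w) = 0" for u v w by (simp add: jac_def br_hh_hh)
  assume "a \<in> Bs" "b \<in> Bs" "c \<in> Bs"
  from cs[OF this(1)] cs[OF this(2)] cs[OF this(3)] show ?thesis
    by (elim disjE bexE)
      (simp_all only: hhh jac_hh_hh_xx jac_hh_xx_xx jac_xx_xx_xx
        jac_rotate[of "hh _" "xx _" "hh _"] jac_rotate[of "xx _" "hh _" _] jac_rotate[of "xx _" "xx _" "hh _"])
qed

text \<open>Expansion in the first argument is enough, because the cyclic symmetry of
  \<open>jac\<close> brings each argument to the front in turn.\<close>

lemma jac_zero: "jac f g h = 0"
proof -
  have 1: "jac f g h = (\<Sum>a\<in>Bs. fs (f a) (jac (unit_fun a) g h))" for f g h
  proof -
    have "br f (br g h) = (\<Sum>a\<in>Bs. fs (f a) (br (unit_fun a) (br g h)))" by (rule br_expand_left)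
    moreover have "br g (br h f) = (\<Sum>a\<in>Bs. fs (f a) (br g (br h (unit_fun a))))"
      by (subst br_expand_right[of h f]) (simp add: L.m_sum_right L.m_scale_right)
    moreover have "br h (br f g) = (\<Sum>a\<in>Bs. fs (f a) (br h (br (unit_fun a) g)))"
      by (subst br_expand_left[of f g]) (simp add: L.m_sum_right L.m_scale_right)
    ultimately show ?thesis by (simp add: jac_def fsv.scale_right_distrib sum.distrib)
  qed
  have "jac (unit_fun a) (unit_fun b) h = 0" if "a \<in> Bs" "b \<in> Bs" for a b h
    by (subst jac_rotate, subst jac_rotate, subst 1, rule sum.neutral)
      (use that jac_unit in simp)
  then have 3: "jac (unit_fun b) h (unit_fun a) = 0" if "a \<in> Bs" "b \<in> Bs" for a b h
    using that by (simp add: jac_rotate[of "unit_fun a" "unit_fun b" h, symmetric])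
  have "jac (unit_fun a) g h = 0" if "a \<in> Bs" for a g h
    unfolding jac_rotate[of "unit_fun a" g h] 1[of g h "unit_fun a"]
    by (rule sum.neutral) (use that 3 in simp)
  then show ?thesis by (subst 1) simp
qed

lemma br_jacobi: "br f (br g h) = br (br f g) h + br g (br f h)"
proof -
  have "br f (br g h) + br g (br h f) + br h (br f g) = 0" using jac_zero[of f g h] by (simp add: jac_def)
  moreover have "br g (br h f) = - br g (br f h)" using br_skew[of h f] by (simp add: L.m_minus_right)
  moreover have "br h (br f g) = - br (br f g) h" by (rule br_skew)
  ultimately show ?thesis by (simp add: algebra_simps)
qed

end

section \<open>Nonvanishing modulo 3 and the even Lie superalgebra structure\<close>

context simply_laced
begin

lemma of_int_eq_0: "(of_int x :: 'k) = 0 \<longleftrightarrow> 3 dvd x"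
  using of_int_eq_0_iff_char_dvd[of x, where 'a = 'k] char_three by simp

lemma two_nonzero: "(2 :: 'k) \<noteq> 0"
  using of_int_eq_0[of 2] by simp

text \<open>If \<open>hh v\<close> vanishes, all coordinates of \<open>v\<close> are divisible by 3,
  so \<open>v\<close> is three times a vector and its half norm is divisible by 9.\<close>

lemma hh_nonzero: "\<lbrakk>v \<in> lattice; \<not> 9 dvd ff v v\<rbrakk> \<Longrightarrow> hh v \<noteq> 0"
proof
  assume v: "v \<in> lattice" "\<not> 9 dvd ff v v" and 0: "hh v = 0"
  have "3 dvd v i" for i
  proof (cases "i < n")
    case True
    then show ?thesis using fun_cong[OF 0, of "HB i"] by (simp add: hh_def of_int_eq_0)
  qed (use v in \<open>simp add: lattice_def\<close>)
  then have eq: "v = smul 3 (\<lambda>k. v k div 3)" by (auto simp: fun_eq_iff)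
  have "ff v v = 3 * (3 * ff (\<lambda>k. v k div 3) (\<lambda>k. v k div 3))"
    by (subst (1 2) eq) (simp only: ff_smul)
  then show False using v(2) by simp
qed

lemma hh_root_nonzero: "\<alpha> \<in> roots \<Longrightarrow> hh \<alpha> \<noteq> 0"
  by (rule hh_nonzero) (auto simp: roots_lattice roots_ff)

lemma VL_expand: "f \<in> VL \<Longrightarrow> f = (\<Sum>b\<in>Bs. fs (f b) (unit_fun b))"
proof
  fix x assume f: "f \<in> VL"
  have "(\<Sum>b\<in>Bs. f b * unit_fun b x) = (\<Sum>b\<in>Bs. if b = x then f x else 0)"
    by (intro sum.cong) (auto simp: unit_fun_def)
  also have "\<dots> = f x" using f finite_Bs by (auto simp: VL_def sum.delta)
  finally show "f x = (\<Sum>b\<in>Bs. fs (f b) (unit_fun b)) x" by (simp add: sum_fun_apply)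
qed

lemma L_lie: "lie_superalgebra (alg_record fs br VL (\<lambda>p. if p then {0} else VL))"
proof (rule L.alg_record_lie_superalgebra)
  show "br x y + fs (koszul p q) (br y x) = 0" if "x \<in> (if p then {0} else VL)" "y \<in> (if q then {0} else VL)" for x y p q
    using that br_skew[of x y] by (cases p; cases q) (auto simp: koszul_def)
  show "br x (br y z) = br (br x y) z + fs (koszul p q) (br y (br x z))"
    if "x \<in> (if p then {0} else VL)" "y \<in> (if q then {0} else VL)" for x y z p q
    using that br_jacobi[of x y z] by (cases p; cases q) (auto simp: koszul_def)
  show "\<exists>a\<in>if False then {0} else VL. \<exists>b\<in>if True then {0} else VL. x = a + b" if "x \<in> VL" for x
    using that by auto
qed (auto simp: VL_subspace L.subspace_def[of "{0}"] L.subspace_0[OF VL_subspace] split: if_splits)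

subsection \<open>Gradings\<close>

text \<open>One notion for three gradings: by the root lattice itself, by the integer weight
  \<open>gr\<close>, and by the projected lattice.\<close>

definition deg :: "((nat \<Rightarrow> int) \<Rightarrow> 'g::ab_group_add) \<Rightarrow> basis_index \<Rightarrow> 'g" where
  "deg \<phi> b = (case b of HB _ \<Rightarrow> 0 | XB \<alpha> \<Rightarrow> \<phi> \<alpha>)"

definition supported :: "((nat \<Rightarrow> int) \<Rightarrow> 'g::ab_group_add) \<Rightarrow> 'g \<Rightarrow> (basis_index \<Rightarrow> 'k) set" where
  "supported \<phi> q = {f \<in> VL. \<forall>b. f b \<noteq> 0 \<longrightarrow> deg \<phi> b = q}"

lemma supported_VL: "f \<in> supported \<phi> q \<Longrightarrow> f \<in> VL"
  by (simp add: supported_def)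

lemma supported_subspace: "L.subspace (supported \<phi> q)"
  using VL_subspace by (auto simp: supported_def L.subspace_def) (metis add.right_neutral)

lemma xx_apply: "xx \<alpha> b = (if \<alpha> \<in> roots \<and> b = XB \<alpha> then 1 else 0)"
  by (simp add: xx_def unit_fun_def)

lemma hh_supported: "hh v \<in> supported \<phi> 0" and xx_supported: "xx \<alpha> \<in> supported \<phi> (\<phi> \<alpha>)"
proof -
  have "deg \<phi> b = 0" if "hh v b \<noteq> 0" for b
    using that by (cases b) (simp_all add: hh_def deg_def)
  then show "hh v \<in> supported \<phi> 0" by (simp add: supported_def)
  have "deg \<phi> b = \<phi> \<alpha>" if "xx \<alpha> b \<noteq> 0" for b
    using that by (auto simp: xx_apply deg_def split: if_splits)
  then show "xx \<alpha> \<in> supported \<phi> (\<phi> \<alpha>)" by (simp add: supported_def)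
qed

lemma br_supported:
  assumes add: "\<And>v w. \<phi> (v + w) = \<phi> v + \<phi> w" and fg: "f \<in> supported \<phi> p" "g \<in> supported \<phi> q"
  shows "br f g \<in> supported \<phi> (p + q)"
proof -
  have z: "\<phi> 0 = 0" using add[of 0 0] by simp
  have "str a b \<in> supported \<phi> (deg \<phi> a + deg \<phi> b)" for a b
  proof (cases a; cases b)
    fix \<alpha> \<beta> assume "a = XB \<alpha>" "b = XB \<beta>"
    moreover have "\<phi> \<alpha> + \<phi> \<beta> = 0" if "\<alpha> + \<beta> = 0" using add[of \<alpha> \<beta>] that z by simp
    ultimately show ?thesis
      using hh_supported[of "- \<alpha>" \<phi>] xx_supported[of "\<alpha> + \<beta>" \<phi>]
      by (auto simp: deg_def add hh_rules intro: L.subspace_scale[OF supported_subspace])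
  qed (auto simp: deg_def L.subspace_0[OF supported_subspace]
      intro!: L.subspace_scale[OF supported_subspace] L.subspace_neg[OF supported_subspace] xx_supported)
  then have st: "str a b \<in> supported \<phi> (deg \<phi> a + deg \<phi> b)" for a b .
  have "fs (f a * g b) (str a b) \<in> supported \<phi> (p + q)" for a b
  proof (cases "f a = 0 \<or> g b = 0")
    case True
    then have "fs (f a * g b) (str a b) = 0" by auto
    then show ?thesis using L.subspace_0[OF supported_subspace] by (simp only:)
  next
    case False
    then have "deg \<phi> a = p" "deg \<phi> b = q" using fg by (auto simp: supported_def)
    then have "str a b \<in> supported \<phi> (p + q)" using st[of a b] by (simp only:)
    then show ?thesis by (rule L.subspace_scale[OF supported_subspace])
  qed
  then show ?thesis unfolding br_def by (intro L.subspace_sum supported_subspace)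
qed

definition proj :: "((nat \<Rightarrow> int) \<Rightarrow> 'g::ab_group_add) \<Rightarrow> 'g \<Rightarrow> (basis_index \<Rightarrow> 'k) \<Rightarrow> basis_index \<Rightarrow> 'k" where
  "proj \<phi> q f = (\<lambda>b. if deg \<phi> b = q then f b else 0)"

lemma proj_supported: "f \<in> VL \<Longrightarrow> proj \<phi> q f \<in> supported \<phi> q"
  by (auto simp: proj_def supported_def VL_def)

lemma supported_iff: "f \<in> supported \<phi> q \<longleftrightarrow> f \<in> VL \<and> proj \<phi> q f = f"
  by (auto simp: proj_def supported_def fun_eq_iff)

lemma proj_linear: "proj \<phi> q (f + g) = proj \<phi> q f + proj \<phi> q g" "proj \<phi> q (fs c f) = fs c (proj \<phi> q f)"
  "proj \<phi> q (sum F S) = (\<Sum>i\<in>S. proj \<phi> q (F i))"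
  by (auto simp: proj_def fun_eq_iff sum_fun_apply)

lemma proj_proj: "proj \<phi> p (proj \<phi> q f) = (if p = q then proj \<phi> q f else 0)"
  by (auto simp: proj_def fun_eq_iff)

lemma proj_sum: "\<lbrakk>f \<in> VL; finite S; deg \<phi> ` Bs \<subseteq> S\<rbrakk> \<Longrightarrow> f = (\<Sum>q\<in>S. proj \<phi> q f)"
proof
  fix b assume a: "f \<in> VL" "finite S" "deg \<phi> ` Bs \<subseteq> S"
  have "(\<Sum>q\<in>S. proj \<phi> q f b) = (\<Sum>q\<in>S. if q = deg \<phi> b then f b else 0)"
    by (intro sum.cong) (auto simp: proj_def)
  also have "\<dots> = (if deg \<phi> b \<in> S then f b else 0)" using a by (simp add: sum.delta)
  also have "\<dots> = f b" using a by (auto simp: VL_def)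
  finally show "f b = (\<Sum>q\<in>S. proj \<phi> q f) b" by (simp add: sum_fun_apply)
qed

lemma supported_independent:
  assumes "finite S" "\<And>q. q \<in> S \<Longrightarrow> F q \<in> supported \<phi> q" "sum F S = 0" "q \<in> S"
  shows "F q = 0"
proof -
  have "proj \<phi> q (F p) = (if p = q then F q else 0)" if "p \<in> S" for p
    using assms(2)[OF that] proj_proj[of \<phi> q p "F p"] by (auto simp: supported_iff)
  then have "(\<Sum>p\<in>S. proj \<phi> q (F p)) = (\<Sum>p\<in>S. if p = q then F q else 0)" by (intro sum.cong) auto
  also have "\<dots> = F q" using assms(1,4) by (simp add: sum.delta)
  finally have "F q = proj \<phi> q (sum F S)" by (simp add: proj_linear)
  also have "\<dots> = 0" using assms(3) by (simp add: proj_def fun_eq_iff)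
  finally show ?thesis .
qed

lemma br_proj:
  assumes add: "\<And>v w. \<phi> (v + w) = \<phi> v + \<phi> w" and e: "e \<in> supported \<phi> p" and f: "f \<in> VL"
  shows "proj \<phi> q (br e f) = br e (proj \<phi> (q - p) f)"
proof -
  let ?S = "deg \<phi> ` Bs"
  have "br e f = (\<Sum>r\<in>?S. br e (proj \<phi> r f))"
    using arg_cong[OF proj_sum[OF f, of ?S \<phi>], of "br e"] finite_Bs by (simp add: L.m_sum_right)
  then have "proj \<phi> q (br e f) = (\<Sum>r\<in>?S. proj \<phi> q (br e (proj \<phi> r f)))" by (simp add: proj_linear)
  also have "\<dots> = (\<Sum>r\<in>?S. if r = q - p then br e (proj \<phi> r f) else 0)"
  proof (rule sum.cong[OF refl])
    fix r
    let ?x = "br e (proj \<phi> r f)"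
    have "?x \<in> supported \<phi> (p + r)" by (rule br_supported[OF add e proj_supported[OF f]])
    then have x: "proj \<phi> (p + r) ?x = ?x" by (simp add: supported_iff)
    show "proj \<phi> q ?x = (if r = q - p then ?x else 0)"
    proof (cases "r = q - p")
      case True
      then show ?thesis using x by simp
    next
      case False
      then have "q \<noteq> p + r" by auto
      then show ?thesis using proj_proj[of \<phi> q "p + r" ?x] False unfolding x by simp
    qed
  qed
  also have "\<dots> = (if q - p \<in> ?S then br e (proj \<phi> (q - p) f) else 0)" using finite_Bs by (simp add: sum.delta)
  also have "\<dots> = br e (proj \<phi> (q - p) f)"
  proof (cases "q - p \<in> ?S")
    case False
    have "proj \<phi> (q - p) f b = 0" for b
    proof -
      have "deg \<phi> b \<noteq> q - p" if b: "b \<in> Bs"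
      proof
        assume a: "deg \<phi> b = q - p"
        show False by (rule notE[OF False], rule image_eqI[where f = "deg \<phi>" and x = b], rule a[symmetric], rule b)
      qed
      then show ?thesis using f by (cases "b \<in> Bs") (auto simp: proj_def VL_def)
    qed
    then have "proj \<phi> (q - p) f = 0" by (simp add: fun_eq_iff)
    then show ?thesis by simp
  qed simp
  finally show ?thesis .
qed

text \<open>Coroots act diagonally in the root basis. Applied to the bracket of \<open>ee\<close>
  and \<open>ef\<close>, this yields the \<open>sl2\<close> axiom.\<close>

lemma br_hh_apply: "\<lbrakk>v \<in> lattice; f \<in> VL\<rbrakk> \<Longrightarrow> br (hh v) f = (\<lambda>b. of_int (deg (ip v) b) * f b)"
proof -
  assume v: "v \<in> lattice" and f: "f \<in> VL"
  have u: "br (hh v) (unit_fun b) = fs (of_int (deg (ip v) b)) (unit_fun b)" if "b \<in> Bs" for b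
  proof (cases b)
    case (HB i)
    then have "i < n" using that by (auto simp: Bs_def)
    then show ?thesis using HB by (simp add: hh_unit[symmetric] br_hh_hh deg_def fun_eq_iff)
  next
    case (XB \<alpha>)
    then have "\<alpha> \<in> roots" using that by (auto simp: Bs_def)
    then show ?thesis using XB v by (simp add: xx_unit[symmetric] br_hh_xx deg_def)
  qed
  have "br (hh v) f = (\<Sum>b\<in>Bs. fs (f b) (br (hh v) (unit_fun b)))" by (rule br_expand_right)
  also have "\<dots> = (\<Sum>b\<in>Bs. fs (of_int (deg (ip v) b)) (fs (f b) (unit_fun b)))"
    by (intro sum.cong) (auto simp: u mult.commute)
  finally have eq: "br (hh v) f = (\<Sum>b\<in>Bs. fs (of_int (deg (ip v) b)) (fs (f b) (unit_fun b)))" .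
  have "(\<Sum>b\<in>Bs. fs (of_int (deg (ip v) b)) (fs (f b) (unit_fun b))) x
      = of_int (deg (ip v) x) * (\<Sum>b\<in>Bs. fs (f b) (unit_fun b)) x" for x
    unfolding sum_fun_apply sum_distrib_left by (intro sum.cong) (auto simp: unit_fun_def)
  then show ?thesis unfolding eq VL_expand[OF f, symmetric] by (rule ext)
qed

subsection \<open>Generation by simple root vectors\<close>

lemma ip_sum_left: "ip (\<Sum>i\<in>S. smul (c i) (b i)) w = (\<Sum>i\<in>S. c i * ip (b i) w)"
  and ip_sum_right: "ip w (\<Sum>i\<in>S. smul (c i) (b i)) = (\<Sum>i\<in>S. c i * ip w (b i))" for S :: "nat set"
  by (induction S rule: infinite_finite_induct) (auto simp: ip_rules)

lemma lattice_expand: "v \<in> lattice \<Longrightarrow> v = (\<Sum>i<n. smul (v i) (simple i))"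
proof
  fix k assume v: "v \<in> lattice"
  have "(\<Sum>i<n. smul (v i) (simple i)) k = (\<Sum>i<n. v i * simple i k)"
    by (induction n) auto
  also have "\<dots> = (\<Sum>i<n. if i = k then v k else 0)" by (intro sum.cong) (auto simp: simple_def)
  also have "\<dots> = v k" using v by (auto simp: lattice_def sum.delta)
  finally show "v k = (\<Sum>i<n. smul (v i) (simple i)) k" by simp
qed

text \<open>Split the root as \<open>p - m\<close> into positive and negative parts. They have
  disjoint supports, so their pairing is not positive and the half norms of \<open>p\<close> and
  \<open>m\<close> add up to at most 1. As positive integers they cannot both occur.\<close>

lemma root_sign:
  assumes "\<alpha> \<in> roots" shows "(\<forall>i. 0 \<le> \<alpha> i) \<or> (\<forall>i. \<alpha> i \<le> 0)"
proof -
  define p m where "p = (\<lambda>i. max (\<alpha> i) 0)" and "m = (\<lambda>i. max (- \<alpha> i) 0)"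
  have L: "p \<in> lattice" "m \<in> lattice" using roots_lattice[OF assms] by (auto simp: lattice_def p_def m_def)
  have a: "\<alpha> = p - m" by (auto simp: p_def m_def fun_eq_iff)
  have "ip p m = (\<Sum>i<n. p i * (\<Sum>j<n. m j * ip (simple i) (simple j)))"
    unfolding lattice_sum[OF L(1)] ip_commute[of "simple _" m] lattice_sum[OF L(2)]
    by (simp add: ip_commute)
  also have "\<dots> = (\<Sum>i<n. \<Sum>j<n. p i * (m j * ip (simple i) (simple j)))" by (simp add: sum_distrib_left)
  also have "\<dots> \<le> 0"
  proof (intro sum_nonpos)
    fix i j assume ij: "i \<in> {..<n}" "j \<in> {..<n}"
    show "p i * (m j * ip (simple i) (simple j)) \<le> 0"
    proof (cases "i = j")
      case True
      then show ?thesis by (auto simp: p_def m_def max_def)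
    next
      case False
      then have "ip (simple i) (simple j) \<le> 0" using off_diagonal ij by (simp add: ip_def)
      moreover have "0 \<le> p i" "0 \<le> m j" by (auto simp: p_def m_def)
      ultimately show ?thesis by (simp add: mult_nonneg_nonpos)
    qed
  qed
  finally have "ff p p + ff m m \<le> 1" using roots_ff[OF assms] by (simp add: a ff_diff_self)
  then have "p = 0 \<or> m = 0" using positive[OF L(1)] positive[OF L(2)] by fastforce
  then show ?thesis
    by (auto simp: p_def m_def fun_eq_iff max_def split: if_splits)
qed

text \<open>Induction on height. The norm 2 is a nonnegative combination of the pairings with the
  \<open>b i\<close>, so some \<open>b i\<close> that occurs has a positive pairing; either it is
  the root itself, or subtracting it leaves a root of smaller height, and the bracket back has
  coefficient plus or minus one.\<close>

lemma cone_generation: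
  fixes b :: "nat \<Rightarrow> nat \<Rightarrow> int" and c :: "nat \<Rightarrow> nat"
  assumes W: "L.subspace W" "\<And>x y. \<lbrakk>x \<in> W; y \<in> W\<rbrakk> \<Longrightarrow> br x y \<in> W"
    and b: "\<And>i. i < N \<Longrightarrow> b i \<in> roots" "\<And>i. i < N \<Longrightarrow> xx (b i) \<in> W"
  shows "\<lbrakk>\<alpha> \<in> roots; \<alpha> = (\<Sum>i<N. smul (int (c i)) (b i))\<rbrakk> \<Longrightarrow> xx \<alpha> \<in> W"
proof (induction "\<Sum>i<N. c i" arbitrary: \<alpha> c rule: less_induct)
  case less
  have "2 = (\<Sum>i<N. int (c i) * ip \<alpha> (b i))"
    using ip_root_self[OF less.prems(1)] ip_sum_right[of \<alpha> "\<lambda>i. int (c i)" b "{..<N}"] less.prems(2) by simp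
  then have "\<not> (\<forall>i\<in>{..<N}. int (c i) * ip \<alpha> (b i) \<le> 0)"
    using sum_nonpos[of "{..<N}" "\<lambda>i. int (c i) * ip \<alpha> (b i)"] by auto
  then obtain i where i: "i < N" "0 < int (c i) * ip \<alpha> (b i)" by force
  then have ci: "0 < c i" "0 < ip \<alpha> (b i)" by (auto simp: zero_less_mult_iff)
  show ?case
  proof (cases "ip \<alpha> (b i) = 2")
    case True
    then show ?thesis using root_pair(3)[OF less.prems(1) b(1)[OF i(1)]] b(2)[OF i(1)] by simp
  next
    case False
    then have one: "ip \<alpha> (b i) = 1" using root_pair(1)[OF less.prems(1) b(1)[OF i(1)]] ci by auto
    define w c' where "w = \<alpha> - b i" and "c' = c(i := c i - 1)"
    have w: "w \<in> roots" using root_pair(5)[OF less.prems(1) b(1)[OF i(1)]] one by (simp add: w_def)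
    have eq: "smul (int (c i)) (b i) = smul (int (c' i)) (b i) + b i"
      using ci by (auto simp: c'_def fun_eq_iff of_nat_diff algebra_simps)
    have s: "(\<Sum>j<N. smul (int (c j)) (b j)) = (\<Sum>j<N. smul (int (c' j)) (b j)) + b i"
      using i(1) eq by (simp add: sum.remove[of "{..<N}" i] c'_def algebra_simps)
    then have "w = (\<Sum>j<N. smul (int (c' j)) (b j))" unfolding w_def less.prems(2) by simp
    moreover have "(\<Sum>j<N. c' j) < (\<Sum>j<N. c j)"
      using i(1) ci by (intro sum_strict_mono_ex1) (auto simp: c'_def)
    ultimately have "xx w \<in> W" using less.hyps w by blast
    moreover have "ip (b i) w = -1"
      using one b(1)[OF i(1)] by (simp add: w_def ip_rules ip_root_self ip_commute[of "b i" \<alpha>])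
    then have "br (xx (b i)) (xx w) = fs (eps (b i) w) (xx \<alpha>)"
      using br_xx_xx_sum[OF b(1)[OF i(1)] w] by (simp add: w_def)
    ultimately have "fs (eps (b i) w) (fs (eps (b i) w) (xx \<alpha>)) \<in> W"
      using W b(2)[OF i(1)] by (metis L.subspace_scale)
    then show ?thesis by (simp add: fs_def eps_square)
  qed
qed

lemma smul_unit: "smul 1 v = v" "smul (-1) v = - v"
  by (simp_all add: fun_eq_iff)

lemma root_cone:
  assumes "\<alpha> \<in> roots"
  obtains c s where "s = 1 \<or> s = -1" "\<alpha> = (\<Sum>i<n. smul (int (c i)) (smul s (simple i)))"
proof (cases "\<forall>i. 0 \<le> \<alpha> i")
  case True
  show ?thesis
    by (rule that[of 1 "\<lambda>i. nat (\<alpha> i)"])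
      (use lattice_expand[OF roots_lattice[OF assms]] True in auto)
next
  case False
  then have le: "\<forall>i. \<alpha> i \<le> 0" using root_sign[OF assms] by blast
  have "smul (int (nat (- \<alpha> i))) (smul (-1) (simple i)) = smul (\<alpha> i) (simple i)" for i
    using le by (auto simp: fun_eq_iff)
  then show ?thesis
    by (intro that[of "-1" "\<lambda>i. nat (- \<alpha> i)"]) (use lattice_expand[OF roots_lattice[OF assms]] in simp_all)
qed

theorem contragredient_simply_laced:
  fixes R :: "('k, 'h::ab_group_add) realization"
  assumes R: "is_realization A R" and rank: "vec_space.rank n (map_mat of_int A :: 'k mat) = n"
    and A: "dim_row A = n" "\<And>i j. \<lbrakk>i < n; j < n\<rbrakk> \<Longrightarrow> A $$ (i, j) = ip (simple i) (simple j)"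
    and par: "\<And>i. par i = False"
  obtains g where "g \<in> superalgebra_iso (contragredient A par R) (alg_record fs br VL (\<lambda>p. if p then {0} else VL))"
    "\<And>i. i < n \<Longrightarrow> g (chevalley_e A par R i) = xx (simple i)" "nonassoc_algebra (contragredient A par R)"
proof -
  \<comment> \<open>The minus sign in \<open>?F\<close> compensates the rule
    \<open>br (xx \<alpha>) (xx (- \<alpha>)) = - hh \<alpha>\<close>.\<close>
  let ?E = "\<lambda>i. xx (simple i)" and ?F = "\<lambda>i. - xx (- simple i)" and ?y = "\<lambda>i. hh (simple i)"
  let ?G = "supported (id :: (nat \<Rightarrow> int) \<Rightarrow> _)"
  have id_add: "id (v + w) = id v + id w" for v w :: "nat \<Rightarrow> int" by simp
  have sl: "simple i \<in> lattice" if "i < n" for i using that by simp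
  show ?thesis
  proof (rule L.contragredient_iso_full_rank[OF R _ L_lie, where E = ?E and F = ?F and y = ?y and G = ?G and par = par])
    show "vec_space.rank (dim_row A) (map_mat of_int A :: 'k mat) = dim_row A" using rank A(1) by simp
    show "?E i \<in> ?G (\<lambda>k. if k = i then 1 else 0)" for i using xx_supported[of "simple i" id] by (simp add: simple_def)
    show "?F i \<in> ?G (\<lambda>k. if k = i then -1 else 0)" for i
    proof -
      have "- simple i = (\<lambda>k. if k = i then -1 else 0)" by (auto simp: simple_def)
      then show ?thesis using L.subspace_neg[OF supported_subspace xx_supported[of "- simple i" id]] by simp
    qed
    show "?y i \<in> ?G (\<lambda>k. 0)" for i using hh_supported[of "simple i" id] by (simp add: zero_fun_def)
    show "c i = 0" if "(\<Sum>i<dim_row A. fs (c i) (?y i)) = 0" "i < dim_row A" for c i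
    proof -
      have "(\<Sum>j<n. fs (c j) (?y j)) (HB i) = (\<Sum>j<n. if j = i then c i else 0)"
        unfolding sum_fun_apply using that A(1) by (intro sum.cong) (auto simp: hh_def simple_def)
      then show ?thesis using that A(1) by (simp add: sum.delta)
    qed
    show "br (?E i) (?F j) = (if i = j then ?y i else 0)" if "i < dim_row A" "j < dim_row A" for i j
    proof (cases "i = j")
      case False
      have "ip (simple i) (simple j) \<le> 0" using off_diagonal False that A(1) by (simp add: ip_def)
      then have "br (xx (simple i)) (xx (- simple j)) = 0"
        using that A(1) by (intro br_xx_xx_zero) (auto simp: ip_rules)
      then show ?thesis using False by (simp add: L.m_minus_right)
    qed (use that A(1) in \<open>simp add: L.m_minus_right br_xx_neg\<close>)
    show "br (?y i) (?E j) = fs (of_int (A $$ (i, j))) (?E j)" "br (?y i) (?F j) = - fs (of_int (A $$ (i, j))) (?F j)"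
      if "i < dim_row A" "j < dim_row A" for i j
      using that A sl by (simp_all add: br_hh_xx ip_rules L.m_minus_right)
    show "br (?y i) (?y j) = 0" for i j by (rule br_hh_hh)
    show "br u v \<in> ?G (\<lambda>k. q k + q' k)" if "u \<in> ?G q" "v \<in> ?G q'" for u v q q'
      using br_supported[OF id_add that] by (simp add: plus_fun_def)
    show "cf q = 0" if "finite S" "\<And>q. q \<in> S \<Longrightarrow> cf q \<in> ?G q" "sum cf S = 0" "q \<in> S" for S cf q
      by (rule supported_independent[OF that(1) that(2) that(3,4)])
    show "\<exists>z\<in>?G (\<lambda>k. - q k). br z u \<noteq> 0" if u: "u \<in> ?G q" "u \<noteq> 0" "q \<noteq> (\<lambda>k. 0)" for u q
    proof -
      obtain x where x: "u x \<noteq> 0" using u(2) by (auto simp: fun_eq_iff)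
      then have "deg id x = q" "x \<in> Bs" using u(1) by (auto simp: supported_def VL_def)
      then have xq: "x = XB q" "q \<in> roots" using u(3) by (auto simp: deg_def Bs_def zero_fun_def)
      \<comment> \<open>Outside degree 0 a component of the root grading is the line of one root
        vector, so nondegeneracy reduces to a nonzero coroot.\<close>
      have "u = fs (u (XB q)) (xx q)"
      proof
        fix b
        have "b = XB q" if "u b \<noteq> 0"
        proof -
          have "deg id b = q" using u(1) that by (simp add: supported_def)
          then show ?thesis using u(3) by (cases b) (simp_all add: deg_def zero_fun_def)
        qed
        then show "u b = fs (u (XB q)) (xx q) b" using xq(2) by (cases "b = XB q") (auto simp: xx_apply)
      qed
      then have "br (xx (- q)) u = br (xx (- q)) (fs (u (XB q)) (xx q))" by (rule arg_cong)
      also have "\<dots> = fs (u (XB q)) (hh q)"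
        using xq(2) br_xx_neg[of "- q"] by (simp add: L.m_scale_right hh_rules)
      finally have "br (xx (- q)) u \<noteq> 0" using x xq hh_root_nonzero[OF xq(2)] by simp
      moreover have "xx (- q) \<in> ?G (\<lambda>k. - q k)" using xx_supported[of "- q" id] by (simp add: fun_Compl_def)
      ultimately show ?thesis by blast
    qed
    show "VL \<subseteq> W" if W: "L.subspace W" "\<And>u v. \<lbrakk>u \<in> W; v \<in> W\<rbrakk> \<Longrightarrow> br u v \<in> W" "\<And>i. i < dim_row A \<Longrightarrow> ?y i \<in> W"
        "\<And>i. i < dim_row A \<Longrightarrow> ?E i \<in> W" "\<And>i. i < dim_row A \<Longrightarrow> ?F i \<in> W" for W
    proof -
      have neg: "xx (- simple i) \<in> W" if "i < n" for i
        using L.subspace_neg[OF W(1) W(5)[of i]] that A(1) by simp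
      have pos: "xx (simple i) \<in> W" if "i < n" for i using W(4) that A(1) by simp
      have gens: "xx (smul s (simple i)) \<in> W \<and> smul s (simple i) \<in> roots" if s: "s = 1 \<or> s = -1" and i: "i < n" for s i
        using s
      proof
        assume s1: "s = 1"
        show ?thesis unfolding s1 smul_unit using pos[OF i] simple_root[OF i] by (rule conjI)
      next
        assume s1: "s = -1"
        have "- simple i \<in> roots" unfolding roots_neg using simple_root[OF i] .
        with neg[OF i] show ?thesis unfolding s1 smul_unit by (rule conjI)
      qed
      have "xx \<alpha> \<in> W" if \<alpha>: "\<alpha> \<in> roots" for \<alpha>
      proof -
        obtain c s where cs: "s = 1 \<or> s = -1" "\<alpha> = (\<Sum>i<n. smul (int (c i)) (smul s (simple i)))"
          by (rule root_cone[OF \<alpha>])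
        show ?thesis by (rule cone_generation[OF W(1,2) gens[OF cs(1), THEN conjunct2] gens[OF cs(1), THEN conjunct1] \<alpha> cs(2)])
      qed
      then have "unit_fun b \<in> W" if "b \<in> Bs" for b
        using that W(3) A(1) hh_unit xx_unit unfolding Bs_def by auto
      then have "(\<Sum>b\<in>Bs. fs (f b) (unit_fun b)) \<in> W" for f
        by (intro L.subspace_sum[OF W(1)] L.subspace_scale[OF W(1)])
      then show ?thesis using VL_expand by (metis subsetI)
    qed
  next
    show "?F i \<in> (if par i then {0} else VL)" for i using L.subspace_neg[OF VL_subspace xx_VL] by (simp add: par)
    show "supported id q \<subseteq> VL" for q using supported_VL by blast
  qed (use A(1) that in \<open>simp_all add: par supported_subspace\<close>)
qed

end

section \<open>Two orthogonal roots\<close>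

locale orthogonal_pair = simply_laced n ff lattice three
  for n ff lattice and three :: "'k::field itself" +
  fixes a1 a2 :: "nat \<Rightarrow> int"
  assumes a_roots: "a1 \<in> roots" "a2 \<in> roots" and a_orth: "ip a1 a2 = 0"
begin

definition ee :: "basis_index \<Rightarrow> 'k" where "ee = xx a1 + xx a2"

text \<open>Chosen so that its bracket with \<open>ee\<close> is the coroot of
  \<open>a1 + a2\<close>; orthogonality kills the mixed brackets.\<close>

definition ef :: "basis_index \<Rightarrow> 'k" where "ef = - xx (- a1) - xx (- a2)"

abbreviation gr :: "(nat \<Rightarrow> int) \<Rightarrow> int" where "gr \<equiv> ip (a1 + a2)"

lemma gr_add: "gr (v + w) = gr v + gr w"
  by (simp add: ip_rules)

lemma gr_eq: "gr v = ip a1 v + ip a2 v"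
  by (simp add: ip_rules)

lemma a_orth': "ip a2 a1 = 0"
  using a_orth by (simp add: ip_commute)

text \<open>A pairing 2 or -2 with one of the two roots means equality up to sign with that root,
  which is orthogonal to the other one. This is what keeps the sum of the two pairings between -2
  and 2.\<close>

lemma ip_constraints:
  assumes "\<alpha> \<in> roots"
  shows "- 2 \<le> ip a1 \<alpha> \<and> ip a1 \<alpha> \<le> 2 \<and> - 2 \<le> ip a2 \<alpha> \<and> ip a2 \<alpha> \<le> 2 \<and>
    (ip a1 \<alpha> = 2 \<or> ip a1 \<alpha> = - 2 \<longrightarrow> ip a2 \<alpha> = 0) \<and> (ip a2 \<alpha> = 2 \<or> ip a2 \<alpha> = - 2 \<longrightarrow> ip a1 \<alpha> = 0)"
proof -
  have neg: "\<alpha> = - a" if "a + \<alpha> = 0" for a using that by (simp add: eq_neg_iff_add_eq_0 add.commute)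
  have "ip a2 \<alpha> = 0" if "ip a1 \<alpha> = 2 \<or> ip a1 \<alpha> = - 2"
  proof -
    have "\<alpha> = a1 \<or> \<alpha> = - a1" using root_pair(2,3)[OF a_roots(1) assms] that neg[of a1] by blast
    then show ?thesis using a_orth' by (elim disjE) (simp_all add: ip_rules)
  qed
  moreover have "ip a1 \<alpha> = 0" if "ip a2 \<alpha> = 2 \<or> ip a2 \<alpha> = - 2"
  proof -
    have "\<alpha> = a2 \<or> \<alpha> = - a2" using root_pair(2,3)[OF a_roots(2) assms] that neg[of a2] by blast
    then show ?thesis using a_orth by (elim disjE) (simp_all add: ip_rules)
  qed
  moreover have "- 2 \<le> ip a1 \<alpha> \<and> ip a1 \<alpha> \<le> 2" "- 2 \<le> ip a2 \<alpha> \<and> ip a2 \<alpha> \<le> 2"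
    using root_pair(1)[OF a_roots(1) assms] root_pair(1)[OF a_roots(2) assms] by auto
  ultimately show ?thesis by blast
qed

lemma gr_bound: "\<alpha> \<in> roots \<Longrightarrow> - 2 \<le> gr \<alpha> \<and> gr \<alpha> \<le> 2"
proof -
  assume "\<alpha> \<in> roots"
  note c = ip_constraints[OF this]
  show ?thesis unfolding gr_eq
    by (cases "ip a1 \<alpha> = 2 \<or> ip a1 \<alpha> = - 2"; cases "ip a2 \<alpha> = 2 \<or> ip a2 \<alpha> = - 2") (use c in linarith)+
qed

lemma gr_zero_cases:
  assumes "\<alpha> \<in> roots" "gr \<alpha> = 0"
  shows "(ip a1 \<alpha> = 0 \<and> ip a2 \<alpha> = 0) \<or> (ip a1 \<alpha> = 1 \<and> ip a2 \<alpha> = -1) \<or> (ip a1 \<alpha> = -1 \<and> ip a2 \<alpha> = 1)"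
proof -
  have e: "ip a2 \<alpha> = - ip a1 \<alpha>" using assms(2) gr_eq[of \<alpha>] by linarith
  show ?thesis using ip_constraints[OF assms(1)] unfolding e by linarith
qed

lemma gr_odd_cases:
  assumes "\<alpha> \<in> roots" "gr \<alpha> = -1"
  shows "(ip a1 \<alpha> = -1 \<and> ip a2 \<alpha> = 0) \<or> (ip a1 \<alpha> = 0 \<and> ip a2 \<alpha> = -1)"
proof -
  have e: "ip a2 \<alpha> = - 1 - ip a1 \<alpha>" using assms(2) gr_eq[of \<alpha>] by linarith
  show ?thesis using ip_constraints[OF assms(1)] unfolding e by linarith
qed

lemma ee_ef: "br ee ef = hh (a1 + a2)"
proof -
  have "br (xx a1) (xx (- a2)) = 0" "br (xx a2) (xx (- a1)) = 0"
    using a_roots a_orth a_orth' by (auto intro!: br_xx_xx_zero simp: ip_rules)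
  then show ?thesis
    using a_roots by (simp add: ee_def ef_def L.m_add_left L.m_diff_right L.m_minus_right br_xx_neg hh_rules)
qed

lemma ee_supported: "ee \<in> supported gr 2"
  using xx_supported[of a1 gr] xx_supported[of a2 gr] L.subspace_add[OF supported_subspace]
  by (simp add: ee_def gr_eq ip_root_self a_roots a_orth a_orth')

lemma ef_supported: "ef \<in> supported gr (-2)"
proof -
  have "xx (- a1) \<in> supported gr (-2)" "xx (- a2) \<in> supported gr (-2)"
    using xx_supported[of "- a1" gr] xx_supported[of "- a2" gr]
    by (simp_all add: gr_eq ip_root_self a_roots a_orth a_orth' ip_rules)
  then show ?thesis unfolding ef_def
    by (intro L.subspace_diff[OF supported_subspace] L.subspace_neg[OF supported_subspace])
qed

lemma deg_gr_bound: "b \<in> Bs \<Longrightarrow> deg gr b \<in> {-2..2}"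
  using gr_bound by (auto simp: Bs_def deg_def simp del: ip_rules)

sublocale S: sl2_graded_lie "fs :: 'k \<Rightarrow> (basis_index \<Rightarrow> 'k) \<Rightarrow> _" br VL "proj gr" ee ef
proof
  show "(3 :: 'k) = 0" using of_int_eq_0[of 3] by simp
  show "br x y = - br y x" for x y by (rule br_skew)
  show "br x (br y z) = br (br x y) z + br y (br x z)" for x y z by (rule br_jacobi)
  show "ee \<in> VL" "ef \<in> VL" using ee_supported ef_supported supported_VL by blast+
  show "proj gr j x \<in> VL" if "x \<in> VL" for x j using proj_supported[OF that] supported_VL by blast
  show "proj gr j x = 0" if x: "x \<in> VL" "j < -2 \<or> 2 < j" for x j
  proof
    fix b
    show "proj gr j x b = 0 b"
    proof (cases "b \<in> Bs")
      case True
      then show ?thesis using deg_gr_bound[OF True] x(2) by (auto simp: proj_def)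
    next
      case False
      then show ?thesis using x(1) by (simp add: proj_def VL_def)
    qed
  qed
  show "x = (\<Sum>j\<in>{-2..2}. proj gr j x)" if "x \<in> VL" for x
    by (rule proj_sum[OF that]) (use deg_gr_bound in auto)
  show "proj gr (i + j) (br (proj gr i x) (proj gr j y)) = br (proj gr i x) (proj gr j y)" if "x \<in> VL" "y \<in> VL" for x y i j
    using br_supported[OF gr_add proj_supported[OF that(1)] proj_supported[OF that(2)]]
    unfolding supported_iff by (rule conjunct2)
  show "proj gr 2 ee = ee" "proj gr (-2) ef = ef" using ee_supported ef_supported by (simp_all add: supported_iff)
  show "br ee (br ef (proj gr j x)) - br ef (br ee (proj gr j x)) = fs (of_int j) (proj gr j x)" if x: "x \<in> VL" for x j
  proof -
    have s: "proj gr j x \<in> supported gr j" by (rule proj_supported[OF x])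
    have "br ee (br ef (proj gr j x)) - br ef (br ee (proj gr j x)) = br (hh (a1 + a2)) (proj gr j x)"
      using br_jacobi[of ee ef "proj gr j x"] by (simp add: ee_ef)
    also have "\<dots> = (\<lambda>b. of_int (deg gr b) * proj gr j x b)"
      by (rule br_hh_apply) (use a_roots roots_lattice supported_VL[OF s] in auto)
    also have "\<dots> = fs (of_int j) (proj gr j x)" by (auto simp: fun_eq_iff proj_def)
    finally show ?thesis .
  qed
qed (simp_all add: VL_subspace proj_linear proj_proj)

lemma homog_eq: "S.homog j = supported gr j"
  by (auto simp: S.homog_def supported_iff)

abbreviation "dd \<equiv> br ee"

lemma dd_xx: "dd (xx \<alpha>) = br (xx a1) (xx \<alpha>) + br (xx a2) (xx \<alpha>)"
  by (simp add: ee_def L.m_add_left)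

lemma dd_low:
  assumes "\<alpha> \<in> roots"
  shows "\<lbrakk>ip a1 \<alpha> = -1; 0 \<le> ip a2 \<alpha>\<rbrakk> \<Longrightarrow> dd (xx \<alpha>) = fs (eps a1 \<alpha>) (xx (a1 + \<alpha>))"
    and "\<lbrakk>ip a2 \<alpha> = -1; 0 \<le> ip a1 \<alpha>\<rbrakk> \<Longrightarrow> dd (xx \<alpha>) = fs (eps a2 \<alpha>) (xx (a2 + \<alpha>))"
    and "\<lbrakk>ip a1 \<alpha> = 0; ip a2 \<alpha> = 0\<rbrakk> \<Longrightarrow> dd (xx \<alpha>) = 0"
  unfolding dd_xx using assms a_roots by (simp_all add: br_xx_xx_sum br_xx_xx_zero)

text \<open>Additivity reduces the claim to a root vector of weight -1. There \<open>dd\<close>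
  leads to a multiple of the vector of \<open>a + \<beta>\<close>, and since
  \<open>ip \<beta> (a + \<beta>) = 1\<close> the next bracket already vanishes.\<close>

lemma odd_cube: "u \<in> S.odd_space \<Longrightarrow> S.cube u = 0"
proof -
  assume u: "u \<in> S.odd_space"
  then have s: "u \<in> supported gr (-1)" by (simp add: homog_eq)
  define S where "S = {\<beta> \<in> roots. gr \<beta> = -1}"
  have "finite roots" using finite_roots by (simp add: roots_def)
  then have fin: "finite S" by (rule rev_finite_subset) (auto simp: S_def)
  have "u = (\<Sum>\<beta>\<in>S. fs (u (XB \<beta>)) (xx \<beta>))"
  proof
    fix b
    have r: "(\<Sum>\<beta>\<in>S. fs (u (XB \<beta>)) (xx \<beta>)) b = (\<Sum>\<beta>\<in>S. if b = XB \<beta> then u b else 0)"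
      unfolding sum_fun_apply by (intro sum.cong) (auto simp: xx_apply S_def)
    show "u b = (\<Sum>\<beta>\<in>S. fs (u (XB \<beta>)) (xx \<beta>)) b"
    proof (cases "u b = 0")
      case True
      then show ?thesis unfolding r by (auto intro!: sum.neutral)
    next
      case False
      then have "b \<in> Bs" "deg gr b = -1" using s by (auto simp: supported_def VL_def)
      then obtain \<beta> where "b = XB \<beta>" "\<beta> \<in> S" by (auto simp: Bs_def deg_def S_def)
      then show ?thesis unfolding r using fin by (simp add: sum.delta)
    qed
  qed
  moreover have "S.cube (\<Sum>\<beta>\<in>S. fs (u (XB \<beta>)) (xx \<beta>)) = 0"
  proof (rule S.cube_sum_zero[OF fin])
    fix \<beta> assume "\<beta> \<in> S"
    then have b: "\<beta> \<in> roots" "gr \<beta> = -1" by (auto simp: S_def)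
    show "xx \<beta> \<in> S.odd_space" using xx_supported[of \<beta> gr] b by (simp add: homog_eq)
    have z: "br (xx \<beta>) (fs c (xx (a + \<beta>))) = 0" if "a \<in> roots" "ip a \<beta> = -1" for a c
    proof -
      have "a + \<beta> \<in> roots" using root_pair(4)[OF that(1) b(1)] that(2) by simp
      then have "br (xx \<beta>) (xx (a + \<beta>)) = 0"
        using that b(1) by (intro br_xx_xx_zero) (simp_all add: ip_rules ip_root_self ip_commute[of \<beta> a])
      then show ?thesis by (simp add: L.m_scale_right)
    qed
    show "S.cube (xx \<beta>) = 0"
      using gr_odd_cases[OF b] dd_low(1,2)[OF b(1)] z a_roots by auto
  qed
  ultimately show ?thesis by simp
qed

lemma S_lie: "lie_superalgebra S.S_alg"
  by (rule S.S_lie[OF odd_cube])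

end

section \<open>Projection modulo the two roots and its fibres\<close>

locale projected_pair = orthogonal_pair n ff lattice three a1 a2
  for n ff lattice and three :: "'k::field itself" and a1 a2 +
  fixes \<phi> :: "(nat \<Rightarrow> int) \<Rightarrow> nat \<Rightarrow> int"
  assumes phi_add: "\<phi> (v + w) = \<phi> v + \<phi> w" and phi_a: "\<phi> a1 = 0" "\<phi> a2 = 0"
    and phi_kernel: "\<lbrakk>v \<in> lattice; \<phi> v = 0\<rbrakk> \<Longrightarrow> \<exists>k l. v = smul k a1 + smul l a2"
begin

lemma phi_rules: "\<phi> 0 = 0" "\<phi> (- v) = - \<phi> v" "\<phi> (v - w) = \<phi> v - \<phi> w"
proof -
  show z: "\<phi> 0 = 0" using phi_add[of 0 0] by simp
  show n: "\<phi> (- v) = - \<phi> v" for v using phi_add[of v "- v"] z by (simp add: eq_neg_iff_add_eq_0 add.commute)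
  show "\<phi> (v - w) = \<phi> v - \<phi> w" using phi_add[of v "- w"] n[of w] by simp
qed

text \<open>Two roots over the same point differ by a combination of \<open>a1\<close> and
  \<open>a2\<close>; comparing their half norms gives the quadratic equation that limits the
  fibre.\<close>

lemma fibre:
  assumes r: "\<alpha> \<in> roots" "\<beta> \<in> roots" and eq: "\<phi> \<beta> = \<phi> \<alpha>"
  obtains k l where "\<beta> = \<alpha> + (smul k a1 + smul l a2)" "ip a1 \<beta> = ip a1 \<alpha> + 2 * k" "ip a2 \<beta> = ip a2 \<alpha> + 2 * l"
    "k * k + l * l + k * ip a1 \<alpha> + l * ip a2 \<alpha> = 0"
proof -
  have "\<beta> - \<alpha> \<in> lattice" using r roots_lattice by auto
  then obtain k l where kl: "\<beta> - \<alpha> = smul k a1 + smul l a2"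
    using phi_kernel[of "\<beta> - \<alpha>"] eq by (auto simp: phi_rules)
  then have b: "\<beta> = \<alpha> + (smul k a1 + smul l a2)" by (simp add: algebra_simps)
  have i: "ip a1 \<beta> = ip a1 \<alpha> + 2 * k" "ip a2 \<beta> = ip a2 \<alpha> + 2 * l"
    unfolding b by (simp_all add: ip_rules ip_root_self a_roots a_orth a_orth')
  have "ff (smul k a1) (smul k a1) = k * k" "ff (smul l a2) (smul l a2) = l * l"
    using roots_ff a_roots by (simp_all only: ff_smul mult_1_right)
  then have "1 = 1 + (k * k + l * l) + (k * ip a1 \<alpha> + l * ip a2 \<alpha>)"
    using roots_ff[OF r(2)] unfolding b
    by (simp only: ff_add_self roots_ff[OF r(1)] ip_rules a_orth ip_commute[of \<alpha> a1] ip_commute[of \<alpha> a2])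
  then show ?thesis using that[OF b i] by simp
qed

text \<open>A root in the kernel is \<open>k a1 + l a2\<close> with \<open>k^2 + l^2 = 1\<close> and
  has weight \<open>2 (k + l)\<close>. Weight 0 would force \<open>l = - k\<close> and hence
  \<open>2 k^2 = 1\<close>, and weight -1 is excluded by parity.\<close>

lemma phi_nonzero: "\<lbrakk>\<alpha> \<in> roots; gr \<alpha> = 0 \<or> gr \<alpha> = -1\<rbrakk> \<Longrightarrow> \<phi> \<alpha> \<noteq> 0"
proof
  assume r: "\<alpha> \<in> roots" "gr \<alpha> = 0 \<or> gr \<alpha> = -1" and 0: "\<phi> \<alpha> = 0"
  obtain k l where kl: "\<alpha> = smul k a1 + smul l a2" using phi_kernel[OF roots_lattice[OF r(1)] 0] by blast
  have i: "ip a1 \<alpha> = 2 * k" "ip a2 \<alpha> = 2 * l"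
    unfolding kl by (simp_all add: ip_rules ip_root_self a_roots a_orth a_orth')
  have "ip \<alpha> \<alpha> = k * ip a1 \<alpha> + l * ip a2 \<alpha>" by (subst (1) kl) (simp add: ip_rules)
  then have "k * k + l * l = 1" using ip_root_self[OF r(1)] i by simp
  moreover have "k + l = 0" using r(2) i unfolding gr_eq by presburger
  ultimately have "2 * (k * k) = 1" by (simp add: eq_neg_iff_add_eq_0[symmetric] add.commute)
  then show False by presburger
qed

text \<open>Equal weights force \<open>l = - k\<close>, and the quadratic equation of the fibre
  factors. Besides the root itself at most one other candidate remains.\<close>

lemma fibre_zero:
  assumes "\<alpha> \<in> roots" "\<beta> \<in> roots" "\<phi> \<beta> = \<phi> \<alpha>" "gr \<beta> = gr \<alpha>"
  shows "\<beta> = \<alpha> \<or> (\<exists>k. \<beta> = \<alpha> + (smul k a1 + smul (- k) a2) \<and> 2 * k = ip a2 \<alpha> - ip a1 \<alpha>)"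
proof -
  obtain k l where kl: "\<beta> = \<alpha> + (smul k a1 + smul l a2)" "ip a1 \<beta> = ip a1 \<alpha> + 2 * k" "ip a2 \<beta> = ip a2 \<alpha> + 2 * l"
    "k * k + l * l + k * ip a1 \<alpha> + l * ip a2 \<alpha> = 0" by (rule fibre[OF assms(1,2,3)])
  have l: "l = - k" using kl(2,3) assms(4) unfolding gr_eq by simp
  have "k * (2 * k + ip a1 \<alpha> - ip a2 \<alpha>) = 0" using kl(4) unfolding l by (simp add: algebra_simps)
  then have "k = 0 \<or> 2 * k = ip a2 \<alpha> - ip a1 \<alpha>" by auto
  then show ?thesis
  proof
    assume "k = 0"
    then have "\<beta> = \<alpha>" using kl(1) unfolding l by (auto simp: fun_eq_iff)
    then show ?thesis by simp
  next
    assume "2 * k = ip a2 \<alpha> - ip a1 \<alpha>"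
    then show ?thesis using kl(1) unfolding l by blast
  qed
qed

lemma fibre_parity: "\<lbrakk>\<alpha> \<in> roots; \<beta> \<in> roots; \<phi> \<beta> = \<phi> \<alpha>\<rbrakk> \<Longrightarrow> even (gr \<beta> - gr \<alpha>)"
  by (erule (2) fibre) (simp add: gr_eq)

abbreviation tw :: "(nat \<Rightarrow> int) \<Rightarrow> nat \<Rightarrow> int" where "tw \<alpha> \<equiv> \<alpha> - a1 + a2"

text \<open>\<open>dd\<close> sends both root vectors to multiples of the vector of
  \<open>a2 + \<alpha>\<close>. Multiplying crosswise by the two signs gives an element of the
  kernel.\<close>

definition sg :: "(nat \<Rightarrow> int) \<Rightarrow> basis_index \<Rightarrow> 'k" where
  "sg \<alpha> = fs (eps a1 (tw \<alpha>)) (xx \<alpha>) - fs (eps a2 \<alpha>) (xx (tw \<alpha>))"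

text \<open>A weight space of the semisimplification comes from a string of one, two or four roots; the
  string is represented by its member of one of the following types.\<close>

definition canon :: "(nat \<Rightarrow> int) \<Rightarrow> bool" where
  "canon \<alpha> \<longleftrightarrow> \<alpha> \<in> roots \<and> (ip a1 \<alpha>, ip a2 \<alpha>) \<in> {(0, 0), (1, -1), (-1, 0), (0, -1)}"

definition rep :: "(nat \<Rightarrow> int) \<Rightarrow> (basis_index \<Rightarrow> 'k) \<times> (basis_index \<Rightarrow> 'k)" where
  "rep \<alpha> = (if gr \<alpha> = -1 then (0, xx \<alpha>) else if ip a1 \<alpha> = 0 then (xx \<alpha>, 0) else (sg \<alpha>, 0))"

definition Gs :: "(nat \<Rightarrow> int) \<Rightarrow> ((basis_index \<Rightarrow> 'k) \<times> (basis_index \<Rightarrow> 'k)) set" where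
  "Gs \<gamma> = {y \<in> S.even_space \<times> S.odd_space. fst y \<in> supported \<phi> \<gamma> \<and> snd y \<in> supported \<phi> \<gamma>}"

lemma canon_root: "canon \<alpha> \<Longrightarrow> \<alpha> \<in> roots" and canon_gr: "canon \<alpha> \<Longrightarrow> gr \<alpha> = 0 \<or> gr \<alpha> = -1"
  by (auto simp: canon_def gr_eq)

lemma tw_props:
  assumes "\<alpha> \<in> roots" "ip a1 \<alpha> = 1" "ip a2 \<alpha> = -1"
  shows "tw \<alpha> \<in> roots" "ip a1 (tw \<alpha>) = -1" "ip a2 (tw \<alpha>) = 1" "ip \<alpha> (tw \<alpha>) = 0" "\<phi> (tw \<alpha>) = \<phi> \<alpha>" "a1 + tw \<alpha> = a2 + \<alpha>"
    "tw \<alpha> \<noteq> \<alpha>"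
proof -
  have c: "ip \<alpha> a1 = 1" "ip \<alpha> a2 = -1" using assms ip_commute[of \<alpha> a1] ip_commute[of \<alpha> a2] by linarith+
  note s = ip_root_self[OF a_roots(1)] ip_root_self[OF a_roots(2)] ip_root_self[OF assms(1)]
  show i: "ip a1 (tw \<alpha>) = -1" "ip a2 (tw \<alpha>) = 1" "ip \<alpha> (tw \<alpha>) = 0"
    by (simp_all add: ip_rules s a_orth a_orth' assms c)
  have r: "\<alpha> - a1 \<in> roots" using root_pair(5)[OF assms(1) a_roots(1)] c(1) by blast
  have "ip (\<alpha> - a1) a2 = -1" by (simp add: ip_rules a_orth c)
  then show "tw \<alpha> \<in> roots" using root_pair(4)[OF r a_roots(2)] by blast
  show "\<phi> (tw \<alpha>) = \<phi> \<alpha>" by (simp add: phi_add phi_rules phi_a)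
  show "a1 + tw \<alpha> = a2 + \<alpha>" by (simp add: algebra_simps)
  show "tw \<alpha> \<noteq> \<alpha>"
  proof
    assume "tw \<alpha> = \<alpha>"
    from arg_cong[OF this, of "ip a1"] show False unfolding i(1) assms(2) by simp
  qed
qed

lemma untwist:
  assumes "\<beta> \<in> roots" "ip a1 \<beta> = -1" "ip a2 \<beta> = 1"
  obtains \<alpha> where "\<alpha> \<in> roots" "ip a1 \<alpha> = 1" "ip a2 \<alpha> = -1" "\<beta> = tw \<alpha>" "\<phi> \<alpha> = \<phi> \<beta>" "\<alpha> = \<beta> + a1 - a2"
proof
  let ?\<alpha> = "\<beta> + a1 - a2"
  have c: "ip \<beta> a1 = -1" "ip \<beta> a2 = 1" using assms ip_commute[of \<beta> a1] ip_commute[of \<beta> a2] by linarith+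
  note s = ip_root_self[OF a_roots(1)] ip_root_self[OF a_roots(2)]
  have r: "\<beta> + a1 \<in> roots" using root_pair(4)[OF assms(1) a_roots(1)] c(1) by blast
  have "ip (\<beta> + a1) a2 = 1" by (simp add: ip_rules a_orth c)
  then show "?\<alpha> \<in> roots" using root_pair(5)[OF r a_roots(2)] by blast
  show "ip a1 ?\<alpha> = 1" "ip a2 ?\<alpha> = -1" by (simp_all add: ip_rules s a_orth a_orth' assms)
  show "\<beta> = tw ?\<alpha>" by (simp add: algebra_simps)
  show "\<phi> ?\<alpha> = \<phi> \<beta>" by (simp add: phi_add phi_rules phi_a)
qed (rule refl)

end

section \<open>Weight spaces of the semisimplification\<close>

context projected_pair
begin

lemma ee_phi: "ee \<in> supported \<phi> 0"
proof -
  have "xx a1 \<in> supported \<phi> 0" "xx a2 \<in> supported \<phi> 0"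
    using xx_supported[of a1 \<phi>] xx_supported[of a2 \<phi>] unfolding phi_a by simp_all
  then show ?thesis unfolding ee_def by (rule L.subspace_add[OF supported_subspace])
qed

lemma Gs_subspace: "S.pair.subspace (Gs \<gamma>)"
proof -
  have "Gs \<gamma> = (S.even_space \<inter> supported \<phi> \<gamma>) \<times> (S.odd_space \<inter> supported \<phi> \<gamma>)" by (auto simp: Gs_def)
  then show ?thesis
    using S.pair_subspace[OF L.subspace_inter[OF S.even_subspace supported_subspace]
        L.subspace_inter[OF S.homog_subspace supported_subspace]] by simp
qed

lemma Gs_mult: "\<lbrakk>x \<in> Gs \<gamma>; y \<in> Gs \<delta>\<rbrakk> \<Longrightarrow> S.br2 x y \<in> Gs (\<gamma> + \<delta>)"
proof -
  assume xy: "x \<in> Gs \<gamma>" "y \<in> Gs \<delta>"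
  then have c: "S.br2 x y \<in> S.even_space \<times> S.odd_space" by (intro S.br2_closed) (auto simp: Gs_def)
  have s: "fst x \<in> supported \<phi> \<gamma>" "snd x \<in> supported \<phi> \<gamma>" "fst y \<in> supported \<phi> \<delta>" "snd y \<in> supported \<phi> \<delta>"
    using xy by (auto simp: Gs_def)
  note b = br_supported[OF phi_add]
  have d: "dd (snd x) \<in> supported \<phi> \<gamma>" "dd (snd y) \<in> supported \<phi> \<delta>"
    using b[OF ee_phi s(2)] b[OF ee_phi s(4)] by simp_all
  have "fst (S.br2 x y) \<in> supported \<phi> (\<gamma> + \<delta>)" "snd (S.br2 x y) \<in> supported \<phi> (\<gamma> + \<delta>)"
    unfolding S.br2_def fst_conv snd_conv
    by (intro L.subspace_add[OF supported_subspace] L.subspace_diff[OF supported_subspace] b s d)+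
  then show ?thesis using c by (simp add: Gs_def)
qed

lemma dd_sg:
  assumes "\<alpha> \<in> roots" "ip a1 \<alpha> = 1" "ip a2 \<alpha> = -1"
  shows "dd (sg \<alpha>) = 0" "sg \<alpha> \<in> supported gr 0" "sg \<alpha> \<in> supported \<phi> (\<phi> \<alpha>)"
proof -
  note t = tw_props[OF assms]
  have "dd (xx \<alpha>) = fs (eps a2 \<alpha>) (xx (a2 + \<alpha>))" using dd_low(2)[OF assms(1)] assms by simp
  moreover have "dd (xx (tw \<alpha>)) = fs (eps a1 (tw \<alpha>)) (xx (a2 + \<alpha>))" using dd_low(1)[OF t(1)] t by simp
  ultimately show "dd (sg \<alpha>) = 0" unfolding sg_def L.m_diff_right L.m_scale_right by (simp add: mult.commute)
  have "xx \<alpha> \<in> supported gr 0" "xx (tw \<alpha>) \<in> supported gr 0"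
    using xx_supported[of \<alpha> gr] xx_supported[of "tw \<alpha>" gr] assms t by (simp_all add: gr_eq)
  then show "sg \<alpha> \<in> supported gr 0"
    unfolding sg_def by (intro L.subspace_diff[OF supported_subspace] L.subspace_scale[OF supported_subspace])
  have "xx \<alpha> \<in> supported \<phi> (\<phi> \<alpha>)" "xx (tw \<alpha>) \<in> supported \<phi> (\<phi> \<alpha>)"
    using xx_supported[of \<alpha> \<phi>] xx_supported[of "tw \<alpha>" \<phi>] t by simp_all
  then show "sg \<alpha> \<in> supported \<phi> (\<phi> \<alpha>)"
    unfolding sg_def by (intro L.subspace_diff[OF supported_subspace] L.subspace_scale[OF supported_subspace])
qed

lemma canon_cases:
  assumes "canon \<alpha>"
  obtains (single) "\<alpha> \<in> roots" "ip a1 \<alpha> = 0" "ip a2 \<alpha> = 0" "gr \<alpha> = 0" "rep \<alpha> = (xx \<alpha>, 0)"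
  | (four) "\<alpha> \<in> roots" "ip a1 \<alpha> = 1" "ip a2 \<alpha> = -1" "gr \<alpha> = 0" "rep \<alpha> = (sg \<alpha>, 0)"
  | (odd1) "\<alpha> \<in> roots" "ip a1 \<alpha> = -1" "ip a2 \<alpha> = 0" "gr \<alpha> = -1" "rep \<alpha> = (0, xx \<alpha>)"
  | (odd2) "\<alpha> \<in> roots" "ip a1 \<alpha> = 0" "ip a2 \<alpha> = -1" "gr \<alpha> = -1" "rep \<alpha> = (0, xx \<alpha>)"
  using assms unfolding canon_def rep_def gr_eq by auto

lemma rep_Gs: "canon \<alpha> \<Longrightarrow> rep \<alpha> \<in> Gs (\<phi> \<alpha>)"
proof -
  assume "canon \<alpha>"
  then show ?thesis
    using xx_supported[of \<alpha> gr] xx_supported[of \<alpha> \<phi>] dd_low(3)[of \<alpha>] dd_sg[of \<alpha>]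
    by (cases rule: canon_cases) (simp_all add: Gs_def S.even_space_def homog_eq L.subspace_0[OF supported_subspace])
qed

lemma single_support:
  assumes "f \<in> VL" "\<alpha> \<in> roots" "\<And>\<beta>. \<lbrakk>\<beta> \<in> roots; f (XB \<beta>) \<noteq> 0\<rbrakk> \<Longrightarrow> \<beta> = \<alpha>" "\<And>i. f (HB i) = 0"
  shows "f = fs (f (XB \<alpha>)) (xx \<alpha>)"
proof
  fix b show "f b = fs (f (XB \<alpha>)) (xx \<alpha>) b"
  proof (cases b)
    case (XB \<beta>)
    show ?thesis
    proof (cases "f b = 0")
      case True
      then show ?thesis unfolding XB by (cases "\<beta> = \<alpha>") (simp_all add: xx_apply)
    next
      case False
      then have "b \<in> Bs" using assms(1) unfolding VL_def by blast
      then have "\<beta> \<in> roots" unfolding XB Bs_def by blast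
      then have "\<beta> = \<alpha>" using assms(3) False unfolding XB by blast
      then show ?thesis unfolding XB using assms(2) by (simp add: xx_apply)
    qed
  next
    case (HB i)
    show ?thesis unfolding HB fs_apply assms(4) by (simp add: xx_apply)
  qed
qed

lemma Gs_components:
  assumes y: "y \<in> Gs \<gamma>" and g: "\<gamma> \<noteq> 0"
  shows "fst y \<in> VL" "snd y \<in> VL" "fst y (HB i) = 0" "snd y (HB i) = 0"
    and "fst y (XB \<beta>) \<noteq> 0 \<Longrightarrow> \<beta> \<in> roots \<and> gr \<beta> = 0 \<and> \<phi> \<beta> = \<gamma>"
    and "snd y (XB \<beta>) \<noteq> 0 \<Longrightarrow> \<beta> \<in> roots \<and> gr \<beta> = -1 \<and> \<phi> \<beta> = \<gamma>"
proof -
  have s: "fst y \<in> supported \<phi> \<gamma>" "snd y \<in> supported \<phi> \<gamma>" "fst y \<in> supported gr 0" "snd y \<in> supported gr (-1)"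
    using y by (auto simp: Gs_def S.even_space_def homog_eq)
  show V: "fst y \<in> VL" "snd y \<in> VL" using s supported_VL by blast+
  show "fst y (HB i) = 0" "snd y (HB i) = 0"
    using s(1,2) g unfolding supported_def deg_def by force+
  show "fst y (XB \<beta>) \<noteq> 0 \<Longrightarrow> \<beta> \<in> roots \<and> gr \<beta> = 0 \<and> \<phi> \<beta> = \<gamma>"
    "snd y (XB \<beta>) \<noteq> 0 \<Longrightarrow> \<beta> \<in> roots \<and> gr \<beta> = -1 \<and> \<phi> \<beta> = \<gamma>"
    using s V unfolding supported_def deg_def VL_def Bs_def by force+
qed

text \<open>Weights in a fibre agree modulo 2, so only one parity occurs. The fibre equation leaves
  one root of the given weight, or two over a string of four; in the latter case being killed by
  \<open>dd\<close> is one nontrivial linear condition.\<close>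

lemma Gs_one_dimensional:
  assumes c: "canon \<alpha>" and y: "y \<in> Gs (\<phi> \<alpha>)"
  shows "\<exists>k. y = S.scale2 k (rep \<alpha>)"
proof -
  have r: "\<alpha> \<in> roots" by (rule canon_root[OF c])
  have g: "\<phi> \<alpha> \<noteq> 0" by (rule phi_nonzero[OF r canon_gr[OF c]])
  note comp = Gs_components[OF y g]
  have zero: "f = 0" if "f \<in> VL" "\<And>\<beta>. f (XB \<beta>) = 0" "\<And>i. f (HB i) = 0" for f :: "basis_index \<Rightarrow> 'k"
  proof
    fix b show "f b = 0 b" using that by (cases b) auto
  qed
  have E: "snd y = 0" if g0: "gr \<alpha> = 0"
  proof (rule zero[OF comp(2) _ comp(4)])
    fix \<beta> show "snd y (XB \<beta>) = 0"
    proof (rule ccontr)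
      assume "snd y (XB \<beta>) \<noteq> 0"
      from comp(6)[OF this] fibre_parity[OF r, of \<beta>] show False unfolding g0 by simp
    qed
  qed
  have O: "fst y = 0" if g1: "gr \<alpha> = -1"
  proof (rule zero[OF comp(1) _ comp(3)])
    fix \<beta> show "fst y (XB \<beta>) = 0"
    proof (rule ccontr)
      assume "fst y (XB \<beta>) \<noteq> 0"
      from comp(5)[OF this] fibre_parity[OF r, of \<beta>] show False unfolding g1 by simp
    qed
  qed
  \<comment> \<open>The difference of the pairings is odd, so the equation for a second root of the
    same weight has no integer solution.\<close>
  have odd: ?thesis if o: "ip a2 \<alpha> - ip a1 \<alpha> = 1 \<or> ip a2 \<alpha> - ip a1 \<alpha> = - 1" "gr \<alpha> = -1" "rep \<alpha> = (0, xx \<alpha>)"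
  proof -
    have "snd y = fs (snd y (XB \<alpha>)) (xx \<alpha>)"
    proof (rule single_support[OF comp(2) r _ comp(4)])
      fix \<beta> assume "snd y (XB \<beta>) \<noteq> 0"
      from comp(6)[OF this] have b: "\<beta> \<in> roots" "\<phi> \<beta> = \<phi> \<alpha>" "gr \<beta> = gr \<alpha>" using o(2) by simp_all
      show "\<beta> = \<alpha>"
      proof (rule ccontr)
        assume "\<beta> \<noteq> \<alpha>"
        then obtain k where "2 * k = ip a2 \<alpha> - ip a1 \<alpha>" using fibre_zero[OF r b] by blast
        then have "2 * k = 1 \<or> 2 * k = - 1" using o(1) by metis
        then show False by presburger
      qed
    qed
    then show ?thesis using O[OF o(2)] unfolding o(3) by (intro exI[of _ "snd y (XB \<alpha>)"]) (simp add: S.scale2_def prod_eq_iff)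
  qed
  from c show ?thesis
  proof (cases rule: canon_cases)
    case single
    have "fst y = fs (fst y (XB \<alpha>)) (xx \<alpha>)"
    proof (rule single_support[OF comp(1) r _ comp(3)])
      fix \<beta> assume "fst y (XB \<beta>) \<noteq> 0"
      from comp(5)[OF this] have b: "\<beta> \<in> roots" "\<phi> \<beta> = \<phi> \<alpha>" "gr \<beta> = gr \<alpha>" using single(4) by simp_all
      show "\<beta> = \<alpha>"
      proof (rule ccontr)
        assume "\<beta> \<noteq> \<alpha>"
        then obtain k where k: "\<beta> = \<alpha> + (smul k a1 + smul (- k) a2)" "2 * k = ip a2 \<alpha> - ip a1 \<alpha>"
          using fibre_zero[OF r b] by blast
        then have "k = 0" unfolding single by simp
        then have "\<beta> = \<alpha>" unfolding k(1) by (simp add: fun_eq_iff)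
        then show False using \<open>\<beta> \<noteq> \<alpha>\<close> by blast
      qed
    qed
    then show ?thesis
      using E[OF single(4)] unfolding single(5) by (intro exI[of _ "fst y (XB \<alpha>)"]) (simp add: S.scale2_def prod_eq_iff)
  next
    case odd1
    show ?thesis by (rule odd) (simp_all add: odd1)
  next
    case odd2
    show ?thesis by (rule odd) (simp_all add: odd2)
  next
    case four
    note t = tw_props[OF four(1-3)]
    have sy: "snd y = 0" by (rule E[OF four(4)])
    define s u where "s = fst y (XB \<alpha>)" and "u = fst y (XB (tw \<alpha>))"
    have two: "\<beta> = \<alpha> \<or> \<beta> = tw \<alpha>" if "fst y (XB \<beta>) \<noteq> 0" for \<beta>
    proof -
      from comp(5)[OF that] have b: "\<beta> \<in> roots" "\<phi> \<beta> = \<phi> \<alpha>" "gr \<beta> = gr \<alpha>" using four(4) by simp_all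
      from fibre_zero[OF r b] show ?thesis
      proof (elim disjE exE conjE)
        fix k assume k: "\<beta> = \<alpha> + (smul k a1 + smul (- k) a2)" "2 * k = ip a2 \<alpha> - ip a1 \<alpha>"
        then have "k = -1" unfolding four by simp
        then show ?thesis unfolding k(1) by (simp add: fun_eq_iff)
      qed simp
    qed
    have y1: "fst y = fs s (xx \<alpha>) + fs u (xx (tw \<alpha>))"
    proof
      fix b show "fst y b = (fs s (xx \<alpha>) + fs u (xx (tw \<alpha>))) b"
      proof (cases b)
        case (HB i)
        show ?thesis unfolding HB comp(3) by (simp add: xx_apply)
      next
        case (XB \<beta>)
        consider "\<beta> = \<alpha>" | "\<beta> = tw \<alpha>" | "fst y (XB \<beta>) = 0" "\<beta> \<noteq> \<alpha>" "\<beta> \<noteq> tw \<alpha>" using two by blast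
        then show ?thesis
        proof cases
          case 1
          show ?thesis unfolding XB 1 using t(7)[symmetric] four(1) by (simp add: xx_apply s_def)
        next
          case 2
          show ?thesis unfolding XB 2 using t(7) t(1) by (simp add: xx_apply u_def)
        next
          case 3
          then show ?thesis unfolding XB by (simp add: xx_apply)
        qed
      qed
    qed
    have "fst y \<in> S.even_space" using y unfolding Gs_def by (simp add: mem_Times_iff)
    then have "dd (fst y) = 0" unfolding S.even_space_def by blast
    moreover have "dd (xx \<alpha>) = fs (eps a2 \<alpha>) (xx (a2 + \<alpha>))" by (rule dd_low(2)[OF four(1,3)]) (simp add: four(2))
    moreover have "dd (xx (tw \<alpha>)) = fs (eps a1 (tw \<alpha>)) (xx (a2 + \<alpha>))"
      unfolding t(6)[symmetric] by (rule dd_low(1)[OF t(1,2)]) (simp add: t(3))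
    \<comment> \<open>The single condition on the two coefficients: both images are multiples of the
      same root vector.\<close>
    ultimately have "fs (s * eps a2 \<alpha> + u * eps a1 (tw \<alpha>)) (xx (a2 + \<alpha>)) = 0"
      unfolding y1 L.m_add_right L.m_scale_right by (simp add: L.scale_left_distrib)
    moreover have "a2 + \<alpha> \<in> roots" using root_pair(4)[OF a_roots(2) four(1)] four(3) by simp
    ultimately have "s * eps a2 \<alpha> + u * eps a1 (tw \<alpha>) = 0"
      using fun_cong[of _ _ "XB (a2 + \<alpha>)"] unfolding fs_apply xx_apply by fastforce
    then have z: "(s * eps a2 \<alpha> + u * eps a1 (tw \<alpha>)) * eps a1 (tw \<alpha>) = 0" by simp
    define q where "q = (eps a1 (tw \<alpha>) :: 'k)"
    have q: "q * q = 1" "q * (q * c) = c" for c unfolding q_def by (simp_all add: eps_square)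
    have "(s * eps a2 \<alpha> + u * q) * q = s * q * eps a2 \<alpha> + u * (q * q)" by (simp add: algebra_simps)
    with z have "s * q * eps a2 \<alpha> + u = 0" unfolding q q_def[symmetric] by simp
    then have u: "u = - (s * q * eps a2 \<alpha>)" by (simp add: add_eq_0_iff2)
    have "fst y = fs (s * q) (sg \<alpha>)"
      unfolding y1 sg_def u q_def[symmetric]
      by (simp add: L.scale_right_diff_distrib q mult.assoc L.scale_minus_left)
    then have "fst y = fs (s * eps a1 (tw \<alpha>)) (sg \<alpha>)" unfolding q_def .
    then show ?thesis
      using sy four(5) by (intro exI[of _ "s * eps a1 (tw \<alpha>)"]) (simp add: S.scale2_def prod_eq_iff)
  qed
qed

text \<open>A nonzero coordinate gives a root over \<open>\<gamma>\<close>. Over a string of four it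
  may be the member with pairings (-1, 1); \<open>untwist\<close> then passes to the one with
  pairings (1, -1).\<close>

lemma Gs_canon:
  assumes y: "y \<in> Gs \<gamma>" "y \<noteq> 0" and g: "\<gamma> \<noteq> 0"
  obtains \<alpha> where "canon \<alpha>" "\<phi> \<alpha> = \<gamma>"
proof -
  note comp = Gs_components[OF y(1) g]
  have "\<exists>\<beta>. fst y (XB \<beta>) \<noteq> 0 \<or> snd y (XB \<beta>) \<noteq> 0"
  proof (rule ccontr)
    assume "\<not> ?thesis"
    then have n: "fst y (XB \<beta>) = 0" "snd y (XB \<beta>) = 0" for \<beta> by blast+
    have "fst y b = 0" "snd y b = 0" for b using n comp(3,4) by (cases b; simp)+
    then have "fst y = 0" "snd y = 0" by (simp_all add: fun_eq_iff)
    then show False using y(2) by (simp add: prod_eq_iff)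
  qed
  then obtain \<beta> where b: "\<beta> \<in> roots" "gr \<beta> = 0 \<or> gr \<beta> = -1" "\<phi> \<beta> = \<gamma>" using comp(5,6) by blast
  show ?thesis
  proof (cases "ip a1 \<beta> = -1 \<and> ip a2 \<beta> = 1")
    case True
    obtain \<alpha> where "\<alpha> \<in> roots" "ip a1 \<alpha> = 1" "ip a2 \<alpha> = -1" "\<beta> = tw \<alpha>" "\<phi> \<alpha> = \<phi> \<beta>" "\<alpha> = \<beta> + a1 - a2"
      using untwist[OF b(1)] True by blast
    note u = this
    have "canon \<alpha>" using u(1-3) unfolding canon_def by blast
    moreover have "\<phi> \<alpha> = \<gamma>" unfolding u(5) by (rule b(3))
    ultimately show ?thesis by (rule that)
  next
    case False
    have "(ip a1 \<beta>, ip a2 \<beta>) \<in> {(0, 0), (1, -1), (-1, 0), (0, -1)}"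
      using False b(2) gr_zero_cases[OF b(1)] gr_odd_cases[OF b(1)] by blast
    then have "canon \<beta>" using b(1) unfolding canon_def by blast
    then show ?thesis using b(3) by (rule that)
  qed
qed

end

section \<open>Nondegeneracy and spanning\<close>

context projected_pair
begin

text \<open>Lets the two odd types be treated together: \<open>a\<close> is the root to which the
  odd one is attached with pairing -1, and \<open>a'\<close> is the other.\<close>

definition partners :: "(nat \<Rightarrow> int) \<Rightarrow> (nat \<Rightarrow> int) \<Rightarrow> bool" where
  "partners a a' \<longleftrightarrow> (a, a') \<in> {(a1, a2), (a2, a1)}"

lemma partners_props:
  assumes "partners a a'"
  shows "a \<in> roots" "a' \<in> roots" "ip a a' = 0" "ip a' a = 0" "\<phi> a = 0" "gr v = ip a v + ip a' v" "ip a a = 2"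
  using assms unfolding partners_def
  by (auto simp: a_roots a_orth a_orth' phi_a gr_eq ip_root_self simp del: ip_rules)

lemma odd_props:
  assumes p: "partners a a'" and r: "\<alpha> \<in> roots" "ip a \<alpha> = -1" "ip a' \<alpha> = 0"
  shows "gr \<alpha> = -1" "canon \<alpha>" "rep \<alpha> = (0, xx \<alpha>)" "dd (xx \<alpha>) = fs (eps a \<alpha>) (xx (a + \<alpha>))" "a + \<alpha> \<in> roots"
proof -
  show g: "gr \<alpha> = -1" unfolding partners_props(6)[OF p] r by simp
  show "rep \<alpha> = (0, xx \<alpha>)" unfolding rep_def g by simp
  show "canon \<alpha>" unfolding canon_def using p r unfolding partners_def by auto
  show "a + \<alpha> \<in> roots" using root_pair(4)[OF partners_props(1)[OF p] r(1)] r(2) by blast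
  show "dd (xx \<alpha>) = fs (eps a \<alpha>) (xx (a + \<alpha>))"
    using p r dd_low(1,2)[OF r(1)] unfolding partners_def by auto
qed

lemma root_uminus: "\<alpha> \<in> roots \<Longrightarrow> - \<alpha> \<in> roots"
  unfolding roots_def by simp

text \<open>The root \<open>- \<alpha>\<close> has weight 1, and \<open>- \<alpha> - a\<close> is
  the member of its string of weight -1. The bracket is a signed coroot of
  \<open>a + 2 \<alpha>\<close>; this vector has half norm 3, which is not divisible by 9, so the
  coroot survives modulo 3.\<close>

lemma odd_bracket:
  assumes p: "partners a a'" and r: "\<alpha> \<in> roots" "ip a \<alpha> = -1" "ip a' \<alpha> = 0"
  shows "- \<alpha> - a \<in> roots" "ip a (- \<alpha> - a) = -1" "ip a' (- \<alpha> - a) = 0"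
    and "S.br2 (0, xx \<alpha>) (0, xx (- \<alpha> - a)) = (- fs (eps a \<alpha>) (hh (a + \<alpha>) + hh \<alpha>), 0)"
    and "hh (a + \<alpha>) + hh \<alpha> \<noteq> 0"
proof -
  note o = odd_props[OF p r] and pp = partners_props[OF p]
  let ?\<beta> = "- \<alpha> - a"
  have b: "?\<beta> = - (a + \<alpha>)" by simp
  show b1: "?\<beta> \<in> roots" unfolding b by (rule root_uminus[OF o(5)])
  show b2: "ip a ?\<beta> = -1" "ip a' ?\<beta> = 0" by (simp_all add: ip_rules pp r)
  note o' = odd_props[OF p b1 b2]
  have "eps a a = (- 1 :: 'k)" by (rule eps_root[OF pp(1)])
  then have e: "eps a ?\<beta> = (- eps a \<alpha> :: 'k)" by (simp add: eps_rules)
  have s: "a + ?\<beta> = - \<alpha>" by simp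
  have "br (dd (xx \<alpha>)) (xx ?\<beta>) = - fs (eps a \<alpha>) (hh (a + \<alpha>))"
    unfolding o(4) b L.m_scale_left br_xx_neg[OF o(5)] by (simp add: fun_eq_iff)
  moreover have "br (xx \<alpha>) (dd (xx ?\<beta>)) = fs (eps a \<alpha>) (hh \<alpha>)"
    unfolding o'(4) s e L.m_scale_right br_xx_neg[OF r(1)] by (simp add: fun_eq_iff)
  ultimately have "br (dd (xx \<alpha>)) (xx ?\<beta>) - br (xx \<alpha>) (dd (xx ?\<beta>)) = - fs (eps a \<alpha>) (hh (a + \<alpha>) + hh \<alpha>)"
    by (simp add: L.scale_right_distrib)
  then show "S.br2 (0, xx \<alpha>) (0, xx ?\<beta>) = (- fs (eps a \<alpha>) (hh (a + \<alpha>) + hh \<alpha>), 0)"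
    unfolding S.br2_def fst_conv snd_conv by simp
  have "ip (a + \<alpha>) \<alpha> = 1" using r(2) ip_root_self[OF r(1)] by (simp only: ip_rules)
  then have f: "ff (a + \<alpha> + \<alpha>) (a + \<alpha> + \<alpha>) = 3"
    using roots_ff[OF r(1)] roots_ff[OF o(5)] ff_add_self[of "a + \<alpha>" \<alpha>] by linarith
  have "hh (a + \<alpha> + \<alpha>) \<noteq> 0"
    by (rule hh_nonzero) (use lattice_closed(2)[OF roots_lattice[OF o(5)] roots_lattice[OF r(1)]] in \<open>unfold f, simp_all\<close>)
  then show "hh (a + \<alpha>) + hh \<alpha> \<noteq> 0" unfolding hh_rules(1)[of "a + \<alpha>" \<alpha>] .
qed

lemma canon_partner:
  assumes "canon \<alpha>"
  obtains (single) "\<alpha> \<in> roots" "ip a1 \<alpha> = 0" "ip a2 \<alpha> = 0" "rep \<alpha> = (xx \<alpha>, 0)"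
  | (four) "\<alpha> \<in> roots" "ip a1 \<alpha> = 1" "ip a2 \<alpha> = -1" "rep \<alpha> = (sg \<alpha>, 0)"
  | (odd) a a' where "partners a a'" "\<alpha> \<in> roots" "ip a \<alpha> = -1" "ip a' \<alpha> = 0"
  using assms
proof (cases rule: canon_cases)
  case single
  then show ?thesis using that(1) by blast
next
  case four
  then show ?thesis using that(2) by blast
next
  case odd1
  then show ?thesis using that(3)[of a1 a2] by (simp add: partners_def)
next
  case odd2
  then show ?thesis using that(3)[of a2 a1] by (simp add: partners_def)
qed

text \<open>The partner comes from the negated string. The bracket has weight 0 and is a nonzero
  coroot because the relevant half norms are 1 for a single root, 2 for a string of four and 3 for
  an odd one.\<close>

lemma nondegenerate_canon:
  assumes "canon \<alpha>"
  shows "\<exists>z\<in>Gs (- \<phi> \<alpha>). S.br2 z (rep \<alpha>) \<noteq> 0"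
  using assms
proof (cases rule: canon_partner)
  case single
  have r: "- \<alpha> \<in> roots" by (rule root_uminus[OF single(1)])
  have c: "canon (- \<alpha>)" unfolding canon_def using r single by (simp add: ip_rules)
  have z: "rep (- \<alpha>) = (xx (- \<alpha>), 0)" unfolding rep_def gr_eq using single by (simp add: ip_rules)
  have "S.br2 (rep (- \<alpha>)) (rep \<alpha>) = (hh \<alpha>, 0)"
    unfolding z single(4) S.br2_def fst_conv snd_conv using br_xx_neg[OF r] by (simp add: hh_rules)
  then have "S.br2 (rep (- \<alpha>)) (rep \<alpha>) \<noteq> 0" using hh_root_nonzero[OF single(1)] by (simp add: prod_eq_iff)
  then show ?thesis using rep_Gs[OF c] unfolding phi_rules by blast
next
  case four
  note t = tw_props[OF four(1-3)]
  \<comment> \<open>The partner is built on \<open>- ?\<tau>\<close> and not on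
    \<open>- \<alpha>\<close>, since it is \<open>- ?\<tau>\<close> that has pairings (1, -1). As
    \<open>tw (- ?\<tau>)\<close> is \<open>- \<alpha>\<close>, its vector involves the negatives of
    the two roots of \<open>sg \<alpha>\<close>.\<close>
  let ?\<tau> = "tw \<alpha>"
  have r: "- ?\<tau> \<in> roots" "- \<alpha> \<in> roots" by (rule root_uminus[OF t(1)]) (rule root_uminus[OF four(1)])
  have i: "ip a1 (- ?\<tau>) = 1" "ip a2 (- ?\<tau>) = -1" unfolding ip_rules(6) t by simp_all
  have c: "canon (- ?\<tau>)" unfolding canon_def i using r(1) by simp
  have z: "rep (- ?\<tau>) = (sg (- ?\<tau>), 0)" unfolding rep_def gr_eq i by simp
  have w: "tw (- ?\<tau>) = - \<alpha>" by simp
  define p q u v where "p = (eps a1 (- \<alpha>) :: 'k)" and "q = (eps a2 (- ?\<tau>) :: 'k)"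
    and "u = (eps a1 ?\<tau> :: 'k)" and "v = (eps a2 \<alpha> :: 'k)"
  have pm: "p = 1 \<or> p = -1" "q = 1 \<or> q = -1" "u = 1 \<or> u = -1" "v = 1 \<or> v = -1"
    unfolding p_def q_def u_def v_def eps_def by auto
  have s: "sg (- ?\<tau>) = fs p (xx (- ?\<tau>)) - fs q (xx (- \<alpha>))" "sg \<alpha> = fs u (xx \<alpha>) - fs v (xx ?\<tau>)"
    unfolding sg_def w p_def q_def u_def v_def by (rule refl)+
  have ip0: "ip (- ?\<tau>) \<alpha> = 0" "ip (- \<alpha>) ?\<tau> = 0" using t(4) ip_commute[of ?\<tau> \<alpha>] unfolding ip_rules(5) by linarith+
  have b: "br (xx (- ?\<tau>)) (xx \<alpha>) = 0" "br (xx (- \<alpha>)) (xx ?\<tau>) = 0"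
    by (rule br_xx_xx_zero[OF r(1) four(1)]; unfold ip0; simp) (rule br_xx_xx_zero[OF r(2) t(1)]; unfold ip0; simp)
  have b': "br (xx (- ?\<tau>)) (xx ?\<tau>) = hh ?\<tau>" "br (xx (- \<alpha>)) (xx \<alpha>) = hh \<alpha>"
    using br_xx_neg[OF r(1)] br_xx_neg[OF r(2)] unfolding minus_minus hh_rules(3) by simp_all
  have e: "br (sg (- ?\<tau>)) (sg \<alpha>) = - (fs (p * v) (hh ?\<tau>) + fs (q * u) (hh \<alpha>))"
    unfolding s L.m_diff_left L.m_diff_right L.m_scale_left L.m_scale_right b b'
    by (simp add: mult.commute[of u q] mult.commute[of v p])
  \<comment> \<open>The coefficients are signs, so up to sign the bracket is the coroot of the sum
    or of the difference. The two roots are orthogonal, so both vectors have half norm 2.\<close>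
  have f: "ff (?\<tau> + \<alpha>) (?\<tau> + \<alpha>) = 2" "ff (?\<tau> - \<alpha>) (?\<tau> - \<alpha>) = 2"
    using roots_ff[OF t(1)] roots_ff[OF four(1)] t(4) ip_commute[of ?\<tau> \<alpha>] ff_add_self[of ?\<tau> \<alpha>] ff_diff_self[of ?\<tau> \<alpha>] by linarith+
  note l = lattice_closed(2,3)[OF roots_lattice[OF t(1)] roots_lattice[OF four(1)]]
  have h: "hh (?\<tau> + \<alpha>) \<noteq> 0" "hh (?\<tau> - \<alpha>) \<noteq> 0"
    by (rule hh_nonzero[OF l(1)], unfold f, simp) (rule hh_nonzero[OF l(2)], unfold f, simp)
  have "fs (p * v) (hh ?\<tau>) + fs (q * u) (hh \<alpha>) \<noteq> 0"
  proof
    assume z: "fs (p * v) (hh ?\<tau>) + fs (q * u) (hh \<alpha>) = 0"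
    have k: "p * v = 1 \<or> p * v = -1" "q * u = 1 \<or> q * u = -1" using pm by auto
    have fe: "fs (-1) f = - f" "fs 1 f = f" for f :: "basis_index \<Rightarrow> 'k" by (simp_all add: fun_eq_iff)
    have z': "- f + g = - (f - g)" "f + - g = f - g" "- f - g = - (f + g)" for f g :: "basis_index \<Rightarrow> 'k"
      by simp_all
    have "hh ?\<tau> + hh \<alpha> = 0 \<or> hh ?\<tau> - hh \<alpha> = 0"
      using k(1)
    proof
      assume 1: "p * v = 1"
      from k(2) show ?thesis by (rule disjE) (use z in \<open>simp_all only: 1 fe z' neg_equal_0_iff_equal simp_thms\<close>)
    next
      assume 1: "p * v = -1"
      from k(2) show ?thesis by (rule disjE) (use z in \<open>simp_all only: 1 fe z' neg_equal_0_iff_equal simp_thms\<close>)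
    qed
    then show False using h unfolding hh_rules by blast
  qed
  note nz = this
  have e2: "S.br2 (rep (- ?\<tau>)) (rep \<alpha>) = (- (fs (p * v) (hh ?\<tau>) + fs (q * u) (hh \<alpha>)), 0)"
    unfolding z four(4) S.br2_def fst_conv snd_conv e by simp
  have "S.br2 (rep (- ?\<tau>)) (rep \<alpha>) \<noteq> 0"
    using nz unfolding e2 zero_prod_def prod.inject neg_equal_0_iff_equal by blast
  moreover have "\<phi> (- ?\<tau>) = - \<phi> \<alpha>" unfolding phi_rules(2) t(5) ..
  ultimately show ?thesis using rep_Gs[OF c] by (intro bexI[of _ "rep (- ?\<tau>)"]) simp_all
next
  case (odd a a')
  note o = odd_props[OF odd] and b = odd_bracket[OF odd]
  note o' = odd_props[OF odd(1) b(1-3)] and b' = odd_bracket[OF odd(1) b(1-3)]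
  have e: "- (- \<alpha> - a) - a = \<alpha>" by simp
  have "S.br2 (rep (- \<alpha> - a)) (rep \<alpha>) \<noteq> 0"
  proof -
    have "(eps a (- \<alpha> - a) :: 'k) \<noteq> 0" by (rule eps_nonzero)
    then show ?thesis using b'(5) unfolding o(3) o'(3) b'(4)[unfolded e] prod_eq_iff fst_conv fst_zero neg_equal_0_iff_equal L.scale_eq_0_iff by blast
  qed
  moreover have "\<phi> (- \<alpha> - a) = - \<phi> \<alpha>" unfolding phi_rules partners_props(5)[OF odd(1)] by simp
  ultimately show ?thesis using rep_Gs[OF o'(2)] by (intro bexI[of _ "rep (- \<alpha> - a)"]) simp_all
qed

lemma Gs_nondegenerate:
  assumes "y \<in> Gs \<gamma>" "y \<noteq> 0" "\<gamma> \<noteq> 0"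
  shows "\<exists>z\<in>Gs (- \<gamma>). S.br2 z y \<noteq> 0"
proof -
  obtain \<alpha> where a: "canon \<alpha>" "\<phi> \<alpha> = \<gamma>" by (rule Gs_canon[OF assms])
  obtain k where k: "y = S.scale2 k (rep \<alpha>)" using Gs_one_dimensional[OF a(1)] assms(1) unfolding a(2) by blast
  have "k \<noteq> 0" using assms(2) unfolding k by (auto simp: S.scale2_def prod_eq_iff fun_eq_iff)
  obtain z where z: "z \<in> Gs (- \<gamma>)" "S.br2 z (rep \<alpha>) \<noteq> 0" using nondegenerate_canon[OF a(1)] unfolding a(2) by blast
  have "S.br2 z y \<noteq> 0" unfolding k S.pair.m_scale_right S.pair.scale_eq_0_iff using z(2) \<open>k \<noteq> 0\<close> by blast
  then show ?thesis using z(1) by blast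
qed

text \<open>Weight spaces are lines, so any nonzero vector of the right weight in \<open>W\<close>
  yields the representative, whatever the scalar is.\<close>

lemma Gs_subset_of_nonzero:
  assumes "canon \<alpha>" "S.pair.subspace W" "z \<in> W" "z \<in> Gs (\<phi> \<alpha>)" "z \<noteq> 0"
  shows "rep \<alpha> \<in> W"
proof -
  obtain k where k: "z = S.scale2 k (rep \<alpha>)" using Gs_one_dimensional[OF assms(1,4)] by blast
  have "k \<noteq> 0" using assms(5) unfolding k by (auto simp: S.scale2_def prod_eq_iff fun_eq_iff)
  then have "rep \<alpha> = S.scale2 (inverse k) z" unfolding k S.pair.scale_scale by simp
  then show ?thesis using S.pair.subspace_scale[OF assms(2,3)] by metis
qed

lemma Gs_independent:
  assumes "finite S" "\<And>q. q \<in> S \<Longrightarrow> cf q \<in> Gs q" "sum cf S = 0" "q \<in> S"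
  shows "cf q = 0"
proof -
  have "fst (cf q) = 0"
    by (rule supported_independent[OF assms(1), of "\<lambda>q. fst (cf q)" \<phi>])
      (use assms in \<open>auto simp: Gs_def simp flip: fst_sum\<close>)
  moreover have "snd (cf q) = 0"
    by (rule supported_independent[OF assms(1), of "\<lambda>q. snd (cf q)" \<phi>])
      (use assms in \<open>auto simp: Gs_def simp flip: snd_sum\<close>)
  ultimately show ?thesis by (simp add: prod_eq_iff)
qed

text \<open>Decompose by projected degree. Each component of nonzero degree is a multiple of a
  representative. In degree 0 no root of weight 0 or -1 can occur, so what is left is a Cartan
  element killed by \<open>dd\<close>.\<close>

lemma pair_span:
  assumes W: "S.pair.subspace W" "\<And>\<alpha>. canon \<alpha> \<Longrightarrow> rep \<alpha> \<in> W"
    "\<And>h. \<lbrakk>h \<in> VL; \<And>\<alpha>. h (XB \<alpha>) = 0; dd h = 0\<rbrakk> \<Longrightarrow> (h, 0) \<in> W"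
  shows "S.even_space \<times> S.odd_space \<subseteq> W"
proof
  fix y assume y: "y \<in> S.even_space \<times> S.odd_space"
  obtain x u where xu: "y = (x, u)" by (cases y)
  have h: "x \<in> supported gr 0" "u \<in> supported gr (-1)" "dd x = 0"
    using y unfolding xu S.even_space_def homog_eq by blast+
  have V: "x \<in> VL" "u \<in> VL" using h supported_VL by blast+
  define z where "z \<gamma> = (proj \<phi> \<gamma> x, proj \<phi> \<gamma> u)" for \<gamma>
  have g: "proj \<phi> \<gamma> f \<in> supported gr j" if "f \<in> supported gr j" for \<gamma> j f
    using that by (auto simp: supported_def proj_def VL_def)
  \<comment> \<open>\<open>ee\<close> has projected degree 0, so \<open>dd\<close> commutes with the
    projections.\<close>
  have dz: "dd (proj \<phi> \<gamma> x) = 0" for \<gamma>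
  proof -
    have "dd (proj \<phi> \<gamma> x) = proj \<phi> \<gamma> (dd x)"
      using br_proj[OF phi_add ee_phi V(1)] by simp
    then show ?thesis unfolding h(3) by (simp add: proj_def fun_eq_iff)
  qed
  have zG: "z \<gamma> \<in> Gs \<gamma>" for \<gamma>
    unfolding z_def Gs_def S.even_space_def homog_eq using g[OF h(1)] g[OF h(2)] dz proj_supported[OF V(1), of \<phi>] proj_supported[OF V(2), of \<phi>]
    by simp
  have zW: "z \<gamma> \<in> W" for \<gamma>
  proof (cases "\<gamma> = 0 \<or> z \<gamma> = 0")
    case False
    then obtain \<alpha> where a: "canon \<alpha>" "\<phi> \<alpha> = \<gamma>" using Gs_canon[OF zG] by metis
    obtain k where "z \<gamma> = S.scale2 k (rep \<alpha>)" using Gs_one_dimensional[OF a(1)] zG unfolding a(2)[symmetric] by blast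
    then show ?thesis using S.pair.subspace_scale[OF W(1) W(2)[OF a(1)]] by metis
  next
    case True
    show ?thesis
    proof (cases "z \<gamma> = 0")
      case True
      then show ?thesis using S.pair.subspace_0[OF W(1)] by metis
    next
      case False
      then have g0: "\<gamma> = 0" using True by blast
      have nz: "\<alpha> \<in> roots \<and> gr \<alpha> = j" if f: "f \<in> supported gr j" "f (XB \<alpha>) \<noteq> 0" for f j \<alpha>
        using f unfolding supported_def VL_def Bs_def deg_def by force
      have x0: "proj \<phi> 0 x (XB \<alpha>) = 0" for \<alpha>
        using nz[OF h(1), of \<alpha>] phi_nonzero[of \<alpha>] by (auto simp: proj_def deg_def)
      have "proj \<phi> 0 u b = 0" for b
      proof (cases b)
        case (XB \<alpha>)
        show ?thesis unfolding XB using nz[OF h(2), of \<alpha>] phi_nonzero[of \<alpha>] by (auto simp: proj_def deg_def)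
      next
        case (HB i)
        have "u b = 0"
        proof (rule ccontr)
          assume "u b \<noteq> 0"
          then have "deg gr b = -1" using h(2) unfolding supported_def by blast
          then show False unfolding HB deg_def by simp
        qed
        then show ?thesis by (simp add: proj_def)
      qed
      then have "proj \<phi> 0 u = 0" by (simp add: fun_eq_iff)
      then have "z \<gamma> = (proj \<phi> 0 x, 0)" unfolding z_def g0 by simp
      moreover have "(proj \<phi> 0 x, 0) \<in> W"
        by (rule W(3)[OF supported_VL[OF g[OF h(1)]] x0 dz])
      ultimately show ?thesis by simp
    qed
  qed
  have "x = (\<Sum>\<gamma>\<in>deg \<phi> ` Bs. proj \<phi> \<gamma> x)" "u = (\<Sum>\<gamma>\<in>deg \<phi> ` Bs. proj \<phi> \<gamma> u)"
    by (rule proj_sum[OF V(1)]; simp add: finite_Bs) (rule proj_sum[OF V(2)]; simp add: finite_Bs)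
  then have "y = (\<Sum>\<gamma>\<in>deg \<phi> ` Bs. z \<gamma>)"
    unfolding xu z_def by (intro prod_eqI) (simp_all only: fst_sum snd_sum fst_conv snd_conv)
  then show "y \<in> W" using S.pair.subspace_sum[OF W(1), of "deg \<phi> ` Bs" z] zW by metis
qed

end

section \<open>Generation by descent\<close>

context projected_pair
begin

text \<open>Nonzero brackets are recognised by one root coordinate, here and in the two lemmas that
  follow. If the roots are opposite, the bracket is a coroot and has no root coordinate at
  all.\<close>

lemma br_xx_coeff:
  assumes "\<beta> \<in> roots" "\<gamma> \<in> roots" "\<alpha> \<in> roots"
  shows "br (xx \<beta>) (xx \<gamma>) (XB \<alpha>) = (if \<beta> + \<gamma> = \<alpha> then eps \<beta> \<gamma> else 0)"
proof (cases "\<beta> + \<gamma> = 0")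
  case True
  have "\<alpha> \<noteq> 0" using assms(3) zero_not_root by metis
  then show ?thesis unfolding br_xx_xx[OF assms(1,2)] True by (simp add: hh_def)
next
  case False
  then show ?thesis unfolding br_xx_xx[OF assms(1,2)] using assms(3) by (simp add: xx_apply)
qed

lemma br_sg_coeff:
  assumes "b \<in> roots" "\<delta> \<in> roots" "ip a1 \<delta> = 1" "ip a2 \<delta> = -1" "\<alpha> \<in> roots"
  shows "br (xx b) (sg \<delta>) (XB \<alpha>) = eps a1 (tw \<delta>) * (if b + \<delta> = \<alpha> then eps b \<delta> else 0) -
    eps a2 \<delta> * (if b + tw \<delta> = \<alpha> then eps b (tw \<delta>) else 0)"
  unfolding sg_def L.m_diff_right L.m_scale_right minus_apply fs_apply
    br_xx_coeff[OF assms(1,2,5)] br_xx_coeff[OF assms(1) tw_props(1)[OF assms(2-4)] assms(5)] ..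

lemma br_odd_coeff:
  assumes "partners a a'" "\<beta> \<in> roots" "ip a \<beta> = -1" "ip a' \<beta> = 0"
    and "partners c c'" "\<delta> \<in> roots" "ip c \<delta> = -1" "ip c' \<delta> = 0" and "\<alpha> \<in> roots"
  shows "fst (S.br2 (rep \<beta>) (rep \<delta>)) (XB \<alpha>) = eps a \<beta> * (if a + \<beta> + \<delta> = \<alpha> then eps (a + \<beta>) \<delta> else 0) -
    eps c \<delta> * (if \<beta> + (c + \<delta>) = \<alpha> then eps \<beta> (c + \<delta>) else 0)"
proof -
  note o = odd_props[OF assms(1-4)] and o' = odd_props[OF assms(5-8)]
  show ?thesis
    unfolding o(3) o'(3) S.br2_def fst_conv snd_conv o(4) o'(4) L.m_scale_left L.m_scale_right L.m_zero_left add_0_left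
      minus_apply fs_apply br_xx_coeff[OF o(5) assms(6,9)] br_xx_coeff[OF assms(2) o'(5) assms(9)] ..
qed

lemma coeff_nonzero: "fst z b \<noteq> 0 \<Longrightarrow> z \<noteq> 0" "snd z b \<noteq> 0 \<Longrightarrow> z \<noteq> 0" for z :: "(basis_index \<Rightarrow> 'k) \<times> (basis_index \<Rightarrow> 'k)"
  by auto

text \<open>The canonical types without (1, -1). Projected simple roots and their negatives are of
  these types, so the first factor of a bracket is always a single root vector.\<close>

definition generating :: "(nat \<Rightarrow> int) \<Rightarrow> bool" where
  "generating b \<longleftrightarrow> b \<in> roots \<and> (ip a1 b, ip a2 b) \<in> {(0, 0), (-1, 0), (0, -1)}"

text \<open>One step of the induction: the weight of \<open>\<alpha>\<close> is that of
  \<open>b\<close>, or the weight vector is, up to a nonzero scalar, a bracket of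
  \<open>rep b\<close> with a representative of smaller height.\<close>

definition descends :: "(nat \<Rightarrow> int) \<Rightarrow> (nat \<Rightarrow> int) \<Rightarrow> bool" where
  "descends \<alpha> b \<longleftrightarrow> \<phi> b = \<phi> \<alpha> \<or> (\<exists>\<delta>. canon \<delta> \<and> \<phi> \<delta> = \<phi> \<alpha> - \<phi> b \<and> S.br2 (rep b) (rep \<delta>) \<noteq> 0)"

lemma descendsI: "\<lbrakk>canon \<delta>; \<phi> \<delta> = \<phi> \<alpha> - \<phi> b; S.br2 (rep b) (rep \<delta>) \<noteq> 0\<rbrakk> \<Longrightarrow> descends \<alpha> b"
  unfolding descends_def by blast

lemma generating_cases:
  assumes "generating b"
  obtains (even) "b \<in> roots" "ip a1 b = 0" "ip a2 b = 0" "rep b = (xx b, 0)"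
  | (odd) c c' where "partners c c'" "b \<in> roots" "ip c b = -1" "ip c' b = 0"
proof -
  have r: "b \<in> roots" and cs: "(ip a1 b = 0 \<and> ip a2 b = 0) \<or> (ip a1 b = -1 \<and> ip a2 b = 0) \<or> (ip a1 b = 0 \<and> ip a2 b = -1)"
    using assms unfolding generating_def by auto
  from cs show ?thesis
  proof (elim disjE conjE)
    assume i: "ip a1 b = 0" "ip a2 b = 0"
    then have "rep b = (xx b, 0)" unfolding rep_def gr_eq by simp
    then show ?thesis using that(1) r i by blast
  next
    assume "ip a1 b = -1" "ip a2 b = 0"
    then show ?thesis using that(2)[of a1 a2] r by (simp add: partners_def)
  next
    assume "ip a1 b = 0" "ip a2 b = -1"
    then show ?thesis using that(2)[of a2 a1] r by (simp add: partners_def)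
  qed
qed

lemma ip_one_or_eq: "\<lbrakk>\<alpha> \<in> roots; b \<in> roots; 0 < ip \<alpha> b\<rbrakk> \<Longrightarrow> b = \<alpha> \<or> (ip \<alpha> b = 1 \<and> ip b \<alpha> = 1 \<and> \<alpha> - b \<in> roots)"
  using root_pair(1,3,5)[of \<alpha> b] ip_commute[of b \<alpha>] by fastforce

lemma even_coeff: "fst (S.br2 (x, 0) (y, 0)) = br x y" "snd (S.br2 (x, 0) (0, v)) = br x v" "snd (S.br2 (0, u) (y, 0)) = br u y"
  unfolding S.br2_def by simp_all

lemma single_rep: "\<lbrakk>\<alpha> \<in> roots; ip a1 \<alpha> = 0; ip a2 \<alpha> = 0\<rbrakk> \<Longrightarrow> canon \<alpha> \<and> rep \<alpha> = (xx \<alpha>, 0)"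
  and four_rep: "\<lbrakk>\<alpha> \<in> roots; ip a1 \<alpha> = 1; ip a2 \<alpha> = -1\<rbrakk> \<Longrightarrow> canon \<alpha> \<and> rep \<alpha> = (sg \<alpha>, 0)"
  unfolding canon_def rep_def gr_eq by simp_all

lemma partners_swap: "partners a a' \<Longrightarrow> partners a' a"
  and partners_cases: "\<lbrakk>partners a a'; partners c c'\<rbrakk> \<Longrightarrow> (c = a \<and> c' = a') \<or> (c = a' \<and> c' = a)"
  and partners_single: "\<lbrakk>partners a a'; ip a1 v = 0; ip a2 v = 0\<rbrakk> \<Longrightarrow> ip a v = 0 \<and> ip a' v = 0"
    "\<lbrakk>partners a a'; ip a v = 0; ip a' v = 0\<rbrakk> \<Longrightarrow> ip a1 v = 0 \<and> ip a2 v = 0"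
  unfolding partners_def by auto

text \<open>A positive pairing makes \<open>\<alpha> - b\<close> a root. For even \<open>b\<close>
  it is again orthogonal to both roots; for odd \<open>b\<close> it has weight 1 and has to be
  shifted down to its representative.\<close>

lemma descend_single:
  assumes a: "\<alpha> \<in> roots" "ip a1 \<alpha> = 0" "ip a2 \<alpha> = 0" and g: "generating b" and pos: "0 < ip \<alpha> b"
  shows "descends \<alpha> b"
proof -
  have b: "b \<in> roots" using g unfolding generating_def by blast
  show ?thesis
  proof (cases "b = \<alpha>")
    case True
    then show ?thesis unfolding descends_def by simp
  next
    case False
    then have w: "ip b \<alpha> = 1" "\<alpha> - b \<in> roots" using ip_one_or_eq[OF a(1) b pos] by blast+
    let ?w = "\<alpha> - b"
    from g show ?thesis
    proof (cases rule: generating_cases)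
      case even
      have r: "canon ?w" "rep ?w = (xx ?w, 0)" using single_rep[OF w(2)] a even by (simp_all add: ip_rules)
      have "fst (S.br2 (rep b) (rep ?w)) (XB \<alpha>) = eps b ?w"
        unfolding even(4) r(2) even_coeff br_xx_coeff[OF b w(2) a(1)] by simp
      then have "S.br2 (rep b) (rep ?w) \<noteq> 0" using eps_nonzero[of b ?w] coeff_nonzero(1) by metis
      then show ?thesis by (intro descendsI[OF r(1)]) (simp add: phi_rules)
    next
      case (odd c c')
      note pp = partners_props[OF odd(1)]
      have i: "ip c \<alpha> = 0" "ip c' \<alpha> = 0" using partners_single(1)[OF odd(1) a(2,3)] by blast+
      \<comment> \<open>\<open>?w\<close> pairs to 1 with \<open>c\<close>; subtracting
        \<open>c\<close> keeps the projection and reaches weight -1.\<close>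
      let ?\<delta> = "?w - c"
      have j: "ip c ?w = 1" "ip c' ?w = 0" unfolding ip_rules(4) i odd(3,4) by simp_all
      have "ip ?w c = 1" using j(1) ip_commute[of ?w c] by simp
      then have r: "?\<delta> \<in> roots" using root_pair(5)[OF w(2) pp(1)] by blast
      have k: "ip c ?\<delta> = -1" "ip c' ?\<delta> = 0" unfolding ip_rules(4)[of _ ?w c] j pp by simp_all
      have e1: "c + b + ?\<delta> = \<alpha>" "b + (c + ?\<delta>) = \<alpha>" by (simp_all add: algebra_simps)
      \<comment> \<open>Both terms of the odd bracket land on \<open>\<alpha>\<close>. Because
        \<open>b\<close> and \<open>c\<close> pair to -1, exchanging them changes the sign, so the
        terms add up to twice a sign instead of cancelling.\<close>
      have sw: "eps b c = (- eps c b :: 'k)" by (rule eps_minus_one[OF odd(3)])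
      have "fst (S.br2 (rep b) (rep ?\<delta>)) (XB \<alpha>) = eps c b * eps (c + b) ?\<delta> - eps c ?\<delta> * eps b (c + ?\<delta>)"
        unfolding br_odd_coeff[OF odd odd(1) r k a(1)] e1 by simp
      also have "\<dots> = 2 * (eps c b * eps c ?\<delta> * eps b ?\<delta>)"
        unfolding eps_rules(1)[of c b ?\<delta>] eps_rules(2)[of b c ?\<delta>] sw by (simp only: algebra_simps) simp
      finally have "fst (S.br2 (rep b) (rep ?\<delta>)) (XB \<alpha>) \<noteq> 0"
        using S.two_neq_zero by (simp only: mult_eq_0_iff eps_nonzero simp_thms) 
      then show ?thesis
        by (intro descendsI[OF odd_props(2)[OF odd(1) r k] _ coeff_nonzero(1)]) (simp_all add: phi_rules pp(5))
    qed
  qed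
qed

text \<open>The hypothesis is positivity against \<open>2 \<alpha> + a\<close>. As \<open>b\<close>
  does not pair positively with \<open>a\<close>, already \<open>ip \<alpha> b\<close> is positive
  and \<open>\<alpha> - b\<close> is a root. It is odd if \<open>b\<close> is even, orthogonal to
  both roots if \<open>b\<close> is attached to the same root, and part of a string of four if
  \<open>b\<close> is attached to the other.\<close>

lemma descend_odd:
  assumes p: "partners a a'" and a: "\<alpha> \<in> roots" "ip a \<alpha> = -1" "ip a' \<alpha> = 0" and g: "generating b"
    and pos: "0 < 2 * ip \<alpha> b + ip a b"
  shows "descends \<alpha> b"
proof -
  have b: "b \<in> roots" using g unfolding generating_def by blast
  note o = odd_props[OF p a]
  show ?thesis
  proof (cases "b = \<alpha>")
    case True
    then show ?thesis unfolding descends_def by simp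
  next
    case False
    have ab: "ip a b \<le> 0" using g p unfolding generating_def partners_def by auto
    then have "0 < ip \<alpha> b" using pos by linarith
    then have w: "ip b \<alpha> = 1" "\<alpha> - b \<in> roots" using ip_one_or_eq[OF a(1) b] False by blast+
    let ?w = "\<alpha> - b"
    have bw: "b + ?w = \<alpha>" by simp
    from g show ?thesis
    proof (cases rule: generating_cases)
      case even
      have "ip a b = 0" "ip a' b = 0" using partners_single(1)[OF p even(2,3)] by blast+
      then have i: "ip a ?w = -1" "ip a' ?w = 0" unfolding ip_rules a by simp_all
      note o' = odd_props[OF p w(2) i]
      have "snd (S.br2 (rep b) (rep ?w)) (XB \<alpha>) = eps b ?w"
        unfolding even(4) o'(3) even_coeff br_xx_coeff[OF b w(2) a(1)] by simp
      then have "S.br2 (rep b) (rep ?w) \<noteq> 0" using eps_nonzero[of b ?w] coeff_nonzero(2) by metis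
      then show ?thesis by (intro descendsI[OF o'(2)]) (simp add: phi_rules)
    next
      case (odd c c')
      note ob = odd_props[OF odd]
      from partners_cases[OF p odd(1)] show ?thesis
      proof (elim disjE conjE)
        assume c: "c = a" "c' = a'"
        have "ip a ?w = 0" "ip a' ?w = 0" using odd(3,4) unfolding ip_rules a c by simp_all
        then have i: "ip a1 ?w = 0" "ip a2 ?w = 0" using partners_single(2)[OF p] by blast+
        have r: "canon ?w" "rep ?w = (xx ?w, 0)" using single_rep[OF w(2) i] by blast+
        have "snd (S.br2 (rep b) (rep ?w)) (XB \<alpha>) = eps b ?w"
          unfolding ob(3) r(2) even_coeff br_xx_coeff[OF b w(2) a(1)] by simp
        then have "S.br2 (rep b) (rep ?w) \<noteq> 0" using eps_nonzero[of b ?w] coeff_nonzero(2) by metis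
        then show ?thesis by (intro descendsI[OF r(1)]) (simp add: phi_rules)
      next
        assume c: "c = a'" "c' = a"
        have i: "ip a ?w = -1" "ip a' ?w = 1" using odd(3,4) unfolding ip_rules a c by simp_all
        \<comment> \<open>The operation \<open>tw\<close> is not symmetric in the two roots: in one
          order \<open>?w\<close> is the twisted member of its string, in the other it is the
          representative.\<close>
        from p consider "a = a1" "a' = a2" | "a = a2" "a' = a1" unfolding partners_def by auto
        then show ?thesis
        proof cases
          case 1
          obtain \<delta> where d: "\<delta> \<in> roots" "ip a1 \<delta> = 1" "ip a2 \<delta> = -1" "?w = tw \<delta>" "\<phi> \<delta> = \<phi> ?w" "\<delta> = ?w + a1 - a2"
            by (rule untwist[OF w(2) i[unfolded 1]])
          have r: "canon \<delta>" "rep \<delta> = (sg \<delta>, 0)" using four_rep[OF d(1-3)] by blast+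
          have n: "b + \<delta> \<noteq> \<alpha>"
          proof
            assume "b + \<delta> = \<alpha>"
            then have "\<delta> = ?w" by (metis add_diff_cancel_left')
            then show False using tw_props(7)[OF d(1-3)] unfolding d(4)[symmetric] by metis
          qed
          have "snd (S.br2 (rep b) (rep \<delta>)) (XB \<alpha>) = - (eps a2 \<delta> * eps b ?w)"
            unfolding ob(3) r(2) even_coeff br_sg_coeff[OF b d(1-3) a(1)] d(4)[symmetric] if_not_P[OF n] if_P[OF bw] by simp
          then have "snd (S.br2 (rep b) (rep \<delta>)) (XB \<alpha>) \<noteq> 0" by (simp only: neg_equal_0_iff_equal mult_eq_0_iff eps_nonzero simp_thms)
          then show ?thesis by (intro descendsI[OF r(1) _ coeff_nonzero(2)]) (simp_all only: phi_rules d(5))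
        next
          case 2
          have d: "ip a1 ?w = 1" "ip a2 ?w = -1" using i unfolding 2 by blast+
          have r: "canon ?w" "rep ?w = (sg ?w, 0)" using four_rep[OF w(2) d] by blast+
          have n: "b + tw ?w \<noteq> \<alpha>" using tw_props(7)[OF w(2) d] bw by (metis add_left_cancel)
          have "snd (S.br2 (rep b) (rep ?w)) (XB \<alpha>) = eps a1 (tw ?w) * eps b ?w"
            unfolding ob(3) r(2) even_coeff br_sg_coeff[OF b w(2) d a(1)] if_P[OF bw] if_not_P[OF n] by simp
          then have "snd (S.br2 (rep b) (rep ?w)) (XB \<alpha>) \<noteq> 0" by (simp only: mult_eq_0_iff eps_nonzero simp_thms)
          then show ?thesis by (intro descendsI[OF r(1) _ coeff_nonzero(2)]) (simp_all add: phi_rules)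
        qed
      qed
    qed
  qed
qed

text \<open>The hypothesis is positivity against \<open>2 \<alpha> - a1 + a2\<close>, the sum of
  \<open>\<alpha>\<close> and \<open>tw \<alpha>\<close>. Depending on the type of \<open>b\<close>,
  the root to be reduced is one or the other of these two.\<close>

lemma descend_four:
  assumes a: "\<alpha> \<in> roots" "ip a1 \<alpha> = 1" "ip a2 \<alpha> = -1" and g: "generating b"
    and pos: "0 < 2 * ip \<alpha> b - ip a1 b + ip a2 b"
  shows "descends \<alpha> b"
proof -
  note t = tw_props[OF a]
  have b: "b \<in> roots" and cs: "(ip a1 b = 0 \<and> ip a2 b = 0) \<or> (ip a1 b = -1 \<and> ip a2 b = 0) \<or> (ip a1 b = 0 \<and> ip a2 b = -1)"
    using g unfolding generating_def by auto
  have ne: "b \<noteq> \<alpha>" "b \<noteq> tw \<alpha>"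
  proof -
    show "b \<noteq> \<alpha>"
    proof
      assume "b = \<alpha>"
      from cs[unfolded this a] show False by simp
    qed
    show "b \<noteq> tw \<alpha>"
    proof
      assume "b = tw \<alpha>"
      from cs[unfolded this t(2,3)] show False by simp
    qed
  qed
  from cs show ?thesis
  proof (elim disjE conjE)
    assume i: "ip a1 b = 0" "ip a2 b = 0"
    then have "0 < ip \<alpha> b" using pos by simp
    then have w: "\<alpha> - b \<in> roots" using ip_one_or_eq[OF a(1) b] ne(1) by blast
    let ?w = "\<alpha> - b"
    have d: "ip a1 ?w = 1" "ip a2 ?w = -1" unfolding ip_rules a i by simp_all
    have r: "canon ?w" "rep ?w = (sg ?w, 0)" using four_rep[OF w d] by blast+
    have rb: "rep b = (xx b, 0)" using single_rep[OF b i] by blast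
    have bw: "b + ?w = \<alpha>" by simp
    have n: "b + tw ?w \<noteq> \<alpha>" using tw_props(7)[OF w d] bw by (metis add_left_cancel)
    have "fst (S.br2 (rep b) (rep ?w)) (XB \<alpha>) = eps a1 (tw ?w) * eps b ?w"
      unfolding rb r(2) even_coeff br_sg_coeff[OF b w d a(1)] if_P[OF bw] if_not_P[OF n] by simp
    then have "fst (S.br2 (rep b) (rep ?w)) (XB \<alpha>) \<noteq> 0" by (simp only: mult_eq_0_iff eps_nonzero simp_thms)
    then show ?thesis by (intro descendsI[OF r(1) _ coeff_nonzero(1)]) (simp_all add: phi_rules)
  next
    \<comment> \<open>Here \<open>ip \<alpha> b\<close> may be 0. The other member
      \<open>tw \<alpha>\<close> pairs with \<open>b\<close> by one more, so it is the one from
      which \<open>b\<close> is subtracted.\<close>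
    assume i: "ip a1 b = -1" "ip a2 b = 0"
    have "ip (tw \<alpha>) b = ip \<alpha> b + 1" unfolding ip_rules i by simp
    moreover have "0 \<le> ip \<alpha> b" using pos i by simp
    ultimately have "0 < ip (tw \<alpha>) b" by linarith
    then have w: "tw \<alpha> - b \<in> roots" using ip_one_or_eq[OF t(1) b] ne(2) by blast
    let ?w = "tw \<alpha> - b"
    have j: "ip a1 ?w = 0" "ip a2 ?w = 1" unfolding ip_rules(4)[of _ "tw \<alpha>" b] t i by simp_all
    have "ip ?w a2 = 1" using j(2) ip_commute[of ?w a2] by simp
    then have r: "?w - a2 \<in> roots" using root_pair(5)[OF w a_roots(2)] by blast
    have p: "partners a1 a2" "partners a2 a1" unfolding partners_def by simp_all
    have k: "ip a2 (?w - a2) = -1" "ip a1 (?w - a2) = 0"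
      unfolding ip_rules(4)[of _ ?w a2] j a_orth ip_root_self[OF a_roots(2)] by simp_all
    have e: "a1 + b + (?w - a2) = \<alpha>" "b + (a2 + (?w - a2)) = tw \<alpha>" by (simp_all add: algebra_simps)
    \<comment> \<open>The two terms of the odd bracket land on different members of the string, so
      they cannot cancel.\<close>
    have "fst (S.br2 (rep b) (rep (?w - a2))) (XB \<alpha>) = eps a1 b * eps (a1 + b) (?w - a2)"
      unfolding br_odd_coeff[OF p(1) b i p(2) r k a(1)] e if_not_P[OF t(7)] by simp
    then have "fst (S.br2 (rep b) (rep (?w - a2))) (XB \<alpha>) \<noteq> 0" by (simp only: mult_eq_0_iff eps_nonzero simp_thms)
    then show ?thesis
      by (intro descendsI[OF odd_props(2)[OF p(2) r k] _ coeff_nonzero(1)]) (simp_all only: phi_rules phi_add phi_a, simp)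
  next
    assume i: "ip a1 b = 0" "ip a2 b = -1"
    then have "0 < ip \<alpha> b" using pos by simp
    then have w: "\<alpha> - b \<in> roots" using ip_one_or_eq[OF a(1) b] ne(1) by blast
    let ?w = "\<alpha> - b"
    have j: "ip a1 ?w = 1" "ip a2 ?w = 0" unfolding ip_rules a i by simp_all
    have "ip ?w a1 = 1" using j(1) ip_commute[of ?w a1] by simp
    then have r: "?w - a1 \<in> roots" using root_pair(5)[OF w a_roots(1)] by blast
    have p: "partners a1 a2" "partners a2 a1" unfolding partners_def by simp_all
    have k: "ip a1 (?w - a1) = -1" "ip a2 (?w - a1) = 0"
      unfolding ip_rules(4)[of _ ?w a1] j a_orth' ip_root_self[OF a_roots(1)] by simp_all
    have e: "a2 + b + (?w - a1) = tw \<alpha>" "b + (a1 + (?w - a1)) = \<alpha>" by (simp_all add: algebra_simps)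
    have "fst (S.br2 (rep b) (rep (?w - a1))) (XB \<alpha>) = - (eps a1 (?w - a1) * eps b (a1 + (?w - a1)))"
      unfolding br_odd_coeff[OF p(2) b i(2,1) p(1) r k a(1)] e if_not_P[OF t(7)] by simp
    then have "fst (S.br2 (rep b) (rep (?w - a1))) (XB \<alpha>) \<noteq> 0"
      by (simp only: neg_equal_0_iff_equal mult_eq_0_iff eps_nonzero simp_thms)
    then show ?thesis
      by (intro descendsI[OF odd_props(2)[OF p(1) r k] _ coeff_nonzero(1)]) (simp_all only: phi_rules phi_a, simp)
  qed
qed

text \<open>The vector \<open>v\<close> is the orthogonal projection of \<open>\<alpha>\<close>, up to a factor, to the complement of \<open>a1\<close> and \<open>a2\<close>;
  it only depends on the image of \<open>\<alpha>\<close> under \<open>\<phi>\<close>.\<close>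

lemma canon_descent:
  assumes "canon \<alpha>"
  obtains v where "ip v a1 = 0" "ip v a2 = 0" "0 < ip v \<alpha>" "\<And>b. \<lbrakk>generating b; 0 < ip v b\<rbrakk> \<Longrightarrow> descends \<alpha> b"
  using assms
proof (cases rule: canon_partner)
  case single
  show ?thesis
    by (rule that[of \<alpha>])
      (use single ip_root_self[OF single(1)] ip_commute[of \<alpha> a1] ip_commute[of \<alpha> a2] descend_single[OF single(1-3)] in simp_all)
next
  case four
  let ?v = "\<alpha> + \<alpha> - a1 + a2"
  have e: "ip ?v w = 2 * ip \<alpha> w - ip a1 w + ip a2 w" for w unfolding ip_rules by simp
  have c: "ip \<alpha> a1 = 1" "ip \<alpha> a2 = -1" using four ip_commute[of \<alpha> a1] ip_commute[of \<alpha> a2] by simp_all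
  show ?thesis
    by (rule that[of ?v]; unfold e c four a_orth a_orth' ip_root_self[OF a_roots(1)] ip_root_self[OF a_roots(2)]
        ip_root_self[OF four(1)]) (simp_all add: descend_four[OF four(1-3)])
next
  case (odd a a')
  note pp = partners_props[OF odd(1)]
  let ?v = "\<alpha> + \<alpha> + a"
  have e: "ip ?v w = 2 * ip \<alpha> w + ip a w" for w unfolding ip_rules by simp
  have c: "ip \<alpha> a = -1" "ip \<alpha> a' = 0" using odd ip_commute[of \<alpha> a] ip_commute[of \<alpha> a'] by simp_all
  have z: "ip ?v a = 0" "ip ?v a' = 0" unfolding e c pp by simp_all
  then have z': "ip ?v a1 = 0" "ip ?v a2 = 0" using odd(1) unfolding partners_def by auto
  have "0 < ip ?v \<alpha>" unfolding e ip_root_self[OF odd(2)] odd by simp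
  then show ?thesis by (rule that[OF z' _ descend_odd[OF odd]]) (unfold e)
qed

text \<open>The induction of \<open>cone_generation\<close> on projected weights. There
  \<open>\<alpha>\<close> is known only modulo \<open>a1\<close> and \<open>a2\<close>, so its own
  pairing is replaced by that with a vector \<open>v\<close> orthogonal to both, and subtraction of
  a root by \<open>descends\<close>.\<close>

lemma cone_generation_pair:
  fixes b :: "nat \<Rightarrow> nat \<Rightarrow> int" and c :: "nat \<Rightarrow> nat"
  assumes W: "S.pair.subspace W" "\<And>x y. \<lbrakk>x \<in> W; y \<in> W\<rbrakk> \<Longrightarrow> S.br2 x y \<in> W"
    and b: "\<And>i. i < N \<Longrightarrow> generating (b i)" "\<And>i. i < N \<Longrightarrow> rep (b i) \<in> W"
  shows "\<lbrakk>canon \<alpha>; \<phi> \<alpha> = \<phi> (\<Sum>i<N. smul (int (c i)) (b i))\<rbrakk> \<Longrightarrow> rep \<alpha> \<in> W"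
proof (induction "\<Sum>i<N. c i" arbitrary: \<alpha> c rule: less_induct)
  case less
  let ?s = "\<lambda>c. \<Sum>i<N. smul (int (c i)) (b i)"
  have bc: "canon (b i)" "b i \<in> roots" if "i < N" for i
    using b(1)[OF that] unfolding generating_def canon_def by auto
  have "\<exists>v. ip v a1 = 0 \<and> ip v a2 = 0 \<and> 0 < ip v \<alpha> \<and> (\<forall>b. generating b \<longrightarrow> 0 < ip v b \<longrightarrow> descends \<alpha> b)"
  proof (rule canon_descent[OF less.prems(1)])
    fix v assume x: "ip v a1 = 0" "ip v a2 = 0" "0 < ip v \<alpha>" "\<And>b. \<lbrakk>generating b; 0 < ip v b\<rbrakk> \<Longrightarrow> descends \<alpha> b"
    show ?thesis by (intro exI[of _ v] conjI allI impI x)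
  qed
  then obtain v where v: "ip v a1 = 0" "ip v a2 = 0" "0 < ip v \<alpha>"
    and desc: "\<forall>b. generating b \<longrightarrow> 0 < ip v b \<longrightarrow> descends \<alpha> b" by (elim exE conjE)
  have "(\<Sum>i\<in>S. smul (int (c i)) (b i)) \<in> lattice" if "finite S" "S \<subseteq> {..<N}" for S
    using that by (induction S rule: finite_induct) (simp_all add: bc(2) roots_lattice)
  then have "?s c \<in> lattice" by simp
  then have "\<alpha> - ?s c \<in> lattice" using roots_lattice[OF canon_root[OF less.prems(1)]] by (intro lattice_closed(3))
  moreover have "\<phi> (\<alpha> - ?s c) = 0" unfolding phi_rules(3) less.prems(2) by simp
  ultimately obtain k l where kl: "\<alpha> - ?s c = smul k a1 + smul l a2" using phi_kernel by blast
  have "ip v (\<alpha> - ?s c) = 0" unfolding kl ip_rules v by simp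
  then have "ip v \<alpha> = (\<Sum>i<N. int (c i) * ip v (b i))"
    using ip_sum_right[of v "\<lambda>i. int (c i)" b "{..<N}"] unfolding ip_rules(4) by linarith
  then have "\<not> (\<forall>i\<in>{..<N}. int (c i) * ip v (b i) \<le> 0)"
    using v(3) sum_nonpos[of "{..<N}" "\<lambda>i. int (c i) * ip v (b i)"] by fastforce
  then obtain i where i: "i < N" "0 < int (c i) * ip v (b i)" by (auto simp: not_le)
  then have ci: "0 < c i" "0 < ip v (b i)" by (simp_all add: zero_less_mult_iff)
  from desc[rule_format, OF b(1)[OF i(1)] ci(2)] consider "\<phi> (b i) = \<phi> \<alpha>" |
    \<delta> where "canon \<delta>" "\<phi> \<delta> = \<phi> \<alpha> - \<phi> (b i)" "S.br2 (rep (b i)) (rep \<delta>) \<noteq> 0"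
    unfolding descends_def by blast
  then show ?case
  proof cases
    case 1
    have "rep (b i) \<noteq> 0"
    proof
      assume "rep (b i) = 0"
      then have "S.br2 z (rep (b i)) = 0" for z by simp
      then show False using nondegenerate_canon[OF bc(1)[OF i(1)]] by blast
    qed
    then show ?thesis
      using Gs_subset_of_nonzero[OF less.prems(1) W(1) b(2)[OF i(1)]] rep_Gs[OF bc(1)[OF i(1)]] 1 by simp
  next
    case (2 \<delta>)
    define c' where "c' = c(i := c i - 1)"
    have lt: "(\<Sum>j<N. c' j) < (\<Sum>j<N. c j)"
      using i(1) ci by (intro sum_strict_mono_ex1) (auto simp: c'_def)
    have eq: "smul (int (c i)) (b i) = smul (int (c' i)) (b i) + b i"
      using ci by (auto simp: c'_def fun_eq_iff of_nat_diff algebra_simps)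
    have "?s c = ?s c' + b i"
      using i(1) eq by (simp add: sum.remove[of "{..<N}" i] c'_def algebra_simps)
    then have "\<phi> \<delta> = \<phi> (?s c')" unfolding 2(2) less.prems(2) by (simp add: phi_add)
    then have "rep \<delta> \<in> W" by (rule less.hyps[OF lt 2(1)])
    then have w: "S.br2 (rep (b i)) (rep \<delta>) \<in> W" by (rule W(2)[OF b(2)[OF i(1)]])
    have "S.br2 (rep (b i)) (rep \<delta>) \<in> Gs (\<phi> \<alpha>)"
      using Gs_mult[OF rep_Gs[OF bc(1)[OF i(1)]] rep_Gs[OF 2(1)]] unfolding 2(2) by simp
    then show ?thesis by (rule Gs_subset_of_nonzero[OF less.prems(1) W(1) w _ 2(3)])
  qed
qed

end

section \<open>The root lattice of type E8\<close>

text \<open>Each edge of the Dynkin diagram is counted in one direction only; symmetrising gives the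
  Cartan matrix.\<close>

definition e8_form :: "(nat \<Rightarrow> int) \<Rightarrow> (nat \<Rightarrow> int) \<Rightarrow> int" where
  "e8_form v w = v 0 * w 0 + v 1 * w 1 + v 2 * w 2 + v 3 * w 3 + v 4 * w 4 + v 5 * w 5 + v 6 * w 6 + v 7 * w 7
    - v 0 * w 2 - v 1 * w 3 - v 2 * w 3 - v 3 * w 4 - v 4 * w 5 - v 5 * w 6 - v 6 * w 7"

text \<open>Squares are completed along the three arms of the diagram from their ends towards the
  branch node 3. The last coefficient is 1 - 1/4 - 1/3 - 2/5 = 1/60, and 120 clears all
  denominators.\<close>

lemma e8_form_squares:
  "120 * e8_form v v = 30 * ((2 * v 0 - v 2) * (2 * v 0 - v 2)) + 10 * ((3 * v 2 - 2 * v 3) * (3 * v 2 - 2 * v 3)) +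
    30 * ((2 * v 1 - v 3) * (2 * v 1 - v 3)) + 30 * ((2 * v 7 - v 6) * (2 * v 7 - v 6)) +
    10 * ((3 * v 6 - 2 * v 5) * (3 * v 6 - 2 * v 5)) + 5 * ((4 * v 5 - 3 * v 4) * (4 * v 5 - 3 * v 4)) +
    3 * ((5 * v 4 - 4 * v 3) * (5 * v 4 - 4 * v 3)) + 2 * (v 3 * v 3)"
  unfolding e8_form_def by (simp add: algebra_simps)

lemma square_bound:
  fixes x m :: int
  assumes "x * x < (m + 1) * (m + 1)" "0 \<le> m"
  shows "- m \<le> x \<and> x \<le> m"
proof (rule ccontr)
  assume "\<not> ?thesis"
  then have "m + 1 \<le> x \<or> m + 1 \<le> - x" by linarith
  then show False
  proof
    assume "m + 1 \<le> x"
    then have "(m + 1) * (m + 1) \<le> x * x" using assms(2) by (intro mult_mono) auto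
    then show False using assms(1) by linarith
  next
    assume "m + 1 \<le> - x"
    then have "(m + 1) * (m + 1) \<le> (- x) * (- x)" using assms(2) by (intro mult_mono) auto
    then show False using assms(1) by simp
  qed
qed

lemma less_8_cases: "i < 8 \<Longrightarrow> i = 0 \<or> i = 1 \<or> i = 2 \<or> i = 3 \<or> i = 4 \<or> i = 5 \<or> i = 6 \<or> i = (7::nat)"
  and less_6_cases: "i < 6 \<Longrightarrow> i = 0 \<or> i = 1 \<or> i = 2 \<or> i = 3 \<or> i = 4 \<or> i = (5::nat)"
  by (auto simp: numeral_eq_Suc less_Suc_eq)

text \<open>A crude bound whose only purpose is the finiteness of the set of roots.\<close>

lemma e8_form_bound:
  assumes "e8_form v v \<le> 1" "i < 8"
  shows "- 7 \<le> v i \<and> v i \<le> 7"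
proof -
  define p0 p1 p2 p4 p5 p6 p7 where "p0 = 2 * v 0 - v 2" and "p1 = 2 * v 1 - v 3" and "p2 = 3 * v 2 - 2 * v 3"
    and "p4 = 5 * v 4 - 4 * v 3" and "p5 = 4 * v 5 - 3 * v 4" and "p6 = 3 * v 6 - 2 * v 5" and "p7 = 2 * v 7 - v 6"
  have s: "30 * (p0 * p0) + 10 * (p2 * p2) + 30 * (p1 * p1) + 30 * (p7 * p7) + 10 * (p6 * p6) + 5 * (p5 * p5) +
      3 * (p4 * p4) + 2 * (v 3 * v 3) \<le> 120"
    using e8_form_squares[of v] assms(1) unfolding p0_def p1_def p2_def p4_def p5_def p6_def p7_def by linarith
  have n: "0 \<le> p0 * p0" "0 \<le> p1 * p1" "0 \<le> p2 * p2" "0 \<le> p4 * p4" "0 \<le> p5 * p5" "0 \<le> p6 * p6" "0 \<le> p7 * p7"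
    "0 \<le> v 3 * v 3" by (rule zero_le_square)+
  \<comment> \<open>Each square is at most 120 divided by its coefficient; the bounds are the next
    larger perfect squares.\<close>
  have b: "v 3 * v 3 < 64" "p4 * p4 < 49" "p5 * p5 < 25" "p6 * p6 < 16" "p7 * p7 < 9" "p1 * p1 < 9" "p2 * p2 < 16" "p0 * p0 < 9"
    using s n by linarith+
  have "- 7 \<le> v 3 \<and> v 3 \<le> 7" "- 6 \<le> p4 \<and> p4 \<le> 6" "- 4 \<le> p5 \<and> p5 \<le> 4" "- 3 \<le> p6 \<and> p6 \<le> 3" "- 2 \<le> p7 \<and> p7 \<le> 2"
    "- 2 \<le> p1 \<and> p1 \<le> 2" "- 3 \<le> p2 \<and> p2 \<le> 3" "- 2 \<le> p0 \<and> p0 \<le> 2"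
    using b by (auto intro!: square_bound)
  then have "- 7 \<le> v 0 \<and> v 0 \<le> 7" "- 7 \<le> v 1 \<and> v 1 \<le> 7" "- 7 \<le> v 2 \<and> v 2 \<le> 7" "- 7 \<le> v 3 \<and> v 3 \<le> 7"
    "- 7 \<le> v 4 \<and> v 4 \<le> 7" "- 7 \<le> v 5 \<and> v 5 \<le> 7" "- 7 \<le> v 6 \<and> v 6 \<le> 7" "- 7 \<le> v 7 \<and> v 7 \<le> 7"
    unfolding p0_def p1_def p2_def p4_def p5_def p6_def p7_def by linarith+
  then show ?thesis using less_8_cases[OF assms(2)] by (elim disjE) simp_all
qed

lemma e8_form_nonpos:
  assumes "e8_form v v \<le> 0" "i < 8"
  shows "v i = 0"
proof -
  define p0 p1 p2 p4 p5 p6 p7 where "p0 = 2 * v 0 - v 2" and "p1 = 2 * v 1 - v 3" and "p2 = 3 * v 2 - 2 * v 3"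
    and "p4 = 5 * v 4 - 4 * v 3" and "p5 = 4 * v 5 - 3 * v 4" and "p6 = 3 * v 6 - 2 * v 5" and "p7 = 2 * v 7 - v 6"
  have s: "30 * (p0 * p0) + 10 * (p2 * p2) + 30 * (p1 * p1) + 30 * (p7 * p7) + 10 * (p6 * p6) + 5 * (p5 * p5) +
      3 * (p4 * p4) + 2 * (v 3 * v 3) \<le> 0"
    using e8_form_squares[of v] assms(1) unfolding p0_def p1_def p2_def p4_def p5_def p6_def p7_def by linarith
  have n: "0 \<le> p0 * p0" "0 \<le> p1 * p1" "0 \<le> p2 * p2" "0 \<le> p4 * p4" "0 \<le> p5 * p5" "0 \<le> p6 * p6" "0 \<le> p7 * p7"
    "0 \<le> v 3 * v 3" by (rule zero_le_square)+
  have "v 3 * v 3 = 0" "p4 * p4 = 0" "p5 * p5 = 0" "p6 * p6 = 0" "p7 * p7 = 0" "p1 * p1 = 0" "p2 * p2 = 0" "p0 * p0 = 0"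
    using s n by linarith+
  then have "v 3 = 0" "p4 = 0" "p5 = 0" "p6 = 0" "p7 = 0" "p1 = 0" "p2 = 0" "p0 = 0"
    by (simp_all only: mult_eq_0_iff disj_absorb)
  then have "v 0 = 0" "v 1 = 0" "v 2 = 0" "v 3 = 0" "v 4 = 0" "v 5 = 0" "v 6 = 0" "v 7 = 0"
    unfolding p0_def p1_def p2_def p4_def p5_def p6_def p7_def by linarith+
  then show ?thesis using less_8_cases[OF assms(2)] by (elim disjE) simp_all
qed

abbreviation e8_lattice :: "(nat \<Rightarrow> int) set" where "e8_lattice \<equiv> {v. \<forall>i\<ge>8. v i = 0}"

lemma e8_form_simple:
  "\<lbrakk>i < 8; j < 8\<rbrakk> \<Longrightarrow> e8_form (simple i) (simple j) + e8_form (simple j) (simple i) = cartan_e8 $$ (i, j)"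
  by (drule less_8_cases, drule less_8_cases, elim disjE)
    (simp_all add: e8_form_def simple_def cartan_e8_def mat_of_rows_list_def)

lemma e8_form_add: "e8_form (v + w) u = e8_form v u + e8_form w u" "e8_form u (v + w) = e8_form u v + e8_form u w"
  unfolding e8_form_def by (simp_all add: algebra_simps)

lemma even_lattice_e8: "even_lattice 8 e8_form"
proof
  have z: "v = 0" if "\<forall>i\<ge>8. v i = 0" "e8_form v v \<le> 0" for v
  proof
    fix i show "v i = 0 i" using that(1) e8_form_nonpos[OF that(2), of i] by (cases "i < 8") simp_all
  qed
  show "0 < e8_form v v" if "v \<in> e8_lattice" "v \<noteq> 0" for v
    using z[of v] that by (cases "e8_form v v \<le> 0") simp_all
  have "finite {v::nat \<Rightarrow> int. \<forall>i. (i \<in> {..<8} \<longrightarrow> v i \<in> {-7..7}) \<and> (i \<notin> {..<8} \<longrightarrow> v i = 0)}"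
    by (rule finite_set_of_finite_funs) simp_all
  then show "finite {v \<in> e8_lattice. e8_form v v = 1}"
    by (rule rev_finite_subset) (use e8_form_bound in auto)
  show "e8_form (simple i) (simple i) = 1" if "i < 8" for i
    using less_8_cases[OF that] by (elim disjE) (simp_all add: e8_form_def simple_def)
  show "e8_form (simple i) (simple j) + e8_form (simple j) (simple i) \<le> 0" if "i < 8" "j < 8" "i \<noteq> j" for i j
    using less_8_cases[OF that(1)] less_8_cases[OF that(2)] that(3)
    by (elim disjE) (simp_all add: e8_form_def simple_def)
qed (rule e8_form_add)+

section \<open>Ranks of the two Cartan matrices\<close>

lemma full_rank:
  fixes A :: "'k::field mat"
  assumes A: "A \<in> carrier_mat n n" and "\<And>v. \<lbrakk>v \<in> carrier_vec n; A *\<^sub>v v = 0\<^sub>v n\<rbrakk> \<Longrightarrow> v = 0\<^sub>v n"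
  shows "vec_space.rank n A = n"
proof -
  have "det A \<noteq> 0" using det_0_iff_vec_prod_zero[OF A] assms(2) by metis
  then show ?thesis using vec_space.det_rank_iff[OF A] by blast
qed

lemma mult_vec_entry:
  assumes "A \<in> carrier_mat n n" "v \<in> carrier_vec n" "A *\<^sub>v v = 0\<^sub>v n" "i < n"
  shows "(\<Sum>j<n. A $$ (i, j) * v $ j) = 0"
proof -
  have "(A *\<^sub>v v) $ i = (\<Sum>j<n. A $$ (i, j) * v $ j)"
    using assms(1,2,4) by (auto simp: scalar_prod_def lessThan_atLeast0 intro!: sum.cong)
  then show ?thesis using assms(3,4) by simp
qed

lemma sum_lessThan_8: "(\<Sum>j<8. f j) = f 0 + f 1 + f 2 + f 3 + f 4 + f 5 + f 6 + f (7::nat)"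
  and sum_lessThan_6: "(\<Sum>j<6. f j) = f 0 + f 1 + f 2 + f 3 + f 4 + f (5::nat)" for f :: "nat \<Rightarrow> 'b::ab_group_add"
  by (simp_all add: eval_nat_numeral)

lemma dim_cartan: "dim_row cartan_e8 = 8" "dim_col cartan_e8 = 8" "dim_row cartan_g66 = 6" "dim_col cartan_g66 = 6"
  by (simp_all add: cartan_e8_def cartan_g66_def mat_of_rows_list_def)

text \<open>The determinant is 1, so back substitution with integer combinations alone shows that
  the kernel is trivial over any field.\<close>

lemma rank_cartan_e8: "vec_space.rank 8 (map_mat of_int cartan_e8 :: 'k::field mat) = 8"
proof (rule full_rank)
  show A: "(map_mat of_int cartan_e8 :: 'k mat) \<in> carrier_mat 8 8" by (rule carrier_matI; simp only: index_map_mat dim_cartan)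
  fix v :: "'k vec" assume v: "v \<in> carrier_vec 8" "map_mat of_int cartan_e8 *\<^sub>v v = 0\<^sub>v 8"
  have e: "(\<Sum>j<8. of_int (cartan_e8 $$ (i, j)) * v $ j) = 0" if i: "i < 8" for i
  proof -
    have "(\<Sum>j<8. of_int (cartan_e8 $$ (i, j)) * v $ j) = (\<Sum>j<8. (map_mat of_int cartan_e8 :: 'k mat) $$ (i, j) * v $ j)"
      by (rule sum.cong[OF refl]) (use i in \<open>simp only: lessThan_iff index_map_mat(1) dim_cartan\<close>)
    also have "\<dots> = 0" by (rule mult_vec_entry[OF A v i])
    finally show ?thesis .
  qed
  define x0 x1 x2 x3 x4 x5 x6 x7 where "x0 = v $ 0" and "x1 = v $ 1" and "x2 = v $ 2" and "x3 = v $ 3"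
    and "x4 = v $ 4" and "x5 = v $ 5" and "x6 = v $ 6" and "x7 = v $ 7"
  note d = x0_def[symmetric] x1_def[symmetric] x2_def[symmetric] x3_def[symmetric] x4_def[symmetric] x5_def[symmetric]
    x6_def[symmetric] x7_def[symmetric]
  note e' = e[unfolded sum_lessThan_8 d, simplified cartan_e8_def mat_of_rows_list_def]
  have r: "2 * x0 - x2 = 0" "2 * x1 - x3 = 0" "2 * x2 - x0 - x3 = 0" "2 * x3 - x1 - x2 - x4 = 0" "2 * x4 - x3 - x5 = 0"
    "2 * x5 - x4 - x6 = 0" "2 * x6 - x5 - x7 = 0" "2 * x7 - x6 = 0"
    subgoal using e'[of 0] by simp
    subgoal using e'[of 1] by simp
    subgoal using e'[of 2] by simp
    subgoal using e'[of 3] by (simp add: algebra_simps)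
    subgoal using e'[of 4] by simp
    subgoal using e'[of 5] by simp
    subgoal using e'[of 6] by simp
    subgoal using e'[of 7] by simp
    done
  have s: "x2 = 2 * x0" "x3 = 2 * x1" "x3 = 2 * x2 - x0" "x4 = 2 * x3 - x1 - x2" "x5 = 2 * x4 - x3" "x6 = 2 * x5 - x4"
    "x7 = 2 * x6 - x5" "2 * x7 = x6"
    by (rule r[THEN eq_iff_diff_eq_0[THEN iffD2], symmetric] r(8)[THEN eq_iff_diff_eq_0[THEN iffD2]])+
  have x4: "x4 = 3 * x1 - 2 * x0" unfolding s(4) s(1,2) by simp
  have x5: "x5 = 4 * x1 - 4 * x0" unfolding s(5) x4 s(2) by simp
  have x6: "x6 = 5 * x1 - 6 * x0" unfolding s(6) x5 x4 by simp
  have x7: "x7 = 6 * x1 - 8 * x0" unfolding s(7) x6 x5 by simp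
  have q1: "2 * x1 = 3 * x0" using s(3) unfolding s(1,2) by simp
  have q2: "7 * x1 = 10 * x0" using s(8) unfolding x7 x6 by (simp add: algebra_simps)
  \<comment> \<open>A combination of the two remaining equations with coefficient 1 for
    \<open>x1\<close>; no division occurs.\<close>
  have "x1 = 7 * x1 - 3 * (2 * x1)" by simp
  also have "\<dots> = x0" unfolding q1 q2 by simp
  finally have x1: "x1 = x0" .
  have "x0 = 3 * x0 - 2 * x1" unfolding x1 by simp
  then have x0: "x0 = 0" unfolding q1 by simp
  have "x0 = 0" "x1 = 0" "x2 = 0" "x3 = 0" "x4 = 0" "x5 = 0" "x6 = 0" "x7 = 0"
    unfolding s(1) s(2) x4 x5 x6 x7 x1 x0 by simp_all
  note z = this[folded d]
  show "v = 0\<^sub>v 8"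
  proof (rule eq_vecI)
    fix i assume "i < dim_vec (0\<^sub>v 8 :: 'k vec)"
    then have i: "i < 8" by simp
    from less_8_cases[OF i] show "v $ i = 0\<^sub>v 8 $ i" by (elim disjE) (simp_all add: z z[unfolded One_nat_def])
  qed (use v in simp)
qed

text \<open>Back substitution ends in \<open>5 * x5 = 0\<close>. In characteristic 3 one subtracts
  this from \<open>6 * x5 = 0\<close>.\<close>

lemma rank_cartan_g66:
  assumes three: "(3 :: 'k::field) = 0"
  shows "vec_space.rank 6 (map_mat of_int cartan_g66 :: 'k mat) = 6"
proof (rule full_rank)
  show A: "(map_mat of_int cartan_g66 :: 'k mat) \<in> carrier_mat 6 6" by (rule carrier_matI; simp only: index_map_mat dim_cartan)
  fix v :: "'k vec" assume v: "v \<in> carrier_vec 6" "map_mat of_int cartan_g66 *\<^sub>v v = 0\<^sub>v 6"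
  have e: "(\<Sum>j<6. of_int (cartan_g66 $$ (i, j)) * v $ j) = 0" if i: "i < 6" for i
  proof -
    have "(\<Sum>j<6. of_int (cartan_g66 $$ (i, j)) * v $ j) = (\<Sum>j<6. (map_mat of_int cartan_g66 :: 'k mat) $$ (i, j) * v $ j)"
      by (rule sum.cong[OF refl]) (use i in \<open>simp only: lessThan_iff index_map_mat(1) dim_cartan\<close>)
    also have "\<dots> = 0" by (rule mult_vec_entry[OF A v i])
    finally show ?thesis .
  qed
  define x0 x1 x2 x3 x4 x5 where "x0 = v $ 0" and "x1 = v $ 1" and "x2 = v $ 2" and "x3 = v $ 3"
    and "x4 = v $ 4" and "x5 = v $ 5"
  note d = x0_def[symmetric] x1_def[symmetric] x2_def[symmetric] x3_def[symmetric] x4_def[symmetric] x5_def[symmetric]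
  note e' = e[unfolded sum_lessThan_6 d, simplified cartan_g66_def mat_of_rows_list_def]
  have r: "- x1 = 0" "- x0 - x2 = 0" "2 * x2 - x1 - x3 = 0" "2 * x3 - x2 - x4 = 0" "2 * x4 - x3 - x5 = 0" "2 * x5 - x4 = 0"
    subgoal using e'[of 0] by simp
    subgoal using e'[of 1] by simp
    subgoal using e'[of 2] by simp
    subgoal using e'[of 3] by simp
    subgoal using e'[of 4] by simp
    subgoal using e'[of 5] by simp
    done
  have x4: "x4 = 2 * x5" using r(6) by simp
  have x3: "x3 = 3 * x5" using r(5) unfolding x4 by (simp add: algebra_simps)
  have x2: "x2 = 4 * x5" using r(4) unfolding x3 x4 by (simp add: algebra_simps)
  have x1: "x1 = 0" using r(1) by simp
  have f: "5 * x5 = 0" using r(3) unfolding x1 x2 x3 by (simp add: algebra_simps)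
  have t: "3 * (2 * x5) = 0" unfolding three by (rule mult_zero_left)
  have "x5 = 3 * (2 * x5) - 5 * x5" by simp
  then have x5: "x5 = 0" unfolding t f by simp
  have "x0 = - x2" using r(2) by (metis diff_0_right diff_eq_diff_eq eq_iff_diff_eq_0 minus_diff_eq)
  then have x0: "x0 = 0" unfolding x2 x5 by simp
  have "x0 = 0" "x1 = 0" "x2 = 0" "x3 = 0" "x4 = 0" "x5 = 0" unfolding x0 x1 x2 x3 x4 x5 by simp_all
  note z = this[folded d]
  show "v = 0\<^sub>v 6"
  proof (rule eq_vecI)
    fix i assume "i < dim_vec (0\<^sub>v 6 :: 'k vec)"
    then have i: "i < 6" by simp
    from less_6_cases[OF i] show "v $ i = 0\<^sub>v 6 $ i" by (elim disjE) (simp_all add: z z[unfolded One_nat_def])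
  qed (use v in simp)
qed

declare One_nat_def [simp del] add_2_eq_Suc [simp del] add_2_eq_Suc' [simp del]

lemma simple_apply: "simple i k = (if k = i then 1 else 0)"
  by (simp add: simple_def)

section \<open>Chevalley generators with the Cartan matrix of g(6,6)\<close>

locale e8_setting =
  fixes three :: "'k::field itself"
  assumes characteristic: "CHAR('k) = 3"
begin

sublocale even_lattice 8 e8_form e8_lattice
  by (rule even_lattice_e8) (rule reflexive)

sublocale simply_laced 8 e8_form e8_lattice three
  by unfold_locales (rule characteristic)

lemma ip_simple: "\<lbrakk>i < 8; j < 8\<rbrakk> \<Longrightarrow> ip (simple i) (simple j) = cartan_e8 $$ (i, j)"
  unfolding ip_def by (rule e8_form_simple)

lemma simple_root: "i < 8 \<Longrightarrow> simple i \<in> roots"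
  unfolding roots_def using ff_simple by (simp add: simple_apply)

sublocale projected_pair 8 e8_form e8_lattice three "simple 0" "simple 1" "\<lambda>v k. v (k + 2)"
proof unfold_locales
  show "simple 0 \<in> roots" "simple 1 \<in> roots" by (rule simple_root; simp)+
  show "ip (simple 0) (simple 1) = 0" by (simp add: ip_def e8_form_def simple_def)
  show "\<exists>k l. v = smul k (simple 0) + smul l (simple 1)" if "v \<in> e8_lattice" "(\<lambda>k. v (k + 2)) = 0" for v
  proof (intro exI)
    show "v = smul (v 0) (simple 0) + smul (v 1) (simple 1)"
    proof
      fix k :: nat
      have "v k = 0" if k: "2 \<le> k"
        using fun_cong[OF \<open>(\<lambda>k. v (k + 2)) = 0\<close>, of "k - 2"] unfolding le_add_diff_inverse2[OF k] by simp
      then show "v k = (smul (v 0) (simple 0) + smul (v 1) (simple 1)) k"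
        by (cases "k = 0"; cases "k = 1") (auto simp: simple_apply)
    qed
  qed
qed (auto simp: simple_apply fun_eq_iff)

abbreviation proj6 :: "(nat \<Rightarrow> int) \<Rightarrow> nat \<Rightarrow> int" where "proj6 v \<equiv> (\<lambda>k. v (k + 2))"

definition pos_root :: "nat \<Rightarrow> nat \<Rightarrow> int" where "pos_root i = simple (i + 2)"

text \<open>For the two odd indices \<open>- pos_root i\<close> has weight 1;
  \<open>simple i\<close> is the root to which \<open>pos_root i\<close> is attached, and
  subtracting it leads to the member of weight -1.\<close>

definition neg_root :: "nat \<Rightarrow> nat \<Rightarrow> int" where
  "neg_root i = - pos_root i - (if i < 2 then simple i else 0)"

text \<open>For odd indices this is the vector produced by \<open>odd_bracket\<close>. Its pairing
  with its own root is -3 and with a neighbouring root 2, which are 0 and -1 modulo 3, as the matrix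
  requires.\<close>

definition cart :: "nat \<Rightarrow> nat \<Rightarrow> int" where
  "cart i = (if i < 2 then - (simple i + pos_root i) - pos_root i else pos_root i)"

text \<open>The sign that makes the bracket of \<open>cE i\<close> and \<open>cF i\<close> equal to
  \<open>cY i\<close>: it undoes the cocycle of the odd bracket, or the minus sign in the bracket of
  opposite root vectors.\<close>

definition coef :: "nat \<Rightarrow> 'k" where
  "coef i = (if i < 2 then eps (simple i) (pos_root i) else - 1)"

abbreviation "cE i \<equiv> rep (pos_root i)"
abbreviation "cF i \<equiv> S.scale2 (coef i) (rep (neg_root i))"
abbreviation "cY i \<equiv> (hh (cart i), 0 :: basis_index \<Rightarrow> 'k)"

lemma coef_square: "coef i * coef i = 1"
  unfolding coef_def by (simp add: eps_square)

lemma proj_roots: "proj6 (pos_root i) = (\<lambda>k. if k = i then 1 else 0)" "proj6 (neg_root i) = (\<lambda>k. if k = i then -1 else 0)"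
  by (auto simp: pos_root_def neg_root_def simple_apply fun_eq_iff)

lemma generating_roots: "i < 6 \<Longrightarrow> generating (pos_root i)" "i < 6 \<Longrightarrow> generating (neg_root i)"
  by (drule less_6_cases, elim disjE; simp add: generating_def roots_def ip_def e8_form_def pos_root_def neg_root_def simple_apply)+

lemma gr_roots:
  "i < 6 \<Longrightarrow> gr (pos_root i) = (if i < 2 then -1 else 0)" "i < 6 \<Longrightarrow> gr (neg_root i) = (if i < 2 then -1 else 0)"
  by (drule less_6_cases, elim disjE; simp add: gr_eq ip_def e8_form_def pos_root_def neg_root_def simple_apply)+

lemma canon_generating: "generating b \<Longrightarrow> canon b"
  unfolding generating_def canon_def by auto

lemma cart_simple: "i < 6 \<Longrightarrow> ip (cart i) (simple 0) = 0" "i < 6 \<Longrightarrow> ip (cart i) (simple 1) = 0"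
  by (drule less_6_cases, elim disjE; simp add: ip_def e8_form_def pos_root_def cart_def simple_apply)+

lemma cart_lattice: "i < 6 \<Longrightarrow> cart i \<in> e8_lattice"
  by (auto simp: cart_def pos_root_def simple_apply)

lemma cart_pos: "\<lbrakk>i < 6; j < 6\<rbrakk> \<Longrightarrow> 3 dvd ip (cart i) (pos_root j) - cartan_g66 $$ (i, j)"
  by (drule less_6_cases, drule less_6_cases, elim disjE;
      simp add: ip_def e8_form_def pos_root_def cart_def simple_apply cartan_g66_def mat_of_rows_list_def)

lemma cart_neg: "\<lbrakk>i < 6; j < 6\<rbrakk> \<Longrightarrow> 3 dvd ip (cart i) (neg_root j) + cartan_g66 $$ (i, j)"
  by (drule less_6_cases, drule less_6_cases, elim disjE;
      simp add: ip_def e8_form_def pos_root_def neg_root_def cart_def simple_apply cartan_g66_def mat_of_rows_list_def)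

lemma of_int_dvd: "3 dvd a - b \<Longrightarrow> (of_int a :: 'k) = of_int b"
  using of_int_eq_0[of "a - b"] by simp

lemma cart_rep:
  assumes "v \<in> e8_lattice" "generating b"
  shows "S.br2 (hh v, 0) (rep b) = S.scale2 (of_int (ip v b)) (rep b)"
proof -
  have "rep b = (xx b, 0) \<or> rep b = (0, xx b)"
    using assms(2) unfolding generating_def rep_def gr_eq by auto
  then show ?thesis
    by (elim disjE) (simp_all add: S.br2_def S.scale2_def br_hh_xx[OF assms(1)] fun_eq_iff)
qed

lemma dd_hh: "v \<in> e8_lattice \<Longrightarrow> dd (hh v) = - (fs (of_int (ip v (simple 0))) (xx (simple 0)) + fs (of_int (ip v (simple 1))) (xx (simple 1)))"
  unfolding ee_def L.m_add_left by (simp add: br_xx_hh)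

lemma cY_space: "i < 6 \<Longrightarrow> hh (cart i) \<in> S.even_space"
proof -
  assume i: "i < 6"
  have "dd (hh (cart i)) = 0" unfolding dd_hh[OF cart_lattice[OF i]] cart_simple[OF i] by (simp add: fun_eq_iff)
  then show ?thesis unfolding S.even_space_def homog_eq using hh_supported[of "cart i" gr] by blast
qed

lemma bracket_same: "i < 6 \<Longrightarrow> S.br2 (cE i) (cF i) = cY i"
proof -
  assume i: "i < 6"
  note g = generating_roots[OF i] and r = gr_roots[OF i]
  show ?thesis
  proof (cases "i < 2")
    case True
    have "i = 0 \<or> i = 1" using True by linarith
    then have "partners (simple i) (simple (1 - i))" by (elim disjE) (simp_all add: partners_def)
    moreover have "pos_root i \<in> roots" using g(1) unfolding generating_def by blast
    moreover have "ip (simple i) (pos_root i) = -1" "ip (simple (1 - i)) (pos_root i) = 0"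
      using less_6_cases[OF i] True by (elim disjE; simp add: ip_def e8_form_def pos_root_def simple_apply)+
    ultimately have b: "S.br2 (0, xx (pos_root i)) (0, xx (- pos_root i - simple i)) =
        (- fs (eps (simple i) (pos_root i)) (hh (simple i + pos_root i) + hh (pos_root i)), 0)"
      by (rule odd_bracket(4))
    have n: "neg_root i = - pos_root i - simple i" using True by (simp add: neg_root_def)
    have "rep (pos_root i) = (0, xx (pos_root i))" "rep (neg_root i) = (0, xx (neg_root i))"
      using r True unfolding rep_def by simp_all
    then have "S.br2 (cE i) (cF i) = S.scale2 (coef i) (- fs (coef i) (hh (simple i + pos_root i) + hh (pos_root i)), 0)"
      using b True unfolding S.pair.m_scale_right n coef_def by simp
    also have "\<dots> = (- (hh (simple i + pos_root i) + hh (pos_root i)), 0)"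
      using coef_square[of i] by (simp add: S.scale2_def fun_eq_iff mult.assoc[symmetric])
    also have "- (hh (simple i + pos_root i) + hh (pos_root i)) = hh (- (simple i + pos_root i) - pos_root i)"
      unfolding hh_rules(2)[of "- (simple i + pos_root i)"] hh_rules(3)[of "simple i + pos_root i"] by simp
    also have "- (simple i + pos_root i) - pos_root i = cart i" using True unfolding cart_def by simp
    finally show ?thesis .
  next
    case False
    have n: "neg_root i = - pos_root i" using False by (simp add: neg_root_def)
    have x: "pos_root i \<in> roots" using g(1) unfolding generating_def by blast
    have z: "ip (simple 0) (pos_root i) = 0" "ip (simple 0) (neg_root i) = 0"
      using less_6_cases[OF i] False by (elim disjE; simp add: ip_def e8_form_def pos_root_def neg_root_def simple_apply)+
    then have "rep (pos_root i) = (xx (pos_root i), 0)" "rep (neg_root i) = (xx (neg_root i), 0)"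
      using r False unfolding rep_def by simp_all
    then have q: "rep (pos_root i) = (xx (pos_root i), 0)" "rep (neg_root i) = (xx (- pos_root i), 0)" unfolding n by blast+
    have c: "coef i = - 1" "cart i = pos_root i" using False unfolding coef_def cart_def by simp_all
    have "S.br2 (cE i) (rep (neg_root i)) = (- hh (pos_root i), 0)"
      unfolding q S.br2_def fst_conv snd_conv br_xx_neg[OF x] by simp
    then show ?thesis unfolding S.pair.m_scale_right c by (simp add: S.scale2_def fun_eq_iff)
  qed
qed

text \<open>The bracket has a weight with one entry 1 and one entry -1. If it were nonzero, that
  weight would be the projection of a root, but the coordinates of a root never have mixed
  signs.\<close>

lemma bracket_different: "\<lbrakk>i < 6; j < 6; i \<noteq> j\<rbrakk> \<Longrightarrow> S.br2 (cE i) (cF j) = 0"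
proof (rule ccontr)
  assume i: "i < 6" "j < 6" "i \<noteq> j" and nz: "S.br2 (cE i) (cF j) \<noteq> 0"
  let ?\<gamma> = "proj6 (pos_root i) + proj6 (neg_root j)"
  have "cF j \<in> Gs (proj6 (neg_root j))"
    by (rule S.pair.subspace_scale[OF Gs_subspace rep_Gs[OF canon_generating[OF generating_roots(2)[OF i(2)]]]])
  then have G: "S.br2 (cE i) (cF j) \<in> Gs ?\<gamma>"
    by (rule Gs_mult[OF rep_Gs[OF canon_generating[OF generating_roots(1)[OF i(1)]]]])
  have "?\<gamma> i = 1" "?\<gamma> j = -1" using i(3) unfolding plus_fun_def proj_roots by simp_all
  then have "?\<gamma> \<noteq> 0" by (metis zero_fun_apply zero_neq_one)
  then obtain \<alpha> where a: "canon \<alpha>" "proj6 \<alpha> = ?\<gamma>" using Gs_canon[OF G nz] by blast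
  have "\<alpha> (i + 2) = 1" "\<alpha> (j + 2) = -1"
    using fun_cong[OF a(2), of i] fun_cong[OF a(2), of j] \<open>?\<gamma> i = 1\<close> \<open>?\<gamma> j = -1\<close> by simp_all
  moreover have "0 \<le> \<alpha> (i + 2) \<and> 0 \<le> \<alpha> (j + 2) \<or> \<alpha> (i + 2) \<le> 0 \<and> \<alpha> (j + 2) \<le> 0"
    using root_sign[OF canon_root[OF a(1)]] by blast
  ultimately show False by linarith
qed

text \<open>The family \<open>b\<close> projects to \<open>s\<close> times the unit vectors. Only
  coordinates from 2 on are compared, so the first two coordinates of \<open>\<alpha>\<close> are
  arbitrary.\<close>

lemma proj_cone:
  assumes "\<alpha> \<in> roots" "\<And>k. k < 6 \<Longrightarrow> s * int (c k) = \<alpha> (k + 2)" "\<And>i. proj6 (b i) = (\<lambda>k. if k = i then s else 0)"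
  shows "proj6 \<alpha> = proj6 (\<Sum>i<6. smul (int (c i)) (b i))"
proof
  fix k
  have b: "b i (k + 2) = (if k = i then s else 0)" for i using fun_cong[OF assms(3)[of i], of k] by simp
  have "(\<Sum>i\<in>I. smul (int (c i)) (b i)) (k + 2) = (\<Sum>i\<in>I. int (c i) * b i (k + 2))" if "finite I" for I
    using that by (induction I rule: finite_induct) simp_all
  from this[of "{..<6}"] have "(\<Sum>i<6. smul (int (c i)) (b i)) (k + 2) = (\<Sum>i<6. int (c i) * b i (k + 2))" by simp
  also have "\<dots> = (\<Sum>i<6. if k = i then int (c k) * s else 0)"
    by (rule sum.cong[OF refl]) (simp only: b, simp)
  also have "\<dots> = (if k < 6 then int (c k) * s else 0)" by simp
  also have "\<dots> = \<alpha> (k + 2)"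
  proof (cases "k < 6")
    case True
    then show ?thesis using assms(2)[OF True] by (simp add: mult.commute)
  next
    case False
    then show ?thesis using roots_lattice[OF assms(1)] by simp
  qed
  finally show "\<alpha> (k + 2) = (\<Sum>i<6. smul (int (c i)) (b i)) (k + 2)" by (rule sym)
qed

text \<open>By \<open>root_sign\<close> each canonical root projects into the cone of the six
  positive or of the six negative generators, so descent reaches its representative. The Cartan
  elements killed by \<open>dd\<close> are expanded directly in the \<open>cY i\<close>.\<close>

lemma generation:
  assumes W: "S.pair.subspace W" "\<And>u v. \<lbrakk>u \<in> W; v \<in> W\<rbrakk> \<Longrightarrow> S.br2 u v \<in> W" and y: "\<And>i. i < 6 \<Longrightarrow> cY i \<in> W"
    and e: "\<And>i. i < 6 \<Longrightarrow> cE i \<in> W" and f: "\<And>i. i < 6 \<Longrightarrow> cF i \<in> W"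
  shows "S.even_space \<times> S.odd_space \<subseteq> W"
proof (rule pair_span[OF W(1)])
  have f': "rep (neg_root i) \<in> W" if "i < 6" for i
  proof -
    have "rep (neg_root i) = S.scale2 (coef i) (cF i)" unfolding S.pair.scale_scale coef_square by simp
    then show ?thesis using S.pair.subspace_scale[OF W(1) f[OF that], of "coef i"] by simp
  qed
  fix \<alpha> assume c: "canon \<alpha>"
  note r = canon_root[OF c]
  from root_sign[OF r] show "rep \<alpha> \<in> W"
  proof
    assume s: "\<forall>i. 0 \<le> \<alpha> i"
    show ?thesis
      by (rule cone_generation_pair[OF W generating_roots(1) e c proj_cone[OF r, of 1 "\<lambda>k. nat (\<alpha> (k + 2))"]])
        (use s proj_roots in simp_all)
  next
    assume s: "\<forall>i. \<alpha> i \<le> 0"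
    show ?thesis
      by (rule cone_generation_pair[OF W generating_roots(2) f' c proj_cone[OF r, of "-1" "\<lambda>k. nat (- \<alpha> (k + 2))"]])
        (use s proj_roots in simp_all)
  qed
next
  fix h assume h: "h \<in> VL" "\<And>\<alpha>. h (XB \<alpha>) = 0" "dd h = 0"
  define x where "x i = h (HB i)" for i
  have sf: "(\<Sum>i\<in>I. F i) b = (\<Sum>i\<in>I. F i b)" for F :: "nat \<Rightarrow> basis_index \<Rightarrow> 'k" and I b by (rule sum_fun_apply)
  have hx: "h = (\<Sum>i<8. fs (x i) (hh (simple i)))"
  proof
    fix b show "h b = (\<Sum>i<8. fs (x i) (hh (simple i))) b"
    proof (cases b)
      case (XB \<alpha>)
      then show ?thesis unfolding sf by (simp add: h(2) hh_def)
    next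
      case (HB k)
      have "(\<Sum>i<8. fs (x i) (hh (simple i)) b) = (\<Sum>i<8. if k = i then x k else 0)"
        by (rule sum.cong) (auto simp: HB hh_def simple_apply)
      moreover have "h (HB k) = 0" if "\<not> k < 8" using h(1) that unfolding VL_def Bs_def by auto
      ultimately show ?thesis unfolding sf by (simp add: HB x_def)
    qed
  qed
  have d: "dd h = (\<Sum>i<8. fs (x i) (dd (hh (simple i))))"
    by (subst hx) (simp only: L.m_sum_right L.m_scale_right)
  have dv: "dd h (XB a) = (\<Sum>i<8. x i * dd (hh (simple i)) (XB a))" for a unfolding d sf fs_apply ..
  have "simple 0 0 \<noteq> simple 1 0" by (simp add: simple_apply)
  then have ne: "simple 0 \<noteq> simple 1" "simple 1 \<noteq> simple 0" by metis+
  have d0: "dd (hh (simple i)) (XB (simple 0)) = - of_int (ip (simple i) (simple 0))"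
    "dd (hh (simple i)) (XB (simple 1)) = - of_int (ip (simple i) (simple 1))" if "i < 8" for i
    unfolding dd_hh[OF lattice_closed(6)[OF that]] using ne simple_root[of 0] simple_root[of 1] by (simp_all add: xx_apply)
  have "(\<Sum>i<8. x i * - of_int (ip (simple i) (simple 0))) = 0" "(\<Sum>i<8. x i * - of_int (ip (simple i) (simple 1))) = 0"
    using dv[of "simple 0"] dv[of "simple 1"] d0 unfolding h(3) by simp_all
  then have x: "x 2 = 2 * x 0" "x 3 = 2 * x 1"
    unfolding sum_lessThan_8 by (simp_all add: ip_def e8_form_def simple_apply)
  \<comment> \<open>The kernel condition says that \<open>h\<close> pairs to 0 with both simple
    roots modulo 3, which expresses coordinates 2 and 3 through 0 and 1. As \<open>cart i\<close>
    contains \<open>- simple i\<close> for \<open>i < 2\<close>, the coefficient there is minus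
    coordinate \<open>i\<close>; the other four coordinates are read off directly.\<close>
  define t where "t i = (if i < 2 then - x i else x (i + 2))" for i :: nat
  have "(h, 0) = (\<Sum>i<6. S.scale2 (t i) (cY i))"
  proof (rule prod_eqI)
    have "h b = (\<Sum>i<6. t i * hh (cart i) b)" for b
    proof (cases b)
      case (XB \<alpha>)
      then show ?thesis by (simp add: h(2) hh_def)
    next
      case (HB k)
      show ?thesis
      proof (cases "k < 8")
        case True
        from less_8_cases[OF True] show ?thesis
          unfolding HB sum_lessThan_6 by (elim disjE) (simp_all add: hh_def t_def cart_def pos_root_def simple_apply x x_def[symmetric])
      next
        case False
        then have "h (HB k) = 0" using h(1) unfolding VL_def Bs_def by auto
        then show ?thesis using False by (simp add: HB hh_def)
      qed
    qed
    then show "fst (h, 0 :: basis_index \<Rightarrow> 'k) = fst (\<Sum>i<6. S.scale2 (t i) (cY i))"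
      unfolding fst_sum by (simp add: S.scale2_def fun_eq_iff sf)
    show "snd (h, 0 :: basis_index \<Rightarrow> 'k) = snd (\<Sum>i<6. S.scale2 (t i) (cY i))"
      unfolding snd_sum by (simp add: S.scale2_def fun_eq_iff sf)
  qed
  also have "\<dots> \<in> W"
    by (rule S.pair.subspace_sum[OF W(1)], rule S.pair.subspace_scale[OF W(1)]) (simp add: y)
  finally show "(h, 0) \<in> W" .
qed

text \<open>Coordinate \<open>i + 2\<close> occurs in \<open>cart i\<close> only, with coefficient
  -2 or 1, and 2 is invertible modulo 3.\<close>

lemma cY_independent:
  assumes "(\<Sum>i<6. S.scale2 (c i) (cY i)) = 0" "i < 6"
  shows "c i = 0"
proof -
  have "fst (\<Sum>i<6. S.scale2 (c i) (cY i)) (HB (i + 2)) = 0" unfolding assms(1) by simp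
  then have "(\<Sum>j<6. c j * of_int (cart j (i + 2))) = 0"
    using assms(2) unfolding fst_sum by (simp add: S.scale2_def sum_fun_apply hh_def)
  moreover have "of_int (cart j (i + 2)) = (if j = i then if i < 2 then - 2 else 1 else 0 :: 'k)" for j
    by (auto simp: cart_def pos_root_def simple_apply)
  ultimately have "c i * (if i < 2 then - 2 else 1) = 0"
    using assms(2) by (simp add: if_distrib[of "(*) _"] cong: if_cong)
  then show ?thesis using S.two_neq_zero by (simp split: if_splits)
qed

theorem g66_iso:
  fixes R :: "('k, 'h::ab_group_add) realization"
  assumes R: "is_realization cartan_g66 R"
  obtains f where "f \<in> superalgebra_iso (contragredient cartan_g66 parity_g66 R) S.S_alg"
    "nonassoc_algebra (contragredient cartan_g66 parity_g66 R)"
proof (rule S.pair.contragredient_iso_full_rank[OF R, where E = cE and F = cF and y = cY and G = Gs,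
      unfolded dim_cartan, of "S.even_space \<times> S.odd_space" "S.part2 S.even_space S.odd_space"])
  have three: "(3 :: 'k) = 0" using of_int_eq_0[of 3] by simp
  show "vec_space.rank 6 (map_mat of_int cartan_g66 :: 'k mat) = 6" by (rule rank_cartan_g66[OF three])
  have part: "rep b \<in> S.part2 S.even_space S.odd_space (parity_g66 i)" if "generating b" "gr b = (if i < 2 then -1 else 0)" for b i
  proof -
    have "rep b \<in> S.even_space \<times> S.odd_space" using rep_Gs[OF canon_generating[OF that(1)]] unfolding Gs_def by blast
    moreover have "parity_g66 i \<longleftrightarrow> i < 2" unfolding parity_g66_def by auto
    moreover have "i < 2 \<Longrightarrow> fst (rep b) = 0" "\<not> i < 2 \<Longrightarrow> snd (rep b) = 0" using that(2) unfolding rep_def by simp_all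
    ultimately show ?thesis unfolding S.part2_def by (cases "i < 2") (auto simp: prod_eq_iff mem_Times_iff)
  qed
  show "cE i \<in> S.part2 S.even_space S.odd_space (parity_g66 i)" if "i < 6" for i
    by (rule part[OF generating_roots(1)[OF that] gr_roots(1)[OF that]])
  have scale_part: "S.scale2 c v \<in> S.part2 S.even_space S.odd_space p" if "v \<in> S.part2 S.even_space S.odd_space p" for c v p
    using that L.subspace_scale[OF S.even_subspace] L.subspace_scale[OF S.homog_subspace]
    unfolding S.part2_def S.scale2_def by (cases p) auto
  show "cF i \<in> S.part2 S.even_space S.odd_space (parity_g66 i)" if "i < 6" for i
    by (rule scale_part[OF part[OF generating_roots(2)[OF that] gr_roots(2)[OF that]]])
  show "cY i \<in> S.part2 S.even_space S.odd_space False" if "i < 6" for i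
    using cY_space[OF that] unfolding S.part2_def by simp
  show "cE i \<in> Gs (\<lambda>k. if k = i then 1 else 0)" if "i < 6" for i
    using rep_Gs[OF canon_generating[OF generating_roots(1)[OF that]]] unfolding proj_roots .
  show "cF i \<in> Gs (\<lambda>k. if k = i then -1 else 0)" if "i < 6" for i
    using S.pair.subspace_scale[OF Gs_subspace rep_Gs[OF canon_generating[OF generating_roots(2)[OF that]]]] unfolding proj_roots .
  show "cY i \<in> Gs (\<lambda>k. 0)" if "i < 6" for i
    using cY_space[OF that] hh_supported[of "cart i" proj6] L.subspace_0[OF supported_subspace, of proj6 0]
      L.subspace_0[OF S.homog_subspace]
    unfolding Gs_def zero_fun_def[symmetric] by simp
  show "c i = 0" if "(\<Sum>i<6. S.scale2 (c i) (cY i)) = 0" "i < 6" for c i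
    by (rule cY_independent[OF that])
  show "S.br2 (cE i) (cF j) = (if i = j then cY i else 0)" if "i < 6" "j < 6" for i j
    using bracket_same[OF that(1)] bracket_different[OF that] by (cases "i = j") simp_all
  show "S.br2 (cY i) (cE j) = S.scale2 (of_int (cartan_g66 $$ (i, j))) (cE j)" if "i < 6" "j < 6" for i j
    unfolding cart_rep[OF cart_lattice[OF that(1)] generating_roots(1)[OF that(2)]] of_int_dvd[OF cart_pos[OF that]] ..
  show "S.br2 (cY i) (cF j) = - S.scale2 (of_int (cartan_g66 $$ (i, j))) (cF j)" if "i < 6" "j < 6" for i j
  proof -
    have "3 dvd ip (cart i) (neg_root j) - (- cartan_g66 $$ (i, j))" using cart_neg[OF that] by simp
    from of_int_dvd[OF this] show ?thesis
      unfolding S.pair.m_scale_right cart_rep[OF cart_lattice[OF that(1)] generating_roots(2)[OF that(2)]]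
      by (simp add: mult.commute)
  qed
  show "S.br2 (cY i) (cY j) = 0" for i j by (simp add: S.br2_def br_hh_hh zero_prod_def)
  show "Gs q \<subseteq> S.even_space \<times> S.odd_space" for q unfolding Gs_def by blast
  show "S.br2 u v \<in> Gs (\<lambda>k. q k + q' k)" if "u \<in> Gs q" "v \<in> Gs q'" for u v q q'
    using Gs_mult[OF that] unfolding plus_fun_def .
  show "\<exists>z\<in>Gs (\<lambda>k. - q k). S.br2 z u \<noteq> 0" if "u \<in> Gs q" "u \<noteq> 0" "q \<noteq> (\<lambda>k. 0)" for u q
    using Gs_nondegenerate[OF that(1,2)] that(3) unfolding zero_fun_def fun_Compl_def by blast
  show "lie_superalgebra S.S_alg" by (rule S_lie)
  show "S.pair.subspace (Gs q)" for q by (rule Gs_subspace)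
  show "cf q = 0" if "finite S" "\<And>q. q \<in> S \<Longrightarrow> cf q \<in> Gs q" "sum cf S = 0" "q \<in> S" for S cf q
    by (rule Gs_independent[OF that])
  show "S.even_space \<times> S.odd_space \<subseteq> W"
    if "S.pair.subspace W" "\<And>u v. \<lbrakk>u \<in> W; v \<in> W\<rbrakk> \<Longrightarrow> S.br2 u v \<in> W" "\<And>i. i < 6 \<Longrightarrow> cY i \<in> W"
      "\<And>i. i < 6 \<Longrightarrow> cE i \<in> W" "\<And>i. i < 6 \<Longrightarrow> cF i \<in> W" for W
    by (rule generation[OF that])
qed (rule that)

end

section \<open>Finite dimension of the abstract algebra\<close>

context simply_laced
begin

text \<open>The finite basis of \<open>VL\<close> is pulled back along \<open>g\<close>. The image
  of the span of the pulled back vectors is a subspace containing that basis, so it is all of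
  \<open>VL\<close>, and injectivity gives the claim upstairs.\<close>

lemma copy_fin_dim:
  assumes W: "nonassoc_algebra W" and g: "g \<in> superalgebra_iso W (alg_record fs br VL P)"
  shows "vectorspace.fin_dim class_ring W"
proof -
  interpret W: nonassoc_algebra W by (rule W)
  have hom: "alg_hom W (alg_record fs br VL P) g" and bij: "bij_betw g (carrier W) VL"
    using g unfolding superalgebra_iso_alt by simp_all
  note h = alg_homD[OF hom, unfolded alg_record_simps]
  define gi where "gi = inv_into (carrier W) g"
  define A where "A = (\<lambda>b. gi (unit_fun b)) ` Bs"
  have u: "unit_fun b \<in> VL" if "b \<in> Bs" for b using that by (simp add: VL_def unit_fun_def)
  have gi: "gi f \<in> carrier W" "g (gi f) = f" if "f \<in> VL" for f
    unfolding gi_def by (rule bij_betwE[OF bij_betw_inv_into[OF bij], rule_format, OF that]) (rule bij_betw_inv_into_right[OF bij that])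
  have A: "A \<subseteq> carrier W" unfolding A_def using gi(1) u by blast
  have "submodule class_ring (W.span A) W" by (rule W.span_is_submodule[OF A])
  then have s: "W.span A \<subseteq> carrier W" "\<And>x y. \<lbrakk>x \<in> W.span A; y \<in> W.span A\<rbrakk> \<Longrightarrow> x \<oplus>\<^bsub>W\<^esub> y \<in> W.span A" "\<zero>\<^bsub>W\<^esub> \<in> W.span A"
    "\<And>c x. x \<in> W.span A \<Longrightarrow> c \<odot>\<^bsub>W\<^esub> x \<in> W.span A"
    unfolding submodule_def by auto
  have U: "L.subspace (g ` W.span A)"
  proof (rule L.subspaceI)
    have "g (0 \<odot>\<^bsub>W\<^esub> \<zero>\<^bsub>W\<^esub>) = 0" unfolding h(3)[OF W.zero_closed] by simp
    moreover have "g (0 \<odot>\<^bsub>W\<^esub> \<zero>\<^bsub>W\<^esub>) \<in> g ` W.span A" by (rule imageI[OF s(4)[OF s(3)]])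
    ultimately show "0 \<in> g ` W.span A" by simp
  next
    fix x y assume "x \<in> g ` W.span A" "y \<in> g ` W.span A"
    then obtain x' y' where x: "x' \<in> W.span A" "x = g x'" and y: "y' \<in> W.span A" "y = g y'" by blast
    show "x + y \<in> g ` W.span A"
      unfolding x(2) y(2) h(2)[OF subsetD[OF s(1) x(1)] subsetD[OF s(1) y(1)], symmetric]
      by (rule imageI[OF s(2)[OF x(1) y(1)]])
  next
    fix c x assume "x \<in> g ` W.span A"
    then obtain x' where x: "x' \<in> W.span A" "x = g x'" by blast
    show "fs c x \<in> g ` W.span A"
      unfolding x(2) h(3)[OF subsetD[OF s(1) x(1)], symmetric] by (rule imageI[OF s(4)[OF x(1)]])
  qed
  have all: "f \<in> g ` W.span A" if f: "f \<in> VL" for f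
  proof -
    have "(\<Sum>b\<in>Bs. fs (f b) (unit_fun b)) \<in> g ` W.span A"
    proof (rule L.subspace_sum[OF U], rule L.subspace_scale[OF U])
      fix b assume b: "b \<in> Bs"
      then have "gi (unit_fun b) \<in> W.span A" using W.in_own_span[OF A] unfolding A_def by blast
      then show "unit_fun b \<in> g ` W.span A" using gi(2)[OF u[OF b]] by (rule rev_image_eqI[OF _ sym])
    qed
    then show ?thesis by (rule ssubst[where P = "\<lambda>z. z \<in> g ` W.span A", OF VL_expand[OF f]])
  qed
  have "carrier W \<subseteq> W.span A"
  proof
    fix x assume x: "x \<in> carrier W"
    obtain z where z: "g x = g z" "z \<in> W.span A" using all[OF h(1)[OF x]] by (rule imageE)
    have "x = z" by (rule inj_onD[OF bij_betw_imp_inj_on[OF bij] z(1) x subsetD[OF s(1) z(2)]])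
    then show "x \<in> W.span A" using z(2) by simp
  qed
  with s(1) have eq: "W.span A = carrier W" by (rule equalityI)
  have fin: "finite A" unfolding A_def by (rule finite_imageI[OF finite_Bs])
  show ?thesis unfolding W.fin_dim_def by (intro exI[of _ A] conjI fin A eq)
qed

end

lemma quotient_superalgebra_carrier: "carrier (quotient_superalgebra L I) = (\<lambda>x. I +>\<^bsub>L\<^esub> x) ` carrier L"
  by (auto simp: quotient_superalgebra_def FactRing_def A_RCOSETS_def' a_r_coset_def)

lemma chevalley_e_carrier:
  assumes "i < dim_row A" shows "chevalley_e A par R i \<in> carrier (contragredient A par R)"
proof -
  have "gen (Chev_e i) \<in> carrier (contragredient_free A par)"
    using assms by (simp add: free_superalgebra_def generators_def)
  then show ?thesis
    unfolding chevalley_e_def contragredient_def tilde_class_def tilde_contragredient_def quotient_superalgebra_carrier by blast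
qed

section \<open>Assembly of the isomorphism\<close>

context e8_setting
begin

text \<open>Both superalgebras are compared with \<open>S.S_alg\<close>. The Lie axioms, including
  the cube identity, are known there and are transported to the semisimplification and to the
  contragredient algebra, where only the nonassociative structure was available.\<close>

theorem e8_semisimplification:
  fixes R :: "('k, 'h::ab_group_add) realization" and R' :: "('k, 'h2::ab_group_add) realization"
  assumes R: "is_realization cartan_e8 R" and R': "is_realization cartan_g66 R'"
  defines "W \<equiv> contragredient cartan_e8 parity_e8 R" and "e \<equiv> chevalley_e cartan_e8 parity_e8 R"
  shows "lie_algebra_in_rep_alpha3 W (\<lambda>y. (e 0 \<oplus>\<^bsub>W\<^esub> e 1) \<otimes>\<^bsub>W\<^esub> y) \<and>
    lie_superalgebra_isomorphic (semisimplification W (\<lambda>y. (e 0 \<oplus>\<^bsub>W\<^esub> e 1) \<otimes>\<^bsub>W\<^esub> y))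
      (contragredient cartan_g66 parity_g66 R')"
proof -
  define t where "t = (\<lambda>y. (e 0 \<oplus>\<^bsub>W\<^esub> e 1) \<otimes>\<^bsub>W\<^esub> y)"
  define P where "P = (\<lambda>p. if p then {0} else VL)"
  have entries: "cartan_e8 $$ (i, j) = ip (simple i) (simple j)" if "i < 8" "j < 8" for i j
    using ip_simple[OF that] by simp
  obtain g where g: "g \<in> superalgebra_iso W (alg_record fs br VL P)" "\<And>i. i < 8 \<Longrightarrow> g (e i) = xx (simple i)"
    "nonassoc_algebra W"
    unfolding W_def e_def P_def
    by (rule contragredient_simply_laced[OF R rank_cartan_e8 dim_cartan(1) entries, of parity_e8]) (auto simp: parity_e8_def)
  have lie: "lie_superalgebra W"
    by (rule lie_superalgebra_transport[OF g(3) L_lie g(1)[unfolded P_def]])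
  interpret W: lie_superalgebra W by (rule lie)
  have hom: "alg_hom W (alg_record fs br VL P) g" and bij: "bij_betw g (carrier W) VL" and gpart: "g ` part W p = P p" for p
    using g(1) unfolding superalgebra_iso_alt by simp_all
  note h = alg_homD[OF hom, unfolded alg_record_simps]
  have inj: "x = y" if "x \<in> carrier W" "y \<in> carrier W" "g x = g y" for x y
    using bij_betw_imp_inj_on[OF bij] that by (meson inj_onD)
  have ec: "e 0 \<in> carrier W" "e 1 \<in> carrier W"
    unfolding e_def W_def by (rule chevalley_e_carrier; simp add: dim_cartan)+
  define e' where "e' = e 0 \<oplus>\<^bsub>W\<^esub> e 1"
  have e': "e' \<in> carrier W" unfolding e'_def using ec by simp
  have ge: "g e' = ee" unfolding e'_def h(2)[OF ec] ee_def by (simp add: g(2))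
  have tc: "t y \<in> carrier W" if "y \<in> carrier W" for y
    unfolding t_def e'_def[symmetric] by (rule W.bracket_closed[OF e' that])
  have gt: "g (t y) = br ee (g y)" if "y \<in> carrier W" for y
    unfolding t_def e'_def[symmetric] h(4)[OF e' that] ge ..
  have fd: "vectorspace.fin_dim class_ring W" by (rule copy_fin_dim[OF g(3,1)])
  have gz: "g \<zero>\<^bsub>W\<^esub> = 0" using h(2)[OF W.zero_closed W.zero_closed] by simp
  interpret C: sl2_graded_copy "fs :: 'k \<Rightarrow> (basis_index \<Rightarrow> 'k) \<Rightarrow> _" br VL "proj gr" ee ef W P g t
    by unfold_locales (fact lie fd g(1) | erule tc gt)+
  obtain F where F: "F \<in> superalgebra_iso (semisimplification W t) S.S_alg" "nonassoc_algebra (semisimplification W t)"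
    by (rule C.semisimplification_iso)
  obtain G where G: "G \<in> superalgebra_iso (contragredient cartan_g66 parity_g66 R') S.S_alg"
    "nonassoc_algebra (contragredient cartan_g66 parity_g66 R')" by (rule g66_iso[OF R'])
  have "inv_into (carrier (contragredient cartan_g66 parity_g66 R')) G \<in>
      superalgebra_iso S.S_alg (contragredient cartan_g66 parity_g66 R')"
    by (rule superalgebra_iso_inv[OF G(2) nonassoc_algebra.part_carrier[OF G(2)] G(1)])
  from superalgebra_iso_comp[OF F(1) this]
  have "lie_superalgebra_isomorphic (semisimplification W t) (contragredient cartan_g66 parity_g66 R')"
    unfolding lie_superalgebra_isomorphic_def
    using lie_superalgebra_transport[OF F(2) S_lie F(1)] lie_superalgebra_transport[OF G(2) S_lie G(1)] by blast
  moreover have "lie_algebra_in_rep_alpha3 W t"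
    unfolding lie_algebra_in_rep_alpha3_def rep_alpha3_def
  proof (intro conjI ballI)
    show "lie_superalgebra W" "vectorspace.fin_dim class_ring W" by (rule lie) (rule fd)
    show "vectorspace class_ring W" by unfold_locales
    have sub: "part W p \<subseteq> carrier W" for p by (rule nonassoc_algebra.part_carrier[OF g(3)])
    have "part W True \<subseteq> {\<zero>\<^bsub>W\<^esub>}"
    proof
      fix x assume x: "x \<in> part W True"
      then have "g x = 0" using gpart[of True] unfolding P_def by auto
      then have "x = \<zero>\<^bsub>W\<^esub>" using inj[OF subsetD[OF sub x] W.zero_closed] gz by simp
      then show "x \<in> {\<zero>\<^bsub>W\<^esub>}" by simp
    qed
    moreover have "part W True \<noteq> {}" using gpart[of True] unfolding P_def by auto
    ultimately show "part W True = {\<zero>\<^bsub>W\<^esub>}" by blast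
    show "t \<in> LinearCombinations.module_hom class_ring W W"
      unfolding LinearCombinations.module_hom_def t_def e'_def[symmetric]
      using e' by (auto simp: W.bracket_closed W.bracket_add_right W.bracket_smult_right)
    show "t (t (t x)) = \<zero>\<^bsub>W\<^esub>" if x: "x \<in> carrier W" for x
    proof (rule inj[OF tc[OF tc[OF tc[OF x]]] W.zero_closed])
      show "g (t (t (t x))) = g \<zero>\<^bsub>W\<^esub>"
        unfolding gt[OF tc[OF tc[OF x]]] gt[OF tc[OF x]] gt[OF x] gz by (rule S.d_cube[OF h(1)[OF x]])
    qed
    show "t (x \<otimes>\<^bsub>W\<^esub> y) = t x \<otimes>\<^bsub>W\<^esub> y \<oplus>\<^bsub>W\<^esub> x \<otimes>\<^bsub>W\<^esub> t y" if x: "x \<in> carrier W" and y: "y \<in> carrier W" for x y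
    proof -
      note c = W.bracket_closed[OF x y] W.bracket_closed[OF tc[OF x] y] W.bracket_closed[OF x tc[OF y]]
      show ?thesis
      proof (rule inj[OF tc[OF c(1)] W.a_closed[OF c(2,3)]])
        show "g (t (x \<otimes>\<^bsub>W\<^esub> y)) = g (t x \<otimes>\<^bsub>W\<^esub> y \<oplus>\<^bsub>W\<^esub> x \<otimes>\<^bsub>W\<^esub> t y)"
          unfolding gt[OF c(1)] h(2)[OF c(2,3)] h(4)[OF x y] h(4)[OF tc[OF x] y] h(4)[OF x tc[OF y]] gt[OF x] gt[OF y]
          by (rule br_jacobi)
      qed
    qed
  qed
  ultimately show ?thesis unfolding t_def by blast
qed

end

theorem corollary4p6p2:
  fixes R :: "('k::alg_closed_field, 'h::ab_group_add) realization"
    and R' :: "('k, 'h2::ab_group_add) realization"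
  assumes "CHAR('k) = 3"
    and "is_realization cartan_e8 R"
    and "is_realization cartan_g66 R'"
  shows "let e8 = contragredient cartan_e8 parity_e8 R;
             e = chevalley_e cartan_e8 parity_e8 R;
             d = (\<lambda>y. (e 0 \<oplus>\<^bsub>e8\<^esub> e 1) \<otimes>\<^bsub>e8\<^esub> y);
             g66 = contragredient cartan_g66 parity_g66 R'
         in lie_algebra_in_rep_alpha3 e8 d \<and>
            lie_superalgebra_isomorphic (semisimplification e8 d) g66"
  unfolding Let_def
  by (rule e8_setting.e8_semisimplification[OF e8_setting.intro[OF assms(1)] assms(2,3)])

end
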